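(* Assume the Unique Games Conjecture. Let $H$ be any fixed directed graph on $k$ vertices and let $\varepsilon>0$ be any fixed constant. Then there is no polynomial-time $\left(\frac{\alpha_H}{2\lceil \log k\rceil} - \varepsilon\right)$-approximation algorithm for Directed Multicut$(H)$.
   Context: Here $\log$ is the base-2 logarithm. Directed Multicut: the input is a directed supply graph $G=(V,E)$ with nonnegative edge weights $w_e$ and a directed simple demand graph $H=(V_H,F)$ with $V_H \subseteq V$. A feasible solution is a set $E'\subseteq E$ such that for every $(s,t)\in F$ there is no directed path from $s$ to $t$ in $G-E'$; the goal is to minimize $\sum_{e\in E'} w_e$. Directed Multicut$(H)$ is the special case in which the demand graph is the fixed graph $H$ (its vertices mapped to vertices of an arbitrary supply graph $G$). The distance LP for an instance is: minimize $\sum_{e\in E} w_e x_e$ subject to $\sum_{e\in p} x_e \ge 1$ for every directed $s$-$t$ path $p$ in $G$ and every $(s,t)\in F$, and $x_e\ge 0$. The flow-cut gap $\alpha_H$ is the supremum, over all instances of Directed Multicut$(H)$, of the ratio between the optimum multicut weight and the optimum value of the distance LP. An $\alpha$-approximation algorithm returns a feasible solution of weight at most $\alpha$ times the optimum.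
   Formalization: The Unique Games Conjecture is taken in its NP-hardness form, so P ≠ NP is assumed explicitly (otherwise the claim can fail), and H is required to have at least one arc, since otherwise α_H (a supremum of 0/0) or the division by ⌈log k⌉ is undefined. *)

theory Defs
  imports
    Complex_Main
    "HOL-Library.Extended_Real"
    "HOL-Library.FuncSet"
    "HOL-Library.Log_Nat"
    "HOL-Combinatorics.Permutations"
    "HOL-Computational_Algebra.Polynomial"
    "Graph_Theory.Pair_Digraph"
begin

section \<open>Polynomial-time computation\<close>

text \<open>
  Deterministic multitape Turing machines with two-way infinite tapes. States and tape symbols
  are initial segments of the naturals. State 0 is initial and state 1 is the halting state;
  symbol 0 is the blank, symbols 1 and 2 are the bits False and True. An action on a tape is a
  written symbol together with a head movement in \<open>{-1, 0, 1}\<close>. Tape 0 carries both the input and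
  the output.
\<close>

record tm =
  tm_tapes :: nat
  tm_states :: nat
  tm_symbols :: nat
  tm_delta :: "nat \<Rightarrow> nat list \<Rightarrow> nat \<times> (nat \<times> int) list"

definition tm_wf :: "tm \<Rightarrow> bool" where
  "tm_wf M \<longleftrightarrow> 1 \<le> tm_tapes M \<and> 2 \<le> tm_states M \<and> 3 \<le> tm_symbols M \<and>
     (\<forall>q ss. q < tm_states M \<and> length ss = tm_tapes M \<and> set ss \<subseteq> {..<tm_symbols M} \<longrightarrow>
        (case tm_delta M q ss of (q', as) \<Rightarrow>
           q' < tm_states M \<and> length as = tm_tapes M \<and>
           set as \<subseteq> {..<tm_symbols M} \<times> {-1, 0, 1}))"

type_synonym tm_config = "nat \<times> ((int \<Rightarrow> nat) \<times> int) list"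

definition word_tape :: "bool list \<Rightarrow> int \<Rightarrow> nat" where
  "word_tape x i = (if 0 \<le> i \<and> i < int (length x) then (if x ! nat i then 2 else 1) else 0)"

definition tm_init :: "tm \<Rightarrow> bool list \<Rightarrow> tm_config" where
  "tm_init M x = (0, (word_tape x, 0) # replicate (tm_tapes M - 1) (\<lambda>_. 0, 0))"

definition tm_step :: "tm \<Rightarrow> tm_config \<Rightarrow> tm_config" where
  "tm_step M = (\<lambda>(q, ts).
     if q = 1 then (q, ts)
     else (case tm_delta M q (map (\<lambda>(t, h). t h) ts) of (q', as) \<Rightarrow>
       (q', map2 (\<lambda>(t, h) (s, d). (t(h := s), h + d)) ts as)))"

text \<open>
  The output is the bit string that starts in cell 0 of tape 0 and is followed by a blank.
  Halting configurations are fixed points of the step function, so this says that the machine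
  halts within the given number of steps.
\<close>

definition tm_outputs :: "tm \<Rightarrow> bool list \<Rightarrow> nat \<Rightarrow> bool list \<Rightarrow> bool" where
  "tm_outputs M x n y \<longleftrightarrow> (case (tm_step M ^^ n) (tm_init M x) of (q, ts) \<Rightarrow>
     q = 1 \<and> (\<forall>i \<le> length y. fst (hd ts) (int i) = word_tape y (int i)))"

text \<open>Nothing is required of the machine on inputs outside \<open>D\<close>.\<close>

definition poly_time_on :: "bool list set \<Rightarrow> (bool list \<Rightarrow> bool list) \<Rightarrow> bool" where
  "poly_time_on D f \<longleftrightarrow> (\<exists>M (p :: nat poly). tm_wf M \<and>
     (\<forall>x \<in> D. tm_outputs M x (poly p (length x)) (f x)))"

section \<open>Encodings\<close>

text \<open>
  All codes below are prefix-free, hence tuples are encoded by concatenation. Numbers are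
  written in binary, least significant bit first.
\<close>

definition enc_list :: "('a \<Rightarrow> bool list) \<Rightarrow> 'a list \<Rightarrow> bool list" where
  "enc_list f xs = concat (map (\<lambda>x. True # f x) xs) @ [False]"

definition enc_bits :: "bool list \<Rightarrow> bool list" where
  "enc_bits = enc_list (\<lambda>b. [b])"

definition enc_nat :: "nat \<Rightarrow> bool list" where
  "enc_nat n = enc_bits (map (bit n) [0..<floorlog 2 n])"

definition enc_arc :: "nat \<times> nat \<Rightarrow> bool list" where
  "enc_arc = (\<lambda>(u, v). enc_nat u @ enc_nat v)"

text \<open>For nonnegative rational numbers only.\<close>

definition enc_rat :: "rat \<Rightarrow> bool list" where
  "enc_rat r = (case quotient_of r of (a, b) \<Rightarrow> enc_nat (nat a) @ enc_nat (nat b))"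

section \<open>P, NP and NP-hardness of promise problems\<close>

definition class_P :: "bool list set set" where
  "class_P = {L. poly_time_on UNIV (\<lambda>x. [x \<in> L])}"

definition class_NP :: "bool list set set" where
  "class_NP = {L. \<exists>V \<in> class_P. \<exists>p :: nat poly.
     \<forall>x. x \<in> L \<longleftrightarrow> (\<exists>w. length w \<le> poly p (length x) \<and> enc_bits x @ w \<in> V)}"

definition NP_hard_promise :: "bool list set \<Rightarrow> bool list set \<Rightarrow> bool" where
  "NP_hard_promise YES NO \<longleftrightarrow> (\<forall>L \<in> class_NP. \<exists>f. poly_time_on UNIV f \<and>
     (\<forall>x. (x \<in> L \<longrightarrow> f x \<in> YES) \<and> (x \<notin> L \<longrightarrow> f x \<in> NO)))"

section \<open>The Unique Games Conjecture\<close>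

text \<open>
  A unique game on the bipartite multigraph with sides \<open>{..<ug_left U}\<close> and \<open>{..<ug_right U}\<close>.
  A constraint \<open>(u, v, \<pi>)\<close> is satisfied if the label of \<open>v\<close> is the image under \<open>\<pi>\<close> of the label
  of \<open>u\<close>.
\<close>

record ug =
  ug_left :: nat
  ug_right :: nat
  ug_constraints :: "(nat \<times> nat \<times> (nat \<Rightarrow> nat)) list"

definition ug_instance :: "nat \<Rightarrow> ug \<Rightarrow> bool" where
  "ug_instance R U \<longleftrightarrow> 1 \<le> R \<and> ug_constraints U \<noteq> [] \<and>
     (\<forall>(u, v, \<pi>) \<in> set (ug_constraints U).
        u < ug_left U \<and> v < ug_right U \<and> \<pi> permutes {..<R})"

definition ug_satisfied :: "ug \<Rightarrow> (nat \<Rightarrow> nat) \<Rightarrow> (nat \<Rightarrow> nat) \<Rightarrow> real" where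
  "ug_satisfied U f g =
     real (length (filter (\<lambda>(u, v, \<pi>). g v = \<pi> (f u)) (ug_constraints U)))
       / real (length (ug_constraints U))"

definition ug_value :: "nat \<Rightarrow> ug \<Rightarrow> real" where
  "ug_value R U = Max {ug_satisfied U f g | f g.
     f \<in> {..<ug_left U} \<rightarrow>\<^sub>E {..<R} \<and> g \<in> {..<ug_right U} \<rightarrow>\<^sub>E {..<R}}"

definition enc_ug :: "nat \<Rightarrow> ug \<Rightarrow> bool list" where
  "enc_ug R U = enc_nat (ug_left U) @ enc_nat (ug_right U) @
     enc_list (\<lambda>(u, v, \<pi>). enc_nat u @ enc_nat v @ enc_list enc_nat (map \<pi> [0..<R]))
       (ug_constraints U)"

definition unique_games_conjecture :: bool where
  "unique_games_conjecture \<longleftrightarrow> (\<forall>\<epsilon> > 0. \<forall>\<delta> > 0. \<exists>R.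
     NP_hard_promise
       {enc_ug R U | U. ug_instance R U \<and> ug_value R U \<ge> 1 - \<epsilon>}
       {enc_ug R U | U. ug_instance R U \<and> ug_value R U \<le> \<delta>})"

section \<open>Directed Multicut with a fixed demand graph\<close>

text \<open>
  The field \<open>terminal\<close> embeds the vertices of the demand graph into those of the supply graph.
\<close>

record dmc =
  supply_graph :: "nat pair_pre_digraph"
  weight :: "nat \<times> nat \<Rightarrow> real"
  terminal :: "nat \<Rightarrow> nat"

definition dmc_instance :: "nat pair_pre_digraph \<Rightarrow> dmc \<Rightarrow> bool" where
  "dmc_instance H I \<longleftrightarrow> pair_fin_digraph (supply_graph I) \<and>
     (\<forall>e \<in> parcs (supply_graph I). 0 \<le> weight I e) \<and>
     inj_on (terminal I) (pverts H) \<and> terminal I ` pverts H \<subseteq> pverts (supply_graph I)"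

definition multicut :: "nat pair_pre_digraph \<Rightarrow> dmc \<Rightarrow> (nat \<times> nat) set \<Rightarrow> bool" where
  "multicut H I C \<longleftrightarrow> C \<subseteq> parcs (supply_graph I) \<and>
     (\<forall>(s, t) \<in> parcs H.
        \<not> (\<exists>p. pre_digraph.apath
                 (with_proj ((supply_graph I)\<lparr>parcs := parcs (supply_graph I) - C\<rparr>))
                 (terminal I s) p (terminal I t)))"

definition multicut_opt :: "nat pair_pre_digraph \<Rightarrow> dmc \<Rightarrow> real" where
  "multicut_opt H I = (INF C \<in> {C. multicut H I C}. \<Sum>e\<in>C. weight I e)"

definition distance_lp_feasible ::
    "nat pair_pre_digraph \<Rightarrow> dmc \<Rightarrow> (nat \<times> nat \<Rightarrow> real) \<Rightarrow> bool" where
  "distance_lp_feasible H I x \<longleftrightarrow> (\<forall>e \<in> parcs (supply_graph I). 0 \<le> x e) \<and>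
     (\<forall>(s, t) \<in> parcs H. \<forall>p.
        pre_digraph.apath (with_proj (supply_graph I)) (terminal I s) p (terminal I t)
          \<longrightarrow> (\<Sum>e\<leftarrow>p. x e) \<ge> 1)"

definition distance_lp_opt :: "nat pair_pre_digraph \<Rightarrow> dmc \<Rightarrow> real" where
  "distance_lp_opt H I =
     (INF x \<in> {x. distance_lp_feasible H I x}. \<Sum>e\<in>parcs (supply_graph I). weight I e * x e)"

text \<open>
  Instances of LP value 0 also have multicut optimum 0; their undefined ratio 0/0 is left out.
\<close>

definition flow_cut_gap :: "nat pair_pre_digraph \<Rightarrow> ereal" where
  "flow_cut_gap H = (SUP I \<in> {I. dmc_instance H I \<and> distance_lp_opt H I > 0}.
     ereal (multicut_opt H I / distance_lp_opt H I))"

text \<open>Instances given to an algorithm have rational weights.\<close>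

definition dmc_inputs :: "nat pair_pre_digraph \<Rightarrow> dmc set" where
  "dmc_inputs H = {I. dmc_instance H I \<and> (\<forall>e \<in> parcs (supply_graph I). weight I e \<in> \<rat>)}"

definition enc_dmc :: "nat pair_pre_digraph \<Rightarrow> dmc \<Rightarrow> bool list" where
  "enc_dmc H I = (let vs = sorted_list_of_set (pverts (supply_graph I)) in
     enc_list enc_nat vs @
     enc_list (\<lambda>e. enc_arc e @ enc_rat (inv real_of_rat (weight I e)))
       (filter (\<lambda>e. e \<in> parcs (supply_graph I)) (List.product vs vs)) @
     enc_list enc_nat (map (terminal I) (sorted_list_of_set (pverts H))))"

definition dmc_approximation ::
    "nat pair_pre_digraph \<Rightarrow> ereal \<Rightarrow> (bool list \<Rightarrow> bool list) \<Rightarrow> bool" where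
  "dmc_approximation H \<alpha> A \<longleftrightarrow> (\<forall>I \<in> dmc_inputs H. \<exists>es.
     A (enc_dmc H I) = enc_list enc_arc es \<and> multicut H I (set es) \<and>
     ereal (\<Sum>e\<in>set es. weight I e) \<le> \<alpha> * ereal (multicut_opt H I))"

definition poly_time_dmc_approximable :: "nat pair_pre_digraph \<Rightarrow> ereal \<Rightarrow> bool" where
  "poly_time_dmc_approximable H \<alpha> \<longleftrightarrow>
     (\<exists>A. poly_time_on (enc_dmc H ` dmc_inputs H) A \<and> dmc_approximation H \<alpha> A)"

end

theory Submission
  imports Defs "HOL-Number_Theory.Cong"
begin

text \<open>
  Number the vertices of \<open>H\<close> in binary. Every demand \<open>(s, t)\<close> is contained in one of the
  \<open>2 \<lceil>log k\<rceil>\<close> bipartite demand graphs whose sources have a given bit with a given value and whose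
  sinks have the opposite value. A gap instance for \<open>H\<close> therefore yields one for such a bipartite
  piece, at the loss of a factor \<open>2 \<lceil>log k\<rceil>\<close>. In the bipartite case a multicut is a labelling of the
  vertices by sets of sources, the LP solution is a family of distances, and cutting every source at
  a common random threshold costs the LP value.

  This turns a gap instance into a dictatorship test. Replace every vertex by a cube whose points
  assign a threshold in binary to every label of a unique game, and shift the thresholds by the
  length along every arc. The dictator cuts cost about the LP value. Unit arcs along the edges of the
  cube bound the total influence of a cheap cut, so that by the theorem of Kahn, Kalai and Linial
  each of its Boolean functions is almost constant unless it has an influential coordinate. If all are
  almost constant then, by the invariance of the uniform measure under shifts, rounding them to
  constants gives an integral cut of the gap instance, which is expensive. The influential coordinates of a
  cheap cut yield good labels for the unique game.

  An approximation algorithm with the stated ratio then decides the unique games promise problem,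
  and P would equal NP. Polynomial time is established by compiling a small programming language
  with bit string registers to Turing machines.
\<close>

section \<open>A structured language for Turing machines\<close>

text \<open>The gadget is what forces the demands to be bipartite. Every point of a cube has its own
  threshold, so a terminal has to be joined by uncuttable arcs to all points of its cube. A terminal
  with such arcs in both directions would connect all these points and destroy the dictator cut.
  Terminals in \<open>A\<close> therefore have only arcs out and the others only arcs in; demands of
  \<open>H\<close> outside the piece are then separated for free, and the result is an instance for
  \<open>H\<close> itself. Thresholds are written in bits because the theorem on influences is about
  the discrete cube. A shift modulo \<open>2 ^ n\<close> preserves the measure but not the edges; in
  the soundness proof it only meets functions that are almost constant. The constants are chosen in
  the order \<open>P\<close>, \<open>\<tau>\<close>, \<open>Q\<close>, \<open>\<Lambda>\<close>, and
  only then the parameters of the unique game, which determine \<open>R\<close>. A large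
  \<open>P\<close> makes the unit arcs negligible for dictators; the bound \<open>2 * P * K\<close>
  on total influence then yields a \<open>\<tau>\<close> independent of \<open>R\<close>; a large
  \<open>Q\<close> makes the functions at the two ends of a cheap constraint agree up to
  \<open>\<tau> / 4\<close>, so that influence is passed on.\<close>

type_synonym tapes = "nat \<Rightarrow> (int \<Rightarrow> nat) \<times> int"

datatype com =
    Skip
  | Act "(nat \<Rightarrow> nat) \<Rightarrow> nat \<Rightarrow> nat \<times> int"
  | Seq com com
  | Cond "(nat \<Rightarrow> nat) \<Rightarrow> bool" com com
  | Loop "(nat \<Rightarrow> nat) \<Rightarrow> bool" com

definition keep :: "(nat \<Rightarrow> nat) \<Rightarrow> nat \<Rightarrow> nat \<times> int" where
  "keep ss i = (ss i, 0)"

text \<open>Tests and sequencing take a step of their own in which no tape changes; this is the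
  origin of the \<open>+ 1\<close> and \<open>+ 2\<close> in the running times below. In return
  every step is one transition of a machine whose states are commands.\<close>

primrec com_step :: "com \<Rightarrow> (nat \<Rightarrow> nat) \<Rightarrow> com \<times> (nat \<Rightarrow> nat \<times> int)" where
  "com_step Skip ss = (Skip, keep ss)"
| "com_step (Act a) ss = (Skip, a ss)"
| "com_step (Seq c d) ss =
     (if c = Skip then (d, keep ss) else (Seq (fst (com_step c ss)) d, snd (com_step c ss)))"
| "com_step (Cond p c d) ss = (if p ss then c else d, keep ss)"
| "com_step (Loop p c) ss = (if p ss then Seq c (Loop p c) else Skip, keep ss)"

definition heads :: "tapes \<Rightarrow> nat \<Rightarrow> nat" where
  "heads \<tau> i = fst (\<tau> i) (snd (\<tau> i))"

definition perform :: "(nat \<Rightarrow> nat \<times> int) \<Rightarrow> tapes \<Rightarrow> tapes" where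
  "perform a \<tau> i = ((fst (\<tau> i))(snd (\<tau> i) := fst (a i)), snd (\<tau> i) + snd (a i))"

definition config_step :: "com \<times> tapes \<Rightarrow> com \<times> tapes" where
  "config_step = (\<lambda>(c, \<tau>). (fst (com_step c (heads \<tau>)), perform (snd (com_step c (heads \<tau>))) \<tau>))"

text \<open>\<open>Skip\<close> is a fixed point of \<open>config_step\<close>, so \<open>t\<close>
  is an upper bound on the running time rather than the exact one.\<close>

definition runs :: "com \<Rightarrow> tapes \<Rightarrow> nat \<Rightarrow> tapes \<Rightarrow> bool" where
  "runs c \<tau> t \<tau>' \<longleftrightarrow> (config_step ^^ t) (c, \<tau>) = (Skip, \<tau>')"

lemma perform_keep [simp]: "perform (keep (heads \<tau>)) \<tau> = \<tau>"
  by (auto simp: perform_def keep_def heads_def fun_eq_iff prod_eq_iff)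

lemma runs_Skip: "runs Skip \<tau> 0 \<tau>"
  by (simp add: runs_def)

lemma runs_Act: "runs (Act a) \<tau> 1 (perform (a (heads \<tau>)) \<tau>)"
  by (simp add: runs_def config_step_def)

lemma runs_Seq:
  assumes "runs c \<tau> t \<tau>1" "runs d \<tau>1 t' \<tau>2"
  shows "runs (Seq c d) \<tau> (t + 1 + t') \<tau>2"
  using assms(1)
proof (induction t arbitrary: c \<tau>)
  case 0
  then have "c = Skip" "\<tau> = \<tau>1" by (auto simp: runs_def)
  with assms(2) show ?case
    by (simp add: runs_def funpow_Suc_right config_step_def del: funpow.simps)
next
  case (Suc t)
  show ?case
  proof (cases "c = Skip")
    case True
    have fix_Skip: "(config_step ^^ n) (Skip, \<tau>) = (Skip, \<tau>)" for n
      by (induction n) (auto simp: config_step_def)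
    have "\<tau> = \<tau>1" using Suc.prems True fix_Skip[of "Suc t"] unfolding runs_def by simp
    have "runs Skip \<tau> t \<tau>1" using fix_Skip \<open>\<tau> = \<tau>1\<close> by (simp add: runs_def)
    from Suc.IH[OF this] have "(config_step ^^ (t + 1 + t')) (Seq Skip d, \<tau>) = (Skip, \<tau>2)"
      by (simp add: runs_def)
    \<comment> \<open>The first command has time left over; the surplus step is spent at the end,
      where \<open>Skip\<close> idles.\<close>
    then have "(config_step ^^ Suc (t + 1 + t')) (Seq Skip d, \<tau>) = (Skip, \<tau>2)"
      by (simp add: config_step_def)
    then show ?thesis using True by (simp add: runs_def)
  next
    case False
    define c' where "c' = fst (com_step c (heads \<tau>))"
    define \<tau>' where "\<tau>' = perform (snd (com_step c (heads \<tau>))) \<tau>"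
    have "runs c' \<tau>' t \<tau>1"
      using Suc.prems by (simp add: runs_def funpow_Suc_right config_step_def c'_def \<tau>'_def del: funpow.simps)
    from Suc.IH[OF this] have "runs (Seq c' d) \<tau>' (t + 1 + t') \<tau>2" .
    moreover have "config_step (Seq c d, \<tau>) = (Seq c' d, \<tau>')"
      using False by (simp add: config_step_def c'_def \<tau>'_def)
    ultimately have "(config_step ^^ Suc (t + 1 + t')) (Seq c d, \<tau>) = (Skip, \<tau>2)"
      unfolding runs_def funpow_Suc_right o_apply by simp
    then show ?thesis unfolding runs_def by simp
  qed
qed

lemma runs_Cond:
  assumes "runs (if p (heads \<tau>) then c else d) \<tau> t \<tau>'"
  shows "runs (Cond p c d) \<tau> (t + 1) \<tau>'"
  using assms unfolding runs_def Suc_eq_plus1[symmetric] funpow_Suc_right o_apply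
  by (simp add: config_step_def)

lemma runs_Loop_end:
  assumes "\<not> p (heads \<tau>)"
  shows "runs (Loop p c) \<tau> 1 \<tau>"
  using assms by (simp add: runs_def config_step_def)

lemma runs_Loop_step:
  assumes "p (heads \<tau>)" "runs c \<tau> t \<tau>1" "runs (Loop p c) \<tau>1 t' \<tau>2"
  shows "runs (Loop p c) \<tau> (t + t' + 2) \<tau>2"
proof -
  have "runs (Seq c (Loop p c)) \<tau> (t + 1 + t') \<tau>2"
    using assms(2,3) by (rule runs_Seq)
  then have "(config_step ^^ Suc (t + 1 + t')) (Loop p c, \<tau>) = (Skip, \<tau>2)"
    using assms(1) unfolding runs_def funpow_Suc_right o_apply by (simp add: config_step_def)
  then show ?thesis unfolding runs_def by simp
qed

lemma runs_Loop_iterate: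
  assumes "\<And>k. k < n \<Longrightarrow> p (heads (T k))" "\<And>k. k < n \<Longrightarrow> runs c (T k) t (T (Suc k))"
    and "\<not> p (heads (T n))"
  shows "runs (Loop p c) (T 0) (n * (t + 2) + 1) (T n)"
proof -
  have "runs (Loop p c) (T (n - k)) (k * (t + 2) + 1) (T n)" if "k \<le> n" for k
    using that
  proof (induction k)
    case 0
    then show ?case using runs_Loop_end[of p "T n" c] assms(3) by simp
  next
    case (Suc k)
    have *: "Suc (n - Suc k) = n - k" using Suc.prems by simp
    have "runs (Loop p c) (T (n - Suc k)) (t + (k * (t + 2) + 1) + 2) (T n)"
      using Suc assms(1)[of "n - Suc k"] assms(2)[of "n - Suc k"] *
      by (intro runs_Loop_step[of p _ c t "T (n - k)"]) auto
    then show ?case by (simp add: algebra_simps)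
  qed
  from this[of n] show ?thesis by simp
qed

text \<open>
  One number bounds the tapes that are touched and the symbols that are written. An action may also
  rewrite the scanned symbol, which makes the condition monotone in the bound.
\<close>

primrec bounded_com :: "nat \<Rightarrow> com \<Rightarrow> bool" where
  "bounded_com B Skip = True"
| "bounded_com B (Act a) = (\<forall>ss i. (fst (a ss i) < B \<or> fst (a ss i) = ss i) \<and>
     snd (a ss i) \<in> {-1, 0, 1} \<and> (B \<le> i \<longrightarrow> a ss i = (ss i, 0)))"
| "bounded_com B (Seq c d) = (bounded_com B c \<and> bounded_com B d)"
| "bounded_com B (Cond p c d) = (bounded_com B c \<and> bounded_com B d)"
| "bounded_com B (Loop p c) = bounded_com B c"

lemma bounded_com_mono: "bounded_com B c \<Longrightarrow> B \<le> B' \<Longrightarrow> bounded_com B' c"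
proof (induction c)
  case (Act a)
  show ?case unfolding bounded_com.simps
  proof (intro allI conjI)
    fix ss i
    have *: "(fst (a ss i) < B \<or> fst (a ss i) = ss i)" "snd (a ss i) \<in> {-1, 0, 1}" "B \<le> i \<longrightarrow> a ss i = (ss i, 0)"
      using Act.prems(1) by simp_all
    show "fst (a ss i) < B' \<or> fst (a ss i) = ss i" "snd (a ss i) \<in> {-1, 0, 1}" "B' \<le> i \<longrightarrow> a ss i = (ss i, 0)"
      using * Act.prems(2) by auto
  qed
qed auto

text \<open>A superset of the commands that execution can reach. It is finite because a running loop
  always has the form \<open>Seq c' (Loop p c)\<close> with \<open>c'\<close> a residual of its
  body; its elements become the states of the machine.\<close>

primrec residuals :: "com \<Rightarrow> com set" where
  "residuals Skip = {Skip}"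
| "residuals (Act a) = {Act a, Skip}"
| "residuals (Seq c d) = (\<lambda>c'. Seq c' d) ` residuals c \<union> residuals d"
| "residuals (Cond p c d) = {Cond p c d} \<union> residuals c \<union> residuals d"
| "residuals (Loop p c) = {Loop p c, Skip} \<union> (\<lambda>c'. Seq c' (Loop p c)) ` residuals c"

lemma finite_residuals: "finite (residuals c)"
  by (induction c) auto

lemma self_in_residuals: "c \<in> residuals c"
  by (induction c) auto

lemma Skip_in_residuals: "Skip \<in> residuals c"
  by (induction c) auto

lemma com_step_residuals: "c' \<in> residuals c \<Longrightarrow> fst (com_step c' ss) \<in> residuals c"
  by (induction c arbitrary: c') (auto simp: self_in_residuals split: if_splits)

lemma bounded_residuals: "c' \<in> residuals c \<Longrightarrow> bounded_com B c \<Longrightarrow> bounded_com B c'"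
  by (induction c arbitrary: c') auto

lemma bounded_com_step:
  assumes "bounded_com B c"
  shows "fst (snd (com_step c ss) i) < B \<or> fst (snd (com_step c ss) i) = ss i"
    "snd (snd (com_step c ss) i) \<in> {-1, 0, 1}"
    "B \<le> i \<Longrightarrow> snd (com_step c ss) i = (ss i, 0)"
  using assms by (induction c) (simp_all add: keep_def)

section \<open>Compilation of commands to machines\<close>

definition input_tapes :: "bool list \<Rightarrow> tapes" where
  "input_tapes x i = (if i = 0 then word_tape x else (\<lambda>_. 0), 0)"

text \<open>The machine model reserves state 0 for the start and state 1 for halting; all other
  commands may be numbered at will. For this the start command has to differ from
  \<open>Skip\<close>.\<close>

definition com_states :: "com \<Rightarrow> com \<Rightarrow> nat" where
  "com_states c0 = (SOME e. inj_on e (residuals c0) \<and> e c0 = 0 \<and> e Skip = 1)"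

lemma com_states:
  assumes "c0 \<noteq> Skip"
  shows "inj_on (com_states c0) (residuals c0)" "com_states c0 c0 = 0" "com_states c0 Skip = 1"
proof -
  obtain h :: "com \<Rightarrow> nat" where h: "inj_on h (residuals c0)"
    using finite_residuals finite_imp_inj_to_nat_seg by metis
  define e where "e c = (if c = c0 then 0 else if c = Skip then 1 else Suc (Suc (h c)))" for c
  have "inj_on e (residuals c0) \<and> e c0 = 0 \<and> e Skip = 1"
    using h assms by (auto simp: e_def inj_on_def split: if_splits)
  then have "inj_on (com_states c0) (residuals c0) \<and> com_states c0 c0 = 0 \<and> com_states c0 Skip = 1"
    unfolding com_states_def by (rule someI[where P = "\<lambda>e. inj_on e (residuals c0) \<and> e c0 = 0 \<and> e Skip = 1"])
  then show "inj_on (com_states c0) (residuals c0)" "com_states c0 c0 = 0" "com_states c0 Skip = 1"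
    by auto
qed

text \<open>Numbers below the number of states that name no residual lead to the halting state,
  since \<open>tm_wf\<close> asks for a legal action in every state.\<close>

definition com_tm :: "nat \<Rightarrow> com \<Rightarrow> tm" where
  "com_tm B c0 = \<lparr>tm_tapes = B, tm_states = Suc (Suc (Max (com_states c0 ` residuals c0))), tm_symbols = B,
     tm_delta = (\<lambda>q ss. if q \<in> com_states c0 ` residuals c0
       then (let c = inv_into (residuals c0) (com_states c0) q;
                 r = com_step c (\<lambda>i. if i < B then ss ! i else 0)
             in (com_states c0 (fst r), map (snd r) [0..<B]))
       else (1, map (\<lambda>s. (s, 0)) ss))\<rparr>"

lemma tm_wf_com_tm:
  assumes "bounded_com B c0" "3 \<le> B" "c0 \<noteq> Skip"
  shows "tm_wf (com_tm B c0)"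
proof -
  have states: "com_states c0 c < Suc (Suc (Max (com_states c0 ` residuals c0)))" if "c \<in> residuals c0" for c
    using Max_ge[of "com_states c0 ` residuals c0" "com_states c0 c"] that finite_residuals
    by (simp add: le_imp_less_Suc less_SucI)
  show ?thesis unfolding tm_wf_def
  proof (intro conjI allI impI)
    fix q ss assume a: "q < tm_states (com_tm B c0) \<and> length ss = tm_tapes (com_tm B c0) \<and>
        set ss \<subseteq> {..<tm_symbols (com_tm B c0)}"
    show "case tm_delta (com_tm B c0) q ss of (q', as) \<Rightarrow>
           q' < tm_states (com_tm B c0) \<and> length as = tm_tapes (com_tm B c0) \<and>
           set as \<subseteq> {..<tm_symbols (com_tm B c0)} \<times> {-1, 0, 1}"
    proof (cases "q \<in> com_states c0 ` residuals c0")
      case True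
      define c where "c = inv_into (residuals c0) (com_states c0) q"
      define s where "s = (\<lambda>i. if i < B then ss ! i else 0)"
      have c: "c \<in> residuals c0" unfolding c_def using True by (rule inv_into_into)
      have s: "s i < B" for i
        using a assms(2) by (auto simp: com_tm_def s_def subset_iff)
      have "fst (snd (com_step c s) i) < B \<and> snd (snd (com_step c s) i) \<in> {-1, 0, 1}" for i
        using bounded_com_step(1,2)[OF bounded_residuals[OF c assms(1)], of s i] s[of i] by auto
      then have "set (map (snd (com_step c s)) [0..<B]) \<subseteq> {..<B} \<times> {-1, 0, 1}"
        by (simp add: image_subset_iff mem_Times_iff)
      then show ?thesis
        using states[OF com_step_residuals[OF c]] True
        by (auto simp: com_tm_def Let_def c_def s_def)
    next
      case False
      then show ?thesis using a by (auto simp: com_tm_def)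
    qed
  qed (use assms in \<open>auto simp: com_tm_def\<close>)
qed

text \<open>A command sees infinitely many tapes while the machine has only \<open>B\<close>. The
  invariant that the other tapes are blank and at rest makes the default symbol 0 in
  \<open>com_tm\<close> the symbol that is really scanned.\<close>

lemma com_tm_simulates:
  assumes "bounded_com B c0" "3 \<le> B" "c0 \<noteq> Skip"
  shows "\<exists>c \<tau>. (config_step ^^ t) (c0, input_tapes x) = (c, \<tau>) \<and> c \<in> residuals c0 \<and>
     (tm_step (com_tm B c0) ^^ t) (tm_init (com_tm B c0) x) = (com_states c0 c, map \<tau> [0..<B]) \<and>
     (\<forall>i\<ge>B. \<tau> i = (\<lambda>_. 0, 0))"
proof (induction t)
  case 0
  have "replicate (B - 1) (\<lambda>_. 0, 0) = map (input_tapes x) [1..<B]"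
    by (rule nth_equalityI) (auto simp: input_tapes_def)
  then have "(word_tape x, 0) # replicate (B - 1) (\<lambda>_. 0, 0) = map (input_tapes x) [0..<B]"
    using assms(2) by (simp add: upt_conv_Cons input_tapes_def)
  then show ?case
    using com_states[OF assms(3)] assms(2)
    by (auto simp: tm_init_def com_tm_def self_in_residuals) (auto simp: input_tapes_def)
next
  case (Suc t)
  then obtain c \<tau> where IH: "(config_step ^^ t) (c0, input_tapes x) = (c, \<tau>)" "c \<in> residuals c0"
      "(tm_step (com_tm B c0) ^^ t) (tm_init (com_tm B c0) x) = (com_states c0 c, map \<tau> [0..<B])"
      "\<forall>i\<ge>B. \<tau> i = (\<lambda>_. 0, 0)" by blast
  define r where "r = com_step c (heads \<tau>)"
  have heads: "(\<lambda>i. if i < B then map (\<lambda>(t, h). t h) (map \<tau> [0..<B]) ! i else 0) = heads \<tau>"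
    using IH(4) by (auto simp: fun_eq_iff heads_def case_prod_beta)
  have inv: "inv_into (residuals c0) (com_states c0) (com_states c0 c) = c"
    using com_states(1)[OF assms(3)] IH(2) by simp
  have blank: "perform (snd r) \<tau> i = (\<lambda>_. 0, 0)" if "B \<le> i" for i
    using bounded_com_step(3)[OF bounded_residuals[OF IH(2) assms(1)] that, of "heads \<tau>"] IH(4) that
    by (auto simp: r_def perform_def heads_def)
  have "tm_step (com_tm B c0) (com_states c0 c, map \<tau> [0..<B]) =
      (com_states c0 (fst r), map (perform (snd r) \<tau>) [0..<B])"
  proof (cases "c = Skip")
    case True
    then show ?thesis using com_states[OF assms(3)]
      by (simp add: tm_step_def r_def)
  next
    case False
    then have "com_states c0 c \<noteq> 1"
      using com_states[OF assms(3)] IH(2) Skip_in_residuals by (metis inj_onD)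
    moreover have "map2 (\<lambda>(t, h) (s, d). (t(h := s), h + d)) (map \<tau> [0..<B]) (map (snd r) [0..<B])
        = map (perform (snd r) \<tau>) [0..<B]"
      by (rule nth_equalityI) (auto simp: perform_def case_prod_beta)
    ultimately show ?thesis
      using heads inv IH(2) unfolding tm_step_def com_tm_def
      by (simp add: Let_def r_def)
  qed
  then show ?case
    using IH blank com_step_residuals[OF IH(2)]
    by (auto simp: config_step_def r_def)
qed

lemma poly_time_on_com:
  fixes p :: "nat poly"
  assumes "bounded_com B c"
    and "\<And>x. x \<in> D \<Longrightarrow> \<exists>t \<tau>. runs c (input_tapes x) t \<tau> \<and> t \<le> poly p (length x) \<and>
       (\<forall>i\<le>length (f x). fst (\<tau> 0) (int i) = word_tape (f x) (int i))"
  shows "poly_time_on D f"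
proof -
  \<comment> \<open>The trailing \<open>Skip\<close> keeps the initial state apart from the halting
    state even if \<open>c\<close> is \<open>Skip\<close>.\<close>
  define c0 where "c0 = Seq c Skip"
  define M where "M = com_tm (B + 3) c0"
  have b: "bounded_com (B + 3) c0" using bounded_com_mono[OF assms(1)] by (simp add: c0_def)
  have "tm_outputs M x (poly (p + 1) (length x)) (f x)" if "x \<in> D" for x
  proof -
    obtain t \<tau> where r: "runs c (input_tapes x) t \<tau>" "t \<le> poly p (length x)"
        "\<forall>i\<le>length (f x). fst (\<tau> 0) (int i) = word_tape (f x) (int i)"
      using assms(2) \<open>x \<in> D\<close> by blast
    have "runs c0 (input_tapes x) (t + 1) \<tau>"
      using runs_Seq[OF r(1) runs_Skip] by (simp add: c0_def)
    moreover have "(config_step ^^ n) (Skip, \<tau>) = (Skip, \<tau>)" for n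
      by (induction n) (auto simp: config_step_def)
    moreover obtain n where n: "poly (p + 1) (length x) = n + (t + 1)"
      using r(2) by (metis add.commute add_le_cancel_right le_Suc_ex poly_add poly_1)
    ultimately have e: "(config_step ^^ poly (p + 1) (length x)) (c0, input_tapes x) = (Skip, \<tau>)"
      unfolding n funpow_add o_apply runs_def by (simp del: funpow.simps add: n)
    have "c0 \<noteq> Skip" by (simp add: c0_def)
    show ?thesis
      using com_tm_simulates[OF b _ \<open>c0 \<noteq> Skip\<close>, of "poly (p + 1) (length x)" x] e r(3) com_states(3)[OF \<open>c0 \<noteq> Skip\<close>]
      by (auto simp: tm_outputs_def M_def hd_map)
  qed
  moreover have "tm_wf M" unfolding M_def using b by (intro tm_wf_com_tm) (auto simp: c0_def)
  ultimately show ?thesis unfolding poly_time_on_def by blast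
qed

section \<open>Programs on registers\<close>

lemma poly_nat_mono:
  fixes p :: "nat poly"
  assumes "a \<le> b"
  shows "poly p a \<le> poly p b"
  using assms by (induction p) (auto intro: mult_mono add_mono)

definition poly_bounded :: "(nat \<Rightarrow> nat) \<Rightarrow> bool" where
  "poly_bounded f \<longleftrightarrow> (\<exists>p :: nat poly. \<forall>n. f n \<le> poly p n)"

lemma poly_bounded_const: "poly_bounded (\<lambda>n. c)"
  unfolding poly_bounded_def by (rule exI[of _ "[:c:]"]) simp

lemma poly_bounded_id: "poly_bounded (\<lambda>n. n)"
  unfolding poly_bounded_def by (rule exI[of _ "[:0, 1:]"]) simp

lemma poly_bounded_add: "poly_bounded f \<Longrightarrow> poly_bounded g \<Longrightarrow> poly_bounded (\<lambda>n. f n + g n)"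
  unfolding poly_bounded_def by (metis add_mono poly_add)

lemma poly_bounded_mult: "poly_bounded f \<Longrightarrow> poly_bounded g \<Longrightarrow> poly_bounded (\<lambda>n. f n * g n)"
  unfolding poly_bounded_def by (metis mult_le_mono poly_mult)

lemma poly_bounded_poly:
  assumes "poly_bounded f"
  shows "poly_bounded (\<lambda>n. poly p (f n))"
proof -
  obtain q where "\<And>n. f n \<le> poly q n" using assms unfolding poly_bounded_def by blast
  then have "poly p (f n) \<le> poly (pcompose p q) n" for n
    by (simp add: poly_pcompose poly_nat_mono)
  then show ?thesis unfolding poly_bounded_def by blast
qed

lemma poly_bounded_Suc: "poly_bounded f \<Longrightarrow> poly_bounded (\<lambda>n. Suc (f n))"
  using poly_bounded_add[OF _ poly_bounded_const[of 1]] by simp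

lemmas poly_bounded_intros =
  poly_bounded_const poly_bounded_id poly_bounded_add poly_bounded_mult poly_bounded_poly poly_bounded_Suc

text \<open>A register is a stack with its top under the head and blanks everywhere else. Head
  positions drift and carry no meaning, so pushing and popping are local operations and no end
  marker is needed.\<close>

definition stack_tape :: "(int \<Rightarrow> nat) \<times> int \<Rightarrow> bool list \<Rightarrow> bool" where
  "stack_tape t x \<longleftrightarrow> (\<forall>i. fst t i = word_tape x (i - snd t))"

definition top_symbol :: "bool list \<Rightarrow> nat" where
  "top_symbol x = (case x of [] \<Rightarrow> 0 | b # _ \<Rightarrow> if b then 2 else 1)"

lemma top_symbol_simps [simp]:
  "top_symbol [] = 0" "top_symbol (b # x) = (if b then 2 else 1)" "top_symbol x = 0 \<longleftrightarrow> x = []"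
  by (auto simp: top_symbol_def split: list.splits)

lemma word_tape_Nil [simp]: "word_tape [] i = 0"
  by (simp add: word_tape_def)

lemma word_tape_Cons:
  "word_tape (b # x) i = (if i = 0 then if b then 2 else 1 else word_tape x (i - 1))"
proof -
  have "nat i = Suc (nat (i - 1))" if "i > 0" using that by linarith
  then show ?thesis by (auto simp: word_tape_def)
qed

lemma stack_tape_head: "stack_tape t x \<Longrightarrow> fst t (snd t) = top_symbol x"
  by (cases x) (auto simp: stack_tape_def word_tape_Cons)

text \<open>Tape 0 is reserved for input and output and tape 1 for the marker of cell 0 of tape 0.\<close>

definition holds :: "tapes \<Rightarrow> (nat \<Rightarrow> bool list) \<Rightarrow> bool" where
  "holds \<tau> s \<longleftrightarrow> (\<forall>r. stack_tape (\<tau> (r + 2)) (s r))"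

text \<open>Head positions are hidden by quantifying over all tapes that hold the store. Tapes 0 and
  1 stay fixed so that the input and output phases can be wrapped around any such program.\<close>

definition sruns :: "com \<Rightarrow> (nat \<Rightarrow> bool list) \<Rightarrow> nat \<Rightarrow> (nat \<Rightarrow> bool list) \<Rightarrow> bool" where
  "sruns c s t s' \<longleftrightarrow> (\<forall>\<tau>. holds \<tau> s \<longrightarrow> (\<exists>t'\<le>t. \<exists>\<tau>'. runs c \<tau> t' \<tau>' \<and> holds \<tau>' s' \<and>
     \<tau>' 0 = \<tau> 0 \<and> \<tau>' 1 = \<tau> 1))"

lemma sruns_weaken: "sruns c s t s' \<Longrightarrow> t \<le> t' \<Longrightarrow> s' = s'' \<Longrightarrow> sruns c s t' s''"
  unfolding sruns_def by (meson le_trans)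

lemma holds_heads: "holds \<tau> s \<Longrightarrow> heads \<tau> (r + 2) = top_symbol (s r)"
  by (simp add: holds_def heads_def stack_tape_head)

lemma sruns_Skip: "sruns Skip s 0 s"
  unfolding sruns_def using runs_Skip by blast

lemma sruns_Seq:
  assumes "sruns c s t s1" "sruns d s1 t' s2"
  shows "sruns (Seq c d) s (t + 1 + t') s2"
  unfolding sruns_def
proof (intro allI impI)
  fix \<tau> assume "holds \<tau> s"
  then obtain u \<tau>1 where 1: "u \<le> t" "runs c \<tau> u \<tau>1" "holds \<tau>1 s1" "\<tau>1 0 = \<tau> 0" "\<tau>1 1 = \<tau> 1"
    using assms(1) unfolding sruns_def by blast
  then obtain u' \<tau>2 where 2: "u' \<le> t'" "runs d \<tau>1 u' \<tau>2" "holds \<tau>2 s2" "\<tau>2 0 = \<tau>1 0" "\<tau>2 1 = \<tau>1 1"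
    using assms(2) unfolding sruns_def by blast
  have "u + 1 + u' \<le> t + 1 + t'" using 1 2 by simp
  then show "\<exists>t''\<le>t + 1 + t'. \<exists>\<tau>'. runs (Seq c d) \<tau> t'' \<tau>' \<and> holds \<tau>' s2 \<and> \<tau>' 0 = \<tau> 0 \<and> \<tau>' 1 = \<tau> 1"
    using runs_Seq[OF 1(2) 2(2)] 1 2 by metis
qed

lemma sruns_Cond:
  assumes "sruns (if q (\<lambda>r. top_symbol (s r)) then c else d) s t s'"
  shows "sruns (Cond (\<lambda>ss. q (\<lambda>r. ss (r + 2))) c d) s (t + 1) s'"
  unfolding sruns_def
proof (intro allI impI)
  fix \<tau> assume h: "holds \<tau> s"
  then obtain u \<tau>1 where 1: "u \<le> t" "runs (if q (\<lambda>r. top_symbol (s r)) then c else d) \<tau> u \<tau>1" "holds \<tau>1 s'"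
      "\<tau>1 0 = \<tau> 0" "\<tau>1 1 = \<tau> 1"
    using assms(1) unfolding sruns_def by blast
  have "(\<lambda>r. heads \<tau> (r + 2)) = (\<lambda>r. top_symbol (s r))" using holds_heads[OF h] by blast
  then have "runs (Cond (\<lambda>ss. q (\<lambda>r. ss (r + 2))) c d) \<tau> (u + 1) \<tau>1"
    using 1(2) by (intro runs_Cond) simp
  then show "\<exists>t'\<le>t + 1. \<exists>\<tau>'. runs (Cond (\<lambda>ss. q (\<lambda>r. ss (r + 2))) c d) \<tau> t' \<tau>' \<and> holds \<tau>' s' \<and> \<tau>' 0 = \<tau> 0 \<and> \<tau>' 1 = \<tau> 1"
    using 1 by (intro exI[of _ "u + 1"]) auto
qed

lemma sruns_Loop_end:
  assumes "\<not> q (\<lambda>r. top_symbol (s r))"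
  shows "sruns (Loop (\<lambda>ss. q (\<lambda>r. ss (r + 2))) c) s 1 s"
  unfolding sruns_def
proof (intro allI impI)
  fix \<tau> assume h: "holds \<tau> s"
  have "(\<lambda>r. heads \<tau> (r + 2)) = (\<lambda>r. top_symbol (s r))" using holds_heads[OF h] by blast
  then have "runs (Loop (\<lambda>ss. q (\<lambda>r. ss (r + 2))) c) \<tau> 1 \<tau>"
    using assms by (intro runs_Loop_end) simp
  then show "\<exists>t'\<le>1. \<exists>\<tau>'. runs (Loop (\<lambda>ss. q (\<lambda>r. ss (r + 2))) c) \<tau> t' \<tau>' \<and> holds \<tau>' s \<and> \<tau>' 0 = \<tau> 0 \<and> \<tau>' 1 = \<tau> 1"
    using h by blast
qed

lemma sruns_Loop_step:
  assumes "q (\<lambda>r. top_symbol (s r))" "sruns c s t s1" "sruns (Loop (\<lambda>ss. q (\<lambda>r. ss (r + 2))) c) s1 t' s2"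
  shows "sruns (Loop (\<lambda>ss. q (\<lambda>r. ss (r + 2))) c) s (t + t' + 2) s2"
  unfolding sruns_def
proof (intro allI impI)
  fix \<tau> assume h: "holds \<tau> s"
  let ?L = "Loop (\<lambda>ss. q (\<lambda>r. ss (r + 2))) c"
  obtain u \<tau>1 where 1: "u \<le> t" "runs c \<tau> u \<tau>1" "holds \<tau>1 s1" "\<tau>1 0 = \<tau> 0" "\<tau>1 1 = \<tau> 1"
    using assms(2) h unfolding sruns_def by blast
  then obtain u' \<tau>2 where 2: "u' \<le> t'" "runs ?L \<tau>1 u' \<tau>2" "holds \<tau>2 s2" "\<tau>2 0 = \<tau>1 0" "\<tau>2 1 = \<tau>1 1"
    using assms(3) unfolding sruns_def by blast
  have "(\<lambda>r. heads \<tau> (r + 2)) = (\<lambda>r. top_symbol (s r))" using holds_heads[OF h] by blast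
  then have "runs ?L \<tau> (u + u' + 2) \<tau>2"
    using assms(1) by (intro runs_Loop_step[OF _ 1(2) 2(2)]) simp
  moreover have "u + u' + 2 \<le> t + t' + 2" using 1 2 by simp
  ultimately show "\<exists>t''\<le>t + t' + 2. \<exists>\<tau>'. runs ?L \<tau> t'' \<tau>' \<and> holds \<tau>' s2 \<and> \<tau>' 0 = \<tau> 0 \<and> \<tau>' 1 = \<tau> 1"
    using 1 2 by metis
qed

lemma sruns_Loop_iterate:
  assumes "\<And>k. k < n \<Longrightarrow> q (\<lambda>r. top_symbol (S k r))" "\<And>k. k < n \<Longrightarrow> sruns c (S k) t (S (Suc k))"
    and "\<not> q (\<lambda>r. top_symbol (S n r))"
  shows "sruns (Loop (\<lambda>ss. q (\<lambda>r. ss (r + 2))) c) (S 0) (n * (t + 2) + 1) (S n)"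
proof -
  let ?L = "Loop (\<lambda>ss. q (\<lambda>r. ss (r + 2))) c"
  have "sruns ?L (S (n - k)) (k * (t + 2) + 1) (S n)" if "k \<le> n" for k
    using that
  proof (induction k)
    case 0
    then show ?case using sruns_Loop_end[of q "S n" c] assms(3) by simp
  next
    case (Suc k)
    have *: "Suc (n - Suc k) = n - k" using Suc.prems by simp
    have "sruns ?L (S (n - Suc k)) (t + (k * (t + 2) + 1) + 2) (S n)"
      using Suc assms(1)[of "n - Suc k"] assms(2)[of "n - Suc k"] *
      by (intro sruns_Loop_step[of q _ c t "S (n - k)"]) auto
    then show ?case by (simp add: algebra_simps)
  qed
  from this[of n] show ?thesis by simp
qed

section \<open>Stack operations\<close>

definition push :: "nat \<Rightarrow> bool \<Rightarrow> com" where
  "push r b = Seq (Act (\<lambda>ss i. (ss i, if i = r + 2 then -1 else 0)))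
     (Act (\<lambda>ss i. (if i = r + 2 then if b then 2 else 1 else ss i, 0)))"

definition pop :: "nat \<Rightarrow> com" where
  "pop r = Act (\<lambda>ss i. if i = r + 2 then (0, 1) else (ss i, 0))"

lemma bounded_push_pop:
  "r + 3 \<le> B \<Longrightarrow> bounded_com B (push r b)" "r + 3 \<le> B \<Longrightarrow> bounded_com B (pop r)"
  by (auto simp: push_def pop_def)

lemma perform_same: "a i = (heads \<tau> i, 0) \<Longrightarrow> perform a \<tau> i = \<tau> i"
  by (auto simp: perform_def heads_def prod_eq_iff)

lemma sruns_push: "sruns (push r b) s 3 (s(r := b # s r))"
  unfolding sruns_def
proof (intro allI impI)
  fix \<tau> assume h: "holds \<tau> s"
  define a1 where "a1 = (\<lambda>(ss :: nat \<Rightarrow> nat) i. (ss i, if i = r + 2 then -1 else 0 :: int))"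
  define a2 where "a2 = (\<lambda>(ss :: nat \<Rightarrow> nat) i. (if i = r + 2 then if b then 2 else 1 else ss i, 0 :: int))"
  define \<tau>1 where "\<tau>1 = perform (a1 (heads \<tau>)) \<tau>"
  define \<tau>2 where "\<tau>2 = perform (a2 (heads \<tau>1)) \<tau>1"
  have "runs (push r b) \<tau> (1 + 1 + 1) \<tau>2"
    unfolding push_def a1_def[symmetric] a2_def[symmetric] \<tau>2_def
    unfolding \<tau>1_def by (rule runs_Seq[OF runs_Act runs_Act])
  moreover have other: "\<tau>2 i = \<tau> i" if "i \<noteq> r + 2" for i
    unfolding \<tau>2_def \<tau>1_def using that by (auto simp: perform_same a1_def a2_def)
  moreover have "holds \<tau>2 (s(r := b # s r))"
    unfolding holds_def
  proof
    fix i
    show "stack_tape (\<tau>2 (i + 2)) ((s(r := b # s r)) i)"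
    proof (cases "i = r")
      case True
      have "\<tau>2 (r + 2) = ((fst (\<tau> (r + 2)))(snd (\<tau> (r + 2)) - 1 := if b then 2 else 1), snd (\<tau> (r + 2)) - 1)"
        by (auto simp: \<tau>2_def \<tau>1_def a1_def a2_def perform_def heads_def)
      moreover have "stack_tape (\<tau> (r + 2)) (s r)" using h by (simp add: holds_def)
      ultimately show ?thesis using True
        by (auto simp: stack_tape_def word_tape_Cons algebra_simps)
    next
      case False
      then show ?thesis using other[of "i + 2"] h by (simp add: holds_def)
    qed
  qed
  ultimately show "\<exists>t'\<le>3. \<exists>\<tau>'. runs (push r b) \<tau> t' \<tau>' \<and> holds \<tau>' (s(r := b # s r)) \<and> \<tau>' 0 = \<tau> 0 \<and> \<tau>' 1 = \<tau> 1"
    by (intro exI[of _ "1 + 1 + 1"] conjI exI[of _ \<tau>2]) auto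
qed

lemma sruns_pop: "sruns (pop r) s 1 (s(r := tl (s r)))"
  unfolding sruns_def
proof (intro allI impI)
  fix \<tau> assume h: "holds \<tau> s"
  define a1 where "a1 = (\<lambda>(ss :: nat \<Rightarrow> nat) i. if i = r + 2 then (0, 1 :: int) else (ss i, 0))"
  define \<tau>1 where "\<tau>1 = perform (a1 (heads \<tau>)) \<tau>"
  have "runs (pop r) \<tau> 1 \<tau>1"
    unfolding pop_def \<tau>1_def a1_def by (intro runs_Act)
  moreover have other: "\<tau>1 i = \<tau> i" if "i \<noteq> r + 2" for i
    unfolding \<tau>1_def using that by (auto simp: perform_same a1_def)
  moreover have "holds \<tau>1 (s(r := tl (s r)))"
    unfolding holds_def
  proof
    fix i
    show "stack_tape (\<tau>1 (i + 2)) ((s(r := tl (s r))) i)"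
    proof (cases "i = r")
      case True
      have "\<tau>1 (r + 2) = ((fst (\<tau> (r + 2)))(snd (\<tau> (r + 2)) := 0), snd (\<tau> (r + 2)) + 1)"
        by (auto simp: \<tau>1_def a1_def perform_def heads_def)
      moreover have st: "stack_tape (\<tau> (r + 2)) (s r)" using h by (simp add: holds_def)
      moreover have "word_tape (tl x) (j - 1) = (if j = 0 then 0 else word_tape x j)" for x j
        by (cases x) (auto simp: word_tape_Cons, simp add: word_tape_def)
      from this[of "s r" "j - snd (\<tau> (r + 2))" for j]
      have "word_tape (tl (s r)) (j - (snd (\<tau> (r + 2)) + 1)) =
          (if j = snd (\<tau> (r + 2)) then 0 else word_tape (s r) (j - snd (\<tau> (r + 2))))" for j
        by (simp add: algebra_simps)
      ultimately show ?thesis using True by (auto simp: stack_tape_def)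
    next
      case False
      then show ?thesis using other[of "i + 2"] h by (simp add: holds_def)
    qed
  qed
  ultimately show "\<exists>t'\<le>1. \<exists>\<tau>'. runs (pop r) \<tau> t' \<tau>' \<and> holds \<tau>' (s(r := tl (s r))) \<and> \<tau>' 0 = \<tau> 0 \<and> \<tau>' 1 = \<tau> 1"
    by (intro exI[of _ 1] conjI exI[of _ \<tau>1]) auto
qed

text \<open>A step writes at most one cell of a tape, and the length of a register is the number of
  its nonblank cells. Every time bound thus yields a bound on the length of the output.\<close>

lemma sruns_length:
  assumes "sruns c s t s'"
  shows "length (s' r) \<le> length (s r) + t"
proof -
  define \<tau> :: tapes where "\<tau> i = (if i < 2 then \<lambda>_. 0 else word_tape (s (i - 2)), 0)" for i
  have "holds \<tau> s" by (simp add: holds_def \<tau>_def stack_tape_def)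
  then obtain u \<tau>' where u: "u \<le> t" "runs c \<tau> u \<tau>'" "holds \<tau>' s'" using assms unfolding sruns_def by blast
  define N where "N = (\<lambda>\<sigma> :: tapes. {i. fst (\<sigma> (r + 2)) i \<noteq> 0})"
  have st: "stack_tape w x \<Longrightarrow> finite {i. fst w i \<noteq> 0} \<and> card {i. fst w i \<noteq> 0} = length x" for w x
  proof -
    assume a: "stack_tape w x"
    have "{i. fst w i \<noteq> 0} = (\<lambda>j. int j + snd w) ` {..<length x}"
    proof (intro set_eqI iffI)
      fix i assume "i \<in> {i. fst w i \<noteq> 0}"
      then have "0 \<le> i - snd w" "i - snd w < length x"
        using a by (auto simp: stack_tape_def word_tape_def split: if_splits)
      then show "i \<in> (\<lambda>j. int j + snd w) ` {..<length x}"
        by (intro image_eqI[of _ _ "nat (i - snd w)"]) auto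
    next
      fix i assume "i \<in> (\<lambda>j. int j + snd w) ` {..<length x}"
      then show "i \<in> {i. fst w i \<noteq> 0}" using a by (auto simp: stack_tape_def word_tape_def)
    qed
    then show ?thesis by (simp add: card_image inj_on_def)
  qed
  have "finite (N (snd ((config_step ^^ k) (c, \<tau>)))) \<and>
      card (N (snd ((config_step ^^ k) (c, \<tau>)))) \<le> length (s r) + k" for k
  proof (induction k)
    case 0
    then show ?case using st[of "\<tau> (r + 2)" "s r"] \<open>holds \<tau> s\<close> by (simp add: N_def holds_def)
  next
    case (Suc k)
    obtain c1 \<tau>1 where e: "(config_step ^^ k) (c, \<tau>) = (c1, \<tau>1)" by fastforce
    have sub: "N (perform a \<tau>1) \<subseteq> insert (snd (\<tau>1 (r + 2))) (N \<tau>1)" for a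
      by (auto simp: N_def perform_def)
    have "finite (N (perform a \<tau>1)) \<and> card (N (perform a \<tau>1)) \<le> Suc (card (N \<tau>1))" for a
    proof -
      have f: "finite (N \<tau>1)" using Suc e by simp
      have "card (N (perform a \<tau>1)) \<le> card (insert (snd (\<tau>1 (r + 2))) (N \<tau>1))"
        using f by (intro card_mono) (auto simp: N_def perform_def)
      also have "\<dots> \<le> Suc (card (N \<tau>1))" using f by (simp add: card_insert_if)
      finally show ?thesis
        using f finite_subset[of "N (perform a \<tau>1)" "insert (snd (\<tau>1 (r + 2))) (N \<tau>1)"] sub by simp
    qed
    from this[of "snd (com_step c1 (heads \<tau>1))"] show ?case using Suc e by (simp add: config_step_def)
  qed
  from this[of u] have "card (N \<tau>') \<le> length (s r) + u" using u(2) by (simp add: runs_def)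
  then show ?thesis using st[of "\<tau>' (r + 2)" "s' r"] u by (simp add: N_def holds_def)
qed

text \<open>The popped bit is lost unless the control remembers it, hence one copy of the body for
  each value of the bit.\<close>

definition pop_each :: "nat \<Rightarrow> (bool \<Rightarrow> com) \<Rightarrow> com" where
  "pop_each r f = Loop (\<lambda>ss. ss (r + 2) \<noteq> 0)
     (Cond (\<lambda>ss. ss (r + 2) = 2) (Seq (pop r) (f True)) (Seq (pop r) (f False)))"

lemma bounded_pop_each: "r + 3 \<le> B \<Longrightarrow> (\<And>b. bounded_com B (f b)) \<Longrightarrow> bounded_com B (pop_each r f)"
  by (simp add: pop_each_def bounded_push_pop)

lemma sruns_pop_each:
  assumes "\<And>k. k \<le> length x \<Longrightarrow> S k r = drop k x"
    and "\<And>k. k < length x \<Longrightarrow> sruns (f (x ! k)) ((S k)(r := drop (Suc k) x)) t (S (Suc k))"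
  shows "sruns (pop_each r f) (S 0) (length x * (t + 5) + 1) (S (length x))"
proof -
  have "sruns (Cond (\<lambda>ss. ss (r + 2) = 2) (Seq (pop r) (f True)) (Seq (pop r) (f False))) (S k) (1 + 1 + t + 1) (S (Suc k))"
    if "k < length x" for k
  proof (rule sruns_Cond[where q = "\<lambda>h. h r = 2"])
    have d: "S k r = x ! k # drop (Suc k) x" using assms(1)[of k] that by (simp add: Cons_nth_drop_Suc)
    have "sruns (Seq (pop r) (f (x ! k))) (S k) (1 + 1 + t) (S (Suc k))"
      using assms(2)[OF that] sruns_pop[of r "S k"] d by (intro sruns_Seq) auto
    then show "sruns (if top_symbol (S k r) = 2 then Seq (pop r) (f True) else Seq (pop r) (f False)) (S k) (1 + 1 + t) (S (Suc k))"
      using d by (cases "x ! k") auto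
  qed
  then have "sruns (Loop (\<lambda>ss. ss (r + 2) \<noteq> 0)
     (Cond (\<lambda>ss. ss (r + 2) = 2) (Seq (pop r) (f True)) (Seq (pop r) (f False)))) (S 0)
      (length x * ((1 + 1 + t + 1) + 2) + 1) (S (length x))"
    using assms(1) by (intro sruns_Loop_iterate[where q = "\<lambda>h. h r \<noteq> 0"]) auto
  then show ?thesis unfolding pop_each_def by (rule sruns_weaken) (auto simp: algebra_simps)
qed

text \<open>Pouring one stack onto another reverses it, so programs below use moves in pairs to
  restore the order.\<close>

definition move :: "nat \<Rightarrow> nat \<Rightarrow> com" where
  "move r r' = pop_each r (push r')"

lemma sruns_move:
  assumes "r \<noteq> r'"
  shows "sruns (move r r') s (length (s r) * 8 + 1) (s(r := [], r' := rev (s r) @ s r'))"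
proof -
  define S where "S k = s(r := drop k (s r), r' := rev (take k (s r)) @ s r')" for k
  have "sruns (pop_each r (push r')) (S 0) (length (s r) * (3 + 5) + 1) (S (length (s r)))"
  proof (rule sruns_pop_each)
    fix k assume "k < length (s r)"
    then show "sruns (push r' (s r ! k)) ((S k)(r := drop (Suc k) (s r))) 3 (S (Suc k))"
      using assms by (intro sruns_weaken[OF sruns_push])
        (auto simp: S_def fun_eq_iff take_Suc_conv_app_nth)
  qed (use assms in \<open>auto simp: S_def\<close>)
  then show ?thesis unfolding move_def by (simp add: S_def)
qed

definition move2 :: "nat \<Rightarrow> nat \<Rightarrow> nat \<Rightarrow> com" where
  "move2 r r' r'' = pop_each r (\<lambda>b. Seq (push r' b) (push r'' b))"

lemma sruns_move2:
  assumes "distinct [r, r', r'']"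
  shows "sruns (move2 r r' r'') s (length (s r) * 12 + 1)
    (s(r := [], r' := rev (s r) @ s r', r'' := rev (s r) @ s r''))"
proof -
  define S where "S k = s(r := drop k (s r), r' := rev (take k (s r)) @ s r', r'' := rev (take k (s r)) @ s r'')" for k
  have "sruns (pop_each r (\<lambda>b. Seq (push r' b) (push r'' b))) (S 0) (length (s r) * ((3 + 1 + 3) + 5) + 1) (S (length (s r)))"
  proof (rule sruns_pop_each)
    fix k assume "k < length (s r)"
    then show "sruns (Seq (push r' (s r ! k)) (push r'' (s r ! k))) ((S k)(r := drop (Suc k) (s r))) (3 + 1 + 3) (S (Suc k))"
      using assms by (intro sruns_weaken[OF sruns_Seq[OF sruns_push sruns_push]])
        (auto simp: S_def fun_eq_iff take_Suc_conv_app_nth)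
  qed (use assms in \<open>auto simp: S_def\<close>)
  then show ?thesis unfolding move2_def by (simp add: S_def)
qed

definition clear :: "nat \<Rightarrow> com" where
  "clear r = pop_each r (\<lambda>_. Skip)"

lemma sruns_clear: "sruns (clear r) s (length (s r) * 5 + 1) (s(r := []))"
proof -
  define S where "S k = s(r := drop k (s r))" for k
  have "sruns (pop_each r (\<lambda>_. Skip)) (S 0) (length (s r) * (0 + 5) + 1) (S (length (s r)))"
  proof (rule sruns_pop_each)
    fix k
    show "sruns Skip ((S k)(r := drop (Suc k) (s r))) 0 (S (Suc k))"
      by (rule sruns_weaken[OF sruns_Skip]) (auto simp: S_def)
  qed (auto simp: S_def)
  then show ?thesis unfolding clear_def by (simp add: S_def)
qed

lemma bounded_move_clear:
  "r + 3 \<le> B \<Longrightarrow> r' + 3 \<le> B \<Longrightarrow> bounded_com B (move r r')"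
  "r + 3 \<le> B \<Longrightarrow> r' + 3 \<le> B \<Longrightarrow> r'' + 3 \<le> B \<Longrightarrow> bounded_com B (move2 r r' r'')"
  "r + 3 \<le> B \<Longrightarrow> bounded_com B (clear r)"
  by (auto simp: move_def move2_def clear_def intro!: bounded_pop_each bounded_push_pop)

primrec pushes :: "nat \<Rightarrow> bool list \<Rightarrow> com" where
  "pushes r [] = Skip"
| "pushes r (b # bs) = Seq (push r b) (pushes r bs)"

lemma bounded_pushes: "r + 3 \<le> B \<Longrightarrow> bounded_com B (pushes r bs)"
  by (induction bs) (auto simp: bounded_push_pop)

lemma sruns_pushes: "sruns (pushes r bs) s (length bs * 4) (s(r := rev bs @ s r))"
proof (induction bs arbitrary: s)
  case Nil
  then show ?case using sruns_Skip by simp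
next
  case (Cons b bs)
  have "sruns (Seq (push r b) (pushes r bs)) s (3 + 1 + length bs * 4)
      ((s(r := b # s r))(r := rev bs @ (s(r := b # s r)) r))"
    by (rule sruns_Seq[OF sruns_push Cons.IH])
  then show ?case unfolding pushes.simps by (rule sruns_weaken) auto
qed

section \<open>Register expressions of polynomial running time\<close>

definition store_size :: "(nat \<Rightarrow> bool list) \<Rightarrow> nat \<Rightarrow> nat" where
  "store_size s e = (\<Sum>i<e. length (s i))"

lemma store_size_Suc [simp]: "store_size s (Suc e) = store_size s e + length (s e)"
  by (simp add: store_size_def)

lemma store_size_upd [simp]: "e \<le> r \<Longrightarrow> store_size (s(r := x)) e = store_size s e"
  by (simp add: store_size_def)

lemma length_le_store_size: "i < e \<Longrightarrow> length (s i) \<le> store_size s e"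
  unfolding store_size_def by (rule member_le_sum) auto

text \<open>
  The expression \<open>E\<close> reads registers below \<open>d\<close>. Its value can be computed into any register
  \<open>e \<ge> d\<close> such that \<open>e\<close> and all registers above it are empty; this leaves room for intermediate
  results between \<open>d\<close> and \<open>e\<close>.
\<close>

definition computable ::
    "nat \<Rightarrow> ((nat \<Rightarrow> bool list) \<Rightarrow> bool) \<Rightarrow> ((nat \<Rightarrow> bool list) \<Rightarrow> bool list) \<Rightarrow> bool" where
  "computable d D E \<longleftrightarrow> (\<forall>e\<ge>d. \<forall>s x. E (s(e := x)) = E s \<and> D (s(e := x)) = D s) \<and>
     (\<forall>e\<ge>d. \<exists>c B (p :: nat poly). bounded_com B c \<and>
        (\<forall>s. D s \<and> (\<forall>i\<ge>e. s i = []) \<longrightarrow> sruns c s (poly p (store_size s e)) (s(e := E s))))"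

lemma computableI:
  assumes "\<And>e s x. d \<le> e \<Longrightarrow> E (s(e := x)) = E s" "\<And>e s x. d \<le> e \<Longrightarrow> D (s(e := x)) = D s"
    and "\<And>e. d \<le> e \<Longrightarrow> \<exists>c B T. bounded_com B c \<and> poly_bounded T \<and>
        (\<forall>s. D s \<and> (\<forall>i\<ge>e. s i = []) \<longrightarrow> sruns c s (T (store_size s e)) (s(e := E s)))"
  shows "computable d D E"
  unfolding computable_def
proof (intro conjI allI impI)
  fix e assume "d \<le> e"
  then obtain c B T where *: "bounded_com B c" "poly_bounded T"
      "\<And>s. D s \<Longrightarrow> (\<forall>i\<ge>e. s i = []) \<Longrightarrow> sruns c s (T (store_size s e)) (s(e := E s))"
    using assms(3) by meson
  obtain p :: "nat poly" where "\<And>n. T n \<le> poly p n" using *(2) unfolding poly_bounded_def by blast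
  with * show "\<exists>c B (p :: nat poly). bounded_com B c \<and>
        (\<forall>s. D s \<and> (\<forall>i\<ge>e. s i = []) \<longrightarrow> sruns c s (poly p (store_size s e)) (s(e := E s)))"
    by (intro exI[of _ c] exI[of _ B] exI[of _ p]) (auto intro: sruns_weaken[OF *(3)])
qed (use assms in auto)

lemma computableD:
  assumes "computable d D E" "d \<le> e"
  shows "E (s(e := x)) = E s" "D (s(e := x)) = D s"
  using assms unfolding computable_def by auto

lemma computableE:
  assumes "computable d D E" "d \<le> e"
  obtains c B p where "bounded_com B c"
    "\<And>s. D s \<Longrightarrow> (\<forall>i\<ge>e. s i = []) \<Longrightarrow> sruns c s (poly p (store_size s e)) (s(e := E s))"
    "\<And>s. D s \<Longrightarrow> (\<forall>i\<ge>e. s i = []) \<Longrightarrow> length (E s) \<le> poly p (store_size s e)"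
proof -
  obtain c B p where *: "bounded_com B c"
    "\<And>s. D s \<Longrightarrow> (\<forall>i\<ge>e. s i = []) \<Longrightarrow> sruns c s (poly p (store_size s e)) (s(e := E s))"
    using assms unfolding computable_def by meson
  have "length (E s) \<le> poly p (store_size s e)" if "D s" "\<forall>i\<ge>e. s i = []" for s
    using sruns_length[OF *(2)[OF that], of e] that by simp
  with * show ?thesis using that by blast
qed

lemma computable_weaken: "computable d D E \<Longrightarrow> d \<le> d' \<Longrightarrow> computable d' D E"
  unfolding computable_def by auto

lemma computable_const:
  assumes "\<And>e s x. d \<le> e \<Longrightarrow> D (s(e := x)) = D s"
  shows "computable d D (\<lambda>s. x)"
proof (rule computableI)
  fix e assume "d \<le> e"
  show "\<exists>c B T. bounded_com B c \<and> poly_bounded T \<and>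
        (\<forall>s. D s \<and> (\<forall>i\<ge>e. s i = []) \<longrightarrow> sruns c s (T (store_size s e)) (s(e := x)))"
    using bounded_pushes[of e "e + 3" "rev x"]
    by (intro exI[of _ "pushes e (rev x)"] exI[of _ "e + 3"] exI[of _ "\<lambda>_. length x * 4"])
      (auto intro!: poly_bounded_intros sruns_weaken[OF sruns_pushes])
qed (use assms in auto)

lemma computable_var:
  assumes "i < d" "\<And>e s x. d \<le> e \<Longrightarrow> D (s(e := x)) = D s"
  shows "computable d D (\<lambda>s. s i)"
proof (rule computableI)
  fix e assume "d \<le> e"
  \<comment> \<open>Reading a stack destroys it: the word is reversed into the scratch register
    \<open>e + 1\<close> and then poured back into \<open>i\<close> and \<open>e\<close> at
    once.\<close>
  define c where "c = Seq (move i (e + 1)) (move2 (e + 1) i e)"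
  have "bounded_com (e + 4) c" unfolding c_def using assms \<open>d \<le> e\<close> by (auto intro: bounded_move_clear)
  moreover have "sruns c s (store_size s e * 20 + 3) (s(e := s i))" if "\<forall>j\<ge>e. s j = []" for s
  proof (rule sruns_weaken)
    show "sruns c s ((length (s i) * 8 + 1) + 1 + (length (s i) * 12 + 1)) (s(e := s i))"
      unfolding c_def
    proof (rule sruns_Seq)
      show "sruns (move i (e + 1)) s (length (s i) * 8 + 1) (s(i := [], e + 1 := rev (s i) @ s (e + 1)))"
        using assms \<open>d \<le> e\<close> by (intro sruns_move) auto
      show "sruns (move2 (e + 1) i e) (s(i := [], e + 1 := rev (s i) @ s (e + 1))) (length (s i) * 12 + 1) (s(e := s i))"
        using assms \<open>d \<le> e\<close> that
        by (intro sruns_weaken[OF sruns_move2]) (auto simp: fun_eq_iff)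
    qed
    have "length (s i) \<le> store_size s e" using assms \<open>d \<le> e\<close> by (intro length_le_store_size) auto
    then show "(length (s i) * 8 + 1) + 1 + (length (s i) * 12 + 1) \<le> store_size s e * 20 + 3" by simp
  qed auto
  ultimately show "\<exists>c B T. bounded_com B c \<and> poly_bounded T \<and>
        (\<forall>s. D s \<and> (\<forall>j\<ge>e. s j = []) \<longrightarrow> sruns c s (T (store_size s e)) (s(e := s i)))"
    by (intro exI[of _ c] exI[of _ "e + 4"] exI[of _ "\<lambda>n. n * 20 + 3"]) (auto intro!: poly_bounded_intros)
qed (use assms in auto)

lemma computable_append:
  assumes E1: "computable d D E1" and E2: "computable d D E2"
  shows "computable d D (\<lambda>s. E1 s @ E2 s)"
proof (rule computableI)
  fix e assume "d \<le> e"
  obtain c1 B1 p1 where 1: "bounded_com B1 c1"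
    "\<And>s. D s \<Longrightarrow> (\<forall>i\<ge>e. s i = []) \<Longrightarrow> sruns c1 s (poly p1 (store_size s e)) (s(e := E1 s))"
    "\<And>s. D s \<Longrightarrow> (\<forall>i\<ge>e. s i = []) \<Longrightarrow> length (E1 s) \<le> poly p1 (store_size s e)"
    using computableE[OF E1 \<open>d \<le> e\<close>] by metis
  have "d \<le> e + 1" using \<open>d \<le> e\<close> by simp
  obtain c2 B2 p2 where 2: "bounded_com B2 c2"
    "\<And>s. D s \<Longrightarrow> (\<forall>i\<ge>e + 1. s i = []) \<Longrightarrow> sruns c2 s (poly p2 (store_size s (e + 1))) (s(e + 1 := E2 s))"
    "\<And>s. D s \<Longrightarrow> (\<forall>i\<ge>e + 1. s i = []) \<Longrightarrow> length (E2 s) \<le> poly p2 (store_size s (e + 1))"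
    using computableE[OF E2 \<open>d \<le> e + 1\<close>] by metis
  \<comment> \<open>With the two values in \<open>e\<close> and \<open>e + 1\<close>, the first is
    poured via \<open>e + 2\<close> onto the second, which gives the concatenation in
    \<open>e + 1\<close>; two more moves bring it down to \<open>e\<close>.\<close>
  define c where "c = Seq c1 (Seq c2 (Seq (move e (e + 2)) (Seq (move (e + 2) (e + 1)) (Seq (move (e + 1) (e + 2)) (move (e + 2) e)))))"
  define P where "P n = poly p1 n + poly p2 (n + poly p1 n)" for n
  have "bounded_com (B1 + B2 + e + 6) c"
    unfolding c_def using bounded_com_mono[OF 1(1)] bounded_com_mono[OF 2(1)] by (auto intro: bounded_move_clear)
  moreover have "sruns c s (P (store_size s e) * 100 + 100) (s(e := E1 s @ E2 s))"
    if D: "D s" and em: "\<forall>j\<ge>e. s j = []" for s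
  proof -
    define n where "n = store_size s e"
    define x where "x = E1 s"
    define y where "y = E2 s"
    have D': "D (s(e := x))" using computableD(2)[OF E1 \<open>d \<le> e\<close>] D by simp
    have y: "E2 (s(e := x)) = y" using computableD(1)[OF E2 \<open>d \<le> e\<close>] by (simp add: y_def)
    have em': "\<forall>i\<ge>e + 1. (s(e := x)) i = []" using em by auto
    have lx: "length x \<le> poly p1 n" using 1(3)[OF D em] by (simp add: x_def n_def)
    have le: "poly p2 (store_size (s(e := x)) (e + 1)) \<le> poly p2 (n + poly p1 n)"
      using lx by (intro poly_nat_mono) (simp add: n_def)
    have ly: "length y \<le> poly p2 (n + poly p1 n)" using 2(3)[of "s(e := x)"] D' em' y le by (metis le_trans)
    have r1: "sruns c1 s (P n) (s(e := x))"
      using 1(2)[OF D em] by (rule sruns_weaken) (auto simp: x_def P_def n_def)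
    have r2: "sruns c2 (s(e := x)) (P n) (s(e := x, e + 1 := y))"
    proof (rule sruns_weaken)
      show "sruns c2 (s(e := x)) (poly p2 (store_size (s(e := x)) (e + 1))) (s(e := x, e + 1 := E2 (s(e := x))))"
        by (rule 2(2)[OF D' em'])
    qed (use le y in \<open>auto simp: P_def\<close>)
    have r3: "sruns (move e (e + 2)) (s(e := x, e + 1 := y)) (P n * 8 + 1) (s(e + 1 := y, e + 2 := rev x))"
      using em lx by (intro sruns_weaken[OF sruns_move]) (auto simp: fun_eq_iff P_def)
    have r4: "sruns (move (e + 2) (e + 1)) (s(e + 1 := y, e + 2 := rev x)) (P n * 8 + 1) (s(e + 1 := x @ y))"
      using em lx by (intro sruns_weaken[OF sruns_move]) (auto simp: fun_eq_iff P_def)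
    have r5: "sruns (move (e + 1) (e + 2)) (s(e + 1 := x @ y)) (P n * 8 + 1) (s(e + 2 := rev (x @ y)))"
      using em lx ly by (intro sruns_weaken[OF sruns_move]) (auto simp: fun_eq_iff P_def)
    have r6: "sruns (move (e + 2) e) (s(e + 2 := rev (x @ y))) (P n * 8 + 1) (s(e := x @ y))"
      using em lx ly by (intro sruns_weaken[OF sruns_move]) (auto simp: fun_eq_iff P_def)
    show ?thesis
      using sruns_Seq[OF r1 sruns_Seq[OF r2 sruns_Seq[OF r3 sruns_Seq[OF r4 sruns_Seq[OF r5 r6]]]]]
      unfolding c_def x_def y_def n_def by (rule sruns_weaken) auto
  qed
  moreover have "poly_bounded (\<lambda>n. P n * 100 + 100)" unfolding P_def by (intro poly_bounded_intros)
  ultimately show "\<exists>c B T. bounded_com B c \<and> poly_bounded T \<and>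
        (\<forall>s. D s \<and> (\<forall>j\<ge>e. s j = []) \<longrightarrow> sruns c s (T (store_size s e)) (s(e := E1 s @ E2 s)))"
    by (intro exI[of _ c] exI[of _ "B1 + B2 + e + 6"] exI[of _ "\<lambda>n. P n * 100 + 100"]) auto
qed (use computableD[OF E1] computableD[OF E2] in auto)

definition cancel :: "nat \<Rightarrow> com" where
  "cancel e = Loop (\<lambda>ss. ss (e + 2) \<noteq> 0 \<and> ss (e + 2) = ss (e + 1 + 2)) (Seq (pop e) (pop (e + 1)))"

text \<open>The loop stops at the first difference or when register \<open>e\<close> is exhausted.
  Both remainders are empty exactly for equal words, so equality becomes a test of two top
  symbols.\<close>

lemma sruns_cancel:
  "\<exists>x' y'. (x' = [] \<and> y' = [] \<longleftrightarrow> s e = s (e + 1)) \<and> length x' \<le> length (s e) \<and> length y' \<le> length (s (e + 1)) \<and>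
     sruns (cancel e) s (length (s e) * 5 + 1) (s(e := x', e + 1 := y'))"
proof (induction "length (s e)" arbitrary: s)
  case 0
  then have "sruns (cancel e) s 1 s"
    unfolding cancel_def by (intro sruns_Loop_end[where q = "\<lambda>h. h e \<noteq> 0 \<and> h e = h (e + 1)"]) auto
  then have "sruns (cancel e) s (length (s e) * 5 + 1) (s(e := s e, e + 1 := s (e + 1)))"
    using 0 by (simp only: fun_upd_triv) (erule sruns_weaken, auto)
  moreover have "s e = [] \<and> s (e + 1) = [] \<longleftrightarrow> s e = s (e + 1)" using 0 by auto
  ultimately show ?case by blast
next
  case (Suc n)
  then obtain b x where x: "s e = b # x" by (metis length_Suc_conv)
  show ?case
  proof (cases "\<exists>y. s (e + 1) = b # y")
    case True
    then obtain y where y: "s (e + 1) = b # y" by blast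
    define s1 where "s1 = s(e := x, e + 1 := y)"
    have "sruns (Seq (pop e) (pop (e + 1))) s (1 + 1 + 1) s1"
      using x y by (intro sruns_weaken[OF sruns_Seq[OF sruns_pop sruns_pop]]) (auto simp: s1_def fun_eq_iff)
    moreover obtain x' y' where *: "(x' = [] \<and> y' = [] \<longleftrightarrow> s1 e = s1 (e + 1))" "length x' \<le> length (s1 e)" "length y' \<le> length (s1 (e + 1))"
       "sruns (cancel e) s1 (length (s1 e) * 5 + 1) (s1(e := x', e + 1 := y'))"
      using Suc(1)[of s1] Suc(2) x by (auto simp: s1_def)
    ultimately have "sruns (cancel e) s ((1 + 1 + 1) + (length (s1 e) * 5 + 1) + 2) (s1(e := x', e + 1 := y'))"
      using x y unfolding cancel_def
      by (intro sruns_Loop_step[where q = "\<lambda>h. h e \<noteq> 0 \<and> h e = h (e + 1)"]) auto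
    then have "sruns (cancel e) s (length (s e) * 5 + 1) (s(e := x', e + 1 := y'))"
      by (rule sruns_weaken) (auto simp: s1_def x fun_eq_iff)
    with * x y show ?thesis by - (rule exI[of _ x'], rule exI[of _ y'], auto simp: s1_def)
  next
    case False
    have "sruns (cancel e) s 1 s"
      unfolding cancel_def using False x
      by (intro sruns_Loop_end[where q = "\<lambda>h. h e \<noteq> 0 \<and> h e = h (e + 1)"])
         (cases "s (e + 1)"; auto split: if_splits)
    then have "sruns (cancel e) s (length (s e) * 5 + 1) (s(e := s e, e + 1 := s (e + 1)))"
      by (rule sruns_weaken) auto
    moreover have "s e = [] \<and> s (e + 1) = [] \<longleftrightarrow> s e = s (e + 1)" using False x by metis
    ultimately show ?thesis by blast
  qed
qed

lemma computable_if_eq: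
  assumes E1: "computable d D E1" and E2: "computable d D E2"
    and E3: "computable d D E3" and E4: "computable d D E4"
  shows "computable d D (\<lambda>s. if E1 s = E2 s then E3 s else E4 s)"
proof (rule computableI)
  fix e assume "d \<le> e"
  obtain c1 B1 p1 where 1: "bounded_com B1 c1"
    "\<And>s. D s \<Longrightarrow> (\<forall>i\<ge>e. s i = []) \<Longrightarrow> sruns c1 s (poly p1 (store_size s e)) (s(e := E1 s))"
    "\<And>s. D s \<Longrightarrow> (\<forall>i\<ge>e. s i = []) \<Longrightarrow> length (E1 s) \<le> poly p1 (store_size s e)"
    using computableE[OF E1 \<open>d \<le> e\<close>] by metis
  have "d \<le> e + 1" using \<open>d \<le> e\<close> by simp
  obtain c2 B2 p2 where 2: "bounded_com B2 c2"
    "\<And>s. D s \<Longrightarrow> (\<forall>i\<ge>e + 1. s i = []) \<Longrightarrow> sruns c2 s (poly p2 (store_size s (e + 1))) (s(e + 1 := E2 s))"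
    "\<And>s. D s \<Longrightarrow> (\<forall>i\<ge>e + 1. s i = []) \<Longrightarrow> length (E2 s) \<le> poly p2 (store_size s (e + 1))"
    using computableE[OF E2 \<open>d \<le> e + 1\<close>] by metis
  obtain c3 B3 p3 where 3: "bounded_com B3 c3"
    "\<And>s. D s \<Longrightarrow> (\<forall>i\<ge>e. s i = []) \<Longrightarrow> sruns c3 s (poly p3 (store_size s e)) (s(e := E3 s))"
    using computableE[OF E3 \<open>d \<le> e\<close>] by metis
  obtain c4 B4 p4 where 4: "bounded_com B4 c4"
    "\<And>s. D s \<Longrightarrow> (\<forall>i\<ge>e. s i = []) \<Longrightarrow> sruns c4 s (poly p4 (store_size s e)) (s(e := E4 s))"
    using computableE[OF E4 \<open>d \<le> e\<close>] by metis
  define c where "c = Seq c1 (Seq c2 (Seq (cancel e)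
     (Cond (\<lambda>ss. ss (e + 2) = 0 \<and> ss (e + 1 + 2) = 0) c3 (Seq (clear e) (Seq (clear (e + 1)) c4)))))"
  define P where "P n = poly p1 n + poly p2 (n + poly p1 n) + poly p3 n + poly p4 n" for n
  have "bounded_com (B1 + B2 + B3 + B4 + e + 6) c"
    unfolding c_def cancel_def
    using bounded_com_mono[OF 1(1)] bounded_com_mono[OF 2(1)] bounded_com_mono[OF 3(1)] bounded_com_mono[OF 4(1)]
    by (auto intro: bounded_move_clear bounded_push_pop)
  moreover have "sruns c s (P (store_size s e) * 100 + 100) (s(e := if E1 s = E2 s then E3 s else E4 s))"
    if D: "D s" and em: "\<forall>j\<ge>e. s j = []" for s
  proof -
    define n where "n = store_size s e"
    define x where "x = E1 s"
    define y where "y = E2 s"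
    have D': "D (s(e := x))" using computableD(2)[OF E1 \<open>d \<le> e\<close>] D by simp
    have y: "E2 (s(e := x)) = y" using computableD(1)[OF E2 \<open>d \<le> e\<close>] by (simp add: y_def)
    have em': "\<forall>i\<ge>e + 1. (s(e := x)) i = []" using em by auto
    have lx: "length x \<le> poly p1 n" using 1(3)[OF D em] by (simp add: x_def n_def)
    have le: "poly p2 (store_size (s(e := x)) (e + 1)) \<le> poly p2 (n + poly p1 n)"
      using lx by (intro poly_nat_mono) (simp add: n_def)
    have ly: "length y \<le> poly p2 (n + poly p1 n)" using 2(3)[of "s(e := x)"] D' em' y le by (metis le_trans)
    have r1: "sruns c1 s (P n) (s(e := x))"
      using 1(2)[OF D em] by (rule sruns_weaken) (auto simp: x_def P_def n_def)
    have r2: "sruns c2 (s(e := x)) (P n) (s(e := x, e + 1 := y))"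
    proof (rule sruns_weaken)
      show "sruns c2 (s(e := x)) (poly p2 (store_size (s(e := x)) (e + 1))) (s(e := x, e + 1 := E2 (s(e := x))))"
        by (rule 2(2)[OF D' em'])
    qed (use le y in \<open>auto simp: P_def\<close>)
    obtain x' y' where xy: "x' = [] \<and> y' = [] \<longleftrightarrow> x = y" "length x' \<le> length x" "length y' \<le> length y"
        and "sruns (cancel e) (s(e := x, e + 1 := y)) (length x * 5 + 1) (s(e := x, e + 1 := y, e := x', e + 1 := y'))"
      using sruns_cancel[of "s(e := x, e + 1 := y)" e] by auto
    then have r3: "sruns (cancel e) (s(e := x, e + 1 := y)) (P n * 5 + 1) (s(e := x', e + 1 := y'))"
      using lx by (elim sruns_weaken) (auto simp: fun_eq_iff P_def)
    have r4: "sruns (Cond (\<lambda>ss. ss (e + 2) = 0 \<and> ss (e + 1 + 2) = 0) c3 (Seq (clear e) (Seq (clear (e + 1)) c4)))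
         (s(e := x', e + 1 := y')) (P n * 11 + 5) (s(e := if x = y then E3 s else E4 s))"
    proof (cases "x = y")
      case True
      then have e: "s(e := x', e + 1 := y') = s" using xy em by (auto simp: fun_eq_iff)
      have "sruns (Cond (\<lambda>ss. ss (e + 2) = 0 \<and> ss (e + 1 + 2) = 0) c3 (Seq (clear e) (Seq (clear (e + 1)) c4))) s (P n + 1) (s(e := E3 s))"
        using 3(2)[OF D em] em
        by (intro sruns_Cond[where q = "\<lambda>h. h e = 0 \<and> h (e + 1) = 0"]) (auto elim!: sruns_weaken simp: P_def n_def)
      then show ?thesis unfolding e by (rule sruns_weaken) (use True in auto)
    next
      case False
      have b1: "sruns (clear e) (s(e := x', e + 1 := y')) (P n * 5 + 1) (s(e + 1 := y'))"
        using lx xy em by (intro sruns_weaken[OF sruns_clear]) (auto simp: fun_eq_iff P_def)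
      have b2: "sruns (clear (e + 1)) (s(e + 1 := y')) (P n * 5 + 1) s"
        using ly xy em by (intro sruns_weaken[OF sruns_clear]) (auto simp: fun_eq_iff P_def)
      have b3: "sruns c4 s (P n) (s(e := E4 s))"
        using 4(2)[OF D em] by (rule sruns_weaken) (auto simp: P_def n_def)
      have "sruns (Cond (\<lambda>ss. ss (e + 2) = 0 \<and> ss (e + 1 + 2) = 0) c3 (Seq (clear e) (Seq (clear (e + 1)) c4))) (s(e := x', e + 1 := y'))
        ((P n * 5 + 1) + 1 + ((P n * 5 + 1) + 1 + P n) + 1) (s(e := E4 s))"
        using sruns_Seq[OF b1 sruns_Seq[OF b2 b3]] xy(1) False
        by (intro sruns_Cond[where q = "\<lambda>h. h e = 0 \<and> h (e + 1) = 0"]) auto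
      then show ?thesis by (rule sruns_weaken) (use False in auto)
    qed
    show ?thesis
      using sruns_Seq[OF r1 sruns_Seq[OF r2 sruns_Seq[OF r3 r4]]]
      unfolding c_def x_def y_def n_def by (rule sruns_weaken) auto
  qed
  moreover have "poly_bounded (\<lambda>n. P n * 100 + 100)" unfolding P_def by (intro poly_bounded_intros)
  ultimately show "\<exists>c B T. bounded_com B c \<and> poly_bounded T \<and>
        (\<forall>s. D s \<and> (\<forall>j\<ge>e. s j = []) \<longrightarrow> sruns c s (T (store_size s e)) (s(e := if E1 s = E2 s then E3 s else E4 s)))"
    by (intro exI[of _ c] exI[of _ "B1 + B2 + B3 + B4 + e + 6"] exI[of _ "\<lambda>n. P n * 100 + 100"]) auto
qed (use computableD[OF E1] computableD[OF E2] computableD[OF E3] computableD[OF E4] in auto)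

section \<open>Finite transducers\<close>

fun transduce :: "(nat \<Rightarrow> bool \<Rightarrow> nat \<times> bool list) \<Rightarrow> nat \<Rightarrow> bool list \<Rightarrow> bool list" where
  "transduce \<delta> q [] = []"
| "transduce \<delta> q (b # x) = snd (\<delta> q b) @ transduce \<delta> (fst (\<delta> q b)) x"

fun transduce_state :: "(nat \<Rightarrow> bool \<Rightarrow> nat \<times> bool list) \<Rightarrow> nat \<Rightarrow> bool list \<Rightarrow> nat" where
  "transduce_state \<delta> q [] = q"
| "transduce_state \<delta> q (b # x) = transduce_state \<delta> (fst (\<delta> q b)) x"

lemma transduce_append:
  "transduce \<delta> q (x @ y) = transduce \<delta> q x @ transduce \<delta> (transduce_state \<delta> q x) y"
  by (induction x arbitrary: q) auto

lemma transduce_state_append: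
  "transduce_state \<delta> q (x @ y) = transduce_state \<delta> (transduce_state \<delta> q x) y"
  by (induction x arbitrary: q) auto

text \<open>The state is kept in unary in register \<open>e + 1\<close>; the output is collected in reverse in \<open>e + 2\<close>.\<close>

primrec dispatch :: "nat \<Rightarrow> (nat \<Rightarrow> bool \<Rightarrow> nat \<times> bool list) \<Rightarrow> bool \<Rightarrow> nat \<Rightarrow> nat \<Rightarrow> com" where
  "dispatch e \<delta> b k 0 = Skip"
| "dispatch e \<delta> b k (Suc n) = Cond (\<lambda>ss. ss (e + 1 + 2) = 0)
     (Seq (pushes (e + 1) (replicate (fst (\<delta> k b)) True)) (pushes (e + 2) (snd (\<delta> k b))))
     (Seq (pop (e + 1)) (dispatch e \<delta> b (Suc k) n))"

lemma bounded_dispatch: "e + 5 \<le> B \<Longrightarrow> bounded_com B (dispatch e \<delta> b k n)"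
  by (induction n arbitrary: k) (auto intro: bounded_pushes bounded_push_pop)

text \<open>The number \<open>k\<close> counts the states already ruled out, so the true state is
  \<open>k + j\<close> when \<open>j\<close> marks are left in the state register.\<close>

lemma sruns_dispatch:
  assumes "\<And>q. q < k + n \<Longrightarrow> fst (\<delta> q b) \<le> M \<and> length (snd (\<delta> q b)) \<le> M"
    and "s (e + 1) = replicate j True" "j < n"
  shows "sruns (dispatch e \<delta> b k n) s (n * 3 + M * 8 + 2)
    (s(e + 1 := replicate (fst (\<delta> (k + j) b)) True, e + 2 := rev (snd (\<delta> (k + j) b)) @ s (e + 2)))"
  using assms
proof (induction n arbitrary: k j s)
  case 0
  then show ?case by simp
next
  case (Suc n)
  show ?case
  proof (cases j)
    case 0
    have "sruns (Seq (pushes (e + 1) (replicate (fst (\<delta> k b)) True)) (pushes (e + 2) (snd (\<delta> k b)))) s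
       (M * 4 + 1 + M * 4) (s(e + 1 := replicate (fst (\<delta> k b)) True, e + 2 := rev (snd (\<delta> k b)) @ s (e + 2)))"
      using Suc.prems(1)[of k] Suc.prems(2) 0
      by (intro sruns_weaken[OF sruns_Seq[OF sruns_pushes sruns_pushes]]) (auto simp: fun_eq_iff)
    then have "sruns (dispatch e \<delta> b k (Suc n)) s (M * 4 + 1 + M * 4 + 1)
        (s(e + 1 := replicate (fst (\<delta> k b)) True, e + 2 := rev (snd (\<delta> k b)) @ s (e + 2)))"
      using Suc.prems(2) 0 unfolding dispatch.simps
      by (intro sruns_Cond[where q = "\<lambda>h. h (e + 1) = 0"]) auto
    then show ?thesis by (rule sruns_weaken) (auto simp: 0)
  next
    case (Suc j')
    define s1 where "s1 = s(e + 1 := replicate j' True)"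
    have r1: "sruns (pop (e + 1)) s 1 s1"
      using Suc.prems(2) Suc by (intro sruns_weaken[OF sruns_pop]) (auto simp: s1_def)
    have "sruns (dispatch e \<delta> b (Suc k) n) s1 (n * 3 + M * 8 + 2)
       (s1(e + 1 := replicate (fst (\<delta> (Suc k + j') b)) True, e + 2 := rev (snd (\<delta> (Suc k + j') b)) @ s1 (e + 2)))"
      using Suc.prems Suc by (intro Suc.IH) (auto simp: s1_def)
    from sruns_Seq[OF r1 this]
    have "sruns (dispatch e \<delta> b k (Suc n)) s (1 + 1 + (n * 3 + M * 8 + 2) + 1)
       (s1(e + 1 := replicate (fst (\<delta> (Suc k + j') b)) True, e + 2 := rev (snd (\<delta> (Suc k + j') b)) @ s1 (e + 2)))"
      using Suc.prems(2) Suc unfolding dispatch.simps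
      by (intro sruns_Cond[where q = "\<lambda>h. h (e + 1) = 0"]) auto
    then show ?thesis by (rule sruns_weaken) (auto simp: Suc s1_def)
  qed
qed

lemma computable_transduce:
  assumes E: "computable d D E" and \<delta>: "\<And>q b. q < n \<Longrightarrow> fst (\<delta> q b) < n" and "q < n"
  shows "computable d D (\<lambda>s. transduce \<delta> q (E s))"
proof (rule computableI)
  fix e assume "d \<le> e"
  obtain c1 B1 p1 where 1: "bounded_com B1 c1"
    "\<And>s. D s \<Longrightarrow> (\<forall>i\<ge>e. s i = []) \<Longrightarrow> sruns c1 s (poly p1 (store_size s e)) (s(e := E s))"
    "\<And>s. D s \<Longrightarrow> (\<forall>i\<ge>e. s i = []) \<Longrightarrow> length (E s) \<le> poly p1 (store_size s e)"
    using computableE[OF E \<open>d \<le> e\<close>] by metis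
  define M where "M = n + (\<Sum>(q, b)\<in>{..<n} \<times> UNIV. length (snd (\<delta> q b)))"
  have M: "fst (\<delta> q b) \<le> M \<and> length (snd (\<delta> q b)) \<le> M" if "q < n" for q b
  proof -
    have "(case (q, b) of (q, b) \<Rightarrow> length (snd (\<delta> q b))) \<le> (\<Sum>(q, b)\<in>{..<n} \<times> UNIV. length (snd (\<delta> q b)))"
      using that by (intro member_le_sum) auto
    then show ?thesis using \<delta>[OF that, of b] by (auto simp: M_def)
  qed
  define c where "c = Seq c1 (Seq (pushes (e + 1) (replicate q True))
     (Seq (pop_each e (\<lambda>b. dispatch e \<delta> b 0 n)) (Seq (clear (e + 1)) (move (e + 2) e))))"
  define T where "T = n * 3 + M * 8 + 2"
  define P where "P m = poly p1 m * (T + 5 + M * 8) + poly p1 m + n * 9 + 20" for m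
  have "bounded_com (B1 + e + 6) c"
    unfolding c_def using bounded_com_mono[OF 1(1)]
    by (auto intro!: bounded_move_clear bounded_pushes bounded_pop_each bounded_dispatch)
  moreover have "sruns c s (P (store_size s e)) (s(e := transduce \<delta> q (E s)))"
    if D: "D s" and em: "\<forall>j\<ge>e. s j = []" for s
  proof -
    define m where "m = store_size s e"
    define x where "x = E s"
    define st where "st k = transduce_state \<delta> q (take k x)" for k
    define S where "S k = s(e := drop k x, e + 1 := replicate (st k) True, e + 2 := rev (transduce \<delta> q (take k x)))" for k
    have lx: "length x \<le> poly p1 m" using 1(3)[OF D em] by (simp add: x_def m_def)
    have st: "transduce_state \<delta> q y < n" for y using \<open>q < n\<close> \<delta> by (induction y arbitrary: q) auto
    have lout: "length (transduce \<delta> q y) \<le> length y * M" for y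
      using \<open>q < n\<close>
    proof (induction y arbitrary: q)
      case (Cons b y)
      show ?case using Cons.IH[OF \<delta>[OF Cons.prems]] M[OF Cons.prems] by (simp add: add_mono)
    qed simp
    have r1: "sruns c1 s (poly p1 m) (s(e := x))"
      using 1(2)[OF D em] by (simp add: x_def m_def)
    have r2: "sruns (pushes (e + 1) (replicate q True)) (s(e := x)) (n * 4) (S 0)"
      using em \<open>q < n\<close> by (intro sruns_weaken[OF sruns_pushes]) (auto simp: S_def st_def fun_eq_iff)
    have r3: "sruns (pop_each e (\<lambda>b. dispatch e \<delta> b 0 n)) (S 0) (length x * (T + 5) + 1) (S (length x))"
    proof (rule sruns_pop_each)
      fix k assume k: "k < length x"
      have step: "transduce_state \<delta> q (take (Suc k) x) = fst (\<delta> (st k) (x ! k))"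
        "transduce \<delta> q (take (Suc k) x) = transduce \<delta> q (take k x) @ snd (\<delta> (st k) (x ! k))"
        using k by (auto simp: take_Suc_conv_app_nth transduce_append transduce_state_append st_def)
      show "sruns (dispatch e \<delta> (x ! k) 0 n) ((S k)(e := drop (Suc k) x)) T (S (Suc k))"
        unfolding T_def
      proof (rule sruns_weaken[OF sruns_dispatch[where j = "st k"]])
        show "st k < n" unfolding st_def by (rule st)
      qed (use M step in \<open>auto simp: S_def st_def fun_eq_iff\<close>)
    qed (auto simp: S_def)
    have r4: "sruns (clear (e + 1)) (S (length x)) (n * 5 + 1) (s(e + 2 := rev (transduce \<delta> q x)))"
      using em st[of x] by (intro sruns_weaken[OF sruns_clear]) (auto simp: S_def fun_eq_iff st_def)
    have r5: "sruns (move (e + 2) e) (s(e + 2 := rev (transduce \<delta> q x))) (length x * M * 8 + 1) (s(e := transduce \<delta> q x))"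
      using em lout[of x] by (intro sruns_weaken[OF sruns_move]) (auto simp: fun_eq_iff)
    have "length x * (T + 5 + M * 8) \<le> poly p1 m * (T + 5 + M * 8)" using lx by (rule mult_le_mono1)
    then have "poly p1 m + 1 + (n * 4 + 1 + ((length x * (T + 5) + 1) + 1 + ((n * 5 + 1) + 1 + (length x * M * 8 + 1)))) \<le> P m"
      by (simp add: P_def algebra_simps)
    then show ?thesis
      using sruns_Seq[OF r1 sruns_Seq[OF r2 sruns_Seq[OF r3 sruns_Seq[OF r4 r5]]]]
      unfolding c_def x_def[symmetric] m_def[symmetric] by (elim sruns_weaken) auto
  qed
  moreover have "poly_bounded P" unfolding P_def by (intro poly_bounded_intros)
  ultimately show "\<exists>c B T. bounded_com B c \<and> poly_bounded T \<and>
        (\<forall>s. D s \<and> (\<forall>j\<ge>e. s j = []) \<longrightarrow> sruns c s (T (store_size s e)) (s(e := transduce \<delta> q (E s))))"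
    by (intro exI[of _ c] exI[of _ "B1 + e + 6"] exI[of _ P]) auto
qed (use computableD[OF E] in auto)

section \<open>Iteration over a list\<close>

definition pack :: "bool list list \<Rightarrow> bool list" where
  "pack xs = concat (map enc_bits xs)"

lemma enc_bits_simps [simp]: "enc_bits [] = [False]" "enc_bits (b # x) = True # b # enc_bits x"
  by (auto simp: enc_bits_def enc_list_def)

lemma pack_simps [simp]: "pack [] = []" "pack (x # xs) = enc_bits x @ pack xs"
  by (auto simp: pack_def)

lemma length_enc_bits: "length (enc_bits x) = 2 * length x + 1"
  by (induction x) auto

definition unpack_item :: "nat \<Rightarrow> nat \<Rightarrow> com" where
  "unpack_item e r = Seq (Loop (\<lambda>ss. ss (e + 2) = 2)
     (Seq (pop e) (Seq (Cond (\<lambda>ss. ss (e + 2) = 2) (push r True) (push r False)) (pop e)))) (pop e)"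

lemma sruns_unpack_item:
  assumes "e \<noteq> r" "s e = enc_bits x @ y"
  shows "sruns (unpack_item e r) s (length x * 10 + 3) (s(e := y, r := rev x @ s r))"
proof -
  let ?L = "Loop (\<lambda>ss. ss (e + 2) = 2)
     (Seq (pop e) (Seq (Cond (\<lambda>ss. ss (e + 2) = 2) (push r True) (push r False)) (pop e)))"
  have L: "sruns ?L s (length x * 10 + 1) (s(e := False # y, r := rev x @ s r))" if "s e = enc_bits x @ y" for s
    using that
  proof (induction x arbitrary: s)
    case Nil
    then have "sruns ?L s 1 s" by (intro sruns_Loop_end[where q = "\<lambda>h. h e = 2"]) auto
    then show ?case using Nil assms(1) by (elim sruns_weaken) auto
  next
    case (Cons b x)
    define s1 where "s1 = s(e := b # enc_bits x @ y)"
    define s2 where "s2 = s1(r := b # s r)"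
    define s3 where "s3 = s2(e := enc_bits x @ y)"
    have r1: "sruns (pop e) s 1 s1" using Cons.prems by (intro sruns_weaken[OF sruns_pop]) (auto simp: s1_def)
    have "sruns (push r b) s1 3 s2" using assms(1) by (intro sruns_weaken[OF sruns_push]) (auto simp: s2_def s1_def)
    then have r2: "sruns (Cond (\<lambda>ss. ss (e + 2) = 2) (push r True) (push r False)) s1 (3 + 1) s2"
      by (intro sruns_Cond[where q = "\<lambda>h. h e = 2"]) (cases b; auto simp: s1_def)
    have r3: "sruns (pop e) s2 1 s3"
      using assms(1) by (intro sruns_weaken[OF sruns_pop]) (auto simp: s3_def s2_def s1_def)
    have "sruns ?L s3 (length x * 10 + 1) (s3(e := False # y, r := rev x @ s3 r))"
      by (rule Cons.IH) (use assms(1) in \<open>simp add: s3_def\<close>)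
    with sruns_Seq[OF r1 sruns_Seq[OF r2 r3]]
    have "sruns ?L s ((1 + 1 + (3 + 1 + 1 + 1)) + (length x * 10 + 1) + 2) (s3(e := False # y, r := rev x @ s3 r))"
      using Cons.prems by (intro sruns_Loop_step[where q = "\<lambda>h. h e = 2"]) auto
    then show ?case by (rule sruns_weaken) (use assms(1) in \<open>auto simp: s3_def s2_def s1_def fun_eq_iff\<close>)
  qed
  have "sruns (unpack_item e r) s ((length x * 10 + 1) + 1 + 1) (s(e := y, r := rev x @ s r))"
    unfolding unpack_item_def
    by (rule sruns_Seq[OF L[of s, OF assms(2)]]) (rule sruns_weaken[OF sruns_pop]; use assms(1) in \<open>auto simp: fun_eq_iff\<close>)
  then show ?thesis by (rule sruns_weaken) auto
qed

text \<open>
  The accumulator is not part of the input of the loop body, so the length of the output of one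
  iteration does not depend on it and the total length stays polynomial.
\<close>

lemma computable_foreach:
  assumes L: "computable d D L" and xs: "\<And>s. D s \<Longrightarrow> L s = pack (xs s)"
    and xs_upd: "\<And>e s x. d \<le> e \<Longrightarrow> xs (s(e := x)) = xs s"
    and E: "\<And>a. d \<le> a \<Longrightarrow> computable (a + 2) D (\<lambda>s. E s (s a) (s (a + 1)))"
    and E_upd: "\<And>e s i x y. d \<le> e \<Longrightarrow> E (s(e := x)) i y = E s i y"
  shows "computable d D (\<lambda>s. concat (map (\<lambda>j. E s (replicate j True) (xs s ! j)) [0..<length (xs s)]))"
proof (rule computableI)
  fix e assume "d \<le> e"
  have "d \<le> e + 2" "e + 2 + 2 = e + 4" "e + 2 + 1 = e + 3" using \<open>d \<le> e\<close> by auto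
  then have E': "computable (e + 4) D (\<lambda>s. E s (s (e + 2)) (s (e + 3)))"
    using E[of "e + 2"] by (simp only:)
  obtain c1 B1 p1 where 1: "bounded_com B1 c1"
    "\<And>s. D s \<Longrightarrow> (\<forall>i\<ge>e. s i = []) \<Longrightarrow> sruns c1 s (poly p1 (store_size s e)) (s(e := L s))"
    "\<And>s. D s \<Longrightarrow> (\<forall>i\<ge>e. s i = []) \<Longrightarrow> length (L s) \<le> poly p1 (store_size s e)"
    using computableE[OF L \<open>d \<le> e\<close>] by metis
  obtain c2 B2 p2 where 2: "bounded_com B2 c2"
    "\<And>s. D s \<Longrightarrow> (\<forall>i\<ge>e + 4. s i = []) \<Longrightarrow> sruns c2 s (poly p2 (store_size s (e + 4))) (s(e + 4 := E s (s (e + 2)) (s (e + 3))))"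
    "\<And>s. D s \<Longrightarrow> (\<forall>i\<ge>e + 4. s i = []) \<Longrightarrow> length (E s (s (e + 2)) (s (e + 3))) \<le> poly p2 (store_size s (e + 4))"
    using computableE[OF E' order_refl] by metis
  \<comment> \<open>Register \<open>e\<close> holds the items still to be read, \<open>e + 1\<close>
    the output in reverse, \<open>e + 2\<close> the index in unary and \<open>e + 3\<close> the
    current item. Register \<open>e + 4\<close> first takes the item in reverse and later the result
    of the body.\<close>
  define body where "body = Seq (unpack_item e (e + 4)) (Seq (move (e + 4) (e + 3)) (Seq c2
     (Seq (move (e + 4) (e + 1)) (Seq (clear (e + 3)) (push (e + 2) True)))))"
  define c where "c = Seq c1 (Seq (Loop (\<lambda>ss. ss (e + 2) \<noteq> 0) body) (Seq (clear (e + 2)) (move (e + 1) e)))"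
  define P where "P m = poly p1 m" for m
  define Q where "Q m = poly p2 (m + P m + P m + P m)" for m
  define T where "T m = P m * 23 + Q m * 8 + poly p2 (m + P m + P m * Q m + P m + P m) + 20" for m
  define U where "U m = P m + P m * (T m + 2) + P m * 5 + P m * Q m * 8 + 10" for m
  have "bounded_com (B1 + B2 + e + 10) c"
    unfolding c_def body_def unpack_item_def using bounded_com_mono[OF 1(1)] bounded_com_mono[OF 2(1)]
    by (auto intro: bounded_move_clear bounded_push_pop)
  moreover have "sruns c s (U (store_size s e)) (s(e := concat (map (\<lambda>j. E s (replicate j True) (xs s ! j)) [0..<length (xs s)])))"
    if D: "D s" and em: "\<forall>j\<ge>e. s j = []" for s
  proof -
    define m where "m = store_size s e"
    define ys where "ys = xs s"
    define out where "out j = E s (replicate j True) (ys ! j)" for j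
    define outs where "outs k = concat (map out [0..<k])" for k
    define S where "S k = s(e := pack (drop k ys), e + 1 := rev (outs k), e + 2 := replicate k True)" for k
    have lP: "length (pack ys) \<le> P m" using 1(3)[OF D em] xs[OF D] by (simp add: P_def m_def ys_def)
    have len_drop: "length (pack (drop k zs)) \<le> length (pack zs)" for k zs
      by (induction zs arbitrary: k) (auto simp: drop_Cons' le_SucI trans_le_add2)
    have len_item: "k < length zs \<Longrightarrow> length (zs ! k) \<le> length (pack zs)" for k zs
    proof (induction zs arbitrary: k)
      case (Cons z zs)
      then show ?case by (cases k) (auto simp: length_enc_bits intro: le_SucI trans_le_add2)
    qed simp
    have len_ys: "length zs \<le> length (pack zs)" for zs
      by (induction zs) (auto simp: length_enc_bits)
    have Supd: "D (s(e := w, e + 1 := x, e + 2 := y, e + 3 := z))" "E (s(e := w, e + 1 := x, e + 2 := y, e + 3 := z)) i v = E s i v" for w x y z i v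
      using D \<open>d \<le> e\<close> by (simp_all add: computableD(2)[OF L] E_upd)
    have lout: "length (out k) \<le> Q m" if "k < length ys" for k
    proof -
      \<comment> \<open>The length bound is read off from a run of the body on a store whose
        accumulator and item list are empty; \<open>E\<close> has the same value there, as it does
        not read these registers.\<close>
      define s' where "s' = s(e := [], e + 1 := [], e + 2 := replicate k True, e + 3 := ys ! k)"
      have *: "E s' (s' (e + 2)) (s' (e + 3)) = out k"
        unfolding s'_def Supd(2) by (simp add: out_def)
      have "length (out k) \<le> poly p2 (store_size s' (e + 4))"
        unfolding *[symmetric] by (rule 2(3)) (use em Supd(1) in \<open>auto simp: s'_def\<close>)
      also have "\<dots> \<le> Q m" unfolding Q_def
        using len_item[OF that] len_ys[of ys] lP that
        by (intro poly_nat_mono) (simp add: s'_def numeral_eq_Suc m_def)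
      finally show ?thesis .
    qed
    have louts: "k \<le> length ys \<Longrightarrow> length (outs k) \<le> k * Q m" for k
      unfolding outs_def by (induction k) (use lout in \<open>auto simp: add.commute add_mono\<close>)
    have louts': "k \<le> length ys \<Longrightarrow> length (outs k) \<le> P m * Q m" for k
      using louts[of k] len_ys[of ys] lP by (meson le_trans mult_le_mono1)
    have r1: "sruns c1 s (P m) (S 0)"
      using 1(2)[OF D em] em by (elim sruns_weaken) (auto simp: P_def m_def S_def outs_def xs[OF D] ys_def fun_eq_iff)
    have step: "sruns body (S k) (T m) (S (Suc k))" if k: "k < length ys" for k
    proof -
      define z where "z = ys ! k"
      define s1 where "s1 = (S k)(e := pack (drop (Suc k) ys))"
      have lz: "length z \<le> P m" using len_item[OF k] lP by (simp add: z_def)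
      have pk: "pack (drop k ys) = enc_bits z @ pack (drop (Suc k) ys)"
        using k by (simp add: z_def flip: Cons_nth_drop_Suc)
      have a1: "sruns (unpack_item e (e + 4)) (S k) (P m * 10 + 3) (s1(e + 4 := rev z))"
        using lz em by (intro sruns_weaken[OF sruns_unpack_item[of _ _ _ z]]) (auto simp: S_def pk s1_def)
      have a2: "sruns (move (e + 4) (e + 3)) (s1(e + 4 := rev z)) (P m * 8 + 1) (s1(e + 3 := z))"
        using lz em by (intro sruns_weaken[OF sruns_move]) (auto simp: s1_def S_def fun_eq_iff)
      have s1: "s1(e + 3 := z) = s(e := pack (drop (Suc k) ys), e + 1 := rev (outs k), e + 2 := replicate k True, e + 3 := z)"
        by (auto simp: s1_def S_def fun_eq_iff)
      have E1: "E (s1(e + 3 := z)) ((s1(e + 3 := z)) (e + 2)) ((s1(e + 3 := z)) (e + 3)) = out k"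
        unfolding s1 Supd(2) by (simp add: out_def z_def)
      have sz: "store_size (s1(e + 3 := z)) (e + 4) \<le> m + P m + P m * Q m + P m + P m"
        using len_drop[of "Suc k" ys] lP louts'[of k] k len_ys[of ys] lz
        unfolding s1 by (simp add: numeral_eq_Suc m_def)
      have a3: "sruns c2 (s1(e + 3 := z)) (poly p2 (m + P m + P m * Q m + P m + P m)) (s1(e + 3 := z, e + 4 := out k))"
      proof (rule sruns_weaken)
        show "sruns c2 (s1(e + 3 := z)) (poly p2 (store_size (s1(e + 3 := z)) (e + 4)))
           (s1(e + 3 := z, e + 4 := E (s1(e + 3 := z)) ((s1(e + 3 := z)) (e + 2)) ((s1(e + 3 := z)) (e + 3))))"
          by (rule 2(2)) (use em Supd(1) in \<open>auto simp: s1\<close>)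
      qed (use poly_nat_mono[OF sz] E1 in auto)
      have a4: "sruns (move (e + 4) (e + 1)) (s1(e + 3 := z, e + 4 := out k)) (Q m * 8 + 1) (s1(e + 3 := z, e + 1 := rev (outs (Suc k))))"
        using lout[OF k] em by (intro sruns_weaken[OF sruns_move]) (auto simp: s1_def S_def fun_eq_iff outs_def)
      have a5: "sruns (clear (e + 3)) (s1(e + 3 := z, e + 1 := rev (outs (Suc k)))) (P m * 5 + 1) (s1(e + 1 := rev (outs (Suc k))))"
        using lz em by (intro sruns_weaken[OF sruns_clear]) (auto simp: s1_def S_def fun_eq_iff)
      have a6: "sruns (push (e + 2) True) (s1(e + 1 := rev (outs (Suc k)))) 3 (S (Suc k))"
        by (rule sruns_weaken[OF sruns_push]) (auto simp: s1_def S_def fun_eq_iff)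
      show ?thesis
        using sruns_Seq[OF a1 sruns_Seq[OF a2 sruns_Seq[OF a3 sruns_Seq[OF a4 sruns_Seq[OF a5 a6]]]]]
        unfolding body_def by (rule sruns_weaken) (auto simp: T_def)
    qed
    have "sruns (Loop (\<lambda>ss. ss (e + 2) \<noteq> 0) body) (S 0) (length ys * (T m + 2) + 1) (S (length ys))"
    proof (rule sruns_Loop_iterate[where q = "\<lambda>h. h e \<noteq> 0"])
      fix k assume "k < length ys"
      then show "top_symbol (S k e) \<noteq> 0"
        by (cases "ys ! k") (auto simp: S_def simp flip: Cons_nth_drop_Suc)
    next
      fix k assume "k < length ys"
      then show "sruns body (S k) (T m) (S (Suc k))" by (rule step)
    qed (auto simp: S_def)
    moreover have "length ys * (T m + 2) \<le> P m * (T m + 2)"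
      using len_ys[of ys] lP by (intro mult_le_mono1) simp
    ultimately have r2: "sruns (Loop (\<lambda>ss. ss (e + 2) \<noteq> 0) body) (S 0) (P m * (T m + 2) + 1) (S (length ys))"
      by (elim sruns_weaken) auto
    have r3: "sruns (clear (e + 2)) (S (length ys)) (P m * 5 + 1) (s(e + 1 := rev (outs (length ys))))"
      using len_ys[of ys] lP em by (intro sruns_weaken[OF sruns_clear]) (auto simp: S_def fun_eq_iff)
    have r4: "sruns (move (e + 1) e) (s(e + 1 := rev (outs (length ys)))) (P m * Q m * 8 + 1) (s(e := outs (length ys)))"
      using louts'[of "length ys"] em by (intro sruns_weaken[OF sruns_move]) (auto simp: fun_eq_iff)
    show ?thesis
      using sruns_Seq[OF r1 sruns_Seq[OF r2 sruns_Seq[OF r3 r4]]]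
      unfolding c_def by (rule sruns_weaken) (auto simp: U_def m_def outs_def out_def[abs_def] ys_def)
  qed
  moreover have "poly_bounded U" unfolding U_def T_def Q_def P_def by (intro poly_bounded_intros)
  ultimately show "\<exists>c B T. bounded_com B c \<and> poly_bounded T \<and>
        (\<forall>s. D s \<and> (\<forall>j\<ge>e. s j = []) \<longrightarrow> sruns c s (T (store_size s e))
          (s(e := concat (map (\<lambda>j. E s (replicate j True) (xs s ! j)) [0..<length (xs s)]))))"
    by (intro exI[of _ c] exI[of _ "B1 + B2 + e + 10"] exI[of _ U]) auto
qed (use computableD[OF L] xs_upd E_upd in auto)

section \<open>Calling Turing machines as subroutines\<close>

text \<open>Tape \<open>n\<close> drives a loop in which the tapes in \<open>X\<close> are moved, and possibly wiped, step by step.\<close>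

definition drive_act :: "nat \<Rightarrow> int \<Rightarrow> bool \<Rightarrow> nat set \<Rightarrow> bool \<Rightarrow> int \<Rightarrow> (nat \<Rightarrow> nat) \<Rightarrow> nat \<Rightarrow> nat \<times> int" where
  "drive_act n dn er X w d ss i =
     (if i = n then (if er then 0 else ss i, dn) else if i \<in> X then (if w then 0 else ss i, d) else (ss i, 0))"

definition wipe :: "bool \<Rightarrow> int \<Rightarrow> nat \<Rightarrow> (int \<Rightarrow> nat) \<Rightarrow> int \<Rightarrow> nat" where
  "wipe w h k f p = (if w \<and> h \<le> p \<and> p < h + int k then 0 else f p)"

definition driven :: "nat \<Rightarrow> int \<Rightarrow> bool \<Rightarrow> nat set \<Rightarrow> bool \<Rightarrow> int \<Rightarrow> nat \<Rightarrow> tapes \<Rightarrow> tapes" where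
  "driven n dn er X w d k \<tau> i =
     (if i = n then (wipe er (snd (\<tau> n)) k (fst (\<tau> n)), snd (\<tau> n) + int k * dn)
      else if i \<in> X then (wipe w (snd (\<tau> i)) k (fst (\<tau> i)), snd (\<tau> i) + int k * d)
      else \<tau> i)"

lemma wipe_False [simp]: "wipe False h k f = f"
  by (auto simp: wipe_def)

lemma wipe_Suc: "(wipe w h k f)(h + int k := if w then 0 else wipe w h k f (h + int k)) = wipe w h (Suc k) f"
  by (auto simp: wipe_def fun_eq_iff)

lemma driven_0 [simp]: "driven n dn er X w d 0 \<tau> = \<tau>"
  by (auto simp: driven_def wipe_def fun_eq_iff prod_eq_iff)

lemma driven_Suc:
  assumes "n \<notin> X" "er \<Longrightarrow> dn = 1" "w \<Longrightarrow> d = 1"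
  shows "perform (drive_act n dn er X w d (heads (driven n dn er X w d k \<tau>))) (driven n dn er X w d k \<tau>)
     = driven n dn er X w d (Suc k) \<tau>"
proof
  fix i
  show "perform (drive_act n dn er X w d (heads (driven n dn er X w d k \<tau>))) (driven n dn er X w d k \<tau>) i
     = driven n dn er X w d (Suc k) \<tau> i"
    using assms wipe_Suc[of True "snd (\<tau> i)" k "fst (\<tau> i)"]
    by (auto simp: perform_def drive_act_def heads_def driven_def algebra_simps)
qed

lemma runs_eq: "runs c \<tau> t \<tau>' \<Longrightarrow> t = t' \<Longrightarrow> \<tau>' = \<tau>'' \<Longrightarrow> runs c \<tau> t' \<tau>''"
  by simp

lemma runs_drive:
  assumes "n \<notin> X" "er \<Longrightarrow> dn = 1" "w \<Longrightarrow> d = 1"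
    and "\<And>k. k < N \<Longrightarrow> fst (\<tau> n) (snd (\<tau> n) + int k * dn) \<noteq> 0" "fst (\<tau> n) (snd (\<tau> n) + int N * dn) = 0"
  shows "runs (Loop (\<lambda>ss. ss n \<noteq> 0) (Act (drive_act n dn er X w d))) \<tau> (N * 3 + 1) (driven n dn er X w d N \<tau>)"
proof -
  have h: "heads (driven n dn er X w d k \<tau>) n = fst (\<tau> n) (snd (\<tau> n) + int k * dn)" for k
    using assms(2) by (auto simp: heads_def driven_def wipe_def)
  have "runs (Loop (\<lambda>ss. ss n \<noteq> 0) (Act (drive_act n dn er X w d))) (driven n dn er X w d 0 \<tau>) (N * (1 + 2) + 1)
      (driven n dn er X w d N \<tau>)"
  proof (rule runs_Loop_iterate)
    fix k
    show "runs (Act (drive_act n dn er X w d)) (driven n dn er X w d k \<tau>) 1 (driven n dn er X w d (Suc k) \<tau>)"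
      using runs_Act[of "drive_act n dn er X w d" "driven n dn er X w d k \<tau>"] driven_Suc[OF assms(1-3)] by simp
  qed (use h assms(4,5) in auto)
  then have "runs (Loop (\<lambda>ss. ss n \<noteq> 0) (Act (drive_act n dn er X w d))) \<tau> (N * (1 + 2) + 1)
      (driven n dn er X w d N \<tau>)" by (simp only: driven_0)
  then show ?thesis by (rule runs_eq) auto
qed

text \<open>The head of \<open>n\<close> stands just right of a nonblank block and returns to its
  first cell; meanwhile the tapes in \<open>X\<close> make one move for each cell of the
  block.\<close>

definition rewind :: "nat \<Rightarrow> nat set \<Rightarrow> bool \<Rightarrow> int \<Rightarrow> com" where
  "rewind n X w d = Seq (Act (drive_act n (-1) False {} False 0))
     (Seq (Loop (\<lambda>ss. ss n \<noteq> 0) (Act (drive_act n (-1) False X w d))) (Act (drive_act n 1 False {} False 0)))"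

lemma runs_rewind:
  assumes "n \<notin> X" "w \<Longrightarrow> d = 1"
    and "\<And>k. k < N \<Longrightarrow> fst (\<tau> n) (snd (\<tau> n) - 1 - int k) \<noteq> 0" "fst (\<tau> n) (snd (\<tau> n) - 1 - int N) = 0"
  shows "runs (rewind n X w d) \<tau> (N * 3 + 5) (driven n (-1) False X w d N \<tau>)"
proof -
  define \<tau>1 where "\<tau>1 = driven n (-1) False {} False 0 1 \<tau>"
  have n1: "\<tau>1 n = (fst (\<tau> n), snd (\<tau> n) - 1)" by (simp add: \<tau>1_def driven_def)
  have r1: "runs (Act (drive_act n (-1) False {} False 0)) \<tau> 1 \<tau>1"
    using runs_Act[of "drive_act n (-1) False {} False 0" \<tau>] driven_Suc[of n "{}" False "-1" False 0 0 \<tau>]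
    by (simp add: \<tau>1_def)
  have r2: "runs (Loop (\<lambda>ss. ss n \<noteq> 0) (Act (drive_act n (-1) False X w d))) \<tau>1 (N * 3 + 1)
      (driven n (-1) False X w d N \<tau>1)"
    using assms by (intro runs_drive) (auto simp: n1)
  define \<tau>2 where "\<tau>2 = driven n (-1) False X w d N \<tau>1"
  have "driven n 1 False {} False 0 (Suc 0) \<tau>2 = driven n (-1) False X w d N \<tau>"
    using assms(1) by (auto simp: \<tau>2_def \<tau>1_def driven_def fun_eq_iff prod_eq_iff)
  then have r3: "runs (Act (drive_act n 1 False {} False 0)) \<tau>2 1 (driven n (-1) False X w d N \<tau>)"
    using runs_Act[of "drive_act n 1 False {} False 0" \<tau>2] driven_Suc[of n "{}" False 1 False 0 0 \<tau>2]
    by simp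
  show ?thesis
    using runs_Seq[OF r1 runs_Seq[OF r2[folded \<tau>2_def] r3]] unfolding rewind_def by (rule runs_eq) auto
qed

text \<open>The tape of a foreign machine may carry symbols beyond the bits. The minimum keeps the
  written symbol below 3, so that the action is bounded whatever is scanned.\<close>

definition copy :: "nat \<Rightarrow> nat \<Rightarrow> bool \<Rightarrow> nat set \<Rightarrow> com" where
  "copy a b er X = Loop (\<lambda>ss. ss a \<noteq> 0)
     (Act (\<lambda>ss i. if i = b then (min (ss a) 2, 1) else drive_act a 1 er X False 1 ss i))"

definition copied :: "nat \<Rightarrow> nat \<Rightarrow> bool \<Rightarrow> nat set \<Rightarrow> bool list \<Rightarrow> tapes \<Rightarrow> tapes" where
  "copied a b er X y \<tau> = (driven a 1 er X False 1 (length y) \<tau>)(b :=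
     (\<lambda>p. if snd (\<tau> b) \<le> p \<and> p < snd (\<tau> b) + int (length y) then word_tape y (p - snd (\<tau> b)) else fst (\<tau> b) p,
      snd (\<tau> b) + int (length y)))"

lemma word_tape_take: "i \<le> length y \<Longrightarrow> 0 \<le> p \<Longrightarrow> p < int i \<Longrightarrow> word_tape (take i y) p = word_tape y p"
  by (auto simp: word_tape_def)

lemma runs_copy:
  assumes "a \<notin> X" "b \<notin> X" "a \<noteq> b"
    and y: "\<And>j. j \<le> length y \<Longrightarrow> fst (\<tau> a) (snd (\<tau> a) + int j) = word_tape y (int j)"
  shows "runs (copy a b er X) \<tau> (length y * 3 + 1) (copied a b er X y \<tau>)"
proof -
  define A where "A = (\<lambda>ss i. if i = b then (min (ss a) 2, 1) else drive_act a 1 er X False 1 ss i)"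
  define T where "T k = copied a b er X (take k y) \<tau>" for k
  have h: "heads (T k) a = word_tape y (int k)" if "k \<le> length y" for k
    using y[OF that] that assms(3) by (auto simp: T_def copied_def heads_def driven_def wipe_def min_def)
  have "runs (Loop (\<lambda>ss. ss a \<noteq> 0) (Act A)) (T 0) (length y * (1 + 2) + 1) (T (length y))"
  proof (rule runs_Loop_iterate)
    fix k assume k: "k < length y"
    then show "heads (T k) a \<noteq> 0" using h[of k] by (auto simp: word_tape_def)
    have "perform (A (heads (T k))) (T k) i = T (Suc k) i" for i
    proof (cases "i = b")
      case True
      have "perform (A (heads (T k))) (T k) b = ((fst (T k b))(snd (T k b) := word_tape y (int k)), snd (T k b) + 1)"
        using h[of k] k by (simp add: perform_def A_def word_tape_def)
      also have "\<dots> = T (Suc k) b"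
        using k by (auto simp: T_def copied_def fun_eq_iff min_def word_tape_take)
      finally show ?thesis using True by simp
    next
      case False
      have "heads (T k) a = heads (driven a 1 er X False 1 k \<tau>) a" "heads (T k) i = heads (driven a 1 er X False 1 k \<tau>) i"
        using False assms(3) k by (auto simp: T_def copied_def heads_def min_def)
      then have "perform (A (heads (T k))) (T k) i =
          perform (drive_act a 1 er X False 1 (heads (driven a 1 er X False 1 k \<tau>))) (driven a 1 er X False 1 k \<tau>) i"
        using False k by (auto simp: perform_def A_def drive_act_def T_def copied_def min_def)
      also have "\<dots> = driven a 1 er X False 1 (Suc k) \<tau> i"
        using assms(1) by (subst driven_Suc) auto
      also have "\<dots> = T (Suc k) i" using False k by (simp add: T_def copied_def min_absorb2)
      finally show ?thesis .
    qed
    then have "perform (A (heads (T k))) (T k) = T (Suc k)" by blast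
    then show "runs (Act A) (T k) 1 (T (Suc k))" using runs_Act[of A "T k"] by simp
  next
    show "\<not> heads (T (length y)) a \<noteq> 0" using h[of "length y"] by (simp add: word_tape_def)
  qed
  moreover have "T 0 = \<tau>" by (auto simp: T_def copied_def fun_eq_iff prod_eq_iff)
  moreover have "T (length y) = copied a b er X y \<tau>" by (simp add: T_def)
  ultimately have "runs (Loop (\<lambda>ss. ss a \<noteq> 0) (Act A)) \<tau> (length y * (1 + 2) + 1) (copied a b er X y \<tau>)"
    by (simp only:)
  then show ?thesis unfolding copy_def A_def by (rule runs_eq) auto
qed

lemma bounded_drive:
  assumes "n < B" "X \<subseteq> {..<B}" "dn \<in> {-1, 0, 1}" "d \<in> {-1, 0, 1}"
  shows "bounded_com B (Act (drive_act n dn er X w d))"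
  using assms by (auto simp: drive_act_def)

lemma bounded_rewind:
  assumes "n < B" "X \<subseteq> {..<B}" "d \<in> {-1, 0, 1}"
  shows "bounded_com B (rewind n X w d)"
  unfolding rewind_def bounded_com.simps(3,5) using assms by (intro conjI bounded_drive) auto

lemma bounded_copy:
  assumes "a < B" "b < B" "X \<subseteq> {..<B}" "3 \<le> B"
  shows "bounded_com B (copy a b er X)"
  using assms by (auto simp: copy_def drive_act_def)


section \<open>Simulating a machine and cleaning up after it\<close>

definition tm_config_valid :: "tm \<Rightarrow> tm_config \<Rightarrow> bool" where
  "tm_config_valid M c \<longleftrightarrow> fst c < tm_states M \<and> length (snd c) = tm_tapes M \<and>
     (\<forall>i<tm_tapes M. \<forall>p. fst (snd c ! i) p < tm_symbols M)"

lemma tm_step_nth: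
  assumes "tm_wf M" "tm_config_valid M c" "fst c \<noteq> 1"
    and r: "r = tm_delta M (fst c) (map (\<lambda>(t, h). t h) (snd c))"
  shows "fst (tm_step M c) = fst r" "length (snd (tm_step M c)) = tm_tapes M"
    "\<And>i. i < tm_tapes M \<Longrightarrow> snd (tm_step M c) ! i =
       ((fst (snd c ! i))(snd (snd c ! i) := fst (snd r ! i)), snd (snd c ! i) + snd (snd r ! i))"
    "fst r < tm_states M" "length (snd r) = tm_tapes M"
    "\<And>i. i < tm_tapes M \<Longrightarrow> fst (snd r ! i) < tm_symbols M \<and> snd (snd r ! i) \<in> {-1, 0, 1}"
proof -
  define ss where "ss = map (\<lambda>(t, h). t h) (snd c)"
  have "length ss = tm_tapes M" "set ss \<subseteq> {..<tm_symbols M}"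
    using assms(2) by (auto simp: ss_def tm_config_valid_def in_set_conv_nth) (metis fst_conv)
  moreover have "fst c < tm_states M" using assms(2) by (simp add: tm_config_valid_def)
  ultimately have *: "case tm_delta M (fst c) ss of (q', as) \<Rightarrow>
           q' < tm_states M \<and> length as = tm_tapes M \<and>
           set as \<subseteq> {..<tm_symbols M} \<times> {-1, 0, 1}"
    using assms(1)[unfolded tm_wf_def, THEN conjunct2, THEN conjunct2, THEN conjunct2, rule_format, of "fst c" ss]
    by (simp only: simp_thms)
  then show r1: "fst r < tm_states M" and r2: "length (snd r) = tm_tapes M"
    by (auto simp: r ss_def case_prod_beta)
  show "fst (snd r ! i) < tm_symbols M \<and> snd (snd r ! i) \<in> {-1, 0, 1}" if "i < tm_tapes M" for i
  proof -
    have "snd r ! i \<in> {..<tm_symbols M} \<times> {-1, 0, 1}"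
      using * that nth_mem[of i "snd r"] by (auto simp: r ss_def case_prod_beta)
    then show ?thesis by (auto simp: mem_Times_iff)
  qed
  have step: "tm_step M c = (fst r, map2 (\<lambda>(t, h) (s, d). (t(h := s), h + d)) (snd c) (snd r))"
    using assms(3) by (auto simp: tm_step_def case_prod_beta r)
  show "fst (tm_step M c) = fst r" by (simp add: step)
  show "length (snd (tm_step M c)) = tm_tapes M"
    using assms(2) r2 by (simp add: step tm_config_valid_def)
  show "snd (tm_step M c) ! i =
       ((fst (snd c ! i))(snd (snd c ! i) := fst (snd r ! i)), snd (snd c ! i) + snd (snd r ! i))"
    if "i < tm_tapes M" for i
    using that r2 assms(2) by (simp add: step tm_config_valid_def case_prod_beta)
qed

text \<open>A head moves by at most one cell per step. The resulting window around cell 0 is what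
  has to be erased after a call.\<close>

lemma tm_config_reachable:
  assumes "tm_wf M" and c: "c = (tm_step M ^^ k) (tm_init M x)"
  shows "tm_config_valid M c \<and> (\<forall>i<tm_tapes M. \<bar>snd (snd c ! i)\<bar> \<le> int k \<and>
     (\<forall>p. fst (snd c ! i) p \<noteq> 0 \<longrightarrow> - int k \<le> p \<and> p < int (max (length x) k)))"
  unfolding c
proof (induction k)
  case 0
  have "0 < tm_states M" "3 \<le> tm_symbols M" "1 \<le> tm_tapes M" using assms(1) by (auto simp: tm_wf_def)
  then show ?case
    by (auto simp: tm_config_valid_def tm_init_def nth_Cons word_tape_def split: nat.splits if_splits)
next
  case (Suc k)
  define c where "c = (tm_step M ^^ k) (tm_init M x)"
  have v: "tm_config_valid M c" and IH: "\<And>i. i < tm_tapes M \<Longrightarrow> \<bar>snd (snd c ! i)\<bar> \<le> int k"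
    "\<And>i p. i < tm_tapes M \<Longrightarrow> fst (snd c ! i) p \<noteq> 0 \<Longrightarrow> - int k \<le> p \<and> p < int (max (length x) k)"
    using Suc by (auto simp: c_def)
  have e: "(tm_step M ^^ Suc k) (tm_init M x) = tm_step M c" by (simp add: c_def)
  show ?case
  proof (cases "fst c = 1")
    case True
    then have "tm_step M c = c" by (simp add: tm_step_def case_prod_beta prod_eq_iff)
    show ?thesis unfolding e \<open>tm_step M c = c\<close>
    proof (intro conjI allI impI)
      show "tm_config_valid M c" by (rule v)
      fix i assume i: "i < tm_tapes M"
      show "\<bar>snd (snd c ! i)\<bar> \<le> int (Suc k)" using IH(1)[OF i] by simp
      fix p assume "fst (snd c ! i) p \<noteq> 0"
      with IH(2)[OF i] show "- int (Suc k) \<le> p" "p < int (max (length x) (Suc k))" by fastforce+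
    qed
  next
    case False
    define r where "r = tm_delta M (fst c) (map (\<lambda>(t, h). t h) (snd c))"
    note st = tm_step_nth[OF assms(1) v False r_def]
    have "\<bar>snd (snd (tm_step M c) ! i)\<bar> \<le> int (Suc k)" if "i < tm_tapes M" for i
      using IH(1)[OF that] st(3,6)[OF that] by auto
    moreover have "- int (Suc k) \<le> p \<and> p < int (max (length x) (Suc k))"
      if "i < tm_tapes M" "fst (snd (tm_step M c) ! i) p \<noteq> 0" for i p
      using IH(1)[OF that(1)] IH(2)[OF that(1), of p] that(2) unfolding st(3)[OF that(1)]
      by (auto split: if_splits)
    moreover have "tm_config_valid M (tm_step M c)"
      using v st unfolding tm_config_valid_def by auto
    ultimately show ?thesis unfolding e by blast
  qed
qed

text \<open>
  The tapes of the simulated machine start at tape \<open>b\<close>. They are followed by a tape that holds the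
  state, a step counter, and a marker tape whose head moves with that of the first tape.
\<close>

definition sim_act :: "tm \<Rightarrow> nat \<Rightarrow> (nat \<Rightarrow> nat) \<Rightarrow> nat \<Rightarrow> nat \<times> int" where
  "sim_act M b ss i = (let q = b + tm_tapes M; r = tm_delta M (ss q) (map (\<lambda>i. ss (b + i)) [0..<tm_tapes M]) in
     if ss q < tm_states M \<and> (\<forall>i<tm_tapes M. ss (b + i) < tm_symbols M) then
       (if i = q then (fst r, 0) else if i = q + 1 then (1, 1) else if i = q + 2 then (ss i, snd (snd r ! 0))
        else if b \<le> i \<and> i < q then snd r ! (i - b) else (ss i, 0))
     else (ss i, 0))"

lemma bounded_sim_act:
  assumes "tm_wf M" "b + tm_tapes M + 3 + tm_states M + tm_symbols M \<le> B"
  shows "bounded_com B (Act (sim_act M b))"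
proof -
  have *: "fst (sim_act M b ss i) < B \<or> fst (sim_act M b ss i) = ss i"
    "snd (sim_act M b ss i) \<in> {-1, 0, 1}" "B \<le> i \<longrightarrow> sim_act M b ss i = (ss i, 0)" for ss i
  proof -
    define q where "q = b + tm_tapes M"
    define r where "r = tm_delta M (ss q) (map (\<lambda>i. ss (b + i)) [0..<tm_tapes M])"
    have K: "1 \<le> tm_tapes M" using assms(1) by (simp add: tm_wf_def)
    have "(fst (sim_act M b ss i) < B \<or> fst (sim_act M b ss i) = ss i) \<and>
      snd (sim_act M b ss i) \<in> {-1, 0, 1} \<and> (B \<le> i \<longrightarrow> sim_act M b ss i = (ss i, 0))"
    proof (cases "ss q < tm_states M \<and> (\<forall>i<tm_tapes M. ss (b + i) < tm_symbols M)")
      case True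
      then have "set (map (\<lambda>i. ss (b + i)) [0..<tm_tapes M]) \<subseteq> {..<tm_symbols M}" by auto
      then have "case r of (q', as) \<Rightarrow> q' < tm_states M \<and> length as = tm_tapes M \<and>
           set as \<subseteq> {..<tm_symbols M} \<times> {-1, 0, 1}"
        using assms(1)[unfolded tm_wf_def, THEN conjunct2, THEN conjunct2, THEN conjunct2, rule_format,
            of "ss q" "map (\<lambda>i. ss (b + i)) [0..<tm_tapes M]"] True
        unfolding r_def by (simp only: simp_thms length_map length_upt diff_zero)
      then have r: "fst r < tm_states M" "length (snd r) = tm_tapes M" "set (snd r) \<subseteq> {..<tm_symbols M} \<times> {-1, 0, 1}"
        by (auto simp: case_prod_beta)
      have "fst (snd r ! j) < tm_symbols M \<and> snd (snd r ! j) \<in> {-1, 0, 1}" if "j < tm_tapes M" for j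
        using subsetD[OF r(3) nth_mem[of j]] that r(2) unfolding mem_Times_iff by simp
      then have n: "fst (snd r ! 0) < tm_symbols M \<and> snd (snd r ! 0) \<in> {-1, 0, 1}"
          "b \<le> i \<Longrightarrow> i < q \<Longrightarrow> fst (snd r ! (i - b)) < tm_symbols M \<and> snd (snd r ! (i - b)) \<in> {-1, 0, 1}"
        using K by (auto simp: q_def)
      have "sim_act M b ss i = (if i = q then (fst r, 0) else if i = q + 1 then (1, 1) else if i = q + 2 then (ss i, snd (snd r ! 0))
        else if b \<le> i \<and> i < q then snd r ! (i - b) else (ss i, 0))"
        using True unfolding sim_act_def Let_def q_def[symmetric] r_def[symmetric] by simp
      then show ?thesis using r(1) n assms(2) K by (auto simp: q_def)
    next
      case False
      then have "sim_act M b ss i = (ss i, 0)"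
        unfolding sim_act_def Let_def q_def[symmetric] r_def[symmetric] by (simp only: if_False)
      then show ?thesis by simp
    qed
    then show "fst (sim_act M b ss i) < B \<or> fst (sim_act M b ss i) = ss i"
      "snd (sim_act M b ss i) \<in> {-1, 0, 1}" "B \<le> i \<longrightarrow> sim_act M b ss i = (ss i, 0)" by auto
  qed
  then show ?thesis unfolding bounded_com.simps by blast
qed

definition shift_tape :: "int \<Rightarrow> (int \<Rightarrow> nat) \<times> int \<Rightarrow> (int \<Rightarrow> nat) \<times> int" where
  "shift_tape h t = (\<lambda>j. fst t (j - h), snd t + h)"

text \<open>Each simulated step adds one mark to the counter, which thus records how far heads can
  have travelled. The marker head copies the moves of the first simulated tape, so its displacement
  tells where cell 0 of that tape is.\<close>

definition simulated :: "tm \<Rightarrow> nat \<Rightarrow> tapes \<Rightarrow> tm_config \<Rightarrow> nat \<Rightarrow> tapes" where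
  "simulated M b \<tau> c k i = (let q = b + tm_tapes M in
     if i = q then (\<lambda>p. if p = snd (\<tau> q) then fst c else 0, snd (\<tau> q))
     else if i = q + 1 then (\<lambda>p. if snd (\<tau> i) \<le> p \<and> p < snd (\<tau> i) + int k then 1 else fst (\<tau> i) p, snd (\<tau> i) + int k)
     else if i = q + 2 then (fst (\<tau> i), snd (\<tau> i) + snd (snd c ! 0))
     else if b \<le> i \<and> i < q then shift_tape (snd (\<tau> i)) (snd c ! (i - b))
     else \<tau> i)"

lemma runs_simulate:
  assumes wf: "tm_wf M" and x: "stack_tape (\<tau> b) x" and blank: "\<And>i. b < i \<Longrightarrow> i \<le> b + tm_tapes M \<Longrightarrow> stack_tape (\<tau> i) []"
    and halt: "\<And>k. k < t \<Longrightarrow> fst ((tm_step M ^^ k) (tm_init M x)) \<noteq> 1" "fst ((tm_step M ^^ t) (tm_init M x)) = 1"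
  shows "runs (Loop (\<lambda>ss. ss (b + tm_tapes M) \<noteq> 1) (Act (sim_act M b))) \<tau> (t * 3 + 1)
    (simulated M b \<tau> ((tm_step M ^^ t) (tm_init M x)) t)"
proof -
  define q where "q = b + tm_tapes M"
  define cfg where "cfg k = (tm_step M ^^ k) (tm_init M x)" for k
  define T where "T k = simulated M b \<tau> (cfg k) k" for k
  have K: "1 \<le> tm_tapes M" using wf by (simp add: tm_wf_def)
  have v: "tm_config_valid M (cfg k)" for k using tm_config_reachable[OF wf cfg_def] by blast
  have hq: "heads (T k) q = fst (cfg k)" for k
    by (simp add: heads_def T_def simulated_def Let_def q_def)
  have hM: "heads (T k) (b + i) = fst (snd (cfg k) ! i) (snd (snd (cfg k) ! i))" if "i < tm_tapes M" for k i
    using that by (simp add: heads_def T_def simulated_def Let_def shift_tape_def)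
  have "runs (Loop (\<lambda>ss. ss q \<noteq> 1) (Act (sim_act M b))) (T 0) (t * (1 + 2) + 1) (T t)"
  proof (rule runs_Loop_iterate)
    fix k assume k: "k < t"
    show "heads (T k) q \<noteq> 1" using halt(1)[OF k] hq by (simp add: cfg_def)
    define r where "r = tm_delta M (fst (cfg k)) (map (\<lambda>(t, h). t h) (snd (cfg k)))"
    have Suc: "cfg (Suc k) = tm_step M (cfg k)" by (simp add: cfg_def)
    note st = tm_step_nth[OF wf v halt(1)[OF k, folded cfg_def] r_def]
    have map_eq: "map (\<lambda>i. heads (T k) (b + i)) [0..<tm_tapes M] = map (\<lambda>(t, h). t h) (snd (cfg k))"
      using v[of k] hM by (intro nth_equalityI) (auto simp: tm_config_valid_def case_prod_beta)
    have ok: "heads (T k) q < tm_states M \<and> (\<forall>i<tm_tapes M. heads (T k) (b + i) < tm_symbols M)"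
      using v[of k] hq hM by (auto simp: tm_config_valid_def)
    have act: "sim_act M b (heads (T k)) i = (if i = q then (fst r, 0) else if i = q + 1 then (1, 1)
        else if i = q + 2 then (heads (T k) i, snd (snd r ! 0))
        else if b \<le> i \<and> i < q then snd r ! (i - b) else (heads (T k) i, 0))" for i
      using ok unfolding sim_act_def Let_def q_def[symmetric] map_eq hq r_def[symmetric] by simp
    have "perform (sim_act M b (heads (T k))) (T k) i = T (Suc k) i" for i
    proof -
      define a where "a = (if i = q then (fst r, 0) else if i = q + 1 then (1, 1)
        else if i = q + 2 then (heads (T k) i, snd (snd r ! 0))
        else if b \<le> i \<and> i < q then snd r ! (i - b) else (heads (T k) i, 0))"
      consider "i = q" | "i = q + 1" | "i = q + 2" | "b \<le> i" "i < q" | "i < b" | "i > q + 2" by linarith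
      then have "((fst (T k i))(snd (T k i) := fst a), snd (T k i) + snd a) = T (Suc k) i"
      proof cases
        case 4
        then have ib: "i - b < tm_tapes M" by (auto simp: q_def)
        have "T k i = shift_tape (snd (\<tau> i)) (snd (cfg k) ! (i - b))"
          "T (Suc k) i = shift_tape (snd (\<tau> i)) (snd (cfg (Suc k)) ! (i - b))"
          using 4 by (auto simp: T_def simulated_def Let_def q_def)
        then show ?thesis
          using 4 st(3)[OF ib] by (auto simp: Suc shift_tape_def fun_eq_iff a_def)
      qed (use K st(1) st(3)[of 0] in \<open>auto simp: Suc T_def simulated_def Let_def q_def heads_def fun_eq_iff a_def\<close>)
      then show ?thesis unfolding perform_def act a_def .
    qed
    then have "perform (sim_act M b (heads (T k))) (T k) = T (Suc k)" by blast
    then show "runs (Act (sim_act M b)) (T k) 1 (T (Suc k))" using runs_Act[of "sim_act M b" "T k"] by simp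
  next
    show "\<not> heads (T t) q \<noteq> 1" using halt(2) hq by (simp add: cfg_def)
  qed
  moreover have "T 0 = \<tau>"
  proof
    fix i
    have "fst (\<tau> i) = (\<lambda>_. 0)" if "b < i" "i \<le> q" using blank[of i] that by (auto simp: stack_tape_def q_def)
    moreover have "fst (\<tau> b) = (\<lambda>j. word_tape x (j - snd (\<tau> b)))" using x by (auto simp: stack_tape_def)
    ultimately show "T 0 i = \<tau> i"
      using K by (auto simp: T_def simulated_def Let_def cfg_def tm_init_def q_def shift_tape_def nth_Cons prod_eq_iff split: nat.splits)
  qed
  ultimately have "runs (Loop (\<lambda>ss. ss q \<noteq> 1) (Act (sim_act M b))) \<tau> (t * (1 + 2) + 1) (T t)" by simp
  then show ?thesis unfolding q_def T_def cfg_def by (rule runs_eq) auto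
qed

definition set_act :: "nat \<Rightarrow> nat \<Rightarrow> (nat \<Rightarrow> nat) \<Rightarrow> nat \<Rightarrow> nat \<times> int" where
  "set_act m v ss i = (if i = m then v else ss i, 0)"

lemma runs_set: "runs (Act (set_act m v)) \<tau> 1 (\<tau>(m := ((fst (\<tau> m))(snd (\<tau> m) := v), snd (\<tau> m))))"
proof -
  have "perform (set_act m v (heads \<tau>)) \<tau> = \<tau>(m := ((fst (\<tau> m))(snd (\<tau> m) := v), snd (\<tau> m)))"
    by (auto simp: fun_eq_iff perform_def set_act_def heads_def prod_eq_iff)
  then show ?thesis using runs_Act[of "set_act m v" \<tau>] by simp
qed

lemma runs_seek:
  assumes "m \<notin> X" and "\<And>p. fst (\<tau> m) p = (if p = h then 1 else 0)" and "snd (\<tau> m) + int N * d = h"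
    and "\<And>k. k < N \<Longrightarrow> snd (\<tau> m) + int k * d \<noteq> h"
  shows "runs (Loop (\<lambda>ss. ss m \<noteq> 1) (Act (drive_act m d False X False d))) \<tau> (N * 3 + 1) (driven m d False X False d N \<tau>)"
proof -
  have h: "heads (driven m d False X False d k \<tau>) m = (if snd (\<tau> m) + int k * d = h then 1 else 0)" for k
    using assms(2) by (auto simp: heads_def driven_def)
  have "runs (Loop (\<lambda>ss. ss m \<noteq> 1) (Act (drive_act m d False X False d))) (driven m d False X False d 0 \<tau>) (N * (1 + 2) + 1)
      (driven m d False X False d N \<tau>)"
  proof (rule runs_Loop_iterate)
    fix k
    show "runs (Act (drive_act m d False X False d)) (driven m d False X False d k \<tau>) 1 (driven m d False X False d (Suc k) \<tau>)"
      using runs_Act[of "drive_act m d False X False d" "driven m d False X False d k \<tau>"] driven_Suc[of m X False d False d k \<tau>] assms(1) by simp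
  qed (use h assms(3,4) in auto)
  then have "runs (Loop (\<lambda>ss. ss m \<noteq> 1) (Act (drive_act m d False X False d))) \<tau> (N * (1 + 2) + 1)
      (driven m d False X False d N \<tau>)" by (simp only: driven_0)
  then show ?thesis by (rule runs_eq) auto
qed

text \<open>The difficulty is to leave no trace: the called machine stops with its heads at unknown
  places and with garbage on its tapes. The counter \<open>n\<close> starts with one mark per input
  symbol and gains one per step, and this number bounds all displacements and all nonblank cells.
  The marker \<open>m\<close> leads the head of tape \<open>b\<close> back to cell 0, from where the
  output is copied to \<open>u\<close>. Every tape in \<open>X\<close> is then moved left twice
  along the counter and wiped while it moves right four times, which covers its whole window.
  Finally the counter erases itself.\<close>

definition call_com :: "tm \<Rightarrow> nat \<Rightarrow> com" where
  "call_com M b = (let q = b + tm_tapes M; n = q + 1; m = q + 2; u = q + 3; X = {b..<q} \<union> {m};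
       pass = (\<lambda>w d. Loop (\<lambda>ss. ss n \<noteq> 0) (Act (drive_act n 1 False X w d))) in
     Seq (copy b n False {}) (Seq (rewind b {} False 0) (Seq (Act (set_act m 1))
    (Seq (Loop (\<lambda>ss. ss q \<noteq> 1) (Act (sim_act M b)))
    (Seq (rewind n {b, m} False (-1)) (Seq (Loop (\<lambda>ss. ss m \<noteq> 1) (Act (drive_act m 1 False {b} False 1)))
    (Seq (copy b u False {m})
    (Seq (pass False (-1)) (Seq (rewind n X False (-1))
    (Seq (pass True 1) (Seq (rewind n X True 1) (Seq (pass True 1) (Seq (rewind n X True 1)
    (Seq (Loop (\<lambda>ss. ss n \<noteq> 0) (Act (drive_act n 1 True {} False 0)))
    (Seq (Act (set_act q 0)) (rewind u {} False 0))))))))))))))))"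

lemma bounded_set_act: "m < B \<Longrightarrow> v < B \<Longrightarrow> bounded_com B (Act (set_act m v))"
  by (auto simp: set_act_def)

lemma bounded_call_com:
  assumes "tm_wf M" "b + tm_tapes M + 6 + tm_states M + tm_symbols M \<le> B"
  shows "bounded_com B (call_com M b)"
  unfolding call_com_def Let_def bounded_com.simps(3,5) using assms
  by (intro conjI bounded_copy bounded_rewind bounded_drive bounded_sim_act bounded_set_act) auto

lemma tm_step_halted: "fst c = 1 \<Longrightarrow> (tm_step M ^^ n) c = c"
  by (induction n) (auto simp: tm_step_def case_prod_beta prod_eq_iff)

lemma runs_call_com:
  assumes wf: "tm_wf M" and x: "stack_tape (\<tau> b) x" and blank: "\<And>i. b < i \<Longrightarrow> stack_tape (\<tau> i) []"
    and out: "tm_outputs M x t0 y" and q: "q = b + tm_tapes M"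
  shows "\<exists>t'\<le>100 * (length x + t0) + 100. \<exists>\<tau>'. runs (call_com M b) \<tau> t' \<tau>' \<and> (\<forall>i<b. \<tau>' i = \<tau> i) \<and>
     (\<forall>i\<ge>b. stack_tape (\<tau>' i) (if i = q + 3 then y else []))"
proof -
  define n m u where "n = q + 1" "m = q + 2" "u = q + 3"
  note nmu = n_m_u_def
  define X where "X = {b..<q} \<union> {m}"
  have K: "1 \<le> tm_tapes M" using wf by (simp add: tm_wf_def)
  define cfg where "cfg k = (tm_step M ^^ k) (tm_init M x)" for k
  \<comment> \<open>The simulation loop leaves at the first halting time; from there to
    \<open>t0\<close> the configuration no longer changes, so the output is the same.\<close>
  define t where "t = (LEAST k. fst (cfg k) = 1)"
  have h0: "fst (cfg t0) = 1" using out by (auto simp: tm_outputs_def cfg_def)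
  have ht: "fst (cfg t) = 1" unfolding t_def by (rule LeastI[of _ t0]) (rule h0)
  have "t \<le> t0" unfolding t_def by (rule Least_le) (rule h0)
  have before: "fst (cfg k) \<noteq> 1" if "k < t" for k using that not_less_Least unfolding t_def by blast
  have "cfg t0 = cfg t"
  proof -
    have "cfg t0 = (tm_step M ^^ (t0 - t)) (cfg t)"
      using \<open>t \<le> t0\<close> funpow_add[of "t0 - t" t "tm_step M"] by (simp add: cfg_def)
    then show ?thesis using tm_step_halted[OF ht] by simp
  qed
  define ts where "ts = snd (cfg t)"
  have y: "\<forall>j\<le>length y. fst (ts ! 0) (int j) = word_tape y (int j)"
  proof -
    have "hd ts = ts ! 0" using tm_config_reachable[OF wf cfg_def, of t] K
      by (intro hd_conv_nth) (auto simp: ts_def tm_config_valid_def)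
    then show ?thesis using out \<open>cfg t0 = cfg t\<close>
      by (auto simp: tm_outputs_def cfg_def ts_def case_prod_beta)
  qed
  have reach: "\<bar>snd (ts ! i)\<bar> \<le> int t" "\<And>p. fst (ts ! i) p \<noteq> 0 \<Longrightarrow> - int t \<le> p \<and> p < int (max (length x) t)"
    if "i < tm_tapes M" for i
    using tm_config_reachable[OF wf cfg_def, of t] that by (auto simp: ts_def)
  have "t \<noteq> 0" using ht by (auto simp: cfg_def tm_init_def intro: ccontr)
  \<comment> \<open>Head positions are bounded by \<open>t\<close> and nonblank cells by the larger
    of \<open>length x\<close> and \<open>t\<close>; the sum, which is also the number of marks on
    the counter, bounds both.\<close>
  define N where "N = length x + t"
  have ly: "length y \<le> N"
  proof (cases y)
    case (Cons a y')
    then have "fst (ts ! 0) (int (length y')) \<noteq> 0" using y by (auto simp: word_tape_def)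
    then have "int (length y') < int (max (length x) t)" using reach(2)[of 0 "int (length y')"] K by auto
    then show ?thesis using Cons by (auto simp: N_def)
  qed simp
  define h where "h i = snd (\<tau> i)" for i
  have tau: "\<tau> i = ((\<lambda>_. 0), h i)" if "b < i" for i
    using blank[OF that] by (auto simp: stack_tape_def h_def prod_eq_iff)
  have taub: "\<tau> b = ((\<lambda>p. word_tape x (p - h b)), h b)"
    using x by (auto simp: stack_tape_def h_def prod_eq_iff)
  have ne: "b < q" "b \<noteq> n" "b \<noteq> m" "b \<noteq> u" "n \<noteq> m" "n \<noteq> u" "m \<noteq> u" "q \<noteq> n" "q \<noteq> m" "q \<noteq> u" "b < n" "b < m" "b < u"
    using K q by (auto simp: nmu)
  have wt0: "word_tape z p = 0 \<longleftrightarrow> \<not> (0 \<le> p \<and> p < int (length z))" for z p by (auto simp: word_tape_def)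
  \<comment> \<open>the counter becomes \<open>length x\<close>\<close>
  define \<tau>2 where "\<tau>2 = \<tau>(n := ((\<lambda>p. word_tape x (p - h n)), h n + int (length x)))"
  have r1: "runs (copy b n False {}) \<tau> (length x * 3 + 1) (copied b n False {} x \<tau>)"
    using ne by (intro runs_copy) (auto simp: taub)
  have c1: "copied b n False {} x \<tau> = \<tau>2(b := ((\<lambda>p. word_tape x (p - h b)), h b + int (length x)))"
    using ne by (auto simp: copied_def driven_def \<tau>2_def tau taub fun_eq_iff word_tape_def)
  have r2: "runs (rewind b {} False 0) (copied b n False {} x \<tau>) (length x * 3 + 5) \<tau>2"
  proof (rule runs_eq)
    show "runs (rewind b {} False 0) (copied b n False {} x \<tau>) (length x * 3 + 5)
       (driven b (- 1) False {} False 0 (length x) (copied b n False {} x \<tau>))"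
      by (rule runs_rewind) (auto simp: c1 wt0)
    show "driven b (- 1) False {} False 0 (length x) (copied b n False {} x \<tau>) = \<tau>2"
      using ne by (auto simp: c1 driven_def fun_eq_iff \<tau>2_def taub)
  qed simp
  define \<tau>3 where "\<tau>3 = \<tau>2(m := ((\<lambda>p. if p = h m then 1 else 0), h m))"
  have r3: "runs (Act (set_act m 1)) \<tau>2 1 \<tau>3"
    using ne by (intro runs_eq[OF runs_set]) (auto simp: \<tau>3_def \<tau>2_def tau fun_eq_iff)
  define \<tau>4 where "\<tau>4 = simulated M b \<tau>3 (cfg t) t"
  have r4: "runs (Loop (\<lambda>ss. ss q \<noteq> 1) (Act (sim_act M b))) \<tau>3 (t * 3 + 1) \<tau>4"
    unfolding q \<tau>4_def cfg_def
  proof (rule runs_simulate[OF wf])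
    show "stack_tape (\<tau>3 b) x" using ne x by (simp add: \<tau>3_def \<tau>2_def)
    show "stack_tape (\<tau>3 i) []" if "b < i" "i \<le> b + tm_tapes M" for i
      using that blank[of i] q by (auto simp: \<tau>3_def \<tau>2_def nmu)
  qed (use before ht in \<open>auto simp: cfg_def\<close>)
  have t3: "\<tau>3 n = ((\<lambda>p. word_tape x (p - h n)), h n + int (length x))"
    "\<tau>3 m = ((\<lambda>p. if p = h m then 1 else 0), h m)" "\<And>i. i \<noteq> n \<Longrightarrow> i \<noteq> m \<Longrightarrow> \<tau>3 i = \<tau> i"
    using ne by (simp_all add: \<tau>3_def \<tau>2_def)
  have sim: "\<tau>4 i = (if i = q then (\<lambda>p. if p = snd (\<tau>3 q) then 1 else 0, snd (\<tau>3 q))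
     else if i = n then (\<lambda>p. if snd (\<tau>3 i) \<le> p \<and> p < snd (\<tau>3 i) + int t then 1 else fst (\<tau>3 i) p, snd (\<tau>3 i) + int t)
     else if i = m then (fst (\<tau>3 i), snd (\<tau>3 i) + snd (ts ! 0))
     else if b \<le> i \<and> i < q then shift_tape (snd (\<tau>3 i)) (ts ! (i - b))
     else \<tau>3 i)" for i
    unfolding \<tau>4_def simulated_def Let_def q[symmetric] n_m_u_def[symmetric] ht ts_def ..
  have q3: "snd (\<tau>3 q) = h q" using t3(3)[of q] ne by (simp add: h_def)
  have t4: "\<tau>4 q = ((\<lambda>p. if p = h q then 1 else 0), h q)" by (simp add: sim q3)
  have t4': "\<tau>4 n = (\<lambda>p. if h n + int (length x) \<le> p \<and> p < h n + int N then 1 else word_tape x (p - h n), h n + int N)"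
    using ne by (auto simp: sim t3 N_def fun_eq_iff)
  have t4: "\<tau>4 q = ((\<lambda>p. if p = h q then 1 else 0), h q)"
    "snd (\<tau>4 n) = h n + int N" "\<And>p. fst (\<tau>4 n) p \<noteq> 0 \<longleftrightarrow> h n \<le> p \<and> p < h n + int N"
    "\<tau>4 m = ((\<lambda>p. if p = h m then 1 else 0), h m + snd (ts ! 0))"
    "\<And>i. b \<le> i \<Longrightarrow> i < q \<Longrightarrow> \<tau>4 i = ((\<lambda>j. fst (ts ! (i - b)) (j - h i)), snd (ts ! (i - b)) + h i)"
    "\<And>i. i < b \<or> u \<le> i \<Longrightarrow> \<tau>4 i = \<tau> i"
  proof -
    show "\<tau>4 q = ((\<lambda>p. if p = h q then 1 else 0), h q)" by (rule t4)
    show "snd (\<tau>4 n) = h n + int N" by (simp add: t4')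
    show "fst (\<tau>4 n) p \<noteq> 0 \<longleftrightarrow> h n \<le> p \<and> p < h n + int N" for p
      unfolding t4' fst_conv using wt0[of x "p - h n"] by (auto simp: N_def)
    show "\<tau>4 m = ((\<lambda>p. if p = h m then 1 else 0), h m + snd (ts ! 0))" using ne by (simp add: sim t3)
    show "\<tau>4 i = ((\<lambda>j. fst (ts ! (i - b)) (j - h i)), snd (ts ! (i - b)) + h i)" if "b \<le> i" "i < q" for i
    proof -
      have "i \<noteq> n" "i \<noteq> m" "i \<noteq> q" using that by (auto simp: nmu)
      then show ?thesis using that by (simp add: sim t3 shift_tape_def h_def)
    qed
    show "\<tau>4 i = \<tau> i" if "i < b \<or> u \<le> i" for i
    proof -
      have "i \<noteq> n" "i \<noteq> m" "i \<noteq> q" "\<not> (b \<le> i \<and> i < q)" using that ne by (auto simp: nmu)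
      then show ?thesis by (auto simp: sim t3)
    qed
  qed
  have t4n: "fst (\<tau>4 n) p = 0 \<longleftrightarrow> \<not> (h n \<le> p \<and> p < h n + int N)" for p using t4(3)[of p] by blast
  define \<tau>5 where "\<tau>5 = driven n (-1) False {b, m} False (-1) N \<tau>4"
  have r5: "runs (rewind n {b, m} False (-1)) \<tau>4 (N * 3 + 5) \<tau>5"
    unfolding \<tau>5_def using ne by (intro runs_rewind) (auto simp: t4(2) t4n)
  have b4: "\<tau>4 b = ((\<lambda>j. fst (ts ! 0) (j - h b)), snd (ts ! 0) + h b)" using t4(5)[of b] ne by simp
  \<comment> \<open>After the move by \<open>N\<close> to the left the marker head is at its mark or
    left of it, at this distance.\<close>
  define N' where "N' = nat (int N - snd (ts ! 0))"
  have N': "int N' = int N - snd (ts ! 0)" "N' \<le> 2 * N"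
    using reach(1)[of 0] K by (auto simp: N'_def N_def)
  define \<tau>6 where "\<tau>6 = driven m 1 False {b} False 1 N' \<tau>5"
  have r6: "runs (Loop (\<lambda>ss. ss m \<noteq> 1) (Act (drive_act m 1 False {b} False 1))) \<tau>5 (N' * 3 + 1) \<tau>6"
    unfolding \<tau>6_def using ne N' by (intro runs_seek[where h = "h m"]) (auto simp: \<tau>5_def driven_def t4)
  have b6: "\<tau>6 b = ((\<lambda>j. fst (ts ! 0) (j - h b)), h b)" "\<tau>6 m = ((\<lambda>p. if p = h m then 1 else 0), h m)"
    "\<tau>6 n = (fst (\<tau>4 n), h n)" "\<And>i. i \<noteq> b \<Longrightarrow> i \<noteq> m \<Longrightarrow> i \<noteq> n \<Longrightarrow> \<tau>6 i = \<tau>4 i"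
    using ne N' by (auto simp: \<tau>6_def \<tau>5_def driven_def b4 t4)
  define \<tau>7 where "\<tau>7 = copied b u False {m} y \<tau>6"
  have r7: "runs (copy b u False {m}) \<tau>6 (length y * 3 + 1) \<tau>7"
    unfolding \<tau>7_def using ne y by (intro runs_copy) (auto simp: b6)
  have u6: "\<tau>6 u = ((\<lambda>_. 0), h u)" using b6(4)[of u] t4(6)[of u] tau[of u] ne by auto
  have t7: "\<tau>7 b = ((\<lambda>j. fst (ts ! 0) (j - h b)), h b + int (length y))" 
    "\<tau>7 m = ((\<lambda>p. if p = h m then 1 else 0), h m + int (length y))"
    "\<tau>7 u = ((\<lambda>p. word_tape y (p - h u)), h u + int (length y))"
    "\<tau>7 n = (fst (\<tau>4 n), h n)" "\<And>i. i \<noteq> b \<Longrightarrow> i \<noteq> m \<Longrightarrow> i \<noteq> n \<Longrightarrow> i \<noteq> u \<Longrightarrow> \<tau>7 i = \<tau>4 i"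
    using ne by (auto simp: \<tau>7_def copied_def driven_def b6 u6 wt0 fun_eq_iff)
  have X: "n \<notin> X" "u \<notin> X" "q \<notin> X" using ne by (auto simp: X_def nmu)
  have sup: "\<exists>g. (\<forall>j. fst (\<tau>7 i) j \<noteq> 0 \<longrightarrow> g - int N \<le> j \<and> j < g + int N) \<and> g - int N \<le> snd (\<tau>7 i) \<and> snd (\<tau>7 i) \<le> g + int N"
    if "i \<in> X" for i
  proof -
    have "(\<forall>j. fst (\<tau>7 i) j \<noteq> 0 \<longrightarrow> h i - int N \<le> j \<and> j < h i + int N) \<and> h i - int N \<le> snd (\<tau>7 i) \<and> snd (\<tau>7 i) \<le> h i + int N"
    proof (cases "i = m")
      case True
      then show ?thesis using \<open>t \<noteq> 0\<close> ly by (auto simp: t7 N_def)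
    next
      case False
      then have i: "b \<le> i" "i < q" "i - b < tm_tapes M" using that q by (auto simp: X_def)
      have f: "fst (\<tau>7 i) = (\<lambda>j. fst (ts ! (i - b)) (j - h i))"
        using t7(5)[of i] t7(1) t4(5)[of i] i False by (cases "i = b") (auto simp: nmu)
      have "h i - int N \<le> snd (\<tau>7 i) \<and> snd (\<tau>7 i) \<le> h i + int N"
        using t7(5)[of i] t7(1) t4(5)[of i] i False reach(1)[OF i(3)] ly by (cases "i = b") (auto simp: nmu N_def)
      moreover have "h i - int N \<le> j \<and> j < h i + int N" if "fst (\<tau>7 i) j \<noteq> 0" for j
        using reach(2)[OF i(3), of "j - h i"] that unfolding f by (auto simp: N_def)
      ultimately show ?thesis by blast
    qed
    then show ?thesis by blast
  qed
  have passR: "runs (Loop (\<lambda>ss. ss n \<noteq> 0) (Act (drive_act n 1 False X w d))) \<sigma> (N * 3 + 1) (driven n 1 False X w d N \<sigma>)"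
    if "\<sigma> n = \<tau>7 n" "w \<Longrightarrow> d = 1" for \<sigma> w d
    using that X by (intro runs_drive) (auto simp: t7(4) t4n)
  have passL: "runs (rewind n X w d) \<sigma> (N * 3 + 5) (driven n (-1) False X w d N \<sigma>)"
    if "\<sigma> n = (fst (\<tau>7 n), h n + int N)" "w \<Longrightarrow> d = 1" for \<sigma> w d
    using that X by (intro runs_rewind) (auto simp: t7(4) t4n)
  define \<tau>8 where "\<tau>8 = driven n 1 False X False (-1) N \<tau>7"
  define \<tau>9 where "\<tau>9 = driven n (-1) False X False (-1) N \<tau>8"
  define \<tau>10 where "\<tau>10 = driven n 1 False X True 1 N \<tau>9"
  define \<tau>11 where "\<tau>11 = driven n (-1) False X True 1 N \<tau>10"
  define \<tau>12 where "\<tau>12 = driven n 1 False X True 1 N \<tau>11"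
  define \<tau>13 where "\<tau>13 = driven n (-1) False X True 1 N \<tau>12"
  have n8: "\<tau>8 n = (fst (\<tau>7 n), h n + int N)" by (simp add: \<tau>8_def driven_def t7(4))
  have n9: "\<tau>9 n = \<tau>7 n" using n8 by (simp add: \<tau>9_def driven_def t7(4))
  have n10: "\<tau>10 n = (fst (\<tau>7 n), h n + int N)" using n9 by (simp add: \<tau>10_def driven_def t7(4))
  have n11: "\<tau>11 n = \<tau>7 n" using n10 by (simp add: \<tau>11_def driven_def t7(4))
  have n12: "\<tau>12 n = (fst (\<tau>7 n), h n + int N)" using n11 by (simp add: \<tau>12_def driven_def t7(4))
  have n13: "\<tau>13 n = \<tau>7 n" using n12 by (simp add: \<tau>13_def driven_def t7(4))
  have oth13: "\<tau>13 i = \<tau>7 i" if "i \<notin> X" for i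
    using that n13 by (cases "i = n") (auto simp: \<tau>13_def \<tau>12_def \<tau>11_def \<tau>10_def \<tau>9_def \<tau>8_def driven_def)
  have X13: "fst (\<tau>13 i) j = 0" if "i \<in> X" for i j
  proof -
    have "i \<noteq> n" using that X by auto
    \<comment> \<open>The wiped cells reach \<open>2 * N\<close> to either side of the head
      position. Head and contents lie within \<open>N\<close> of a common centre, so nothing is
      missed.\<close>
    then have "fst (\<tau>13 i) j = (if snd (\<tau>7 i) - 2 * int N \<le> j \<and> j < snd (\<tau>7 i) + 2 * int N then 0 else fst (\<tau>7 i) j)"
      using that by (auto simp: \<tau>13_def \<tau>12_def \<tau>11_def \<tau>10_def \<tau>9_def \<tau>8_def driven_def wipe_def)
    then show ?thesis using sup[OF that] by fastforce
  qed
  have r8: "runs (Loop (\<lambda>ss. ss n \<noteq> 0) (Act (drive_act n 1 False X False (-1)))) \<tau>7 (N * 3 + 1) \<tau>8"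
    unfolding \<tau>8_def by (rule passR) auto
  have r9: "runs (rewind n X False (-1)) \<tau>8 (N * 3 + 5) \<tau>9"
    unfolding \<tau>9_def by (rule passL) (auto simp: n8)
  have r10: "runs (Loop (\<lambda>ss. ss n \<noteq> 0) (Act (drive_act n 1 False X True (1)))) \<tau>9 (N * 3 + 1) \<tau>10"
    unfolding \<tau>10_def by (rule passR) (auto simp: n9)
  have r11: "runs (rewind n X True (1)) \<tau>10 (N * 3 + 5) \<tau>11"
    unfolding \<tau>11_def by (rule passL) (auto simp: n10)
  have r12: "runs (Loop (\<lambda>ss. ss n \<noteq> 0) (Act (drive_act n 1 False X True (1)))) \<tau>11 (N * 3 + 1) \<tau>12"
    unfolding \<tau>12_def by (rule passR) (auto simp: n11)
  have r13: "runs (rewind n X True (1)) \<tau>12 (N * 3 + 5) \<tau>13"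
    unfolding \<tau>13_def by (rule passL) (auto simp: n12)
  define \<tau>14 where "\<tau>14 = driven n 1 True {} False 0 N \<tau>13"
  have r14: "runs (Loop (\<lambda>ss. ss n \<noteq> 0) (Act (drive_act n 1 True {} False 0))) \<tau>13 (N * 3 + 1) \<tau>14"
    unfolding \<tau>14_def by (rule runs_drive) (auto simp: n13 t7(4) t4n)
  define \<tau>15 where "\<tau>15 = \<tau>14(q := ((\<lambda>_. 0), h q))"
  have q14: "\<tau>14 q = ((\<lambda>p. if p = h q then 1 else 0), h q)"
    using oth13[OF X(3)] t7(5)[of q] t4(1) ne by (auto simp: \<tau>14_def driven_def)
  have r15: "runs (Act (set_act q 0)) \<tau>14 1 \<tau>15"
    by (rule runs_eq[OF runs_set]) (auto simp: \<tau>15_def q14 fun_eq_iff)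
  define \<tau>16 where "\<tau>16 = driven u (-1) False {} False 0 (length y) \<tau>15"
  have u15: "\<tau>15 u = ((\<lambda>p. word_tape y (p - h u)), h u + int (length y))"
    using oth13[OF X(2)] t7(3) ne by (auto simp: \<tau>15_def \<tau>14_def driven_def)
  have r16: "runs (rewind u {} False 0) \<tau>15 (length y * 3 + 5) \<tau>16"
    unfolding \<tau>16_def by (rule runs_rewind) (auto simp: u15 wt0)
  have "runs (call_com M b) \<tau> (length x * 3 + 1 + 1 + (length x * 3 + 5 + 1 + (1 + 1 + (t * 3 + 1 + 1 + (N * 3 + 5 + 1 +
      (N' * 3 + 1 + 1 + (length y * 3 + 1 + 1 + (N * 3 + 1 + 1 + (N * 3 + 5 + 1 + (N * 3 + 1 + 1 + (N * 3 + 5 + 1 +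
      (N * 3 + 1 + 1 + (N * 3 + 5 + 1 + (N * 3 + 1 + 1 + (1 + 1 + (length y * 3 + 5)))))))))))))))) \<tau>16"
    unfolding call_com_def Let_def q[symmetric] n_m_u_def[symmetric] X_def[symmetric]
    by (rule runs_Seq[OF r1 runs_Seq[OF r2 runs_Seq[OF r3 runs_Seq[OF r4 runs_Seq[OF r5 runs_Seq[OF r6 runs_Seq[OF r7
      runs_Seq[OF r8 runs_Seq[OF r9 runs_Seq[OF r10 runs_Seq[OF r11 runs_Seq[OF r12 runs_Seq[OF r13
      runs_Seq[OF r14 runs_Seq[OF r15 r16]]]]]]]]]]]]]]])
  moreover have "\<tau>16 i = \<tau> i" if "i < b" for i
    using that ne oth13[of i] t7(5)[of i] t4(6)[of i] by (auto simp: \<tau>16_def \<tau>15_def \<tau>14_def driven_def X_def nmu)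
  moreover have "stack_tape (\<tau>16 i) (if i = q + 3 then y else [])" if "b \<le> i" for i
  proof -
    consider "i = u" | "i = q" | "i = n" | "i \<in> X" | "u < i"
      using \<open>b \<le> i\<close> unfolding X_def nmu Un_iff atLeastLessThan_iff singleton_iff by linarith
    then show ?thesis
    proof cases
      case 1
      have "\<tau>16 u = ((\<lambda>p. word_tape y (p - h u)), h u)" by (simp add: \<tau>16_def driven_def u15)
      moreover have "u = q + 3" by (simp add: nmu)
      ultimately show ?thesis using 1 by (simp add: stack_tape_def)
    next
      case 2
      then have "fst (\<tau>16 i) = (\<lambda>_. 0)" "i \<noteq> q + 3" using ne by (auto simp: \<tau>16_def driven_def \<tau>15_def)
      then show ?thesis by (simp add: stack_tape_def)
    next
      case 3
      then have "fst (\<tau>16 i) = wipe True (snd (\<tau>7 n)) N (fst (\<tau>7 n))"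
        using ne by (auto simp: \<tau>16_def driven_def \<tau>15_def \<tau>14_def n13)
      moreover have "wipe True (snd (\<tau>7 n)) N (fst (\<tau>7 n)) p = 0" for p
        using t4n[of p] by (auto simp: wipe_def t7(4))
      moreover have "i \<noteq> q + 3" using 3 by (simp add: nmu)
      ultimately show ?thesis by (simp add: stack_tape_def)
    next
      case 4
      then have "i \<noteq> u" "i \<noteq> q" "i \<noteq> n" using X by auto
      then have "\<tau>16 i = \<tau>13 i" "i \<noteq> q + 3" by (auto simp: \<tau>16_def driven_def \<tau>15_def \<tau>14_def, auto simp: nmu)
      then show ?thesis using X13[OF 4] by (simp add: stack_tape_def)
    next
      case 5
      then have "\<tau>16 i = \<tau> i" "i \<noteq> q + 3" "b < i"
        using ne oth13[of i] t7(5)[of i] t4(6)[of i] by (auto simp: \<tau>16_def \<tau>15_def \<tau>14_def driven_def X_def nmu)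
      then show ?thesis using blank[of i] by simp
    qed
  qed
  moreover have "length x * 3 + 1 + 1 + (length x * 3 + 5 + 1 + (1 + 1 + (t * 3 + 1 + 1 + (N * 3 + 5 + 1 +
      (N' * 3 + 1 + 1 + (length y * 3 + 1 + 1 + (N * 3 + 1 + 1 + (N * 3 + 5 + 1 + (N * 3 + 1 + 1 + (N * 3 + 5 + 1 +
      (N * 3 + 1 + 1 + (N * 3 + 5 + 1 + (N * 3 + 1 + 1 + (1 + 1 + (length y * 3 + 5))))))))))))))) \<le> 100 * (length x + t0) + 100"
    using \<open>t \<le> t0\<close> ly N'(2) by (simp add: N_def)
  ultimately show ?thesis by blast
qed

section \<open>Composition with Turing machines\<close>

lemma computable_call:
  assumes f: "poly_time_on Dom f" and E: "computable d D E" and dom: "\<And>s. D s \<Longrightarrow> E s \<in> Dom"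
  shows "computable d D (\<lambda>s. f (E s))"
proof (rule computableI)
  fix e assume "d \<le> e"
  obtain M and p :: "nat poly" where wf: "tm_wf M" and out: "\<And>x. x \<in> Dom \<Longrightarrow> tm_outputs M x (poly p (length x)) (f x)"
    using f unfolding poly_time_on_def by blast
  obtain c1 B1 p1 where 1: "bounded_com B1 c1"
    "\<And>s. D s \<Longrightarrow> (\<forall>i\<ge>e. s i = []) \<Longrightarrow> sruns c1 s (poly p1 (store_size s e)) (s(e := E s))"
    "\<And>s. D s \<Longrightarrow> (\<forall>i\<ge>e. s i = []) \<Longrightarrow> length (E s) \<le> poly p1 (store_size s e)"
    using computableE[OF E \<open>d \<le> e\<close>] by metis
  \<comment> \<open>Register \<open>r\<close> lives on tape \<open>r + 2\<close>. The call starts at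
    tape \<open>e + 2\<close> and leaves its result on tape \<open>e + 2 + tm_tapes M + 3\<close>,
    which is register \<open>u\<close>.\<close>
  define u where "u = e + tm_tapes M + 3"
  define c where "c = Seq c1 (Seq (call_com M (e + 2)) (Seq (move u (e + 1)) (move (e + 1) e)))"
  define L where "L m = 100 * (poly p1 m + poly p (poly p1 m)) + 100" for m
  define P where "P m = poly p1 m + L m * 20 + 100" for m
  have K: "1 \<le> tm_tapes M" using wf by (simp add: tm_wf_def)
  have "bounded_com (B1 + u + 10 + tm_states M + tm_symbols M) c"
    unfolding c_def using bounded_com_mono[OF 1(1)] bounded_call_com[OF wf, of "e + 2"]
    by (auto intro!: bounded_move_clear simp: u_def)
  moreover have "sruns c s (P (store_size s e)) (s(e := f (E s)))" if D: "D s" and em: "\<forall>j\<ge>e. s j = []" for s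
  proof -
    define m where "m = store_size s e"
    define x where "x = E s"
    have lx: "length x \<le> poly p1 m" using 1(3)[OF D em] by (simp add: x_def m_def)
    have r1: "sruns c1 s (poly p1 m) (s(e := x))" using 1(2)[OF D em] by (simp add: x_def m_def)
    have r2: "sruns (call_com M (e + 2)) (s(e := x)) (L m) (s(u := f x))"
      unfolding sruns_def
    proof (intro allI impI)
      fix \<tau> assume h: "holds \<tau> (s(e := x))"
      have st: "stack_tape (\<tau> (r + 2)) ((s(e := x)) r)" for r using h by (simp add: holds_def)
      have "stack_tape (\<tau> (e + 2)) x" using st[of e] by simp
      moreover have "stack_tape (\<tau> i) []" if "e + 2 < i" for i
      proof -
        have "i - 2 + 2 = i" "i - 2 \<noteq> e" "e \<le> i - 2" using that by auto
        then show ?thesis using st[of "i - 2"] em by (simp del: add_2_eq_Suc')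
      qed
      moreover have "tm_outputs M x (poly p (length x)) (f x)" using out dom[OF D] by (simp add: x_def)
      ultimately obtain t' \<tau>' where t: "t' \<le> 100 * (length x + poly p (length x)) + 100"
        "runs (call_com M (e + 2)) \<tau> t' \<tau>'" "\<forall>i<e + 2. \<tau>' i = \<tau> i"
        "\<forall>i\<ge>e + 2. stack_tape (\<tau>' i) (if i = e + 2 + tm_tapes M + 3 then f x else [])"
        using runs_call_com[OF wf _ _ _ refl, of \<tau> "e + 2" x "poly p (length x)" "f x"] by blast
      have "t' \<le> L m" using t(1) lx poly_nat_mono[OF lx, of p] by (simp add: L_def)
      moreover have "holds \<tau>' (s(u := f x))"
        unfolding holds_def
      proof
        fix r
        show "stack_tape (\<tau>' (r + 2)) ((s(u := f x)) r)"
        proof (cases "r < e")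
          case True
          then show ?thesis using t(3) st[of r] by (simp add: u_def)
        next
          case False
          then show ?thesis using t(4) em by (auto simp: u_def split: if_splits dest: spec[of _ "r + 2"])
        qed
      qed
      ultimately show "\<exists>t'\<le>L m. \<exists>\<tau>'. runs (call_com M (e + 2)) \<tau> t' \<tau>' \<and> holds \<tau>' (s(u := f x)) \<and> \<tau>' 0 = \<tau> 0 \<and> \<tau>' 1 = \<tau> 1"
        using t(2,3) by (intro exI[of _ t'] exI[of _ \<tau>'] conjI) auto
    qed
    have ue: "u > e + 1" using K by (simp add: u_def)
    have ly: "length (f x) \<le> L m" using sruns_length[OF r2, of u] em ue by simp
    have r3: "sruns (move u (e + 1)) (s(u := f x)) (L m * 8 + 1) (s(e + 1 := rev (f x)))"
      using ly em ue by (intro sruns_weaken[OF sruns_move]) (auto simp: fun_eq_iff)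
    have r4: "sruns (move (e + 1) e) (s(e + 1 := rev (f x))) (L m * 8 + 1) (s(e := f x))"
      using ly em by (intro sruns_weaken[OF sruns_move]) (auto simp: fun_eq_iff)
    show ?thesis
      using sruns_Seq[OF r1 sruns_Seq[OF r2 sruns_Seq[OF r3 r4]]]
      unfolding c_def by (rule sruns_weaken) (auto simp: P_def m_def x_def)
  qed
  moreover have "poly_bounded P" unfolding P_def L_def by (intro poly_bounded_intros)
  ultimately show "\<exists>c B T. bounded_com B c \<and> poly_bounded T \<and>
        (\<forall>s. D s \<and> (\<forall>j\<ge>e. s j = []) \<longrightarrow> sruns c s (T (store_size s e)) (s(e := f (E s))))"
    by (intro exI[of _ c] exI[of _ "B1 + u + 10 + tm_states M + tm_symbols M"] exI[of _ P]) auto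
qed (use computableD[OF E] in auto)

lemma poly_time_on_computable:
  assumes F: "computable 1 (\<lambda>s. s 0 \<in> Dom) (\<lambda>s. F (s 0))"
  shows "poly_time_on Dom F"
proof -
  obtain c1 B1 p1 where 1: "bounded_com B1 c1"
    "\<And>s. s 0 \<in> Dom \<Longrightarrow> (\<forall>i\<ge>1. s i = []) \<Longrightarrow> sruns c1 s (poly p1 (store_size s 1)) (s(1 := F (s 0)))"
    "\<And>s. s 0 \<in> Dom \<Longrightarrow> (\<forall>i\<ge>1. s i = []) \<Longrightarrow> length (F (s 0)) \<le> poly p1 (store_size s 1)"
    using computableE[OF F order_refl] by metis
  \<comment> \<open>The input is moved from tape 0 to register 0, on tape 2, and erased behind the
    head, since the output must be followed by a blank. The mark on tape 1, whose head moves along,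
    shows the way back to cell 0, where the output has to start.\<close>
  define c where "c = Seq (Act (set_act 1 1)) (Seq (copy 0 2 True {1}) (Seq (Loop (\<lambda>ss. ss 1 \<noteq> 1) (Act (drive_act 1 (-1) False {0} False (-1))))
    (Seq (rewind 2 {} False 0) (Seq c1 (copy 3 0 False {})))))"
  have b: "bounded_com (B1 + 4) c"
    unfolding c_def bounded_com.simps(3,5) using bounded_com_mono[OF 1(1)]
    by (intro conjI bounded_copy bounded_rewind bounded_drive bounded_set_act) auto
  have "poly_bounded (\<lambda>n. n * 9 + poly p1 n * 4 + 100)" by (intro poly_bounded_intros)
  then obtain p :: "nat poly" where p: "\<And>n. n * 9 + poly p1 n * 4 + 100 \<le> poly p n"
    unfolding poly_bounded_def by blast
  show ?thesis
  proof (rule poly_time_on_com[OF b])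
    fix x assume x: "x \<in> Dom"
    define s where "s = (\<lambda>i :: nat. if i = 0 then x else [])"
    define y where "y = F x"
    have wt0: "word_tape z p = 0 \<longleftrightarrow> \<not> (0 \<le> p \<and> p < int (length z))" for z p by (auto simp: word_tape_def)
    define \<tau>0 where "\<tau>0 = input_tapes x"
    define mk where "mk = (\<lambda>p :: int. if p = 0 then 1 else 0 :: nat)"
    define \<tau>1 where "\<tau>1 = \<tau>0(1 := (mk, 0))"
    have r1: "runs (Act (set_act 1 1)) \<tau>0 1 \<tau>1"
      by (rule runs_eq[OF runs_set]) (auto simp: \<tau>1_def \<tau>0_def mk_def input_tapes_def fun_eq_iff)
    define \<tau>2 where "\<tau>2 = copied 0 2 True {1} x \<tau>1"
    have r2: "runs (copy 0 2 True {1}) \<tau>1 (length x * 3 + 1) \<tau>2"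
      unfolding \<tau>2_def by (rule runs_copy) (auto simp: \<tau>1_def \<tau>0_def input_tapes_def)
    have t2: "\<tau>2 0 = ((\<lambda>_. 0), int (length x))" "\<tau>2 1 = (mk, int (length x))"
        "\<tau>2 2 = (word_tape x, int (length x))" "\<And>i. 3 \<le> i \<Longrightarrow> \<tau>2 i = ((\<lambda>_. 0), 0)"
      by (auto simp: \<tau>2_def copied_def driven_def \<tau>1_def \<tau>0_def input_tapes_def wipe_def fun_eq_iff word_tape_def)
    define \<tau>3 where "\<tau>3 = driven 1 (-1) False {0} False (-1) (length x) \<tau>2"
    have r3: "runs (Loop (\<lambda>ss. ss 1 \<noteq> 1) (Act (drive_act 1 (-1) False {0} False (-1)))) \<tau>2 (length x * 3 + 1) \<tau>3"
      unfolding \<tau>3_def by (rule runs_seek[where h = 0]) (auto simp: t2[unfolded One_nat_def] t2 mk_def)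
    define \<tau>4 where "\<tau>4 = driven 2 (-1) False {} False 0 (length x) \<tau>3"
    have t3: "\<tau>3 0 = ((\<lambda>_. 0), 0)" "\<tau>3 1 = (mk, 0)" "\<And>i. 2 \<le> i \<Longrightarrow> \<tau>3 i = \<tau>2 i"
      by (auto simp: \<tau>3_def driven_def t2[unfolded One_nat_def] t2)
    have r4: "runs (rewind 2 {} False 0) \<tau>3 (length x * 3 + 5) \<tau>4"
      unfolding \<tau>4_def by (rule runs_rewind) (auto simp: t3 t2 wt0)
    have t4: "\<tau>4 0 = ((\<lambda>_. 0), 0)" "\<tau>4 2 = (word_tape x, 0)" "\<And>i. 3 \<le> i \<Longrightarrow> \<tau>4 i = ((\<lambda>_. 0), 0)"
      by (auto simp: \<tau>4_def driven_def t3 t2)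
    have "holds \<tau>4 s"
      unfolding holds_def
    proof
      fix r
      show "stack_tape (\<tau>4 (r + 2)) (s r)"
      proof (cases "r = 0")
        case True
        then have "r + 2 = 2" by simp
        with True show ?thesis using t4(2) by (simp only:) (simp add: s_def stack_tape_def)
      next
        case False
        then show ?thesis using t4(3)[of "r + 2"] by (simp add: s_def stack_tape_def)
      qed
    qed
    moreover have "sruns c1 s (poly p1 (length x)) (s(1 := y))"
      using 1(2)[of s] x by (auto simp: s_def store_size_def y_def)
    ultimately obtain t \<tau>5 where t5: "t \<le> poly p1 (length x)" "runs c1 \<tau>4 t \<tau>5" "holds \<tau>5 (s(1 := y))" "\<tau>5 0 = \<tau>4 0"
      unfolding sruns_def by blast
    have ly: "length y \<le> poly p1 (length x)"
      using 1(3)[of s] x by (auto simp: s_def store_size_def y_def)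
    have "stack_tape (\<tau>5 (1 + 2)) y" using t5(3) unfolding holds_def by (metis fun_upd_same)
    then have y3: "fst (\<tau>5 3) p = word_tape y (p - snd (\<tau>5 3))" for p by (simp add: stack_tape_def eval_nat_numeral)
    define \<tau>6 where "\<tau>6 = copied 3 0 False {} y \<tau>5"
    have r6: "runs (copy 3 0 False {}) \<tau>5 (length y * 3 + 1) \<tau>6"
      unfolding \<tau>6_def by (rule runs_copy) (auto simp: y3)
    have "fst (\<tau>6 0) (int i) = word_tape y (int i)" if "i \<le> length y" for i
      using that by (auto simp: \<tau>6_def copied_def t5(4) t4(1) word_tape_def)
    moreover have "runs c \<tau>0 (1 + 1 + (length x * 3 + 1 + 1 + (length x * 3 + 1 + 1 + (length x * 3 + 5 + 1 + (t + 1 + (length y * 3 + 1)))))) \<tau>6"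
      unfolding c_def by (rule runs_Seq[OF r1 runs_Seq[OF r2 runs_Seq[OF r3 runs_Seq[OF r4 runs_Seq[OF t5(2) r6]]]]])
    moreover have "1 + 1 + (length x * 3 + 1 + 1 + (length x * 3 + 1 + 1 + (length x * 3 + 5 + 1 + (t + 1 + (length y * 3 + 1))))) \<le> poly p (length x)"
      using t5(1) ly p[of "length x"] by simp
    ultimately show "\<exists>t \<tau>. runs c (input_tapes x) t \<tau> \<and> t \<le> poly p (length x) \<and>
       (\<forall>i\<le>length (F x). fst (\<tau> 0) (int i) = word_tape (F x) (int i))"
      unfolding \<tau>0_def y_def by blast
  qed
qed

lemma poly_time_on_comp:
  assumes "poly_time_on D f" "poly_time_on D' g" "f ` D \<subseteq> D'"
  shows "poly_time_on D (\<lambda>x. g (f x))"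
proof (rule poly_time_on_computable)
  have "computable 1 (\<lambda>s. s 0 \<in> D) (\<lambda>s. f (s 0))"
    by (rule computable_call[OF assms(1) computable_var]) auto
  then show "computable 1 (\<lambda>s. s 0 \<in> D) (\<lambda>s. g (f (s 0)))"
    using assms(3) by (intro computable_call[OF assms(2)]) auto
qed

section \<open>Scanning the encodings\<close>

lemma floorlog_2_less: "n < 2 ^ floorlog 2 n"
  using floorlog_bounds[of n 2] by (cases "n = 0") auto

lemma floorlog_2_eq:
  assumes "2 ^ k \<le> n" "n < 2 ^ Suc k"
  shows "floorlog 2 n = Suc k"
proof -
  have "0 < n" using assms(1) by (metis gr_zeroI le_zero_eq power_not_zero zero_neq_numeral)
  then have *: "2 ^ (floorlog 2 n - 1) \<le> n" "n < 2 ^ floorlog 2 n" using floorlog_bounds[of n 2] by auto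
  have "(2 :: nat) ^ k < 2 ^ floorlog 2 n" "(2 :: nat) ^ (floorlog 2 n - 1) < 2 ^ Suc k" using assms * by linarith+
  then have "k < floorlog 2 n" "floorlog 2 n - 1 < Suc k" by (auto simp del: power_Suc)
  then show ?thesis by linarith
qed

lemma enc_bits_prefix: "enc_bits x @ s = enc_bits y @ t \<Longrightarrow> x = y \<and> s = t"
proof (induction x arbitrary: y)
  case Nil
  then show ?case by (cases y) auto
next
  case (Cons b x)
  then show ?case by (cases y) auto
qed

lemma enc_nat_prefix: "enc_nat a @ s = enc_nat b @ t \<Longrightarrow> a = b \<and> s = t"
proof -
  assume "enc_nat a @ s = enc_nat b @ t"
  then have *: "map (bit a) [0..<floorlog 2 a] = map (bit b) [0..<floorlog 2 b]" "s = t"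
    unfolding enc_nat_def using enc_bits_prefix by blast+
  then have "take_bit (floorlog 2 a) a = take_bit (floorlog 2 b) b"
    by (metis horner_sum_bit_eq_take_bit)
  then show ?thesis using * by (simp add: take_bit_nat_eq_self floorlog_2_less)
qed

lemma enc_list_simps [simp]:
  "enc_list f [] = [False]" "enc_list f (x # xs) = True # f x @ enc_list f xs"
  by (auto simp: enc_list_def)

lemma enc_list_prefix:
  assumes "\<And>x y s t. x \<in> X \<Longrightarrow> y \<in> X \<Longrightarrow> f x @ s = f y @ t \<Longrightarrow> x = y \<and> s = t" "set xs \<subseteq> X" "set ys \<subseteq> X"
  shows "enc_list f xs @ s = enc_list f ys @ t \<Longrightarrow> xs = ys \<and> s = t"
  using assms(2,3)
proof (induction xs arbitrary: ys)
  case Nil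
  then show ?case by (cases ys) auto
next
  case (Cons x xs)
  then obtain y ys' where ys: "ys = y # ys'" by (cases ys) auto
  then have "f x @ (enc_list f xs @ s) = f y @ (enc_list f ys' @ t)" using Cons.prems(1) by simp
  moreover have "x \<in> X" "y \<in> X" "set xs \<subseteq> X" "set ys' \<subseteq> X" using Cons.prems ys by auto
  ultimately have "x = y \<and> enc_list f xs @ s = enc_list f ys' @ t" by (intro assms(1))
  moreover from this have "xs = ys' \<and> s = t" using \<open>set xs \<subseteq> X\<close> \<open>set ys' \<subseteq> X\<close> by (intro Cons.IH) auto
  ultimately show ?case using ys by simp
qed

lemma enc_nat_list_inj: "enc_list enc_nat xs = enc_list enc_nat ys \<Longrightarrow> xs = ys"
  using enc_list_prefix[of UNIV enc_nat xs ys "[]" "[]", OF enc_nat_prefix] by simp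

lemma pack_inj: "pack xs = pack ys \<Longrightarrow> xs = ys"
proof (induction xs arbitrary: ys)
  case Nil
  then show ?case by (cases ys) (auto simp: enc_bits_def enc_list_def)
next
  case (Cons x xs)
  then show ?case
  proof (cases ys)
    case Nil
    with Cons show ?thesis by (auto simp: enc_bits_def enc_list_def)
  next
    case (Cons y ys')
    then show ?thesis using Cons.prems Cons.IH enc_bits_prefix[of x "pack xs" y "pack ys'"] by auto
  qed
qed

section \<open>Automata for the codes of unique games and of arc lists\<close>

definition quote :: "bool list \<Rightarrow> bool list" where
  "quote x = concat (map (\<lambda>b. [True, b]) x)"

lemma quote_simps [simp]: "quote [] = []" "quote (b # x) = True # b # quote x" "quote (x @ y) = quote x @ quote y"
  by (auto simp: quote_def)

lemma enc_bits_quote: "enc_bits x = quote x @ [False]"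
  by (induction x) auto

definition automaton :: "nat list \<Rightarrow> nat list \<Rightarrow> (nat \<Rightarrow> bool \<Rightarrow> bool list) \<Rightarrow> nat \<Rightarrow> bool \<Rightarrow> nat \<times> bool list" where
  "automaton tt ff em q b = ((if b then tt else ff) ! q, em q b)"

lemma automaton_bounded:
  assumes "\<forall>x\<in>set tt \<union> set ff. x < n" "length tt = n" "length ff = n" "q < n"
  shows "fst (automaton tt ff em q b) < n"
  using assms by (auto simp: automaton_def)

text \<open>In a code written by \<open>enc_bits\<close> flags and bits alternate: state
  \<open>qf\<close> expects a flag, state \<open>qb\<close> a bit, and the flag False leads on to
  \<open>q'\<close>. That last flag is split off because some automata emit an end mark
  there.\<close>

lemma automaton_enc_bits:
  assumes "tt ! qf = qb" "tt ! qb = qf" "ff ! qb = qf" "ff ! qf = q'"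
  shows "transduce_state (automaton tt ff em) qf (enc_bits x) = q'"
    and "(\<And>b. em qb b = h b) \<Longrightarrow> em qf True = h True \<Longrightarrow>
       transduce (automaton tt ff em) qf (enc_bits x) = concat (map h (butlast (enc_bits x))) @ em qf False"
proof -
  show "transduce_state (automaton tt ff em) qf (enc_bits x) = q'"
    using assms by (induction x) (auto simp: automaton_def)
  show "(\<And>b. em qb b = h b) \<Longrightarrow> em qf True = h True \<Longrightarrow>
       transduce (automaton tt ff em) qf (enc_bits x) = concat (map h (butlast (enc_bits x))) @ em qf False"
    using assms by (induction x) (auto simp: automaton_def enc_bits_quote butlast_append)
qed

lemma concat_map_enc_bits: "concat (map h (enc_bits x)) = concat (map h (butlast (enc_bits x))) @ h False"
proof -
  have "enc_bits x = butlast (enc_bits x) @ [False]" by (simp add: enc_bits_quote)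
  from arg_cong[OF this, of "\<lambda>x. concat (map h x)"] show ?thesis by simp
qed

lemma automaton_enc_bits_uniform:
  assumes "tt ! qf = qb" "tt ! qb = qf" "ff ! qb = qf" "ff ! qf = q'" "\<And>b. em qb b = h b" "\<And>b. em qf b = h b"
  shows "transduce (automaton tt ff em) qf (enc_bits x @ y) = concat (map h (enc_bits x)) @ transduce (automaton tt ff em) q' y"
    "transduce_state (automaton tt ff em) qf (enc_bits x @ y) = transduce_state (automaton tt ff em) q' y"
  using automaton_enc_bits(1)[of tt qf qb ff q' em x] automaton_enc_bits(2)[of tt qf qb ff q' em h x] assms
  by (simp_all add: transduce_append transduce_state_append concat_map_enc_bits)

text \<open>States 0 and 1 skip the left size, 2 and 3 the right size; 4 reads the list flag before
  a constraint, 5 and 6 read \<open>u\<close>, 7 and 8 read \<open>v\<close>, 9 reads the list flag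
  before an entry of the permutation, 10 and 11 the entry; 12 is a sink. In each pair the first
  state expects a flag and the second a bit.\<close>

definition ug_tt :: "nat list" where "ug_tt = [1, 0, 3, 2, 5, 6, 5, 8, 7, 10, 11, 10, 12]"
definition ug_ff :: "nat list" where "ug_ff = [2, 0, 4, 2, 12, 7, 5, 9, 7, 4, 9, 10, 12]"

definition constraint_code :: "nat \<Rightarrow> nat \<times> nat \<times> (nat \<Rightarrow> nat) \<Rightarrow> bool list" where
  "constraint_code R = (\<lambda>(u, v, \<pi>). enc_nat u @ enc_nat v @ enc_list enc_nat (map \<pi> [0..<R]))"

lemma enc_ug_eq: "enc_ug R U = enc_nat (ug_left U) @ enc_nat (ug_right U) @ enc_list (constraint_code R) (ug_constraints U)"
  by (simp add: enc_ug_def constraint_code_def)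

lemma ug_perm_run:
  assumes "\<And>b. em 10 b = h b" "\<And>b. em 11 b = h b" "em 9 True = h True"
  shows "transduce (automaton ug_tt ug_ff em) 9 (enc_list enc_nat xs @ y) =
      concat (map h (butlast (enc_list enc_nat xs))) @ em 9 False @ transduce (automaton ug_tt ug_ff em) 4 y"
proof (induction xs)
  case Nil
  then show ?case by (simp add: automaton_def ug_ff_def)
next
  case (Cons x xs)
  have "transduce (automaton ug_tt ug_ff em) 9 (enc_list enc_nat (x # xs) @ y) =
      h True @ transduce (automaton ug_tt ug_ff em) 10 (enc_nat x @ enc_list enc_nat xs @ y)"
    using assms(3) by (simp add: automaton_def ug_tt_def)
  also have "\<dots> = h True @ concat (map h (enc_nat x)) @ transduce (automaton ug_tt ug_ff em) 9 (enc_list enc_nat xs @ y)"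
    unfolding enc_nat_def
    by (subst automaton_enc_bits_uniform(1)[where qb = 11 and q' = 9 and h = h]) (use assms in \<open>auto simp: ug_tt_def ug_ff_def\<close>)
  finally show ?case unfolding Cons by (simp add: butlast_append enc_list_def)
qed

lemma ug_constraint_run:
  assumes "\<And>b. em 5 b = hu b" "\<And>b. em 6 b = hu b" "\<And>b. em 7 b = hv b" "\<And>b. em 8 b = hv b"
    "\<And>b. em 10 b = hp b" "\<And>b. em 11 b = hp b" "em 9 True = hp True"
  shows "transduce (automaton ug_tt ug_ff em) 5 (constraint_code R (u, v, \<pi>) @ y) =
      concat (map hu (enc_nat u)) @ concat (map hv (enc_nat v)) @
      concat (map hp (butlast (enc_list enc_nat (map \<pi> [0..<R])))) @ em 9 False @ transduce (automaton ug_tt ug_ff em) 4 y"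
proof -
  have 1: "transduce (automaton ug_tt ug_ff em) 5 (enc_nat u @ z) = concat (map hu (enc_nat u)) @ transduce (automaton ug_tt ug_ff em) 7 z" for z
    unfolding enc_nat_def
    by (subst automaton_enc_bits_uniform(1)[where qb = 6 and q' = 7 and h = hu]) (use assms in \<open>auto simp: ug_tt_def ug_ff_def\<close>)
  have 2: "transduce (automaton ug_tt ug_ff em) 7 (enc_nat v @ z) = concat (map hv (enc_nat v)) @ transduce (automaton ug_tt ug_ff em) 9 z" for z
    unfolding enc_nat_def
    by (subst automaton_enc_bits_uniform(1)[where qb = 8 and q' = 9 and h = hv]) (use assms in \<open>auto simp: ug_tt_def ug_ff_def\<close>)
  show ?thesis using assms by (simp add: constraint_code_def 1 2 ug_perm_run)
qed

text \<open>The last bit of a constraint code is the False read in state 9; after this bit is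
  quoted, the mark that closes the item is added.\<close>

definition em_items :: "nat \<Rightarrow> bool \<Rightarrow> bool list" where
  "em_items q b = (if q < 5 \<or> q = 12 then [] else if q = 9 \<and> \<not> b then [True, False, False] else [True, b])"

definition em_range :: "nat \<Rightarrow> nat \<Rightarrow> nat \<Rightarrow> bool \<Rightarrow> bool list" where
  "em_range i j q b = (if i \<le> q \<and> q \<le> j then [b] else [])"

lemma butlast_enc_list: "enc_list f xs = butlast (enc_list f xs) @ [False]"
  by (simp add: enc_list_def)

lemma concat_map_singleton: "concat (map (\<lambda>b. [b]) x) = x"
  by (induction x) auto

lemma concat_map_Nil: "concat (map (\<lambda>b. []) x) = []"
  by (induction x) auto

lemma ug_items: "transduce (automaton ug_tt ug_ff em_items) 0 (enc_ug R U) = pack (map (constraint_code R) (ug_constraints U))"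
proof -
  let ?t = "transduce (automaton ug_tt ug_ff em_items)"
  have 1: "?t 0 (enc_nat u @ z) = ?t 2 z" for u z
    unfolding enc_nat_def
    by (subst automaton_enc_bits_uniform(1)[where qb = 1 and q' = 2 and h = "\<lambda>_. []"]) (auto simp: ug_tt_def ug_ff_def em_items_def concat_map_Nil)
  have 2: "?t 2 (enc_nat u @ z) = ?t 4 z" for u z
    unfolding enc_nat_def
    by (subst automaton_enc_bits_uniform(1)[where qb = 3 and q' = 4 and h = "\<lambda>_. []"]) (auto simp: ug_tt_def ug_ff_def em_items_def concat_map_Nil)
  have 3: "?t 5 (constraint_code R c @ z) = enc_bits (constraint_code R c) @ ?t 4 z" for c z
  proof -
    obtain u v \<pi> where c: "c = (u, v, \<pi>)" by (cases c) auto
    have "quote (enc_list enc_nat (map \<pi> [0..<R])) = quote (butlast (enc_list enc_nat (map \<pi> [0..<R]))) @ [True, False]"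
      using arg_cong[OF butlast_enc_list, of quote enc_nat "map \<pi> [0..<R]"] by simp
    then show ?thesis
      unfolding c by (subst ug_constraint_run[where hu = "\<lambda>b. [True, b]" and hv = "\<lambda>b. [True, b]" and hp = "\<lambda>b. [True, b]"])
        (auto simp: em_items_def enc_bits_quote constraint_code_def quote_def[symmetric])
  qed
  have 4: "?t 4 (enc_list (constraint_code R) cs) = pack (map (constraint_code R) cs)" for cs
  proof (induction cs)
    case (Cons c cs)
    then show ?case by (simp add: automaton_def[of _ _ _ 4] ug_tt_def[THEN arg_cong, of "\<lambda>t. t ! 4"] em_items_def[of 4] 3)
  qed (simp add: automaton_def em_items_def)
  show ?thesis by (simp add: enc_ug_eq 1 2 4)
qed

lemma constraint_code_parts:
  "transduce (automaton ug_tt ug_ff (em_range 5 6)) 5 (constraint_code R (u, v, \<pi>)) = enc_nat u"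
  "transduce (automaton ug_tt ug_ff (em_range 7 8)) 5 (constraint_code R (u, v, \<pi>)) = enc_nat v"
  "transduce (automaton ug_tt ug_ff (em_range 9 11)) 5 (constraint_code R (u, v, \<pi>)) = enc_list enc_nat (map \<pi> [0..<R])"
proof -
  show "transduce (automaton ug_tt ug_ff (em_range 5 6)) 5 (constraint_code R (u, v, \<pi>)) = enc_nat u"
    using ug_constraint_run[of "em_range 5 6" "\<lambda>b. [b]" "\<lambda>_. []" "\<lambda>_. []" R u v \<pi> "[]"]
    by (simp add: em_range_def concat_map_singleton concat_map_Nil)
  show "transduce (automaton ug_tt ug_ff (em_range 7 8)) 5 (constraint_code R (u, v, \<pi>)) = enc_nat v"
    using ug_constraint_run[of "em_range 7 8" "\<lambda>_. []" "\<lambda>b. [b]" "\<lambda>_. []" R u v \<pi> "[]"]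
    by (simp add: em_range_def concat_map_singleton concat_map_Nil)
  show "transduce (automaton ug_tt ug_ff (em_range 9 11)) 5 (constraint_code R (u, v, \<pi>)) = enc_list enc_nat (map \<pi> [0..<R])"
    using ug_constraint_run[of "em_range 9 11" "\<lambda>_. []" "\<lambda>_. []" "\<lambda>b. [b]" R u v \<pi> "[]"] butlast_enc_list[of enc_nat "map \<pi> [0..<R]"]
    by (simp add: em_range_def concat_map_singleton concat_map_Nil)
qed

text \<open>State 0 reads the list flag, 1 and 2 read the tail and 3 and 4 the head of an arc; 5 is
  a sink. The flag False in state 3 is the last bit of an arc.\<close>

definition arc_tt :: "nat list" where "arc_tt = [1, 2, 1, 4, 3, 5]"
definition arc_ff :: "nat list" where "arc_ff = [5, 3, 1, 0, 3, 5]"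

definition em_arcs :: "nat \<Rightarrow> bool \<Rightarrow> bool list" where
  "em_arcs q b = (if q = 0 \<or> q = 5 then [] else if q = 3 \<and> \<not> b then [True, False, False] else [True, b])"

lemma arc_items: "transduce (automaton arc_tt arc_ff em_arcs) 0 (enc_list enc_arc es) = pack (map enc_arc es)"
proof (induction es)
  case Nil
  then show ?case by (simp add: automaton_def em_arcs_def)
next
  case (Cons e es)
  let ?t = "transduce (automaton arc_tt arc_ff em_arcs)"
  obtain u v where e: "e = (u, v)" by fastforce
  have 1: "?t 1 (enc_nat u @ z) = quote (enc_nat u) @ ?t 3 z" for z
    unfolding enc_nat_def quote_def
    by (subst automaton_enc_bits_uniform(1)[where qb = 2 and q' = 3 and h = "\<lambda>b. [True, b]"]) (auto simp: arc_tt_def arc_ff_def em_arcs_def)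
  have 2: "?t 3 (enc_nat v @ z) = quote (enc_nat v) @ False # ?t 0 z" for z
    unfolding enc_nat_def quote_def transduce_append concat_map_enc_bits
    using automaton_enc_bits(1)[of arc_tt 3 4 arc_ff 0 em_arcs] automaton_enc_bits(2)[of arc_tt 3 4 arc_ff 0 em_arcs "\<lambda>b. [True, b]"]
    by (simp add: arc_tt_def arc_ff_def em_arcs_def)
  have ea: "enc_arc e = enc_nat u @ enc_nat v" by (simp add: e enc_arc_def)
  have "?t 0 (enc_list enc_arc (e # es)) = ?t 1 (enc_nat u @ enc_nat v @ enc_list enc_arc es)"
    by (simp add: ea automaton_def[of _ _ _ 0] em_arcs_def[of 0]) (simp add: arc_tt_def)
  then show ?case
    by (simp only: 1 2 Cons list.map pack_simps ea enc_bits_quote quote_simps append_assoc append_Cons append_Nil)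
qed

text \<open>
  With this numbering the binary code of a vertex is that of \<open>c\<close>, padded to \<open>q\<close> bits, followed by a
  unary code of \<open>j\<close>, and programs can write it without arithmetic.
\<close>

definition vid :: "nat \<Rightarrow> nat \<Rightarrow> nat \<Rightarrow> nat" where
  "vid q j c = c + 2 ^ (q + j)"

definition unary :: "nat \<Rightarrow> bool list" where
  "unary j = concat (replicate j [True, False]) @ [True, True, False]"

definition index_bits :: "nat \<Rightarrow> nat \<Rightarrow> bool list" where
  "index_bits q c = quote (map (bit c) [0..<q])"

lemma enc_nat_vid:
  assumes "c < 2 ^ q"
  shows "enc_nat (vid q j c) = index_bits q c @ unary j"
proof -
  have qj: "(2 :: nat) ^ q \<le> 2 ^ (q + j)" by simp
  have fl: "floorlog 2 (vid q j c) = Suc (q + j)"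
    unfolding vid_def by (rule floorlog_2_eq) (use assms qj in \<open>simp_all add: less_le_trans\<close>)
  have div: "vid q j c div 2 ^ i = c div 2 ^ i + 2 ^ (q + j - i)" if "i \<le> q + j" for i
  proof -
    have "vid q j c = c + 2 ^ (q + j - i) * 2 ^ i" using that by (simp add: vid_def flip: power_add)
    then show ?thesis by simp
  qed
  have "bit (vid q j c) i \<longleftrightarrow> (if i < q then bit c i else i = q + j)" if "i \<le> q + j" for i
  proof (cases "i < q")
    case True
    then have "even ((2 :: nat) ^ (q + j - i))" by simp
    then show ?thesis using True div[OF that] by (simp add: bit_iff_odd)
  next
    case False
    then have "(2 :: nat) ^ q \<le> 2 ^ i" by simp
    then have "c < 2 ^ i" using assms less_le_trans by blast
    then have "c div 2 ^ i = 0" by simp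
    then show ?thesis using False div[OF that] that by (auto simp: bit_iff_odd)
  qed
  then have "map (bit (vid q j c)) [0..<Suc (q + j)] = map (bit c) [0..<q] @ replicate j False @ [True]"
    by (intro nth_equalityI) (auto simp: nth_append less_Suc_eq simp del: upt_Suc)
  then have "enc_nat (vid q j c) = enc_bits (map (bit c) [0..<q] @ replicate j False @ [True])"
    unfolding enc_nat_def fl by simp
  moreover have "quote (replicate j False) = concat (replicate j [True, False])" by (induction j) auto
  ultimately show ?thesis by (simp add: enc_bits_quote index_bits_def unary_def)
qed

lemma vid_less: "c < 2 ^ q \<Longrightarrow> j < j' \<Longrightarrow> vid q j c < vid q j' c'"
proof -
  assume a: "c < 2 ^ q" "j < j'"
  have "(2 :: nat) ^ q \<le> 2 ^ (q + j)" by simp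
  then have "vid q j c < 2 ^ Suc (q + j)" using a by (simp add: vid_def less_le_trans)
  also have "\<dots> \<le> 2 ^ (q + j')" using a by (intro power_increasing) auto
  finally show ?thesis by (simp add: vid_def)
qed

lemma vid_inj: "c < 2 ^ q \<Longrightarrow> c' < 2 ^ q \<Longrightarrow> vid q j c = vid q j' c' \<longleftrightarrow> j = j' \<and> c = c'"
  using vid_less[of c q j j' c'] vid_less[of c' q j' j c] by (cases j j' rule: linorder_cases) (auto simp: vid_def)

lemma enc_nat_power: "enc_nat (2 ^ t) = unary t"
  using enc_nat_vid[of 0 0 t] by (simp add: vid_def index_bits_def)

lemma enc_rat_of_nat: "enc_rat (inv real_of_rat (real n)) = enc_nat n @ [True, True, False]"
proof -
  have "inj real_of_rat" by (rule injI) simp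
  then have "inv real_of_rat (real n) = of_nat n" using inv_f_f[of real_of_rat "of_nat n"] by simp
  moreover have "quotient_of (of_nat n) = (int n, 1)" using quotient_of_int[of "int n"] by (simp add: of_int_of_nat_eq)
  moreover have "enc_nat 1 = [True, True, False]" using enc_nat_power[of 0] by (simp add: unary_def)
  ultimately show ?thesis by (simp add: enc_rat_def)
qed

section \<open>The reduction as a program\<close>

lemma computable_concat:
  assumes "\<And>e s x. d \<le> e \<Longrightarrow> D (s(e := x)) = D s" "\<And>c. c \<in> set cs \<Longrightarrow> computable d D (E c)"
  shows "computable d D (\<lambda>s. concat (map (\<lambda>c. E c s) cs))"
  using assms(2)
proof (induction cs)
  case Nil
  then show ?case using computable_const[OF assms(1)] by simp
next
  case (Cons c cs)
  then show ?case using computable_append[of d D "E c" "\<lambda>s. concat (map (\<lambda>c. E c s) cs)"] by simp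
qed

text \<open>With finitely many keys the case distinction is a chain of comparisons with constants,
  so the dependence of \<open>E\<close> on the key may be arbitrary. This is how the gadget, a fixed
  finite object, enters the program.\<close>

lemma computable_finite_case:
  assumes "\<And>e s x. d \<le> e \<Longrightarrow> D (s(e := x)) = D s" "computable d D K" "finite A"
    "\<And>k. k \<in> A \<Longrightarrow> computable d D (E k)"
  shows "computable d D (\<lambda>s. if K s \<in> A then E (K s) s else [])"
  using assms(3,4)
proof (induction A rule: finite_induct)
  case empty
  then show ?case using computable_const[OF assms(1)] by simp
next
  case (insert k A)
  have "computable d D (\<lambda>s. if K s = k then E k s else if K s \<in> A then E (K s) s else [])"
    using insert by (intro computable_if_eq assms(2) computable_const[OF assms(1)]) auto
  moreover have "(\<lambda>s. if K s = k then E k s else if K s \<in> A then E (K s) s else []) =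
      (\<lambda>s. if K s \<in> insert k A then E (K s) s else [])" by auto
  ultimately show ?case by simp
qed

lemma computable_automaton:
  assumes "computable d D E" "\<forall>x\<in>set tt \<union> set ff. x < n" "length tt = n" "length ff = n" "q < n"
  shows "computable d D (\<lambda>s. transduce (automaton tt ff em) q (E s))"
  using assms(1) automaton_bounded[OF assms(2-4)] assms(5) by (rule computable_transduce)

lemma ug_automaton: "\<forall>x\<in>set ug_tt \<union> set ug_ff. x < 13" "length ug_tt = 13" "length ug_ff = 13"
  by (auto simp: ug_tt_def ug_ff_def)

lemma arc_automaton: "\<forall>x\<in>set arc_tt \<union> set arc_ff. x < 6" "length arc_tt = 6" "length arc_ff = 6"
  by (auto simp: arc_tt_def arc_ff_def)

section \<open>Programs for the arcs between pairs of constraints\<close>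

definition left_code :: "bool list \<Rightarrow> bool list" where "left_code = transduce (automaton ug_tt ug_ff (em_range 5 6)) 5"
definition right_code :: "bool list \<Rightarrow> bool list" where "right_code = transduce (automaton ug_tt ug_ff (em_range 7 8)) 5"
definition perm_code :: "bool list \<Rightarrow> bool list" where "perm_code = transduce (automaton ug_tt ug_ff (em_range 9 11)) 5"

definition idx :: "bool list \<Rightarrow> bool list" where
  "idx i = transduce (\<lambda>_ _. (0, [True, False])) 0 i @ [True, True, False]"

lemma idx_replicate: "idx (replicate j True) = unary j"
proof -
  have "transduce (\<lambda>_ _. (0, [True, False])) 0 (replicate j True) = concat (replicate j [True, False])"
    by (induction j) auto
  then show ?thesis by (simp add: idx_def unary_def)
qed

text \<open>Indices and endpoints are compared as words, the former in unary as supplied by the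
  loops; no number is ever decoded.\<close>

definition key_code :: "bool list \<Rightarrow> bool list \<Rightarrow> bool list \<Rightarrow> bool list \<Rightarrow> bool list" where
  "key_code i y i' y' = (if i = i' then [True] else [False]) @ (if left_code y = left_code y' then [True] else [False]) @
     (if right_code y = right_code y' then [True] else [False]) @ perm_code y"

text \<open>
  \<open>W\<close> gives the weight of an arc between the gadget vertices \<open>c\<close> and \<open>c'\<close> of two constraints. It may
  depend on a key of the two constraints: whether they are the same, agree in \<open>u\<close> and agree in \<open>v\<close>,
  and the permutation of the first one. An infinite weight \<open>None\<close> is replaced by \<open>2 ^ (m + B)\<close>.
\<close>

locale reduction_table =
  fixes R M q B Thr :: nat and W :: "bool list \<Rightarrow> nat \<Rightarrow> nat \<Rightarrow> nat option" and ter_index :: "nat \<Rightarrow> nat"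
    and H :: "nat pair_pre_digraph"
  assumes M_le: "M \<le> 2 ^ q" and ter_index_less: "s \<in> pverts H \<Longrightarrow> ter_index s < M" and inj_ter_index: "inj_on ter_index (pverts H)"
    and finite_H: "finite (pverts H)" and Thr_le: "Thr \<le> 2 ^ B"
begin

definition ugs :: "bool list set" where
  "ugs = {enc_ug R U | U. ug_instance R U}"

definition constraint_codes :: "bool list \<Rightarrow> bool list list" where
  "constraint_codes X = (SOME ys. transduce (automaton ug_tt ug_ff em_items) 0 X = pack ys)"

lemma constraint_codes_enc_ug: "constraint_codes (enc_ug R U) = map (constraint_code R) (ug_constraints U)"
  unfolding constraint_codes_def ug_items by (rule some_equality[where P = "\<lambda>ys. _ = pack ys"]) (auto dest: pack_inj)

lemma pack_constraint_codes: "X \<in> ugs \<Longrightarrow> transduce (automaton ug_tt ug_ff em_items) 0 X = pack (constraint_codes X)"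
  by (auto simp: ugs_def constraint_codes_enc_ug ug_items)

definition keys :: "bool list set" where
  "keys = (\<lambda>(a, b, c, \<pi>). a # b # c # enc_list enc_nat (map \<pi> [0..<R])) ` (UNIV \<times> UNIV \<times> UNIV \<times> {\<pi>. \<pi> permutes {..<R}})"

lemma finite_keys: "finite keys"
  unfolding keys_def by (intro finite_imageI finite_cartesian_product finite_permutations) auto

text \<open>A weight that exceeds every relevant budget has to grow with the number of constraints.
  A power of two is taken because its binary code is a run of zeros and a final one, which one pass
  over the constraints can write. The trailing three bits are the denominator 1.\<close>

definition weight_code :: "bool list \<Rightarrow> bool list \<Rightarrow> nat \<Rightarrow> nat \<Rightarrow> bool list" where
  "weight_code X k c c' = (case W k c c' of
      None \<Rightarrow> concat (map (\<lambda>j. [True, False]) [0..<length (constraint_codes X)]) @ unary B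
    | Some x \<Rightarrow> enc_nat x) @ [True, True, False]"

definition arc_code :: "bool list \<Rightarrow> bool list \<Rightarrow> nat \<Rightarrow> nat \<Rightarrow> bool list" where
  "arc_code i i' c c' = index_bits q c @ idx i @ index_bits q c' @ idx i'"

definition arc_entry :: "bool list \<Rightarrow> bool list \<Rightarrow> bool list \<Rightarrow> bool list \<Rightarrow> bool list \<Rightarrow> nat \<Rightarrow> nat \<Rightarrow> bool list" where
  "arc_entry X i y i' y' c c' = [True] @ arc_code i i' c c' @
     (if key_code i y i' y' \<in> keys then weight_code X (key_code i y i' y') c c' else [])"

definition all_pairs :: "(bool list \<Rightarrow> bool list \<Rightarrow> bool list \<Rightarrow> bool list \<Rightarrow> bool list \<Rightarrow> nat \<Rightarrow> nat \<Rightarrow> bool list) \<Rightarrow> bool list \<Rightarrow> bool list" where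
  "all_pairs f X = concat (map (\<lambda>j. concat (map (\<lambda>c. concat (map (\<lambda>j'. concat (map (\<lambda>c'.
     f X (replicate j True) (constraint_codes X ! j) (replicate j' True) (constraint_codes X ! j') c c')
       [0..<M])) [0..<length (constraint_codes X)])) [0..<M])) [0..<length (constraint_codes X)])"

definition reduce :: "bool list \<Rightarrow> bool list" where
  "reduce X = concat (map (\<lambda>j. concat (map (\<lambda>c. [True] @ index_bits q c @ idx (replicate j True)) [0..<M])) [0..<length (constraint_codes X)]) @
     [False] @ all_pairs arc_entry X @ [False] @
     enc_list enc_nat (map (\<lambda>s. vid q 0 (ter_index s)) (sorted_list_of_set (pverts H)))"

definition valid_input :: "(nat \<Rightarrow> bool list) \<Rightarrow> bool" where
  "valid_input s \<longleftrightarrow> s 0 \<in> ugs"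

lemma valid_input_upd [simp]: "0 < e \<Longrightarrow> valid_input (s(e := x)) = valid_input s"
  by (simp add: valid_input_def)

lemma computable_input: "1 \<le> d \<Longrightarrow> computable d valid_input (\<lambda>s. s 0)"
  by (intro computable_var) auto

lemma computable_items: "1 \<le> d \<Longrightarrow> computable d valid_input (\<lambda>s. transduce (automaton ug_tt ug_ff em_items) 0 (s 0))"
  by (rule computable_automaton[OF computable_input ug_automaton]) auto

lemma computable_parts:
  assumes "1 \<le> d" "y < d"
  shows "computable d valid_input (\<lambda>s. left_code (s y))" "computable d valid_input (\<lambda>s. right_code (s y))" "computable d valid_input (\<lambda>s. perm_code (s y))"
    "computable d valid_input (\<lambda>s. idx (s y))"
proof -
  have v: "computable d valid_input (\<lambda>s. s y)" using assms by (intro computable_var) auto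
  show "computable d valid_input (\<lambda>s. left_code (s y))" "computable d valid_input (\<lambda>s. right_code (s y))" "computable d valid_input (\<lambda>s. perm_code (s y))"
    unfolding left_code_def right_code_def perm_code_def by (rule computable_automaton[OF v ug_automaton]; simp)+
  show "computable d valid_input (\<lambda>s. idx (s y))"
    unfolding idx_def using assms
    by (intro computable_append computable_transduce[where n = 1, OF v] computable_const) auto
qed

lemma computable_foreach_con:
  assumes "1 \<le> d" "\<And>a. d \<le> a \<Longrightarrow> computable (a + 2) valid_input (\<lambda>s. E s (s a) (s (a + 1)))"
    "\<And>e s i x y. d \<le> e \<Longrightarrow> E (s(e := x)) i y = E s i y"
  shows "computable d valid_input (\<lambda>s. concat (map (\<lambda>j. E s (replicate j True) (constraint_codes (s 0) ! j)) [0..<length (constraint_codes (s 0))]))"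
  by (rule computable_foreach[OF computable_items[OF assms(1)], where xs = "\<lambda>s. constraint_codes (s 0)" and E = E])
    (use assms in \<open>auto simp: valid_input_def pack_constraint_codes\<close>)

lemma computable_key_code:
  assumes "1 \<le> d" "i < d" "y < d" "i' < d" "y' < d"
  shows "computable d valid_input (\<lambda>s. key_code (s i) (s y) (s i') (s y'))"
  unfolding key_code_def using assms
  by (intro computable_append computable_if_eq computable_parts computable_const computable_var) auto

lemma computable_arc_code:
  assumes "1 \<le> d" "i < d" "i' < d"
  shows "computable d valid_input (\<lambda>s. arc_code (s i) (s i') c c')"
  unfolding arc_code_def using assms
  by (intro computable_append computable_parts computable_const) auto

lemma computable_all_pairs:
  assumes f: "\<And>d i y i' y' c c'. 1 \<le> d \<Longrightarrow> i < d \<Longrightarrow> y < d \<Longrightarrow> i' < d \<Longrightarrow> y' < d \<Longrightarrow>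
      computable d valid_input (\<lambda>s. f (s 0) (s i) (s y) (s i') (s y') c c')"
    and "1 \<le> d"
  shows "computable d valid_input (\<lambda>s. all_pairs f (s 0))"
proof -
  have inner: "computable d valid_input (\<lambda>s. concat (map (\<lambda>j'. concat (map (\<lambda>c'.
     f (s 0) (s i) (s y) (replicate j' True) (constraint_codes (s 0) ! j') c c') [0..<M])) [0..<length (constraint_codes (s 0))]))"
    if "1 \<le> d" "i < d" "y < d" for d i y c
  proof (rule computable_foreach_con[where E = "\<lambda>s i' y'. concat (map (\<lambda>c'. f (s 0) (s i) (s y) i' y' c c') [0..<M])"])
    fix a assume "d \<le> a"
    then show "computable (a + 2) valid_input (\<lambda>s. concat (map (\<lambda>c'. f (s 0) (s i) (s y) (s a) (s (a + 1)) c c') [0..<M]))"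
      using that by (intro computable_concat f) auto
  qed (use that in auto)
  show ?thesis
    unfolding all_pairs_def
  proof (rule computable_foreach_con[where E = "\<lambda>s i y. concat (map (\<lambda>c. concat (map (\<lambda>j'. concat (map (\<lambda>c'.
     f (s 0) i y (replicate j' True) (constraint_codes (s 0) ! j') c c') [0..<M])) [0..<length (constraint_codes (s 0))])) [0..<M])"])
    fix a assume "d \<le> a"
    then show "computable (a + 2) valid_input (\<lambda>s. concat (map (\<lambda>c. concat (map (\<lambda>j'. concat (map (\<lambda>c'.
     f (s 0) (s a) (s (a + 1)) (replicate j' True) (constraint_codes (s 0) ! j') c c') [0..<M])) [0..<length (constraint_codes (s 0))])) [0..<M]))"
      using assms(2) by (intro computable_concat inner) auto
  qed (use assms(2) in auto)
qed

lemma computable_foreach_con_const: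
  assumes "1 \<le> d"
  shows "computable d valid_input (\<lambda>s. concat (map (\<lambda>j. x) [0..<length (constraint_codes (s 0))]))"
  using assms by (intro computable_foreach_con[where E = "\<lambda>_ _ _. x"] computable_const) auto

lemma computable_weight_code:
  assumes "1 \<le> d"
  shows "computable d valid_input (\<lambda>s. weight_code (s 0) k c c')"
  unfolding weight_code_def using assms
  by (cases "W k c c'") (auto intro!: computable_append computable_const computable_foreach_con_const)

lemma computable_reduce: "computable 1 valid_input (\<lambda>s. reduce (s 0))"
proof -
  have 1: "computable 1 valid_input (\<lambda>s. concat (map (\<lambda>j. concat (map (\<lambda>c. [True] @ index_bits q c @ idx (replicate j True)) [0..<M])) [0..<length (constraint_codes (s 0))]))"
  proof (rule computable_foreach_con[where E = "\<lambda>s i y. concat (map (\<lambda>c. [True] @ index_bits q c @ idx i) [0..<M])"])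
    fix a :: nat assume "1 \<le> a"
    then show "computable (a + 2) valid_input (\<lambda>s. concat (map (\<lambda>c. [True] @ index_bits q c @ idx (s a)) [0..<M]))"
      by (intro computable_concat computable_append computable_parts computable_const) auto
  qed auto
  have 2: "computable 1 valid_input (\<lambda>s. all_pairs arc_entry (s 0))"
  proof (rule computable_all_pairs)
    fix d i y i' y' c c' :: nat assume d: "1 \<le> d" "i < d" "y < d" "i' < d" "y' < d"
    show "computable d valid_input (\<lambda>s. arc_entry (s 0) (s i) (s y) (s i') (s y') c c')"
      unfolding arc_entry_def using d finite_keys
      by (intro computable_append computable_const computable_arc_code
          computable_finite_case[where E = "\<lambda>k s. weight_code (s 0) k c c'"] computable_key_code computable_weight_code) auto
  qed simp
  show ?thesis unfolding reduce_def
    by (intro computable_append 1 2 computable_const) auto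
qed

end

section \<open>Deciding whether a cut is light\<close>

definition arcs_of :: "bool list \<Rightarrow> bool list list" where
  "arcs_of Z = (SOME zs. transduce (automaton arc_tt arc_ff em_arcs) 0 Z = pack zs)"

lemma arcs_of_enc: "arcs_of (enc_list enc_arc es) = map enc_arc es"
  unfolding arcs_of_def arc_items by (rule some_equality[where P = "\<lambda>zs. _ = pack zs"]) (auto dest: pack_inj)

lemma enc_nat_eq_iff: "enc_nat a = enc_nat b \<longleftrightarrow> a = b"
  using enc_nat_prefix[of a "[]" b "[]"] by auto

lemma enc_arc_eq_iff: "enc_arc e = enc_arc e' \<longleftrightarrow> e = e'"
proof
  assume "enc_arc e = enc_arc e'"
  then have *: "enc_nat (fst e) @ enc_nat (snd e) = enc_nat (fst e') @ enc_nat (snd e')" by (simp add: enc_arc_def split: prod.splits)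
  show "e = e'" using enc_nat_prefix[OF *] by (simp add: enc_nat_eq_iff prod_eq_iff)
qed simp

lemma concat_map_product:
  "concat (map f (List.product xs ys)) = concat (map (\<lambda>x. concat (map (\<lambda>y. f (x, y)) ys)) xs)"
  by (induction xs) (auto simp: comp_def)

lemma concat_map_concat_map:
  "concat (map f (concat (map g xs))) = concat (map (\<lambda>x. concat (map f (g x))) xs)"
  by (induction xs) auto

lemma concat_replicate_eq: "concat (map (\<lambda>j. replicate (f j) b) xs) = replicate (sum_list (map f xs)) b"
  by (induction xs) (auto simp: replicate_add)

lemma concat_map_cong: "(\<And>x. x \<in> set xs \<Longrightarrow> f x = g x) \<Longrightarrow> concat (map f xs) = concat (map g xs)"
  by (metis map_cong)

lemma sum_list_upt: "sum_list (map f [0..<n]) = (\<Sum>i<n. f i)"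
  by (simp add: sum_list_distinct_conv_sum_set atLeast0LessThan)

text \<open>Unary numbers are compared by search: \<open>t < N\<close> holds iff counting from 0 to
  \<open>N - 1\<close> meets \<open>t\<close>. A word of \<open>N\<close> bits False is at the same
  time a packed list of \<open>N\<close> empty items and so drives the loop.\<close>

lemma computable_decision:
  assumes L: "computable d D L" and L_eq: "\<And>s. D s \<Longrightarrow> L s = replicate (N s) False"
    and N: "\<And>e s x. d \<le> e \<Longrightarrow> N (s(e := x)) = N s" and T: "computable d D T"
  shows "computable d D (\<lambda>s. if concat (map (\<lambda>j. if replicate j True = T s then [True] else []) [0..<N s]) = [] then [False] else [True])"
proof -
  have D: "D (s(e := x)) = D s" if "d \<le> e" for e s x using computableD(2)[OF T that] .
  have c: "computable d D (\<lambda>s. x)" for x by (rule computable_const[OF D])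
  have "computable d D (\<lambda>s. concat (map (\<lambda>j. if replicate j True = T s then [True] else []) [0..<length (replicate (N s) ([] :: bool list))]))"
  proof (rule computable_foreach[OF L, where E = "\<lambda>s i y. if i = T s then [True] else []" and xs = "\<lambda>s. replicate (N s) []"])
    show "L s = pack (replicate (N s) [])" if "D s" for s
      using L_eq[OF that] concat_replicate_eq[of "\<lambda>_. 1" False "[0..<N s]"]
      by (simp add: pack_def enc_bits_def map_replicate_const[symmetric])
    show "computable (a + 2) D (\<lambda>s. if s a = T s then [True] else [])" if "d \<le> a" for a
      using that D computable_weaken[OF T, of "a + 2"]
      by (intro computable_if_eq computable_var computable_const) auto
    show "(if i = T (s(e := x)) then [True] else []) = (if i = T s then [True] else [])" if "d \<le> e" for e s i x
      using computableD(1)[OF T that] by simp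
  qed (simp add: N)
  then show ?thesis by (intro computable_if_eq c) simp
qed

lemma concat_if_eq_Nil: "concat (map (\<lambda>j. if P j then [True] else []) xs) = [] \<longleftrightarrow> (\<forall>j\<in>set xs. \<not> P j)"
  by (induction xs) auto

lemma decision_iff: "concat (map (\<lambda>j. if replicate j True = replicate t True then [True] else []) [0..<n]) = [] \<longleftrightarrow> \<not> t < n"
  by (auto simp: replicate_eq_replicate)

context reduction_table begin

text \<open>Costs are added up in unary, where the infinite weight would be exponentially long.
  Capping it at \<open>Thr\<close> times the number of constraints, the threshold of the decision,
  does not change the outcome of the comparison.\<close>

definition ucost :: "bool list \<Rightarrow> bool list \<Rightarrow> nat \<Rightarrow> nat \<Rightarrow> bool list" where
  "ucost X k c c' = (case W k c c' of
      None \<Rightarrow> concat (map (\<lambda>j. replicate Thr True) [0..<length (constraint_codes X)])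
    | Some x \<Rightarrow> replicate x True)"

definition mem :: "(bool list \<Rightarrow> bool list) \<Rightarrow> bool list \<Rightarrow> bool list \<Rightarrow> bool list" where
  "mem Y X z = concat (map (\<lambda>j. if arcs_of (Y X) ! j = z then [True] else []) [0..<length (arcs_of (Y X))])"

definition cost_entry :: "(bool list \<Rightarrow> bool list) \<Rightarrow> bool list \<Rightarrow> bool list \<Rightarrow> bool list \<Rightarrow> bool list \<Rightarrow> bool list \<Rightarrow> nat \<Rightarrow> nat \<Rightarrow> bool list" where
  "cost_entry Y X i y i' y' c c' = (if mem Y X (arc_code i i' c c') = [] then [] else
     if key_code i y i' y' \<in> keys then ucost X (key_code i y i' y') c c' else [])"

definition decide :: "(bool list \<Rightarrow> bool list) \<Rightarrow> bool list \<Rightarrow> bool list" where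
  "decide Y X = (if concat (map (\<lambda>j. if replicate j True = all_pairs (cost_entry Y) X then [True] else [])
     [0..<Thr * length (constraint_codes X)]) = [] then [False] else [True])"

lemma mem_eq_Nil: "Y X = enc_list enc_arc es \<Longrightarrow> mem Y X z = [] \<longleftrightarrow> z \<notin> enc_arc ` set es"
proof -
  assume Y: "Y X = enc_list enc_arc es"
  have "mem Y X z = [] \<longleftrightarrow> (\<forall>j<length (arcs_of (Y X)). arcs_of (Y X) ! j \<noteq> z)" unfolding mem_def concat_if_eq_Nil by auto
  also have "\<dots> \<longleftrightarrow> z \<notin> set (arcs_of (Y X))" by (auto simp: in_set_conv_nth)
  finally show ?thesis by (simp add: Y arcs_of_enc)
qed

lemma computable_mem:
  assumes Y: "computable 1 valid_input (\<lambda>s. Y (s 0))" and enc: "\<And>X. X \<in> ugs \<Longrightarrow> \<exists>es. Y X = enc_list enc_arc es"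
    and "1 \<le> d" and Z: "computable d valid_input Z"
  shows "computable d valid_input (\<lambda>s. mem Y (s 0) (Z s))"
  unfolding mem_def
proof (rule computable_foreach[where xs = "\<lambda>s. arcs_of (Y (s 0))" and E = "\<lambda>s i y. if y = Z s then [True] else []"])
  have "computable d valid_input (\<lambda>s. Y (s 0))" using computable_weaken[OF Y] assms(3) by simp
  then show "computable d valid_input (\<lambda>s. transduce (automaton arc_tt arc_ff em_arcs) 0 (Y (s 0)))"
    by (rule computable_automaton[OF _ arc_automaton]) simp
  show "transduce (automaton arc_tt arc_ff em_arcs) 0 (Y (s 0)) = pack (arcs_of (Y (s 0)))" if "valid_input s" for s
    using that enc[of "s 0"] by (auto simp: valid_input_def arcs_of_enc arc_items)
  show "computable (a + 2) valid_input (\<lambda>s. if s (a + 1) = Z s then [True] else [])" if "d \<le> a" for a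
    using that computable_weaken[OF Z, of "a + 2"]
    by (intro computable_if_eq computable_var computable_const) auto
  show "(if y = Z (s(e := x)) then [True] else []) = (if y = Z s then [True] else [])" if "d \<le> e" for e s x y
    using computableD(1)[OF Z that] by simp
qed (use assms(3) in auto)

lemma computable_ucost:
  assumes "1 \<le> d"
  shows "computable d valid_input (\<lambda>s. ucost (s 0) k c c')"
  unfolding ucost_def using assms
  by (cases "W k c c'") (auto intro!: computable_const computable_foreach_con_const)

lemma computable_decide:
  assumes Y: "computable 1 valid_input (\<lambda>s. Y (s 0))" and enc: "\<And>X. X \<in> ugs \<Longrightarrow> \<exists>es. Y X = enc_list enc_arc es"
  shows "computable 1 valid_input (\<lambda>s. decide Y (s 0))"
  unfolding decide_def
proof (rule computable_decision)
  show "computable 1 valid_input (\<lambda>s. concat (map (\<lambda>j. replicate Thr False) [0..<length (constraint_codes (s 0))]))"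
    by (rule computable_foreach_con_const) simp
  show "concat (map (\<lambda>j. replicate Thr False) [0..<length (constraint_codes (s 0))]) = replicate (Thr * length (constraint_codes (s 0))) False" for s
    by (simp add: concat_replicate_eq sum_list_triv mult.commute)
  show "computable 1 valid_input (\<lambda>s. all_pairs (cost_entry Y) (s 0))"
  proof (rule computable_all_pairs)
    fix d i y i' y' c c' :: nat assume d: "1 \<le> d" "i < d" "y < d" "i' < d" "y' < d"
    show "computable d valid_input (\<lambda>s. cost_entry Y (s 0) (s i) (s y) (s i') (s y') c c')"
      unfolding cost_entry_def using d finite_keys
      by (intro computable_if_eq computable_mem[OF Y enc] computable_const computable_arc_code
          computable_finite_case[where E = "\<lambda>k s. ucost (s 0) k c c'"] computable_key_code computable_ucost) auto
  qed simp
qed auto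

section \<open>The instance that the program writes\<close>

definition key :: "ug \<Rightarrow> nat \<Rightarrow> nat \<Rightarrow> bool list" where
  "key U j j' = (case (ug_constraints U ! j, ug_constraints U ! j') of ((u, v, \<pi>), (u', v', \<pi>')) \<Rightarrow>
     [j = j', u = u', v = v'] @ enc_list enc_nat (map \<pi> [0..<R]))"

lemma key_code_eq: "key_code (replicate j True) (constraint_code R (ug_constraints U ! j)) (replicate j' True) (constraint_code R (ug_constraints U ! j')) = key U j j'"
  by (cases "ug_constraints U ! j"; cases "ug_constraints U ! j'")
    (simp add: key_code_def key_def left_code_def right_code_def perm_code_def constraint_code_parts enc_nat_eq_iff replicate_eq_replicate)

lemma key_in_keys:
  assumes "ug_instance R U" "j < length (ug_constraints U)"
  shows "key U j j' \<in> keys"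
proof -
  obtain u v \<pi> where c: "ug_constraints U ! j = (u, v, \<pi>)" by (cases "ug_constraints U ! j") auto
  have "(u, v, \<pi>) \<in> set (ug_constraints U)" using nth_mem[OF assms(2)] c by simp
  then have \<pi>: "\<pi> permutes {..<R}" using assms(1) unfolding ug_instance_def by blast
  obtain u' v' \<pi>' where c': "ug_constraints U ! j' = (u', v', \<pi>')" by (cases "ug_constraints U ! j'") auto
  have "key U j j' = (\<lambda>(a, b, c, \<pi>). a # b # c # enc_list enc_nat (map \<pi> [0..<R])) (j = j', u = u', v = v', \<pi>)"
    by (simp add: key_def c c')
  moreover have "(j = j', u = u', v = v', \<pi>) \<in> UNIV \<times> UNIV \<times> UNIV \<times> {\<pi>. \<pi> permutes {..<R}}" using \<pi> by simp
  ultimately show ?thesis unfolding keys_def by (rule image_eqI)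
qed

definition arc_weight :: "ug \<Rightarrow> nat \<Rightarrow> nat \<Rightarrow> nat \<Rightarrow> nat \<Rightarrow> nat" where
  "arc_weight U j c j' c' = (case W (key U j j') c c' of None \<Rightarrow> 2 ^ (length (ug_constraints U) + B) | Some x \<Rightarrow> x)"

definition dec :: "nat \<Rightarrow> nat \<times> nat" where
  "dec = inv_into (UNIV \<times> {..<2 ^ q}) (\<lambda>(j, c). vid q j c)"

lemma dec_vid [simp]: "c < M \<Longrightarrow> dec (vid q j c) = (j, c)"
proof -
  assume "c < M"
  moreover have "inj_on (\<lambda>(j, c). vid q j c) (UNIV \<times> {..<2 ^ q})" by (auto simp: inj_on_def vid_inj)
  ultimately show ?thesis using inv_into_f_f[of "\<lambda>(j, c). vid q j c" "UNIV \<times> {..<2 ^ q}" "(j, c)"] M_le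
    by (simp add: dec_def)
qed

definition verts_of :: "ug \<Rightarrow> nat set" where
  "verts_of U = (\<lambda>(j, c). vid q j c) ` ({..<length (ug_constraints U)} \<times> {..<M})"

text \<open>All pairs of vertices are arcs, and those that the gadget does not mention have weight 0
  and are free to cut. The program then need not decide which arcs are present.\<close>

definition inst :: "ug \<Rightarrow> dmc" where
  "inst U = \<lparr>supply_graph = \<lparr>pverts = verts_of U, parcs = verts_of U \<times> verts_of U\<rparr>,
     weight = (\<lambda>(x, y). real (arc_weight U (fst (dec x)) (snd (dec x)) (fst (dec y)) (snd (dec y)))),
     terminal = (\<lambda>s. vid q 0 (ter_index s))\<rparr>"

lemma less_M: "c < M \<Longrightarrow> c < 2 ^ q" using M_le by simp

lemma inst_input:
  assumes "ug_instance R U"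
  shows "inst U \<in> dmc_inputs H"
proof -
  have "0 < length (ug_constraints U)" using assms by (auto simp: ug_instance_def)
  then have "vid q 0 (ter_index s) \<in> verts_of U" if "s \<in> pverts H" for s
    using ter_index_less[OF that] by (auto simp: verts_of_def intro: image_eqI[of _ _ "(0, ter_index s)"])
  moreover have "inj_on (\<lambda>s. vid q 0 (ter_index s)) (pverts H)"
    using inj_ter_index ter_index_less by (auto simp: inj_on_def vid_inj less_M)
  moreover have "finite (verts_of U)" by (simp add: verts_of_def)
  ultimately show ?thesis
    by (auto simp: dmc_inputs_def dmc_instance_def inst_def intro!: pair_fin_digraph.intro pair_wf_digraph.intro pair_fin_digraph_axioms.intro)
qed

text \<open>\<open>enc_dmc\<close> lists the vertices in increasing order; \<open>vid\<close>
  increases in the lexicographic order of the pairs \<open>(j, c)\<close>, which is the order of the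
  loops in \<open>reduce\<close>.\<close>

lemma sorted_verts: "sorted_list_of_set (verts_of U) = concat (map (\<lambda>j. map (vid q j) [0..<M]) [0..<length (ug_constraints U)])"
proof -
  have *: "sorted_wrt (<) (concat (map (\<lambda>j. map (vid q j) [0..<M]) [0..<m]))" for m
  proof (induction m)
    case (Suc m)
    have "sorted_wrt (<) (map (vid q m) [0..<M])"
      by (simp add: sorted_wrt_map vid_def)
    then show ?case using Suc by (auto simp: sorted_wrt_append intro!: vid_less less_M)
  qed simp
  have "set (concat (map (\<lambda>j. map (vid q j) [0..<M]) [0..<length (ug_constraints U)])) = verts_of U"
    by (auto simp: verts_of_def)
  then show ?thesis using *[of "length (ug_constraints U)"]
    by (metis sorted_list_of_set.idem_if_sorted_distinct strict_sorted_iff)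
qed

lemma arc_code_eq: "c < M \<Longrightarrow> c' < M \<Longrightarrow> arc_code (replicate j True) (replicate j' True) c c' = enc_arc (vid q j c, vid q j' c')"
  by (simp add: arc_code_def idx_replicate enc_arc_def enc_nat_vid less_M)

lemma weight_code_eq: "weight_code (enc_ug R U) (key U j j') c c' = enc_nat (arc_weight U j c j' c') @ [True, True, False]"
  by (auto simp: weight_code_def arc_weight_def constraint_codes_enc_ug enc_nat_power unary_def map_replicate_const replicate_add split: option.splits)

lemma reduce_eq:
  assumes U: "ug_instance R U"
  shows "reduce (enc_ug R U) = enc_dmc H (inst U)"
proof -
  let ?m = "length (ug_constraints U)"
  let ?vs = "concat (map (\<lambda>j. map (vid q j) [0..<M]) [0..<?m])"
  have vs: "sorted_list_of_set (pverts (supply_graph (inst U))) = ?vs" by (simp add: inst_def sorted_verts)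
  have set_vs: "set ?vs = verts_of U" by (auto simp: verts_of_def)
  have fil: "filter (\<lambda>e. e \<in> parcs (supply_graph (inst U))) (List.product ?vs ?vs) = List.product ?vs ?vs"
    unfolding filter_id_conv set_product set_vs by (simp add: inst_def)
  have 1: "enc_list enc_nat ?vs = concat (map (\<lambda>j. concat (map (\<lambda>c. [True] @ index_bits q c @ idx (replicate j True)) [0..<M])) [0..<?m]) @ [False]"
    unfolding enc_list_def concat_map_concat_map map_map comp_def
    by (intro arg_cong2[of _ _ _ _ "(@)"] refl concat_map_cong) (simp add: enc_nat_vid less_M idx_replicate)
  have 2: "enc_list (\<lambda>e. enc_arc e @ enc_rat (inv real_of_rat (weight (inst U) e))) (List.product ?vs ?vs) = all_pairs arc_entry (enc_ug R U) @ [False]"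
    unfolding enc_list_def concat_map_product concat_map_concat_map all_pairs_def constraint_codes_enc_ug length_map map_map comp_def
  proof (intro arg_cong2[of _ _ _ _ "(@)"] refl concat_map_cong)
    fix j c j' c' assume "j \<in> set [0..<?m]" "c \<in> set [0..<M]" "j' \<in> set [0..<?m]" "c' \<in> set [0..<M]"
    then have l: "j < ?m" "c < M" "j' < ?m" "c' < M" by auto
    show "True # enc_arc (vid q j c, vid q j' c') @ enc_rat (inv real_of_rat (weight (inst U) (vid q j c, vid q j' c'))) =
      arc_entry (enc_ug R U) (replicate j True) (map (constraint_code R) (ug_constraints U) ! j) (replicate j' True) (map (constraint_code R) (ug_constraints U) ! j') c c'"
      using l key_in_keys[OF U l(1), of j'] by (simp add: arc_entry_def key_code_eq arc_code_eq weight_code_eq inst_def enc_rat_of_nat)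
  qed
  show ?thesis
    unfolding enc_dmc_def Let_def vs fil 1 2 reduce_def constraint_codes_enc_ug by (simp add: inst_def comp_def)
qed

lemma sum_verts:
  fixes f :: "nat \<times> nat \<Rightarrow> 'b :: comm_monoid_add"
  shows "(\<Sum>e\<in>verts_of U \<times> verts_of U. f e) =
    (\<Sum>j<length (ug_constraints U). \<Sum>c<M. \<Sum>j'<length (ug_constraints U). \<Sum>c'<M. f (vid q j c, vid q j' c'))"
proof -
  have inj: "inj_on (\<lambda>(j, c). vid q j c) ({..<length (ug_constraints U)} \<times> {..<M})"
    by (auto simp: inj_on_def vid_inj less_M)
  have *: "(\<Sum>x\<in>verts_of U. g x) = (\<Sum>j<length (ug_constraints U). \<Sum>c<M. g (vid q j c))" for g :: "nat \<Rightarrow> 'b"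
    unfolding verts_of_def sum.reindex[OF inj] sum.cartesian_product by (simp add: comp_def case_prod_unfold)
  have "sum f (verts_of U \<times> verts_of U) = (\<Sum>x\<in>verts_of U. \<Sum>y\<in>verts_of U. f (x, y))"
    by (simp add: sum.cartesian_product)
  then show ?thesis unfolding * .
qed

lemma decide_eq:
  assumes U: "ug_instance R U" and Y: "Y (enc_ug R U) = enc_list enc_arc es" and es: "set es \<subseteq> verts_of U \<times> verts_of U"
  shows "decide Y (enc_ug R U) = [(\<Sum>e\<in>set es. weight (inst U) e) < real (Thr * length (ug_constraints U))]"
proof -
  let ?m = "length (ug_constraints U)"
  define cost where "cost j c j' c' = (case W (key U j j') c c' of None \<Rightarrow> Thr * ?m | Some x \<Rightarrow> x)" for j c j' c'
  define T where "T = (\<Sum>j<?m. \<Sum>c<M. \<Sum>j'<?m. \<Sum>c'<M. if (vid q j c, vid q j' c') \<in> set es then cost j c j' c' else 0)"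
  have "all_pairs (cost_entry Y) (enc_ug R U) = concat (map (\<lambda>j. concat (map (\<lambda>c. concat (map (\<lambda>j'. concat (map (\<lambda>c'.
       replicate (if (vid q j c, vid q j' c') \<in> set es then cost j c j' c' else 0) True) [0..<M])) [0..<?m])) [0..<M])) [0..<?m])"
    unfolding all_pairs_def constraint_codes_enc_ug length_map
  proof (intro concat_map_cong)
    fix j c j' c' assume "j \<in> set [0..<?m]" "c \<in> set [0..<M]" "j' \<in> set [0..<?m]" "c' \<in> set [0..<M]"
    then have l: "j < ?m" "c < M" "j' < ?m" "c' < M" by auto
    have "enc_arc e \<in> enc_arc ` set es \<longleftrightarrow> e \<in> set es" for e by (auto simp: enc_arc_eq_iff image_iff)
    moreover have "ucost (enc_ug R U) (key U j j') c c' = replicate (cost j c j' c') True"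
      by (auto simp: ucost_def cost_def constraint_codes_enc_ug concat_replicate_eq sum_list_triv mult.commute split: option.splits)
    ultimately show "cost_entry Y (enc_ug R U) (replicate j True) (map (constraint_code R) (ug_constraints U) ! j) (replicate j' True) (map (constraint_code R) (ug_constraints U) ! j') c c'
      = replicate (if (vid q j c, vid q j' c') \<in> set es then cost j c j' c' else 0) True"
      using l key_in_keys[OF U l(1), of j'] by (simp add: cost_entry_def key_code_eq arc_code_eq mem_eq_Nil[of Y, OF Y])
  qed
  also have "\<dots> = replicate T True" unfolding concat_replicate_eq sum_list_upt T_def ..
  finally have "decide Y (enc_ug R U) = [T < Thr * ?m]"
    by (simp only: decide_def decision_iff constraint_codes_enc_ug length_map) simp
  moreover have "T < Thr * ?m \<longleftrightarrow> (\<Sum>e\<in>set es. weight (inst U) e) < real (Thr * ?m)"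
  proof -
    define co where "co e = cost (fst (dec (fst e))) (snd (dec (fst e))) (fst (dec (snd e))) (snd (dec (snd e)))" for e
    define wt where "wt e = arc_weight U (fst (dec (fst e))) (snd (dec (fst e))) (fst (dec (snd e))) (snd (dec (snd e)))" for e
    have "T = (\<Sum>e\<in>verts_of U \<times> verts_of U. if e \<in> set es then co e else 0)"
      unfolding sum_verts T_def by (intro sum.cong refl) (simp add: co_def)
    also have "\<dots> = (\<Sum>e\<in>set es. co e)"
      using es by (simp add: sum.If_cases Int_absorb1 verts_of_def)
    finally have T: "T = (\<Sum>e\<in>set es. co e)" .
    have w: "weight (inst U) e = real (wt e)" for e by (simp add: inst_def wt_def case_prod_unfold)
    have "?m < 2 ^ ?m" by (rule less_exp)
    then have big: "Thr * ?m \<le> 2 ^ (?m + B)" using mult_mono[OF Thr_le, of ?m "2 ^ ?m"] by (simp add: power_add mult.commute)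
    \<comment> \<open>Capped and true weights differ only on infinite arcs, and one such arc already
      lifts both sums to the threshold.\<close>
    have "(\<Sum>e\<in>set es. co e) < Thr * ?m \<longleftrightarrow> (\<Sum>e\<in>set es. wt e) < Thr * ?m"
    proof (cases "\<exists>e\<in>set es. co e \<noteq> wt e")
      case True
      then obtain e where e: "e \<in> set es" "co e \<noteq> wt e" by auto
      then have "co e = Thr * ?m" "wt e = 2 ^ (?m + B)" by (auto simp: co_def wt_def cost_def arc_weight_def split: option.splits)
      then have "Thr * ?m \<le> (\<Sum>e\<in>set es. co e)" "Thr * ?m \<le> (\<Sum>e\<in>set es. wt e)"
        using member_le_sum[of e "set es" co] member_le_sum[of e "set es" wt] e(1) big by auto
      then show ?thesis by simp
    qed (simp cong: sum.cong)
    then show ?thesis unfolding T w by (simp flip: of_nat_sum of_nat_mult)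
  qed
  ultimately show ?thesis by simp
qed

end

section \<open>Boolean functions of low influence\<close>

definition chi :: "'a set \<Rightarrow> 'a set \<Rightarrow> real" where
  "chi S z = (-1) ^ card (S \<inter> z)"

definition mean :: "'a set \<Rightarrow> ('a set \<Rightarrow> real) \<Rightarrow> real" where
  "mean X f = (\<Sum>z\<in>Pow X. f z) / 2 ^ card X"

definition fourier :: "'a set \<Rightarrow> ('a set \<Rightarrow> real) \<Rightarrow> 'a set \<Rightarrow> real" where
  "fourier X f S = mean X (\<lambda>z. f z * chi S z)"

definition poly_of :: "'a set \<Rightarrow> nat \<Rightarrow> ('a set \<Rightarrow> real) \<Rightarrow> 'a set \<Rightarrow> real" where
  "poly_of X d c z = (\<Sum>S | S \<subseteq> X \<and> card S \<le> d. c S * chi S z)"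

lemma sum_Pow_insert:
  assumes "finite X" "x \<notin> X"
  shows "(\<Sum>z\<in>Pow (insert x X). f z) = (\<Sum>z\<in>Pow X. f z + f (insert x z))"
proof -
  have "inj_on (insert x) (Pow X)" using assms(2) by (auto simp: inj_on_def)
  moreover have "Pow X \<inter> insert x ` Pow X = {}" using assms(2) by auto
  ultimately show ?thesis using assms by (simp add: Pow_insert sum.union_disjoint sum.reindex sum.distrib)
qed

lemma mean_insert:
  assumes "finite X" "x \<notin> X"
  shows "mean (insert x X) f = mean X (\<lambda>z. (f z + f (insert x z)) / 2)"
  using assms by (simp add: mean_def sum_Pow_insert sum_divide_distrib)

lemma mean_add: "mean X (\<lambda>z. f z + g z) = mean X f + mean X g"
  by (simp add: mean_def sum.distrib add_divide_distrib)

lemma mean_cmult: "mean X (\<lambda>z. c * f z) = c * mean X f"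
  by (simp add: mean_def sum_distrib_left)

lemma mean_sum: "mean X (\<lambda>z. \<Sum>i\<in>I. f i z) = (\<Sum>i\<in>I. mean X (f i))"
  by (simp add: mean_def sum.swap[of _ I] sum_divide_distrib)

lemma mean_cong: "(\<And>z. z \<subseteq> X \<Longrightarrow> f z = g z) \<Longrightarrow> mean X f = mean X g"
  unfolding mean_def by (auto intro!: sum.cong)

lemma mean_nonneg: "(\<And>z. z \<subseteq> X \<Longrightarrow> 0 \<le> f z) \<Longrightarrow> 0 \<le> mean X f"
  unfolding mean_def by (intro divide_nonneg_nonneg sum_nonneg) auto

lemma mean_const: "finite X \<Longrightarrow> mean X (\<lambda>z. c) = c"
  by (simp add: mean_def card_Pow)

lemma mean_Cauchy_Schwarz: "(mean X (\<lambda>z. f z * g z))\<^sup>2 \<le> mean X (\<lambda>z. (f z)\<^sup>2) * mean X (\<lambda>z. (g z)\<^sup>2)"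
proof -
  define A B C where "A = mean X (\<lambda>z. (f z)\<^sup>2)" "B = mean X (\<lambda>z. f z * g z)" "C = mean X (\<lambda>z. (g z)\<^sup>2)"
  have *: "mean X (\<lambda>z. (a * f z + b * g z)\<^sup>2) = a\<^sup>2 * A + 2 * a * b * B + b\<^sup>2 * C" for a b
    unfolding A_B_C_def mean_cmult[symmetric] mean_add[symmetric]
    by (rule mean_cong) (simp add: power2_eq_square algebra_simps)
  have q: "0 \<le> a\<^sup>2 * A + 2 * a * b * B + b\<^sup>2 * C" for a b
    unfolding *[symmetric] by (rule mean_nonneg) simp
  have nn: "0 \<le> A" "0 \<le> C" unfolding A_B_C_def by (auto intro: mean_nonneg)
  have "B\<^sup>2 \<le> A * C"
  proof (cases "A = 0 \<and> C = 0")
    case True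
    then have "B = 0" using q[of 1 1] q[of 1 "-1"] by simp
    then show ?thesis using True by simp
  next
    case False
    \<comment> \<open>The quadratic form is evaluated at \<open>(C, -B)\<close> and at
      \<open>(-B, A)\<close>; the first helps if \<open>C\<close> is positive, the second if
      \<open>A\<close> is.\<close>
    have "0 \<le> C * (A * C - B\<^sup>2)" "0 \<le> A * (A * C - B\<^sup>2)"
      using q[of C "-B"] q[of "-B" A] by (simp_all add: power2_eq_square algebra_simps)
    then show ?thesis using False nn by (auto simp: zero_le_mult_iff)
  qed
  then show ?thesis by (simp add: A_B_C_def)
qed

lemma chi_insert_arg:
  assumes "finite S" "x \<notin> z"
  shows "chi S (insert x z) = (if x \<in> S then - chi S z else chi S z)"
proof (cases "x \<in> S")
  case True
  then have "S \<inter> insert x z = insert x (S \<inter> z)" by auto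
  then show ?thesis using True assms by (simp add: chi_def)
next
  case False
  then have "S \<inter> insert x z = S \<inter> z" by auto
  then show ?thesis using False by (simp add: chi_def)
qed

lemma chi_insert_char:
  assumes "finite S" "x \<notin> S"
  shows "chi (insert x S) z = (if x \<in> z then - chi S z else chi S z)"
proof -
  have "chi (insert x S) z = (-1) ^ card (z \<inter> insert x S)" by (simp add: chi_def Int_commute)
  also have "\<dots> = (if x \<in> z then - chi S z else chi S z)"
  proof (cases "x \<in> z")
    case True
    then have "z \<inter> insert x S = insert x (S \<inter> z)" by auto
    then show ?thesis using True assms by (simp add: chi_def)
  next
    case False
    then have "z \<inter> insert x S = S \<inter> z" by auto
    then show ?thesis using False by (simp add: chi_def)
  qed
  finally show ?thesis .
qed

lemma mean_chi:
  assumes "finite X" "S \<subseteq> X" "S' \<subseteq> X"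
  shows "mean X (\<lambda>z. chi S z * chi S' z) = (if S = S' then 1 else 0)"
  using assms
proof (induction X arbitrary: S S' rule: finite_induct)
  case empty
  then show ?case by (simp add: mean_def chi_def)
next
  case (insert x X)
  have fin: "finite S" "finite S'" using insert by (auto intro: finite_subset)
  define T T' where "T = S - {x}" "T' = S' - {x}"
  note TT = T_T'_def
  have sub: "T \<subseteq> X" "T' \<subseteq> X" using insert by (auto simp: TT)
  have red: "chi S z = chi T z" "chi S' z = chi T' z" if "z \<subseteq> X" for z
  proof -
    have "S \<inter> z = T \<inter> z" "S' \<inter> z = T' \<inter> z" using that insert(2) by (auto simp: TT)
    then show "chi S z = chi T z" "chi S' z = chi T' z" by (auto simp: chi_def)
  qed
  have "mean (insert x X) (\<lambda>z. chi S z * chi S' z) =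
      mean X (\<lambda>z. (if (x \<in> S) = (x \<in> S') then 1 else 0) * (chi T z * chi T' z))"
    unfolding mean_insert[OF insert(1,2)]
  proof (rule mean_cong)
    fix z assume z: "z \<subseteq> X"
    then have "x \<notin> z" using insert by auto
    then show "(chi S z * chi S' z + chi S (insert x z) * chi S' (insert x z)) / 2 =
       (if (x \<in> S) = (x \<in> S') then 1 else 0) * (chi T z * chi T' z)"
      using chi_insert_arg[OF fin(1) \<open>x \<notin> z\<close>] chi_insert_arg[OF fin(2) \<open>x \<notin> z\<close>] red[OF z] by auto
  qed
  also have "\<dots> = (if (x \<in> S) = (x \<in> S') \<and> T = T' then 1 else 0)"
    unfolding mean_cmult insert(3)[OF sub] by simp
  also have "((x \<in> S) = (x \<in> S') \<and> T = T') \<longleftrightarrow> S = S'" by (auto simp: TT)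
  finally show ?case .
qed

text \<open>Along a new coordinate \<open>x\<close> a function is the sum of an even part
  \<open>g\<close> and an odd part \<open>h\<close>, both living on the smaller cube. The first
  carries the coefficients of the sets without \<open>x\<close>, the second those of the sets with
  \<open>x\<close>.\<close>

lemma fourier_expansion:
  assumes "finite X" "z \<subseteq> X"
  shows "f z = (\<Sum>S\<in>Pow X. fourier X f S * chi S z)"
  using assms
proof (induction X arbitrary: f z rule: finite_induct)
  case empty
  then show ?case by (simp add: fourier_def mean_def chi_def)
next
  case (insert x X)
  define g where "g w = (f w + f (insert x w)) / 2" for w
  define h where "h w = (f w - f (insert x w)) / 2" for w
  have nx: "x \<notin> w" if "w \<subseteq> X" for w using that insert by auto
  have fin: "finite S" if "S \<subseteq> X" for S using that insert by (auto intro: finite_subset)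
  have 1: "fourier (insert x X) f S = fourier X g S" if "S \<subseteq> X" for S
    unfolding fourier_def mean_insert[OF insert(1,2)]
  proof (rule mean_cong)
    fix w assume "w \<subseteq> X"
    then show "(f w * chi S w + f (insert x w) * chi S (insert x w)) / 2 = g w * chi S w"
      using chi_insert_arg[OF fin[OF that] nx] nx[OF that] by (simp add: g_def algebra_simps)
  qed
  have 2: "fourier (insert x X) f (insert x S) = fourier X h S" if "S \<subseteq> X" for S
    unfolding fourier_def mean_insert[OF insert(1,2)]
  proof (rule mean_cong)
    fix w assume w: "w \<subseteq> X"
    then show "(f w * chi (insert x S) w + f (insert x w) * chi (insert x S) (insert x w)) / 2 = h w * chi S w"
      using chi_insert_char[OF fin[OF that] nx[OF that]] chi_insert_arg[OF fin[OF that] nx[OF w]] nx[OF that] nx[OF w]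
      by (simp add: h_def algebra_simps)
  qed
  define w where "w = z - {x}"
  have w: "w \<subseteq> X" using insert by (auto simp: w_def)
  have "(\<Sum>S\<in>Pow (insert x X). fourier (insert x X) f S * chi S z) =
     (\<Sum>S\<in>Pow X. fourier X g S * chi S w) + (if x \<in> z then -1 else 1) * (\<Sum>S\<in>Pow X. fourier X h S * chi S w)"
    unfolding sum_Pow_insert[OF insert(1,2)] sum_distrib_left sum.distrib[symmetric]
  proof (rule sum.cong[OF refl])
    fix S assume "S \<in> Pow X"
    then have S: "S \<subseteq> X" by simp
    have "S \<inter> z = S \<inter> w" using nx[OF S] by (auto simp: w_def)
    then have "chi S z = chi S w" by (simp add: chi_def)
    then show "fourier (insert x X) f S * chi S z + fourier (insert x X) f (insert x S) * chi (insert x S) z =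
       fourier X g S * chi S w + (if x \<in> z then -1 else 1) * (fourier X h S * chi S w)"
      using 1[OF S] 2[OF S] chi_insert_char[OF fin[OF S] nx[OF S]] by simp
  qed
  also have "\<dots> = g w + (if x \<in> z then -1 else 1) * h w" using insert(3)[OF w] by simp
  also have "\<dots> = f z"
  proof (cases "x \<in> z")
    case True
    then have "insert x w = z" by (auto simp: w_def)
    then show ?thesis using True by (simp add: g_def h_def field_simps)
  next
    case False
    then have "w = z" by (auto simp: w_def)
    then show ?thesis using False by (simp add: g_def h_def field_simps)
  qed
  finally show ?case by simp
qed

lemma parseval:
  assumes "finite X"
  shows "mean X (\<lambda>z. f z * g z) = (\<Sum>S\<in>Pow X. fourier X f S * fourier X g S)"
proof -
  have "mean X (\<lambda>z. f z * g z) = mean X (\<lambda>z. \<Sum>S\<in>Pow X. fourier X f S * (g z * chi S z))"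
  proof (rule mean_cong)
    fix z assume "z \<subseteq> X"
    then show "f z * g z = (\<Sum>S\<in>Pow X. fourier X f S * (g z * chi S z))"
      by (subst fourier_expansion[OF assms, of z f]) (auto simp: sum_distrib_left mult_ac)
  qed
  then show ?thesis by (simp add: mean_sum mean_cmult fourier_def[of X g])
qed

section \<open>Hypercontractivity for polynomials of low degree\<close>

lemma fourier_poly_of:
  assumes "finite X" "S \<subseteq> X"
  shows "fourier X (poly_of X d c) S = (if card S \<le> d then c S else 0)"
proof -
  have "fourier X (poly_of X d c) S = mean X (\<lambda>z. \<Sum>S' | S' \<subseteq> X \<and> card S' \<le> d. c S' * (chi S' z * chi S z))"
    unfolding fourier_def poly_of_def by (simp add: sum_distrib_left mult_ac)
  also have "\<dots> = (\<Sum>S' | S' \<subseteq> X \<and> card S' \<le> d. c S' * (if S' = S then 1 else 0))"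
    unfolding mean_sum mean_cmult using assms by (intro sum.cong) (auto simp: mean_chi)
  also have "\<dots> = (\<Sum>S' | S' \<subseteq> X \<and> card S' \<le> d. if S' = S then c S' else 0)" by (intro sum.cong) auto
  also have "\<dots> = (if card S \<le> d then c S else 0)"
    using assms by (subst sum.delta) auto
  finally show ?thesis .
qed

text \<open>The character of \<open>{x}\<close> is 1 on one half of the cube and -1 on the other, so
  a polynomial is \<open>f + g\<close> on the first and \<open>f - g\<close> on the second half,
  where the degree of \<open>g\<close> has dropped by one.\<close>

lemma poly_of_insert:
  assumes "finite X" "x \<notin> X" "z \<subseteq> X"
  shows "poly_of (insert x X) d c z = poly_of X d c z + (if d = 0 then 0 else poly_of X (d - 1) (\<lambda>S. c (insert x S)) z)"
    "poly_of (insert x X) d c (insert x z) = poly_of X d c z - (if d = 0 then 0 else poly_of X (d - 1) (\<lambda>S. c (insert x S)) z)"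
proof -
  let ?A = "{S. S \<subseteq> X \<and> card S \<le> d}" and ?B = "{S. S \<subseteq> X \<and> Suc (card S) \<le> d}"
  have fin: "finite S" "x \<notin> S" if "S \<subseteq> X" for S using that assms by (auto intro: finite_subset)
  have split: "{S. S \<subseteq> insert x X \<and> card S \<le> d} = ?A \<union> insert x ` ?B"
  proof (intro set_eqI iffI)
    fix S assume S: "S \<in> {S. S \<subseteq> insert x X \<and> card S \<le> d}"
    show "S \<in> ?A \<union> insert x ` ?B"
    proof (cases "x \<in> S")
      case True
      then have "S = insert x (S - {x})" "S - {x} \<subseteq> X" using S by auto
      moreover have "Suc (card (S - {x})) \<le> d"
        using S True assms(1) card_Suc_Diff1[of S x] finite_subset[of S "insert x X"] by simp
      ultimately show ?thesis by blast
    qed (use S in auto)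
  next
    fix S assume "S \<in> ?A \<union> insert x ` ?B"
    then show "S \<in> {S. S \<subseteq> insert x X \<and> card S \<le> d}" using fin by auto
  qed
  have "inj_on (insert x) ?B" using assms by (auto simp: inj_on_def)
  moreover have "?A \<inter> insert x ` ?B = {}" using assms by auto
  ultimately have sum: "(\<Sum>S | S \<subseteq> insert x X \<and> card S \<le> d. F S) = (\<Sum>S\<in>?A. F S) + (\<Sum>S\<in>?B. F (insert x S))" for F :: "'a set \<Rightarrow> real"
    using assms unfolding split by (subst sum.union_disjoint) (auto simp: sum.reindex)
  have B: "(\<Sum>S\<in>?B. c (insert x S) * chi S z) = (if d = 0 then 0 else poly_of X (d - 1) (\<lambda>S. c (insert x S)) z)"
    unfolding poly_of_def by (cases d) auto
  have "x \<notin> z" using assms by auto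
  have e1: "chi (insert x S) z = chi S z" "chi S (insert x z) = chi S z" "chi (insert x S) (insert x z) = - chi S z"
    if "S \<subseteq> X" for S
    using chi_insert_char[OF fin[OF that]] chi_insert_arg[OF fin(1)[OF that] \<open>x \<notin> z\<close>] fin(2)[OF that] \<open>x \<notin> z\<close> by auto
  have A: "(\<Sum>S\<in>?A. c S * chi S z) = poly_of X d c z" by (simp add: poly_of_def)
  have "poly_of (insert x X) d c z = (\<Sum>S\<in>?A. c S * chi S z) + (\<Sum>S\<in>?B. c (insert x S) * chi S z)"
    unfolding poly_of_def sum using e1 by (intro arg_cong2[where f = "(+)"] sum.cong) auto
  then show "poly_of (insert x X) d c z = poly_of X d c z + (if d = 0 then 0 else poly_of X (d - 1) (\<lambda>S. c (insert x S)) z)"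
    unfolding A B .
  have "(\<Sum>S\<in>?B. c (insert x S) * chi (insert x S) (insert x z)) = - (\<Sum>S\<in>?B. c (insert x S) * chi S z)"
    unfolding sum_negf[symmetric] using e1 by (intro sum.cong) auto
  moreover have "(\<Sum>S\<in>?A. c S * chi S (insert x z)) = (\<Sum>S\<in>?A. c S * chi S z)" using e1 by (intro sum.cong) auto
  ultimately have "poly_of (insert x X) d c (insert x z) = (\<Sum>S\<in>?A. c S * chi S z) - (\<Sum>S\<in>?B. c (insert x S) * chi S z)"
    unfolding poly_of_def sum by simp
  then show "poly_of (insert x X) d c (insert x z) = poly_of X d c z - (if d = 0 then 0 else poly_of X (d - 1) (\<lambda>S. c (insert x S)) z)"
    unfolding A B .
qed

text \<open>Hypercontractivity from the second to the fourth moment. When the two halves of the cube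
  are averaged, the odd terms of the fourth powers of \<open>f + g\<close> and \<open>f - g\<close>
  cancel. What remains are the fourth moments of \<open>f\<close> and \<open>g\<close> and six times
  a mixed term, which Cauchy-Schwarz reduces to the former.\<close>

lemma bonami:
  assumes "finite X"
  shows "mean X (\<lambda>z. (poly_of X d c z) ^ 4) \<le> 9 ^ d * (mean X (\<lambda>z. (poly_of X d c z)\<^sup>2))\<^sup>2"
  using assms
proof (induction X arbitrary: d c rule: finite_induct)
  case empty
  have "poly_of {} d c {} = c {}"
  proof -
    have "{S :: 'a set. S \<subseteq> {} \<and> card S \<le> d} = {{}}" by auto
    then show ?thesis unfolding poly_of_def by (simp only:) (simp add: chi_def)
  qed
  moreover have "(c {}) ^ 4 \<le> 9 ^ d * (c {}) ^ 4"
    using mult_right_mono[of 1 "9 ^ d" "(c {}) ^ 4"] by simp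
  ultimately show ?case by (simp add: mean_def flip: power_mult)
next
  case (insert x X)
  define f where "f = poly_of X d c"
  define g where "g z = (if d = 0 then 0 else poly_of X (d - 1) (\<lambda>S. c (insert x S)) z)" for z
  define a b where "a = mean X (\<lambda>z. (f z)\<^sup>2)" "b = mean X (\<lambda>z. (g z)\<^sup>2)"
  have ab: "0 \<le> a" "0 \<le> b" unfolding a_b_def by (auto intro: mean_nonneg)
  have f4: "mean X (\<lambda>z. (f z) ^ 4) \<le> 9 ^ d * a\<^sup>2" unfolding f_def a_b_def by (rule insert(3))
  \<comment> \<open>The smaller degree of \<open>g\<close> gains a factor 9. In the mixed term its
    root 3 turns the coefficient 6 into the 2 of the binomial formula.\<close>
  have g4: "9 * mean X (\<lambda>z. (g z) ^ 4) \<le> 9 ^ d * b\<^sup>2"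
  proof (cases d)
    case 0
    then show ?thesis using insert(1) by (simp add: g_def a_b_def mean_const)
  next
    case (Suc d')
    have "mean X (\<lambda>z. (g z) ^ 4) \<le> 9 ^ d' * b\<^sup>2"
      unfolding a_b_def g_def Suc using insert(3)[of d' "\<lambda>S. c (insert x S)"] by simp
    then show ?thesis by (simp add: Suc)
  qed
  have fg: "9 * (mean X (\<lambda>z. (f z)\<^sup>2 * (g z)\<^sup>2))\<^sup>2 \<le> (9 ^ d * a * b)\<^sup>2"
  proof -
    have "(mean X (\<lambda>z. (f z)\<^sup>2 * (g z)\<^sup>2))\<^sup>2 \<le> mean X (\<lambda>z. (f z) ^ 4) * mean X (\<lambda>z. (g z) ^ 4)"
      using mean_Cauchy_Schwarz[of X "\<lambda>z. (f z)\<^sup>2" "\<lambda>z. (g z)\<^sup>2"] by (simp flip: power_mult)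
    then have "9 * (mean X (\<lambda>z. (f z)\<^sup>2 * (g z)\<^sup>2))\<^sup>2 \<le> mean X (\<lambda>z. (f z) ^ 4) * (9 * mean X (\<lambda>z. (g z) ^ 4))"
      by simp
    also have "\<dots> \<le> (9 ^ d * a\<^sup>2) * (9 ^ d * b\<^sup>2)"
      by (rule mult_mono[OF f4 g4]) (auto intro!: mean_nonneg)
    finally show ?thesis by (simp add: power2_eq_square mult_ac)
  qed
  have "(3 * mean X (\<lambda>z. (f z)\<^sup>2 * (g z)\<^sup>2))\<^sup>2 \<le> (9 ^ d * a * b)\<^sup>2" using fg by (simp add: power2_eq_square)
  then have fg': "3 * mean X (\<lambda>z. (f z)\<^sup>2 * (g z)\<^sup>2) \<le> 9 ^ d * a * b"
    using ab by (intro power2_le_imp_le[of "3 * mean X (\<lambda>z. (f z)\<^sup>2 * (g z)\<^sup>2)"]) auto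
  have "mean (insert x X) (\<lambda>z. (poly_of (insert x X) d c z) ^ 4) =
      mean X (\<lambda>z. (f z) ^ 4 + (6 * ((f z)\<^sup>2 * (g z)\<^sup>2) + (g z) ^ 4))"
    unfolding mean_insert[OF insert(1,2)]
  proof (rule mean_cong)
    fix z assume z: "z \<subseteq> X"
    have "((f z + g z) ^ 4 + (f z - g z) ^ 4) / 2 = (f z) ^ 4 + (6 * ((f z)\<^sup>2 * (g z)\<^sup>2) + (g z) ^ 4)"
      by (simp add: power4_eq_xxxx power2_eq_square algebra_simps)
    then show "((poly_of (insert x X) d c z) ^ 4 + (poly_of (insert x X) d c (insert x z)) ^ 4) / 2 =
       (f z) ^ 4 + (6 * ((f z)\<^sup>2 * (g z)\<^sup>2) + (g z) ^ 4)"
      using poly_of_insert[OF insert(1,2) z, of d c] by (simp add: f_def g_def)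
  qed
  also have "\<dots> = mean X (\<lambda>z. (f z) ^ 4) + 6 * mean X (\<lambda>z. (f z)\<^sup>2 * (g z)\<^sup>2) + mean X (\<lambda>z. (g z) ^ 4)"
    by (simp add: mean_add mean_cmult)
  also have "\<dots> \<le> 9 ^ d * a\<^sup>2 + 2 * (9 ^ d * a * b) + 9 ^ d * b\<^sup>2"
    using f4 g4 fg' mean_nonneg[of X "\<lambda>z. (g z) ^ 4"] by simp
  also have "\<dots> = 9 ^ d * (a + b)\<^sup>2" by (simp add: power2_eq_square algebra_simps)
  also have "a + b = mean (insert x X) (\<lambda>z. (poly_of (insert x X) d c z)\<^sup>2)"
    unfolding mean_insert[OF insert(1,2)] a_b_def mean_add[symmetric]
  proof (rule mean_cong)
    fix z assume z: "z \<subseteq> X"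
    have "(f z)\<^sup>2 + (g z)\<^sup>2 = ((f z + g z)\<^sup>2 + (f z - g z)\<^sup>2) / 2" by (simp add: power2_eq_square algebra_simps)
    then show "(f z)\<^sup>2 + (g z)\<^sup>2 = ((poly_of (insert x X) d c z)\<^sup>2 + (poly_of (insert x X) d c (insert x z))\<^sup>2) / 2"
      using poly_of_insert[OF insert(1,2) z, of d c] by (simp add: f_def g_def)
  qed
  finally show ?case .
qed


section \<open>Influences and variance\<close>

definition flip :: "'a \<Rightarrow> 'a set \<Rightarrow> 'a set" where
  "flip x z = (if x \<in> z then z - {x} else insert x z)"

definition influence :: "'a set \<Rightarrow> ('a set \<Rightarrow> bool) \<Rightarrow> 'a \<Rightarrow> real" where
  "influence X F x = mean X (\<lambda>z. of_bool (F z \<noteq> F (flip x z)))"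

lemma flip_flip [simp]: "flip x (flip x z) = z"
  by (auto simp: flip_def)

lemma bij_flip: "x \<in> X \<Longrightarrow> bij_betw (flip x) (Pow X) (Pow X)"
  by (rule bij_betwI[where g = "flip x"]) (auto simp: flip_def split: if_splits)

lemma mean_reindex: "bij_betw h (Pow X) (Pow X) \<Longrightarrow> mean X (\<lambda>z. f (h z)) = mean X f"
  unfolding mean_def by (subst sum.reindex_bij_betw) auto

lemma chi_flip: "finite S \<Longrightarrow> chi S (flip x z) = (if x \<in> S then - chi S z else chi S z)"
proof -
  assume S: "finite S"
  show ?thesis
  proof (cases "x \<in> z")
    case True
    then have z: "z = insert x (flip x z)" "x \<notin> flip x z" by (auto simp: flip_def)
    have "chi S z = (if x \<in> S then - chi S (flip x z) else chi S (flip x z))"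
      using chi_insert_arg[OF S z(2)] z(1) by simp
    then show ?thesis by simp
  qed (use S in \<open>simp add: flip_def chi_insert_arg\<close>)
qed

text \<open>The half difference \<open>g\<close> of \<open>f\<close> across \<open>x\<close> carries
  exactly the coefficients of the sets that contain \<open>x\<close>, and it vanishes outside a set
  of measure \<open>p\<close>, the influence. By \<open>bonami\<close> a polynomial of low degree is
  spread out and correlates little with a function on a small set: two applications of
  Cauchy-Schwarz bound \<open>H ^ 4\<close> by \<open>p ^ 3 * 9 ^ d / 16 * H ^ 2\<close> for the
  low-degree part \<open>H\<close>.\<close>

lemma low_degree_derivative:
  fixes F :: "'a set \<Rightarrow> bool"
  assumes "finite X" "x \<in> X"
  defines "f \<equiv> \<lambda>z. of_bool (F z) :: real"
  shows "(\<Sum>S | S \<subseteq> X \<and> x \<in> S. (fourier X f S)\<^sup>2) = influence X F x / 4"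
    and "(\<Sum>S | S \<subseteq> X \<and> x \<in> S \<and> card S \<le> d. (fourier X f S)\<^sup>2) \<le> influence X F x * sqrt (influence X F x) * 3 ^ d / 4"
proof -
  define p where "p = influence X F x"
  define g where "g z = (f z - f (flip x z)) / 2" for z
  define D where "D z = (of_bool (F z \<noteq> F (flip x z)) :: real)" for z
  have fg: "fourier X g S = (if x \<in> S then fourier X f S else 0)" if "S \<subseteq> X" for S
  proof -
    have fin: "finite S" using that assms(1) by (rule finite_subset)
    have "mean X (\<lambda>z. f (flip x z) * chi S z) = mean X (\<lambda>z. f z * chi S (flip x z))"
      using mean_reindex[OF bij_flip[OF assms(2)], of "\<lambda>z. f z * chi S (flip x z)"] by simp
    also have "\<dots> = (if x \<in> S then -1 else 1) * fourier X f S"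
      unfolding fourier_def mean_cmult[symmetric] by (rule mean_cong) (simp add: chi_flip[OF fin])
    finally have *: "mean X (\<lambda>z. f (flip x z) * chi S z) = (if x \<in> S then -1 else 1) * fourier X f S" .
    have "fourier X g S = mean X (\<lambda>z. (1/2) * (f z * chi S z) + (-1/2) * (f (flip x z) * chi S z))"
      unfolding fourier_def by (rule mean_cong) (simp add: g_def field_simps)
    also have "\<dots> = (1/2) * fourier X f S + (-1/2) * ((if x \<in> S then -1 else 1) * fourier X f S)"
      unfolding mean_add mean_cmult * fourier_def ..
    finally show ?thesis by simp
  qed
  have g2: "(g z)\<^sup>2 = (1/4) * D z" "(D z)\<^sup>2 = D z" and gD: "g z = g z * D z" for z
    by (auto simp: g_def D_def f_def power2_eq_square of_bool_def)
  have p: "p = mean X D" by (simp add: p_def influence_def D_def[abs_def])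
  have "0 \<le> p" unfolding p by (rule mean_nonneg) (simp add: D_def)
  have fin: "finite {S. S \<subseteq> X \<and> P S}" for P using assms(1) by simp
  have "(\<Sum>S | S \<subseteq> X \<and> x \<in> S. (fourier X f S)\<^sup>2) = (\<Sum>S\<in>Pow X. fourier X g S * fourier X g S)"
    using assms(1) by (intro sum.mono_neutral_cong_left) (auto simp: fg power2_eq_square)
  also have "\<dots> = p / 4"
    unfolding parseval[OF assms(1), symmetric] using mean_cmult[of X "1/4" D] by (simp add: g2 p flip: power2_eq_square)
  finally show "(\<Sum>S | S \<subseteq> X \<and> x \<in> S. (fourier X f S)\<^sup>2) = influence X F x / 4" by (simp add: p_def)
  define h where "h = poly_of X d (fourier X g)"
  define H where "H = (\<Sum>S | S \<subseteq> X \<and> card S \<le> d. (fourier X g S)\<^sup>2)"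
  have fh: "fourier X h S = (if card S \<le> d then fourier X g S else 0)" if "S \<subseteq> X" for S
    unfolding h_def using assms(1) that by (rule fourier_poly_of)
  have gh: "mean X (\<lambda>z. g z * h z) = H"
    unfolding parseval[OF assms(1)] H_def using assms(1)
    by (intro sum.mono_neutral_cong_right) (auto simp: fh power2_eq_square)
  have hh: "mean X (\<lambda>z. (h z)\<^sup>2) = H"
    unfolding power2_eq_square parseval[OF assms(1)] H_def using assms(1)
    by (intro sum.mono_neutral_cong_right) (auto simp: fh power2_eq_square)
  have "0 \<le> H" unfolding H_def by (intro sum_nonneg) auto
  have "H\<^sup>2 = (mean X (\<lambda>z. g z * (D z * h z)))\<^sup>2"
    unfolding gh[symmetric] by (rule arg_cong[where f = "\<lambda>r. r\<^sup>2"], rule mean_cong) (metis gD mult.assoc)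
  also have "\<dots> \<le> mean X (\<lambda>z. (g z)\<^sup>2) * mean X (\<lambda>z. (D z * h z)\<^sup>2)" by (rule mean_Cauchy_Schwarz)
  also have "mean X (\<lambda>z. (g z)\<^sup>2) = p / 4" using mean_cmult[of X "1/4" D] by (simp add: g2 p)
  finally have 1: "H\<^sup>2 \<le> p / 4 * mean X (\<lambda>z. D z * (h z)\<^sup>2)" by (simp add: power_mult_distrib g2)
  have "(mean X (\<lambda>z. D z * (h z)\<^sup>2))\<^sup>2 \<le> mean X (\<lambda>z. (D z)\<^sup>2) * mean X (\<lambda>z. ((h z)\<^sup>2)\<^sup>2)" by (rule mean_Cauchy_Schwarz)
  also have "\<dots> = p * mean X (\<lambda>z. (h z) ^ 4)" by (simp add: g2 p flip: power_mult)
  also have "\<dots> \<le> p * (9 ^ d * H\<^sup>2)"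
    using bonami[OF assms(1), of d "fourier X g"] \<open>0 \<le> p\<close> hh by (intro mult_left_mono) (auto simp: h_def)
  finally have 2: "(mean X (\<lambda>z. D z * (h z)\<^sup>2))\<^sup>2 \<le> p * (9 ^ d * H\<^sup>2)" .
  have "H ^ 4 = (H\<^sup>2)\<^sup>2" by simp
  also have "\<dots> \<le> (p / 4 * mean X (\<lambda>z. D z * (h z)\<^sup>2))\<^sup>2" using 1 by (intro power_mono) auto
  also have "\<dots> \<le> (p / 4)\<^sup>2 * (p * (9 ^ d * H\<^sup>2))" unfolding power_mult_distrib using 2 by (intro mult_left_mono) auto
  finally have le: "H\<^sup>2 * H\<^sup>2 \<le> (p ^ 3 * 9 ^ d / 16) * H\<^sup>2" by (simp add: power2_eq_square power3_eq_cube power4_eq_xxxx algebra_simps)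
  have "H\<^sup>2 \<le> p ^ 3 * 9 ^ d / 16"
  proof (cases "H = 0")
    case False
    then have "0 < H\<^sup>2" by simp
    with le show ?thesis by (rule mult_right_le_imp_le)
  qed (use \<open>0 \<le> p\<close> in simp)
  also have "\<dots> = (p * sqrt p * 3 ^ d / 4)\<^sup>2"
  proof -
    have "(3 ^ d)\<^sup>2 = (9 :: real) ^ d" by (simp add: power2_eq_square flip: power_mult_distrib)
    then show ?thesis using \<open>0 \<le> p\<close> by (simp add: power_mult_distrib power_divide power3_eq_cube) (simp add: power2_eq_square)
  qed
  finally have "H \<le> p * sqrt p * 3 ^ d / 4" using \<open>0 \<le> p\<close> by (intro power2_le_imp_le[of H]) auto
  moreover have "(\<Sum>S | S \<subseteq> X \<and> x \<in> S \<and> card S \<le> d. (fourier X f S)\<^sup>2) = H"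
    unfolding H_def using assms(1) by (intro sum.mono_neutral_cong_left) (auto simp: fg)
  ultimately show "(\<Sum>S | S \<subseteq> X \<and> x \<in> S \<and> card S \<le> d. (fourier X f S)\<^sup>2) \<le> influence X F x * sqrt (influence X F x) * 3 ^ d / 4"
    by (simp add: p_def)
qed

text \<open>The inequality of Kahn, Kalai and Linial in additive form. The variance is the sum of
  the squared coefficients of the nonempty sets. A set with more than \<open>d\<close> elements is
  counted more than \<open>d\<close> times in the sum of the influences; the smaller sets are
  covered by \<open>low_degree_derivative\<close>.\<close>

lemma variance_le_influences:
  fixes F :: "'a set \<Rightarrow> bool"
  assumes "finite X" "1 \<le> d" and \<tau>: "\<And>x. x \<in> X \<Longrightarrow> influence X F x \<le> \<tau>" and C: "(\<Sum>x\<in>X. influence X F x) \<le> C"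
    and "0 \<le> \<tau>" and \<mu>: "\<mu> = mean X (\<lambda>z. of_bool (F z))"
  shows "\<mu> * (1 - \<mu>) \<le> C * sqrt \<tau> * 3 ^ d / 4 + C / (4 * d)"
proof -
  define f where "f z = (of_bool (F z) :: real)" for z
  define q where "q S = (fourier X f S)\<^sup>2" for S
  have fin: "finite {S. S \<subseteq> X \<and> P S}" for P using assms(1) by simp
  have inf0: "0 \<le> influence X F x" for x unfolding influence_def by (rule mean_nonneg) simp
  have "fourier X f {} = \<mu>" by (simp add: fourier_def chi_def \<mu> f_def[abs_def])
  moreover have "\<mu> = mean X (\<lambda>z. f z * f z)" unfolding \<mu> by (rule mean_cong) (simp add: f_def)
  then have "\<mu> = (\<Sum>S\<in>Pow X. q S)" unfolding parseval[OF assms(1)] q_def power2_eq_square .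
  moreover have "(\<Sum>S\<in>Pow X. q S) = q {} + (\<Sum>S\<in>Pow X - {{}}. q S)"
    using assms(1) by (subst sum.remove[of _ "{}"]) auto
  ultimately have var: "\<mu> * (1 - \<mu>) = (\<Sum>S\<in>Pow X - {{}}. q S)"
    by (simp add: q_def power2_eq_square algebra_simps)
  have "q S \<le> (\<Sum>x\<in>S. (if card S \<le> d then q S else 0) + q S / d)" if "S \<in> Pow X - {{}}" for S
  proof -
    have "finite S" "S \<noteq> {}" using that assms(1) by (auto intro: finite_subset)
    then have c: "1 \<le> card S" by (simp add: Suc_leI card_gt_0_iff)
    have "q S \<le> card S * ((if card S \<le> d then q S else 0) + q S / d)"
    proof (cases "card S \<le> d")
      case True
      have "q S * 1 \<le> q S * card S" using c by (intro mult_left_mono) (auto simp: q_def)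
      then show ?thesis using True by (simp add: q_def algebra_simps add_increasing2)
    next
      case False
      have "q S * d \<le> q S * card S" using False by (intro mult_left_mono) (auto simp: q_def)
      then show ?thesis using False assms(2) by (simp add: field_simps)
    qed
    then show ?thesis by simp
  qed
  then have "\<mu> * (1 - \<mu>) \<le> (\<Sum>S\<in>Pow X - {{}}. \<Sum>x\<in>S. (if card S \<le> d then q S else 0) + q S / d)"
    unfolding var by (rule sum_mono)
  also have "\<dots> = (\<Sum>S\<in>Pow X. \<Sum>x\<in>S. (if card S \<le> d then q S else 0) + q S / d)"
    using assms(1) by (intro sum.mono_neutral_left) auto
  also have "\<dots> = (\<Sum>S\<in>Pow X. \<Sum>x | x \<in> X \<and> x \<in> S. (if card S \<le> d then q S else 0) + q S / d)"
    by (intro sum.cong) auto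
  also have "\<dots> = (\<Sum>x\<in>X. \<Sum>S | S \<in> Pow X \<and> x \<in> S. (if card S \<le> d then q S else 0) + q S / d)"
    using assms(1) by (intro sum.swap_restrict) auto
  also have "\<dots> \<le> (\<Sum>x\<in>X. influence X F x * sqrt \<tau> * 3 ^ d / 4 + influence X F x / (4 * d))"
  proof (rule sum_mono)
    fix x assume x: "x \<in> X"
    have "(\<Sum>S | S \<in> Pow X \<and> x \<in> S. if card S \<le> d then q S else 0) = (\<Sum>S | S \<subseteq> X \<and> x \<in> S \<and> card S \<le> d. q S)"
      using assms(1) by (intro sum.mono_neutral_cong_right) auto
    also have "\<dots> \<le> influence X F x * sqrt (influence X F x) * 3 ^ d / 4"
      unfolding q_def f_def[abs_def] by (rule low_degree_derivative(2)[OF assms(1) x])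
    also have "\<dots> \<le> influence X F x * sqrt \<tau> * 3 ^ d / 4"
      using inf0 \<tau>[OF x] by (intro divide_right_mono mult_right_mono mult_left_mono) auto
    finally have 1: "(\<Sum>S | S \<in> Pow X \<and> x \<in> S. if card S \<le> d then q S else 0) \<le> influence X F x * sqrt \<tau> * 3 ^ d / 4" .
    have "(\<Sum>S | S \<in> Pow X \<and> x \<in> S. q S) = influence X F x / 4"
      using low_degree_derivative(1)[OF assms(1) x, of F] by (simp add: q_def f_def[abs_def])
    then have "(\<Sum>S | S \<in> Pow X \<and> x \<in> S. q S / d) = influence X F x / (4 * d)"
      by (simp only: sum_divide_distrib[symmetric])
    then show "(\<Sum>S | S \<in> Pow X \<and> x \<in> S. (if card S \<le> d then q S else 0) + q S / d) \<le> influence X F x * sqrt \<tau> * 3 ^ d / 4 + influence X F x / (4 * d)"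
      using 1 by (simp add: sum.distrib)
  qed
  also have "\<dots> = (\<Sum>x\<in>X. influence X F x) * (sqrt \<tau> * 3 ^ d / 4 + 1 / (4 * d))"
    unfolding sum_distrib_right by (rule sum.cong) (auto simp: distrib_left)
  also have "\<dots> \<le> C * (sqrt \<tau> * 3 ^ d / 4 + 1 / (4 * d))"
    using C \<open>0 \<le> \<tau>\<close> by (intro mult_right_mono) auto
  finally show ?thesis by (simp add: algebra_simps)
qed

text \<open>The same \<open>\<tau>\<close> serves cubes of every dimension. The number
  \<open>R\<close> of labels comes from the Unique Games Conjecture and is known only after all
  other constants, so this uniformity is essential.\<close>

lemma low_influences_imp_almost_constant:
  fixes C \<delta> :: real
  assumes "0 \<le> C" "0 < \<delta>" "\<delta> \<le> 1 / 2"
  obtains \<tau> where "0 < \<tau>"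
    "\<And>(X :: 'a set) F. finite X \<Longrightarrow> (\<And>x. x \<in> X \<Longrightarrow> influence X F x \<le> \<tau>) \<Longrightarrow> (\<Sum>x\<in>X. influence X F x) \<le> C \<Longrightarrow>
       mean X (\<lambda>z. of_bool (F z)) \<le> \<delta> \<or> 1 - \<delta> \<le> mean X (\<lambda>z. of_bool (F z))"
proof -
  \<comment> \<open>The degree makes the high part at most \<open>\<delta> / 4\<close> and
    \<open>\<tau>\<close> makes the low part at most \<open>\<delta> / 8\<close>, while a mean
    strictly between \<open>\<delta>\<close> and \<open>1 - \<delta>\<close> gives a variance above
    \<open>\<delta> / 2\<close>.\<close>
  obtain d :: nat where d: "C / \<delta> < d" using reals_Archimedean2 by blast
  have d1: "1 \<le> d" using d assms by (cases d) (auto simp: divide_less_0_iff)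
  define \<tau> where "\<tau> = (\<delta> / (2 * (C + 1) * 3 ^ d))\<^sup>2"
  have "0 < \<tau>" using assms by (simp add: \<tau>_def)
  moreover have "mean X (\<lambda>z. of_bool (F z)) \<le> \<delta> \<or> 1 - \<delta> \<le> mean X (\<lambda>z. of_bool (F z))"
    if X: "finite X" "\<And>x. x \<in> X \<Longrightarrow> influence X F x \<le> \<tau>" "(\<Sum>x\<in>X. influence X F x) \<le> C" for X :: "'a set" and F
  proof (rule ccontr)
    define \<mu> where "\<mu> = mean X (\<lambda>z. of_bool (F z))"
    assume "\<not> (mean X (\<lambda>z. of_bool (F z)) \<le> \<delta> \<or> 1 - \<delta> \<le> mean X (\<lambda>z. of_bool (F z)))"
    then have \<mu>: "\<delta> < \<mu>" "\<mu> < 1 - \<delta>" by (auto simp: \<mu>_def)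
    have "0 < (\<mu> - \<delta>) * (1 - \<delta> - \<mu>)" using \<mu> by simp
    then have "\<delta> * (1 - \<delta>) < \<mu> * (1 - \<mu>)" by (simp add: algebra_simps)
    moreover have "\<delta> * (1 / 2) \<le> \<delta> * (1 - \<delta>)" using assms by (intro mult_left_mono) auto
    moreover have "\<mu> * (1 - \<mu>) \<le> C * sqrt \<tau> * 3 ^ d / 4 + C / (4 * d)"
      using X d1 \<open>0 < \<tau>\<close> by (intro variance_le_influences[of X]) (auto simp: \<mu>_def)
    moreover have "C / (4 * d) \<le> \<delta> / 4" using d d1 assms by (simp add: field_simps)
    moreover have "C * sqrt \<tau> * 3 ^ d / 4 \<le> \<delta> / 8"
    proof -
      have "sqrt \<tau> = \<delta> / (2 * (C + 1) * 3 ^ d)" using assms by (simp add: \<tau>_def)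
      moreover have "K \<noteq> 0 \<Longrightarrow> w \<noteq> 0 \<Longrightarrow> C * (\<delta> / (2 * K * w)) * w / 4 = \<delta> / 8 * (C / K)" for K w :: real
        by (simp add: field_simps)
      from this[of "C + 1" "3 ^ d"] have "C * (\<delta> / (2 * (C + 1) * 3 ^ d)) * 3 ^ d / 4 = \<delta> / 8 * (C / (C + 1))" using assms by simp
      ultimately have "C * sqrt \<tau> * 3 ^ d / 4 = \<delta> / 8 * (C / (C + 1))" by simp
      also have "\<dots> \<le> \<delta> / 8 * 1" using assms by (intro mult_left_mono) auto
      finally show ?thesis by simp
    qed
    ultimately show False using assms by simp
  qed
  ultimately show ?thesis using that by blast
qed

section \<open>The cube of labels\<close>

definition coords :: "nat \<Rightarrow> nat \<Rightarrow> (nat \<times> nat) set" where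
  "coords R n = {..<R} \<times> {..<n}"

text \<open>A point of the cube is a subset of \<open>coords R n\<close>; its \<open>i\<close>-th block of \<open>n\<close> bits is a number below \<open>2 ^ n\<close>.\<close>

definition block :: "nat \<Rightarrow> nat \<Rightarrow> (nat \<times> nat) set \<Rightarrow> nat" where
  "block n i z = horner_sum of_bool 2 (map (\<lambda>b. (i, b) \<in> z) [0..<n])"

text \<open>Arithmetic modulo \<open>2 ^ n\<close> makes this a bijection, so the uniform measure is
  preserved; the price is that thresholds near \<open>2 ^ n\<close> wrap around.\<close>

definition shift :: "nat \<Rightarrow> nat \<Rightarrow> nat \<Rightarrow> (nat \<times> nat) set \<Rightarrow> (nat \<times> nat) set" where
  "shift R n k z = {(i, b). i < R \<and> b < n \<and> bit ((block n i z + k) mod 2 ^ n) b}"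

definition permute :: "(nat \<Rightarrow> nat) \<Rightarrow> (nat \<times> nat) set \<Rightarrow> (nat \<times> nat) set" where
  "permute \<pi> z = (\<lambda>(i, b). (\<pi> i, b)) ` z"

lemma finite_coords [simp]: "finite (coords R n)"
  by (simp add: coords_def)

lemma bit_block: "bit (block n i z) b \<longleftrightarrow> b < n \<and> (i, b) \<in> z"
  unfolding block_def by (auto simp: bit_horner_sum_bit_iff)

lemma block_less: "block n i z < 2 ^ n"
proof -
  have "take_bit n (block n i z) = block n i z"
    by (rule bit_eqI) (auto simp: bit_take_bit_iff bit_block)
  then show ?thesis by (simp add: take_bit_nat_eq_self_iff)
qed

lemma block_shift: "i < R \<Longrightarrow> block n i (shift R n k z) = (block n i z + k) mod 2 ^ n"
proof -
  assume "i < R"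
  then have "block n i (shift R n k z) = horner_sum of_bool 2 (map (bit ((block n i z + k) mod 2 ^ n)) [0..<n])"
    unfolding block_def[of n i "shift R n k z"]
    by (intro arg_cong[where f = "horner_sum of_bool 2"] map_cong) (auto simp: shift_def)
  then show ?thesis by (simp add: horner_sum_bit_eq_take_bit take_bit_eq_mod)
qed

lemma block_inj:
  assumes "z \<subseteq> coords R n" "z' \<subseteq> coords R n" "\<And>i. i < R \<Longrightarrow> block n i z = block n i z'"
  shows "z = z'"
proof -
  have "(i, b) \<in> z \<longleftrightarrow> (i, b) \<in> z'" if "i < R" "b < n" for i b
    using assms(3)[OF that(1)] bit_block[of n i z b] bit_block[of n i z' b] that by simp
  then show ?thesis using assms(1,2) by (auto simp: coords_def)
qed

lemma inj_endo_bij_Pow: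
  assumes "finite X" "inj_on h (Pow X)" "h ` Pow X \<subseteq> Pow X"
  shows "bij_betw h (Pow X) (Pow X)"
  using assms endo_inj_surj[of "Pow X" h] by (simp add: bij_betw_def)

lemma bij_shift: "bij_betw (shift R n k) (Pow (coords R n)) (Pow (coords R n))"
proof (rule inj_endo_bij_Pow)
  show "inj_on (shift R n k) (Pow (coords R n))"
  proof (rule inj_onI)
    fix z z' assume z: "z \<in> Pow (coords R n)" "z' \<in> Pow (coords R n)" "shift R n k z = shift R n k z'"
    show "z = z'"
    proof (rule block_inj)
      fix i assume "i < R"
      then have "(block n i z + k) mod 2 ^ n = (block n i z' + k) mod 2 ^ n"
        using z(3) block_shift by metis
      then have "block n i z mod 2 ^ n = block n i z' mod 2 ^ n"
        using cong_add_rcancel_nat[of "block n i z" k "block n i z'" "2 ^ n"] by (simp add: cong_def)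
      then show "block n i z = block n i z'" using block_less by simp
    qed (use z in auto)
  qed
qed (auto simp: shift_def coords_def)

lemma inj_permute_pair: "\<pi> permutes S \<Longrightarrow> inj (\<lambda>(i, b). (\<pi> i, b))"
  by (auto simp: inj_on_def dest: permutes_inj injD)

lemma mem_permute: "\<pi> permutes S \<Longrightarrow> (\<pi> i, b) \<in> permute \<pi> z \<longleftrightarrow> (i, b) \<in> z"
  unfolding permute_def using permutes_inj[of \<pi> S] by (auto dest: injD)

lemma permute_subset: "\<pi> permutes {..<R} \<Longrightarrow> z \<subseteq> coords R n \<Longrightarrow> permute \<pi> z \<subseteq> coords R n"
  using permutes_in_image[of \<pi> "{..<R}"] by (auto simp: permute_def coords_def)

lemma bij_permute: "\<pi> permutes {..<R} \<Longrightarrow> bij_betw (permute \<pi>) (Pow (coords R n)) (Pow (coords R n))"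
  by (rule inj_endo_bij_Pow) (auto simp: permute_def inj_image_eq_iff[OF inj_permute_pair] intro!: inj_onI dest: permute_subset[unfolded permute_def])

lemma block_permute: "\<pi> permutes S \<Longrightarrow> block n (\<pi> i) (permute \<pi> z) = block n i z"
  by (simp add: block_def mem_permute)

lemma permute_flip: "\<pi> permutes S \<Longrightarrow> permute \<pi> (flip (i, b) z) = flip (\<pi> i, b) (permute \<pi> z)"
proof -
  assume \<pi>: "\<pi> permutes S"
  have "permute \<pi> (z - {(i, b)}) = permute \<pi> z - {(\<pi> i, b)}"
    unfolding permute_def image_set_diff[OF inj_permute_pair[OF \<pi>]] by simp
  then show ?thesis using mem_permute[OF \<pi>, of i b z] by (simp add: flip_def) (simp add: permute_def)
qed

lemma block_flip: "i \<noteq> j \<Longrightarrow> block n i (flip (j, b) z) = block n i z"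
  unfolding block_def by (intro arg_cong[where f = "horner_sum of_bool 2"] map_cong) (auto simp: flip_def)

section \<open>Counting points of the cube\<close>

definition cube_count :: "nat \<Rightarrow> nat \<Rightarrow> ((nat \<times> nat) set \<Rightarrow> bool) \<Rightarrow> nat" where
  "cube_count R n P = card {z \<in> Pow (coords R n). P z}"

definition cube_size :: "nat \<Rightarrow> nat \<Rightarrow> nat" where
  "cube_size R n = 2 ^ (R * n)"

lemma card_coords: "card (coords R n) = R * n"
  by (simp add: coords_def card_cartesian_product)

lemma of_nat_count: "of_nat (cube_count R n P) = (\<Sum>z\<in>Pow (coords R n). of_bool (P z))"
proof -
  have "{z \<in> Pow (coords R n). P z} = Pow (coords R n) \<inter> {z. P z}" by auto
  then show ?thesis by (simp add: cube_count_def)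
qed

lemmas count_eq_sum = of_nat_count[where 'a = nat, unfolded of_nat_id]

lemma mean_eq_count: "mean (coords R n) (\<lambda>z. of_bool (P z)) = cube_count R n P / cube_size R n"
  by (simp add: mean_def of_nat_count cube_size_def card_coords)

lemma count_reindex: "bij_betw h (Pow (coords R n)) (Pow (coords R n)) \<Longrightarrow> cube_count R n (\<lambda>z. P (h z)) = cube_count R n P"
  unfolding count_eq_sum by (rule sum.reindex_bij_betw[of h _ _ "\<lambda>z. of_bool (P z)"])

lemma count_mono: "(\<And>z. z \<subseteq> coords R n \<Longrightarrow> P z \<Longrightarrow> P' z) \<Longrightarrow> cube_count R n P \<le> cube_count R n P'"
  unfolding cube_count_def by (intro card_mono) auto

lemma count_disj: "cube_count R n (\<lambda>z. P z \<or> P' z) \<le> cube_count R n P + cube_count R n P'"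
  unfolding count_eq_sum sum.distrib[symmetric] by (rule sum_mono) auto

lemma count_le: "cube_count R n P \<le> cube_size R n"
proof -
  have "cube_count R n P \<le> card (Pow (coords R n))" unfolding cube_count_def by (rule card_mono) auto
  then show ?thesis by (simp add: card_Pow cube_size_def card_coords)
qed

text \<open>Shifting all blocks by \<open>k\<close> and averaging over \<open>k\<close> shows that a block is uniformly distributed.\<close>

lemma count_block:
  assumes "i < R" "T \<subseteq> {..<2 ^ n}"
  shows "2 ^ n * cube_count R n (\<lambda>z. block n i z \<in> T) = cube_size R n * card T"
proof -
  have "2 ^ n * cube_count R n (\<lambda>z. block n i z \<in> T) = (\<Sum>k<2 ^ n. cube_count R n (\<lambda>z. block n i (shift R n k z) \<in> T))"
    using count_reindex[OF bij_shift, of R n "\<lambda>z. block n i z \<in> T"] by simp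
  also have "\<dots> = (\<Sum>z\<in>Pow (coords R n). \<Sum>k<2 ^ n. of_bool ((block n i z + k) mod 2 ^ n \<in> T))"
    unfolding count_eq_sum block_shift[OF assms(1)] by (rule sum.swap)
  also have "\<dots> = (\<Sum>z\<in>Pow (coords R n). card T)"
  proof (rule sum.cong[OF refl])
    fix z
    define t where "t = block n i z"
    have "inj_on (\<lambda>k. (t + k) mod 2 ^ n) {..<2 ^ n}"
    proof (rule inj_onI)
      fix k k' :: nat assume k: "k \<in> {..<2 ^ n}" "k' \<in> {..<2 ^ n}" "(t + k) mod 2 ^ n = (t + k') mod 2 ^ n"
      then have "[t + k = t + k'] (mod 2 ^ n)" by (simp add: cong_def)
      then have "[k = k'] (mod 2 ^ n)" using cong_add_lcancel_nat by blast
      then show "k = k'" using k by (simp add: cong_def)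
    qed
    then have "bij_betw (\<lambda>k. (t + k) mod 2 ^ n) {..<2 ^ n} {..<2 ^ n}"
      using endo_inj_surj[of "{..<2 ^ n :: nat}" "\<lambda>k. (t + k) mod 2 ^ n"] by (simp add: bij_betw_def image_subset_iff)
    then have "(\<Sum>k<2 ^ n. of_bool ((t + k) mod 2 ^ n \<in> T)) = (\<Sum>k<2 ^ n. of_bool (k \<in> T) :: nat)"
      by (rule sum.reindex_bij_betw)
    also have "\<dots> = card T" using assms(2) by (simp add: inf.absorb2)
    finally show "(\<Sum>k<2 ^ n. of_bool ((block n i z + k) mod 2 ^ n \<in> T)) = card T" by (simp add: t_def)
  qed
  also have "\<dots> = cube_size R n * card T" by (simp add: card_Pow card_coords cube_size_def)
  finally show ?thesis .
qed

lemma influence_eq_count: "influence (coords R n) F x = cube_count R n (\<lambda>z. F z \<noteq> F (flip x z)) / cube_size R n"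
  unfolding influence_def by (rule mean_eq_count)

section \<open>The gadget\<close>

text \<open>\<open>Node True\<close> belongs to the cube of the left endpoint of a constraint and
  \<open>Node False\<close> to that of the right endpoint.\<close>

datatype gvert = Term nat | Node bool nat "(nat \<times> nat) set"

text \<open>Different indices may name the same pair of vertices; the graph has no parallel arcs, so
  their weights are added.\<close>

definition arc_sum :: "'i set \<Rightarrow> ('i \<Rightarrow> gvert) \<Rightarrow> ('i \<Rightarrow> gvert) \<Rightarrow> ('i \<Rightarrow> nat) \<Rightarrow> gvert \<Rightarrow> gvert \<Rightarrow> nat" where
  "arc_sum J a b c p q = (\<Sum>i\<in>J. if p = a i \<and> q = b i then c i else 0)"

lemma sum_arc_sum:
  assumes "finite G" "\<And>i. i \<in> J \<Longrightarrow> a i \<in> G \<and> b i \<in> G"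
  shows "(\<Sum>p\<in>G. \<Sum>q\<in>G. if viol p q then arc_sum J a b c p q else 0) = (\<Sum>i\<in>J. if viol (a i) (b i) then c i else 0)"
proof -
  have "(\<Sum>p\<in>G. \<Sum>q\<in>G. if viol p q then arc_sum J a b c p q else 0) =
      (\<Sum>p\<in>G. \<Sum>q\<in>G. \<Sum>i\<in>J. if p = a i \<and> q = b i then (if viol (a i) (b i) then c i else 0) else 0)"
  proof (intro sum.cong refl)
    fix p q
    show "(if viol p q then arc_sum J a b c p q else 0) = (\<Sum>i\<in>J. if p = a i \<and> q = b i then (if viol (a i) (b i) then c i else 0) else 0)"
      by (cases "viol p q") (auto simp: arc_sum_def intro!: sum.cong sum.neutral)
  qed
  also have "\<dots> = (\<Sum>i\<in>J. \<Sum>p\<in>G. \<Sum>q\<in>G. if p = a i \<and> q = b i then (if viol (a i) (b i) then c i else 0) else 0)"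
    by (simp add: sum.swap[of _ J G])
  also have "\<dots> = (\<Sum>i\<in>J. if viol (a i) (b i) then c i else 0)"
  proof (intro sum.cong refl)
    fix i assume i: "i \<in> J"
    define k where "k = (if viol (a i) (b i) then c i else 0)"
    have "(\<Sum>p\<in>G. \<Sum>q\<in>G. if p = a i \<and> q = b i then k else 0) = (\<Sum>p\<in>G. if p = a i then (\<Sum>q\<in>G. if q = b i then k else 0) else 0)"
      by (intro sum.cong) auto
    also have "\<dots> = k" using assms(1) assms(2)[OF i] by simp
    finally show "(\<Sum>p\<in>G. \<Sum>q\<in>G. if p = a i \<and> q = b i then (if viol (a i) (b i) then c i else 0) else 0) = (if viol (a i) (b i) then c i else 0)"
      by (simp only: k_def)
  qed
  finally show ?thesis .
qed

lemma sum_if_eq_count: "(\<Sum>z\<in>Pow (coords R n). if P z then k else 0) = k * cube_count R n P"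
  unfolding count_eq_sum sum_distrib_left by (intro sum.cong) auto

text \<open>
  \<open>D a\<close> is the distance from source \<open>a\<close>, in units in which the LP separates at distance \<open>2 ^ n\<close>. A
  labelling \<open>S\<close> of the vertices by sets of sources stands for the cut of the arcs on which it decreases.
\<close>

locale gap_gadget =
  fixes HV :: "nat set" and F :: "(nat \<times> nat) set" and A V :: "nat set" and E :: "(nat \<times> nat) set"
    and w l :: "nat \<times> nat \<Rightarrow> nat" and ter :: "nat \<Rightarrow> nat" and D :: "nat \<Rightarrow> nat \<Rightarrow> nat" and K :: real and n P Q :: nat
  assumes finite_HV: "finite HV" and finite_V: "finite V" and E_sub: "E \<subseteq> V \<times> V" and A_sub: "A \<subseteq> HV"
    and F_sub: "F \<subseteq> HV \<times> HV" and F_loopfree: "(s, s) \<notin> F" and ter_V: "ter ` HV \<subseteq> V"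
    and D_source: "a \<in> HV \<Longrightarrow> D a (ter a) = 0"
    and D_arc: "(u, v) \<in> E \<Longrightarrow> D a v \<le> D a u + l (u, v)"
    and D_sink: "(a, b) \<in> F \<Longrightarrow> a \<in> A \<Longrightarrow> b \<notin> A \<Longrightarrow> 2 ^ n \<le> D a (ter b)"
    and cut_ge: "(\<And>a b. (a, b) \<in> F \<Longrightarrow> a \<in> A \<Longrightarrow> b \<notin> A \<Longrightarrow> a \<in> S (ter a) \<and> a \<notin> S (ter b)) \<Longrightarrow>
       K \<le> (\<Sum>(u, v) | (u, v) \<in> E \<and> \<not> S u \<subseteq> S v. real (w (u, v)))"
    and K_pos: "0 < K" and P_pos: "0 < P"
begin

lemma finite_E: "finite E"
  using finite_subset[OF E_sub] finite_V by simp

lemma finite_A: "finite A"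
  using A_sub finite_HV by (rule finite_subset)

definition gverts :: "nat \<Rightarrow> gvert set" where
  "gverts R = Term ` HV \<union> (\<lambda>(s, v, z). Node s v z) ` (UNIV \<times> V \<times> Pow (coords R n))"

lemma finite_gverts: "finite (gverts R)"
  using finite_HV finite_V by (simp add: gverts_def)

lemma Node_in_gverts: "v \<in> V \<Longrightarrow> z \<subseteq> coords R n \<Longrightarrow> Node s v z \<in> gverts R"
  unfolding gverts_def by (rule UnI2, rule image_eqI[of _ _ "(s, v, z)"]) auto

text \<open>
  Shifted copies of the arcs of the gap instance, unit arcs along the edges of the cubes, and arcs of
  weight \<open>Q\<close> that link the cubes of the two endpoints of a constraint with permutation \<open>\<pi>\<close>.
\<close>

definition gwt :: "nat \<Rightarrow> (nat \<Rightarrow> nat) \<Rightarrow> gvert \<Rightarrow> gvert \<Rightarrow> nat" where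
  "gwt R \<pi> p q =
     arc_sum (E \<times> Pow (coords R n)) (\<lambda>(e, z). Node True (fst e) z)
       (\<lambda>(e, z). Node True (snd e) (shift R n (l e) z)) (\<lambda>(e, z). P * w e) p q +
     arc_sum (UNIV \<times> V \<times> coords R n \<times> Pow (coords R n)) (\<lambda>(s, v, x, z). Node s v z)
       (\<lambda>(s, v, x, z). Node s v (flip x z)) (\<lambda>_. 1) p q +
     arc_sum (V \<times> Pow (coords R n)) (\<lambda>(v, z). Node True v z) (\<lambda>(v, z). Node False v (permute \<pi> z)) (\<lambda>_. Q) p q +
     arc_sum (V \<times> Pow (coords R n)) (\<lambda>(v, z). Node False v (permute \<pi> z)) (\<lambda>(v, z). Node True v z) (\<lambda>_. Q) p q"

definition gcost :: "nat \<Rightarrow> (nat \<Rightarrow> nat) \<Rightarrow> (gvert \<Rightarrow> gvert \<Rightarrow> bool) \<Rightarrow> nat" where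
  "gcost R \<pi> viol = (\<Sum>p\<in>gverts R. \<Sum>q\<in>gverts R. if viol p q then gwt R \<pi> p q else 0)"

lemma gcost_eq:
  assumes "\<pi> permutes {..<R}"
  shows "gcost R \<pi> viol =
     (\<Sum>e\<in>E. P * w e * cube_count R n (\<lambda>z. viol (Node True (fst e) z) (Node True (snd e) (shift R n (l e) z)))) +
     (\<Sum>s\<in>UNIV. \<Sum>v\<in>V. \<Sum>x\<in>coords R n. cube_count R n (\<lambda>z. viol (Node s v z) (Node s v (flip x z)))) +
     Q * (\<Sum>v\<in>V. cube_count R n (\<lambda>z. viol (Node True v z) (Node False v (permute \<pi> z)))) +
     Q * (\<Sum>v\<in>V. cube_count R n (\<lambda>z. viol (Node False v (permute \<pi> z)) (Node True v z)))"
proof -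
  have split: "(if c then x1 + x2 + x3 + x4 else 0) =
      (if c then x1 else 0) + (if c then x2 else 0) + (if c then x3 else 0) + (if c then x4 else (0 :: nat))" for c x1 x2 x3 x4
    by simp
  have sh: "shift R n k z \<subseteq> coords R n" for k z by (auto simp: shift_def coords_def)
  have fl: "flip x z \<subseteq> coords R n" if "x \<in> coords R n" "z \<subseteq> coords R n" for x z
    using that by (auto simp: flip_def)
  have EV: "a \<in> V" "b \<in> V" if "(a, b) \<in> E" for a b using that E_sub by auto
  have 1: "(\<Sum>i\<in>E \<times> Pow (coords R n). if viol ((\<lambda>(e, z). Node True (fst e) z) i) ((\<lambda>(e, z). Node True (snd e) (shift R n (l e) z)) i)
       then (\<lambda>(e, z). P * w e) i else 0) = (\<Sum>e\<in>E. P * w e * cube_count R n (\<lambda>z. viol (Node True (fst e) z) (Node True (snd e) (shift R n (l e) z))))"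
    unfolding sum_if_eq_count[symmetric] sum.cartesian_product by (intro sum.cong) auto
  have 2: "(\<Sum>i\<in>UNIV \<times> V \<times> coords R n \<times> Pow (coords R n). if viol ((\<lambda>(s, v, x, z). Node s v z) i) ((\<lambda>(s, v, x, z). Node s v (flip x z)) i)
       then (\<lambda>_. 1) i else 0) = (\<Sum>s\<in>UNIV. \<Sum>v\<in>V. \<Sum>x\<in>coords R n. cube_count R n (\<lambda>z. viol (Node s v z) (Node s v (flip x z))))"
    unfolding count_eq_sum sum.cartesian_product by (intro sum.cong) auto
  have 3: "(\<Sum>i\<in>V \<times> Pow (coords R n). if viol ((\<lambda>(v, z). f v z) i) ((\<lambda>(v, z). g v z) i) then (\<lambda>_. Q) i else 0) =
      Q * (\<Sum>v\<in>V. cube_count R n (\<lambda>z. viol (f v z) (g v z)))" for f g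
    unfolding sum_distrib_left sum_if_eq_count[symmetric] sum.cartesian_product by (intro sum.cong) auto
  have pm: "permute \<pi> z \<subseteq> coords R n" if "z \<subseteq> coords R n" for z by (rule permute_subset[OF assms that])
  show ?thesis
    unfolding gcost_def gwt_def split sum.distrib 1[symmetric] 2[symmetric] 3[symmetric]
    by (intro arg_cong2[where f = "(+)"]; intro sum_arc_sum finite_gverts)
       (auto intro!: Node_in_gverts dest: EV sh[THEN subsetD] fl[THEN subsetD] pm[THEN subsetD])
qed

text \<open>A threshold cut: the label of the unique game selects the block that is read as the
  common threshold, and a source is kept at all vertices within that distance. A sink terminal gets
  every source that need not be cut from it, the largest set that the demands allow.\<close>

definition dictator :: "nat \<Rightarrow> nat \<Rightarrow> gvert \<Rightarrow> nat set" where
  "dictator i i' p = (case p of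
      Term s \<Rightarrow> if s \<in> A then {s} else {a \<in> A. (a, s) \<notin> F}
    | Node s v z \<Rightarrow> {a \<in> A. D a v \<le> block n (if s then i else i') z})"

text \<open>Along an arc \<open>e\<close> the threshold grows by \<open>l e\<close> and the distance
  by no more, so labels are lost only if the threshold wraps around, at a fraction
  \<open>l e / 2 ^ n\<close> of the points. A flip is noticed only inside the chosen block, on
  \<open>n\<close> edges per point. The links of weight \<open>Q\<close> are free if the labels
  satisfy the constraint, because \<open>permute\<close> carries one chosen block to the other;
  otherwise all of them are charged.\<close>

lemma gcost_dictator:
  assumes \<pi>: "\<pi> permutes {..<R}" and i: "i < R" "i' < R"
  shows "2 ^ n * gcost R \<pi> (\<lambda>p q. \<not> dictator i i' p \<subseteq> dictator i i' q) \<le>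
    cube_size R n * (P * (\<Sum>e\<in>E. w e * l e) + 2 ^ n * (2 * card V * n) + 2 ^ n * (if i' = \<pi> i then 0 else 2 * Q * card V))"
proof -
  define S where "S = dictator i i'"
  define Z where "Z = cube_size R n"
  define viol where "viol p q \<longleftrightarrow> \<not> S p \<subseteq> S q" for p q
  have S: "S (Node s v z) = {a \<in> A. D a v \<le> block n (if s then i else i') z}" for s v z by (simp add: S_def dictator_def)
  have c1: "2 ^ n * cube_count R n (\<lambda>z. viol (Node True (fst e) z) (Node True (snd e) (shift R n (l e) z))) \<le> Z * l e" if "e \<in> E" for e
  proof -
    \<comment> \<open>The thresholds that wrap around. If \<open>l e\<close> exceeds
      \<open>2 ^ n\<close>, truncated subtraction makes this all of them, and the bound still
      holds.\<close>
    define T where "T = {2 ^ n - l e..<2 ^ n}"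
    have "cube_count R n (\<lambda>z. viol (Node True (fst e) z) (Node True (snd e) (shift R n (l e) z))) \<le> cube_count R n (\<lambda>z. block n i z \<in> T)"
    proof (rule count_mono, rule ccontr)
      fix z assume v: "viol (Node True (fst e) z) (Node True (snd e) (shift R n (l e) z))" and "block n i z \<notin> T"
      then have "block n i z + l e < 2 ^ n" using block_less[of n i z] by (auto simp: T_def)
      then have "block n i (shift R n (l e) z) = block n i z + l e" using block_shift[OF i(1)] by simp
      moreover have "D a (snd e) \<le> block n i z + l e" if "D a (fst e) \<le> block n i z" for a
        using D_arc[of "fst e" "snd e" a] \<open>e \<in> E\<close> that by simp
      ultimately have "S (Node True (fst e) z) \<subseteq> S (Node True (snd e) (shift R n (l e) z))"
        unfolding S by auto
      then show False using v by (simp add: viol_def)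
    qed
    then have "2 ^ n * cube_count R n (\<lambda>z. viol (Node True (fst e) z) (Node True (snd e) (shift R n (l e) z))) \<le> 2 ^ n * cube_count R n (\<lambda>z. block n i z \<in> T)"
      by simp
    also have "\<dots> = Z * card T" unfolding Z_def by (rule count_block[OF i(1)]) (auto simp: T_def)
    also have "\<dots> \<le> Z * l e" by (auto simp: T_def)
    finally show ?thesis .
  qed
  have "2 ^ n * (\<Sum>e\<in>E. P * w e * cube_count R n (\<lambda>z. viol (Node True (fst e) z) (Node True (snd e) (shift R n (l e) z))))
     = (\<Sum>e\<in>E. P * w e * (2 ^ n * cube_count R n (\<lambda>z. viol (Node True (fst e) z) (Node True (snd e) (shift R n (l e) z)))))"
    by (simp add: sum_distrib_left mult_ac)
  also have "\<dots> \<le> (\<Sum>e\<in>E. P * w e * (Z * l e))" by (intro sum_mono mult_le_mono2 c1)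
  also have "\<dots> = Z * (P * (\<Sum>e\<in>E. w e * l e))" by (simp add: sum_distrib_left mult_ac)
  finally have 1: "2 ^ n * (\<Sum>e\<in>E. P * w e * cube_count R n (\<lambda>z. viol (Node True (fst e) z) (Node True (snd e) (shift R n (l e) z)))) \<le> Z * (P * (\<Sum>e\<in>E. w e * l e))" .
  have c2: "(\<Sum>x\<in>coords R n. cube_count R n (\<lambda>z. viol (Node s v z) (Node s v (flip x z)))) \<le> n * Z" for s v
  proof -
    define j where "j = (if s then i else i')"
    have "j < R" using i by (simp add: j_def)
    have "cube_count R n (\<lambda>z. viol (Node s v z) (Node s v (flip x z))) \<le> (if fst x = j then Z else 0)" for x
    proof (cases "fst x = j")
      case False
      then have "\<not> viol (Node s v z) (Node s v (flip x z))" for z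
        using block_flip[of j "fst x" n "snd x" z] unfolding viol_def S j_def[symmetric] by auto
      then show ?thesis by (simp add: cube_count_def)
    qed (simp add: count_le Z_def)
    then have "(\<Sum>x\<in>coords R n. cube_count R n (\<lambda>z. viol (Node s v z) (Node s v (flip x z)))) \<le> (\<Sum>x\<in>coords R n. if fst x = j then Z else 0)"
      by (rule sum_mono)
    also have "\<dots> = (\<Sum>k<R. \<Sum>b<n. if k = j then Z else 0)"
      unfolding coords_def sum.cartesian_product by (intro sum.cong) auto
    also have "\<dots> = (\<Sum>k<R. if k = j then n * Z else 0)" by (intro sum.cong) auto
    also have "\<dots> = n * Z" using \<open>j < R\<close> by simp
    finally show ?thesis .
  qed
  have "(\<Sum>s\<in>UNIV. \<Sum>v\<in>V. \<Sum>x\<in>coords R n. cube_count R n (\<lambda>z. viol (Node s v z) (Node s v (flip x z)))) \<le> (\<Sum>s\<in>(UNIV :: bool set). \<Sum>v\<in>V. n * Z)"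
    by (intro sum_mono c2)
  also have "\<dots> = Z * (2 * card V * n)" by (simp add: UNIV_bool)
  finally have 2: "(\<Sum>s\<in>UNIV. \<Sum>v\<in>V. \<Sum>x\<in>coords R n. cube_count R n (\<lambda>z. viol (Node s v z) (Node s v (flip x z)))) \<le> Z * (2 * card V * n)" .
  have 3: "Q * (\<Sum>v\<in>V. cube_count R n (\<lambda>z. viol (Node True v z) (Node False v (permute \<pi> z)))) +
     Q * (\<Sum>v\<in>V. cube_count R n (\<lambda>z. viol (Node False v (permute \<pi> z)) (Node True v z))) \<le> Z * (if i' = \<pi> i then 0 else 2 * Q * card V)"
  proof (cases "i' = \<pi> i")
    case True
    then have "S (Node True v z) = S (Node False v (permute \<pi> z))" for v z
      unfolding S by (simp add: block_permute[OF \<pi>])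
    then show ?thesis by (simp add: viol_def cube_count_def)
  next
    case False
    have "(\<Sum>v\<in>V. cube_count R n (f v)) \<le> card V * Z" for f
      using sum_bounded_above[of V "\<lambda>v. cube_count R n (f v)" Z] by (simp add: count_le Z_def)
    then have "Q * (\<Sum>v\<in>V. cube_count R n (f v)) \<le> Q * (card V * Z)" for f by (rule mult_le_mono2)
    from add_mono[OF this[of "\<lambda>v z. viol (Node True v z) (Node False v (permute \<pi> z))"]
         this[of "\<lambda>v z. viol (Node False v (permute \<pi> z)) (Node True v z)"]]
    have "Q * (\<Sum>v\<in>V. cube_count R n (\<lambda>z. viol (Node True v z) (Node False v (permute \<pi> z)))) +
      Q * (\<Sum>v\<in>V. cube_count R n (\<lambda>z. viol (Node False v (permute \<pi> z)) (Node True v z))) \<le> Q * (card V * Z) + Q * (card V * Z)" .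
    moreover have "Z * (2 * Q * card V) = Q * (card V * Z) + Q * (card V * Z)" by simp
    ultimately show ?thesis by (simp only: False if_False)
  qed
  have "2 ^ n * gcost R \<pi> viol \<le> Z * (P * (\<Sum>e\<in>E. w e * l e)) + 2 ^ n * (Z * (2 * card V * n)) + 2 ^ n * (Z * (if i' = \<pi> i then 0 else 2 * Q * card V))"
  proof -
    have gen: "k * c1 \<le> a \<Longrightarrow> c2 \<le> b \<Longrightarrow> c3 + c4 \<le> c \<Longrightarrow> k * (c1 + c2 + c3 + c4) \<le> a + k * b + k * c" for k a b c c1 c2 c3 c4 :: nat
    proof -
      assume "k * c1 \<le> a" "c2 \<le> b" "c3 + c4 \<le> c"
      then have "k * c1 + k * c2 + k * (c3 + c4) \<le> a + k * b + k * c" by (intro add_mono mult_le_mono2)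
      then show ?thesis by (simp only: distrib_left add.assoc)
    qed
    show ?thesis unfolding gcost_eq[OF \<pi>] by (rule gen[OF 1 2 3])
  qed
  then show ?thesis unfolding viol_def S_def Z_def by (simp add: algebra_simps)
qed

text \<open>The bound is half of the \<open>\<tau>\<close> at which influence is detected, because
  moving an influential coordinate across a constraint may cost up to
  \<open>\<tau> / 2\<close>.\<close>

definition labels :: "real \<Rightarrow> nat \<Rightarrow> (gvert \<Rightarrow> nat set) \<Rightarrow> bool \<Rightarrow> nat set" where
  "labels \<tau> R S s = {i. i < R \<and> (\<exists>b<n. \<exists>v\<in>V. \<exists>a\<in>A. \<tau> / 2 < influence (coords R n) (\<lambda>z. a \<in> S (Node s v z)) (i, b))}"

text \<open>Markov's inequality: for each vertex and source, total influence \<open>C\<close> leaves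
  room for at most \<open>2 * C / \<tau>\<close> coordinates of influence above
  \<open>\<tau> / 2\<close>.\<close>

lemma card_labels:
  assumes "0 < \<tau>" and C: "\<And>v a. v \<in> V \<Longrightarrow> a \<in> A \<Longrightarrow> (\<Sum>x\<in>coords R n. influence (coords R n) (\<lambda>z. a \<in> S (Node s v z)) x) \<le> C"
  shows "card (labels \<tau> R S s) \<le> card V * card A * (2 * C / \<tau>)"
proof -
  define X where "X = coords R n"
  define h where "h v a x = influence X (\<lambda>z. a \<in> S (Node s v z)) x" for v a x
  define B where "B v a = {x \<in> X. \<tau> / 2 < h v a x}" for v a
  have inf0: "0 \<le> h v a x" for v a x unfolding h_def influence_def by (rule mean_nonneg) simp
  have finB: "finite (B v a)" for v a by (simp add: B_def X_def)
  have "\<tau> / 2 * card (B v a) \<le> C" if "v \<in> V" "a \<in> A" for v a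
  proof -
    have "\<tau> / 2 * card (B v a) = (\<Sum>x\<in>B v a. \<tau> / 2)" by simp
    also have "\<dots> \<le> (\<Sum>x\<in>B v a. h v a x)" by (intro sum_mono) (auto simp: B_def)
    also have "\<dots> \<le> (\<Sum>x\<in>X. h v a x)" using inf0 by (intro sum_mono2) (auto simp: B_def X_def)
    finally show ?thesis using C[OF that] by (simp add: h_def X_def)
  qed
  then have B: "real (card (B v a)) \<le> 2 * C / \<tau>" if "v \<in> V" "a \<in> A" for v a
    using that assms(1) by (simp add: field_simps)
  have "labels \<tau> R S s \<subseteq> fst ` (\<Union>v\<in>V. \<Union>a\<in>A. B v a)"
  proof
    fix i assume "i \<in> labels \<tau> R S s"
    then obtain b v a where "i < R" "b < n" "v \<in> V" "a \<in> A" "\<tau> / 2 < h v a (i, b)"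
      by (auto simp: labels_def h_def X_def)
    then show "i \<in> fst ` (\<Union>v\<in>V. \<Union>a\<in>A. B v a)"
      by (intro image_eqI[of _ _ "(i, b)"]) (auto simp: B_def X_def coords_def)
  qed
  then have "card (labels \<tau> R S s) \<le> card (\<Union>v\<in>V. \<Union>a\<in>A. B v a)"
    using finB finite_V finite_A by (intro surj_card_le) auto
  also have "\<dots> \<le> (\<Sum>v\<in>V. card (\<Union>a\<in>A. B v a))" by (rule card_UN_le[OF finite_V])
  also have "\<dots> \<le> (\<Sum>v\<in>V. \<Sum>a\<in>A. card (B v a))" by (intro sum_mono card_UN_le finite_A)
  finally have "real (card (labels \<tau> R S s)) \<le> (\<Sum>v\<in>V. \<Sum>a\<in>A. real (card (B v a)))"
    by (metis (mono_tags, lifting) of_nat_le_iff of_nat_sum sum.cong)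
  also have "\<dots> \<le> (\<Sum>v\<in>V. \<Sum>a\<in>A. 2 * C / \<tau>)" by (intro sum_mono B)
  finally show ?thesis by (simp add: mult_ac)
qed

text \<open>If no function \<open>a \<in> S (Node True v z)\<close> of \<open>z\<close> had an
  influential coordinate, all would be almost constant. Rounded to constants they would form a cut
  of the gap instance, of weight at least \<open>K\<close>, and each arc of this cut is violated at
  nearly all points of the cube, which exceeds the cost. An influential coordinate on the left is
  then passed to the right by the heavy links.\<close>

lemma local_soundness:
  fixes \<delta> \<tau> :: real
  assumes \<delta>: "0 < \<delta>" "\<delta> < 1 / 2" and \<tau>: "0 < \<tau>" "4 * P * K \<le> \<tau> * Q"
    and kkl: "\<And>f. (\<And>x. x \<in> coords R n \<Longrightarrow> influence (coords R n) f x \<le> \<tau>) \<Longrightarrow>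
       (\<Sum>x\<in>coords R n. influence (coords R n) f x) \<le> 2 * P * K \<Longrightarrow>
       mean (coords R n) (\<lambda>z. of_bool (f z)) \<le> \<delta> \<or> 1 - \<delta> \<le> mean (coords R n) (\<lambda>z. of_bool (f z))"
    and \<pi>: "\<pi> permutes {..<R}"
    and S_source: "\<And>a z. a \<in> A \<Longrightarrow> z \<subseteq> coords R n \<Longrightarrow> a \<in> S (Node True (ter a) z)"
    and S_sink: "\<And>a b z. (a, b) \<in> F \<Longrightarrow> a \<in> A \<Longrightarrow> b \<notin> A \<Longrightarrow> z \<subseteq> coords R n \<Longrightarrow> a \<notin> S (Node True (ter b) z)"
    and S_sub: "\<And>p. S p \<subseteq> A"
    and cost: "real (gcost R \<pi> (\<lambda>p q. \<not> S p \<subseteq> S q)) < P * K * (1 - 2 * \<delta>) * cube_size R n"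
  shows "\<exists>i\<in>labels \<tau> R S True. \<pi> i \<in> labels \<tau> R S False"
    and "real (card (labels \<tau> R S s)) \<le> card V * card A * (4 * P * K / \<tau>)"
proof -
  define X where "X = coords R n"
  define Z where "Z = cube_size R n"
  have Z: "0 < real Z" by (simp add: Z_def cube_size_def)
  define viol where "viol p q \<longleftrightarrow> \<not> S p \<subseteq> S q" for p q
  define c1 where "c1 = (\<Sum>e\<in>E. P * w e * cube_count R n (\<lambda>z. viol (Node True (fst e) z) (Node True (snd e) (shift R n (l e) z))))"
  define c2 where "c2 = (\<Sum>s\<in>UNIV. \<Sum>v\<in>V. \<Sum>x\<in>coords R n. cube_count R n (\<lambda>z. viol (Node s v z) (Node s v (flip x z))))"
  define d where "d v = cube_count R n (\<lambda>z. viol (Node True v z) (Node False v (permute \<pi> z))) +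
      cube_count R n (\<lambda>z. viol (Node False v (permute \<pi> z)) (Node True v z))" for v
  have "gcost R \<pi> viol = c1 + c2 + Q * (\<Sum>v\<in>V. d v)"
    unfolding gcost_eq[OF \<pi>] c1_def c2_def d_def by (simp add: sum.distrib distrib_left)
  then have tot: "real c1 + real c2 + Q * (\<Sum>v\<in>V. real (d v)) < P * K * (1 - 2 * \<delta>) * Z"
    using cost unfolding viol_def Z_def by simp
  have nn: "0 \<le> real Q * (\<Sum>v\<in>V. real (d v))" by (intro mult_nonneg_nonneg sum_nonneg) auto
  have PK: "P * K * (1 - 2 * \<delta>) * Z \<le> P * K * Z"
    using mult_left_mono[of "1 - 2 * \<delta>" 1 "P * K"] K_pos \<delta> by (intro mult_right_mono) auto
  \<comment> \<open>An edge of the cube on which membership of \<open>a\<close> changes is violated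
    in one of its two directions, and flipping shows that both directions have the same count; hence
    the factor 2 against the cost of the unit arcs.\<close>
  have inflC: "(\<Sum>x\<in>X. influence X (\<lambda>z. a \<in> S (Node s v z)) x) \<le> 2 * P * K" if v: "v \<in> V" and a: "a \<in> A" for s v a
  proof -
    have "influence X (\<lambda>z. a \<in> S (Node s v z)) x * Z \<le> 2 * cube_count R n (\<lambda>z. viol (Node s v z) (Node s v (flip x z)))" if x: "x \<in> X" for x
    proof -
      have "influence X (\<lambda>z. a \<in> S (Node s v z)) x * Z = cube_count R n (\<lambda>z. (a \<in> S (Node s v z)) \<noteq> (a \<in> S (Node s v (flip x z))))"
        using Z unfolding X_def influence_eq_count Z_def by simp
      also have "\<dots> \<le> cube_count R n (\<lambda>z. viol (Node s v z) (Node s v (flip x z)) \<or> viol (Node s v (flip x z)) (Node s v z))"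
        by (intro of_nat_mono count_mono) (auto simp: viol_def)
      also have "\<dots> \<le> cube_count R n (\<lambda>z. viol (Node s v z) (Node s v (flip x z))) + cube_count R n (\<lambda>z. viol (Node s v (flip x z)) (Node s v z))"
        unfolding of_nat_add[symmetric] by (intro of_nat_mono count_disj)
      also have "cube_count R n (\<lambda>z. viol (Node s v (flip x z)) (Node s v z)) = cube_count R n (\<lambda>z. viol (Node s v z) (Node s v (flip x z)))"
        using count_reindex[OF bij_flip[OF x[unfolded X_def]], of "\<lambda>z. viol (Node s v z) (Node s v (flip x z))"] by simp
      finally show ?thesis by simp
    qed
    then have "(\<Sum>x\<in>X. influence X (\<lambda>z. a \<in> S (Node s v z)) x) * Z \<le> (\<Sum>x\<in>X. real (2 * cube_count R n (\<lambda>z. viol (Node s v z) (Node s v (flip x z)))))"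
      unfolding sum_distrib_right by (rule sum_mono)
    also have "\<dots> = 2 * real (\<Sum>x\<in>X. cube_count R n (\<lambda>z. viol (Node s v z) (Node s v (flip x z))))" by (simp add: sum_distrib_left)
    also have "(\<Sum>x\<in>X. cube_count R n (\<lambda>z. viol (Node s v z) (Node s v (flip x z)))) \<le> c2"
    proof -
      have "(\<Sum>x\<in>X. cube_count R n (\<lambda>z. viol (Node s v z) (Node s v (flip x z)))) \<le> (\<Sum>v\<in>V. \<Sum>x\<in>X. cube_count R n (\<lambda>z. viol (Node s v z) (Node s v (flip x z))))"
        using member_le_sum[OF v, of "\<lambda>v. \<Sum>x\<in>X. cube_count R n (\<lambda>z. viol (Node s v z) (Node s v (flip x z)))"] finite_V by simp
      also have "\<dots> \<le> c2" unfolding c2_def X_def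
        using member_le_sum[of s UNIV "\<lambda>s. \<Sum>v\<in>V. \<Sum>x\<in>coords R n. cube_count R n (\<lambda>z. viol (Node s v z) (Node s v (flip x z)))"] by simp
      finally show ?thesis .
    qed
    also have "real c2 \<le> P * K * Z" using tot nn PK by linarith
    finally have "(\<Sum>x\<in>X. influence X (\<lambda>z. a \<in> S (Node s v z)) x) * Z \<le> (2 * P * K) * Z" by simp
    then show ?thesis using Z by (rule mult_right_le_imp_le)
  qed
  show "real (card (labels \<tau> R S s)) \<le> card V * card A * (4 * P * K / \<tau>)"
    using card_labels[OF \<tau>(1), of R S s "2 * P * K"] inflC unfolding X_def by simp
  have ex: "\<exists>v\<in>V. \<exists>a\<in>A. \<exists>x\<in>X. \<tau> < influence X (\<lambda>z. a \<in> S (Node True v z)) x"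
  proof (rule ccontr)
    assume neg: "\<not> ?thesis"
    define \<mu> where "\<mu> v a = mean X (\<lambda>z. of_bool (a \<in> S (Node True v z)))" for v a
    have dich: "\<mu> v a \<le> \<delta> \<or> 1 - \<delta> \<le> \<mu> v a" if "v \<in> V" "a \<in> A" for v a
      unfolding \<mu>_def X_def using that neg inflC[OF that, of True]
      by (intro kkl) (auto simp: X_def not_less)
    define S' where "S' v = {a \<in> A. 1 / 2 \<le> \<mu> v a}" for v
    have "K \<le> (\<Sum>(u, v) | (u, v) \<in> E \<and> \<not> S' u \<subseteq> S' v. real (w (u, v)))"
    proof (rule cut_ge)
      fix a b assume ab: "(a, b) \<in> F" "a \<in> A" "b \<notin> A"
      have "\<mu> (ter a) a = mean X (\<lambda>_. 1)" unfolding \<mu>_def X_def using S_source[OF ab(2)] by (intro mean_cong) auto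
      moreover have "\<mu> (ter b) a = mean X (\<lambda>_. 0)" unfolding \<mu>_def X_def using S_sink[OF ab] by (intro mean_cong) auto
      ultimately show "a \<in> S' (ter a) \<and> a \<notin> S' (ter b)" using ab by (simp add: S'_def mean_const X_def)
    qed
    also have "\<dots> = (\<Sum>e | e \<in> E \<and> \<not> S' (fst e) \<subseteq> S' (snd e). real (w e))" by (intro sum.cong) auto
    finally have K: "K \<le> (\<Sum>e | e \<in> E \<and> \<not> S' (fst e) \<subseteq> S' (snd e). real (w e))" .
    \<comment> \<open>Some source is present at almost all points of the tail and absent at almost
      all points of the head. The shift preserves counts, so at most a fraction
      \<open>2 * \<delta>\<close> of the copies of \<open>e\<close> escapes violation.\<close>
    have ge: "(1 - 2 * \<delta>) * Z \<le> cube_count R n (\<lambda>z. viol (Node True (fst e) z) (Node True (snd e) (shift R n (l e) z)))"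
      if e: "e \<in> E" "\<not> S' (fst e) \<subseteq> S' (snd e)" for e
    proof -
      obtain a where "a \<in> S' (fst e)" "a \<notin> S' (snd e)" using e(2) by blast
      then have a: "a \<in> A" "1 / 2 \<le> \<mu> (fst e) a" "\<mu> (snd e) a < 1 / 2" by (auto simp: S'_def)
      have V: "fst e \<in> V" "snd e \<in> V" using e(1) E_sub by auto
      have "1 - \<delta> \<le> \<mu> (fst e) a" "\<mu> (snd e) a \<le> \<delta>" using dich[OF V(1) a(1)] dich[OF V(2) a(1)] a \<delta> by auto
      moreover have "\<mu> v a * Z = cube_count R n (\<lambda>z. a \<in> S (Node True v z))" for v
        using Z unfolding \<mu>_def X_def mean_eq_count Z_def by simp
      ultimately have 1: "(1 - \<delta>) * Z \<le> cube_count R n (\<lambda>z. a \<in> S (Node True (fst e) z))"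
          and 2: "cube_count R n (\<lambda>z. a \<in> S (Node True (snd e) z)) \<le> \<delta> * Z"
        using Z by (metis mult_right_mono less_imp_le)+
      have "cube_count R n (\<lambda>z. a \<in> S (Node True (fst e) z)) \<le>
          cube_count R n (\<lambda>z. viol (Node True (fst e) z) (Node True (snd e) (shift R n (l e) z)) \<or> a \<in> S (Node True (snd e) (shift R n (l e) z)))"
        by (rule count_mono) (auto simp: viol_def)
      also have "\<dots> \<le> cube_count R n (\<lambda>z. viol (Node True (fst e) z) (Node True (snd e) (shift R n (l e) z)))
          + cube_count R n (\<lambda>z. a \<in> S (Node True (snd e) (shift R n (l e) z)))" by (rule count_disj)
      also have "cube_count R n (\<lambda>z. a \<in> S (Node True (snd e) (shift R n (l e) z))) = cube_count R n (\<lambda>z. a \<in> S (Node True (snd e) z))"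
        by (rule count_reindex[OF bij_shift])
      finally have "real (cube_count R n (\<lambda>z. a \<in> S (Node True (fst e) z))) \<le>
          cube_count R n (\<lambda>z. viol (Node True (fst e) z) (Node True (snd e) (shift R n (l e) z))) + cube_count R n (\<lambda>z. a \<in> S (Node True (snd e) z))"
        by linarith
      then show ?thesis using 1 2 by (simp add: algebra_simps)
    qed
    have "P * K * (1 - 2 * \<delta>) * Z \<le> P * (\<Sum>e | e \<in> E \<and> \<not> S' (fst e) \<subseteq> S' (snd e). real (w e)) * ((1 - 2 * \<delta>) * Z)"
      using K \<delta> Z unfolding mult.assoc by (intro mult_left_mono mult_right_mono) auto
    also have "\<dots> = (\<Sum>e | e \<in> E \<and> \<not> S' (fst e) \<subseteq> S' (snd e). P * w e * ((1 - 2 * \<delta>) * Z))"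
      by (simp add: sum_distrib_left sum_distrib_right)
    also have "\<dots> \<le> (\<Sum>e | e \<in> E \<and> \<not> S' (fst e) \<subseteq> S' (snd e). P * w e * real (cube_count R n (\<lambda>z. viol (Node True (fst e) z) (Node True (snd e) (shift R n (l e) z)))))"
      using ge by (intro sum_mono mult_left_mono) auto
    also have "\<dots> \<le> (\<Sum>e\<in>E. P * w e * real (cube_count R n (\<lambda>z. viol (Node True (fst e) z) (Node True (snd e) (shift R n (l e) z)))))"
      using finite_E by (intro sum_mono2) auto
    also have "\<dots> = real c1" by (simp add: c1_def)
    finally show False using tot nn by linarith
  qed
  then obtain v a i b where v: "v \<in> V" "a \<in> A" and ib: "(i, b) \<in> X" and big: "\<tau> < influence X (\<lambda>z. a \<in> S (Node True v z)) (i, b)"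
    by auto
  have ib': "i < R" "b < n" using ib by (auto simp: X_def coords_def)
  define f where "f z \<longleftrightarrow> a \<in> S (Node True v z)" for z
  define g where "g z \<longleftrightarrow> a \<in> S (Node False v z)" for z
  have dv: "cube_count R n (\<lambda>z. f z \<noteq> g (permute \<pi> z)) \<le> d v"
  proof -
    have "cube_count R n (\<lambda>z. f z \<noteq> g (permute \<pi> z)) \<le> cube_count R n (\<lambda>z. viol (Node True v z) (Node False v (permute \<pi> z)) \<or> viol (Node False v (permute \<pi> z)) (Node True v z))"
      by (rule count_mono) (auto simp: viol_def f_def g_def)
    also have "\<dots> \<le> d v" unfolding d_def by (rule count_disj)
    finally show ?thesis .
  qed
  have "real Q * d v \<le> Q * (\<Sum>v\<in>V. real (d v))"
    using member_le_sum[OF v(1), of "\<lambda>v. real (d v)"] finite_V by (intro mult_left_mono) auto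
  then have Qd: "Q * real (d v) < P * K * Z" using tot PK by linarith
  have "0 < \<tau> * Q" using \<tau>(2) K_pos P_pos by (meson less_le_trans mult_pos_pos of_nat_0_less_iff zero_less_numeral)
  then have Q: "0 < real Q" using \<tau>(1) by (simp add: zero_less_mult_iff)
  have "4 * (P * K * Z) \<le> \<tau> * Q * Z" using mult_right_mono[OF \<tau>(2), of Z] by simp
  with Qd have "Q * (4 * real (d v)) < Q * (\<tau> * Z)" by (simp add: algebra_simps)
  then have d4: "4 * real (d v) < \<tau> * Z" using Q by simp
  have flX: "flip (i, b) z \<subseteq> coords R n" if "z \<subseteq> coords R n" for z using ib that by (auto simp: flip_def X_def)
  \<comment> \<open>Sensitivity of \<open>f\<close> at \<open>(i, b)\<close> is compared with that
    of \<open>g\<close> at \<open>(\<pi> i, b)\<close>: they can differ only where the two functions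
    disagree at the point or at its neighbour, which happens at most \<open>2 * d v\<close>
    times.\<close>
  have "cube_count R n (\<lambda>z. f z \<noteq> f (flip (i, b) z)) \<le> cube_count R n (\<lambda>z. (g (permute \<pi> z) \<noteq> g (flip (\<pi> i, b) (permute \<pi> z)) \<or> f z \<noteq> g (permute \<pi> z)) \<or> f (flip (i, b) z) \<noteq> g (permute \<pi> (flip (i, b) z)))"
    by (rule count_mono) (auto simp: permute_flip[OF \<pi>])
  also have "\<dots> \<le> cube_count R n (\<lambda>z. g (permute \<pi> z) \<noteq> g (flip (\<pi> i, b) (permute \<pi> z)) \<or> f z \<noteq> g (permute \<pi> z)) + cube_count R n (\<lambda>z. f (flip (i, b) z) \<noteq> g (permute \<pi> (flip (i, b) z)))"
    by (rule count_disj)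
  also have "cube_count R n (\<lambda>z. f (flip (i, b) z) \<noteq> g (permute \<pi> (flip (i, b) z))) = cube_count R n (\<lambda>z. f z \<noteq> g (permute \<pi> z))"
    by (rule count_reindex[OF bij_flip[OF ib[unfolded X_def]], of "\<lambda>z. f z \<noteq> g (permute \<pi> z)"])
  also have "cube_count R n (\<lambda>z. g (permute \<pi> z) \<noteq> g (flip (\<pi> i, b) (permute \<pi> z)) \<or> f z \<noteq> g (permute \<pi> z)) \<le>
      cube_count R n (\<lambda>z. g (permute \<pi> z) \<noteq> g (flip (\<pi> i, b) (permute \<pi> z))) + cube_count R n (\<lambda>z. f z \<noteq> g (permute \<pi> z))" by (rule count_disj)
  also have "cube_count R n (\<lambda>z. g (permute \<pi> z) \<noteq> g (flip (\<pi> i, b) (permute \<pi> z))) = cube_count R n (\<lambda>z. g z \<noteq> g (flip (\<pi> i, b) z))"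
    by (rule count_reindex[OF bij_permute[OF \<pi>], where P = "\<lambda>z. g z \<noteq> g (flip (\<pi> i, b) z)"])
  finally have le: "cube_count R n (\<lambda>z. f z \<noteq> f (flip (i, b) z)) \<le> cube_count R n (\<lambda>z. g z \<noteq> g (flip (\<pi> i, b) z)) + 2 * d v"
    using dv by linarith
  have inf_f: "influence X f (i, b) * Z = cube_count R n (\<lambda>z. f z \<noteq> f (flip (i, b) z))"
    and inf_g: "influence X g (\<pi> i, b) * Z = cube_count R n (\<lambda>z. g z \<noteq> g (flip (\<pi> i, b) z))"
    using Z unfolding X_def influence_eq_count Z_def by simp_all
  have "\<tau> * Z < influence X f (i, b) * Z" using big Z unfolding f_def by (intro mult_strict_right_mono)
  then have "\<tau> * Z < influence X g (\<pi> i, b) * Z + 2 * d v" using le unfolding inf_f inf_g by linarith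
  then have "\<tau> / 2 * Z < influence X g (\<pi> i, b) * Z" using d4 by simp
  then have big': "\<tau> / 2 < influence X g (\<pi> i, b)" using Z by simp
  have "\<pi> i < R" using permutes_in_image[OF \<pi>, of i] ib' by simp
  then have "\<pi> i \<in> labels \<tau> R S False"
    using big' ib' v unfolding labels_def X_def g_def by blast
  moreover have "i \<in> labels \<tau> R S True"
  proof -
    have "\<tau> / 2 < influence X (\<lambda>z. a \<in> S (Node True v z)) (i, b)" using big \<tau>(1) by linarith
    then show ?thesis using ib' v unfolding labels_def X_def by blast
  qed
  ultimately show "\<exists>i\<in>labels \<tau> R S True. \<pi> i \<in> labels \<tau> R S False" by blast
qed

end

section \<open>Completeness and soundness of the reduction\<close>

context gap_gadget
begin

text \<open>
  The arcs of infinite weight. They attach the terminals to the cubes and identify the cubes of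
  constraints that share an endpoint.
\<close>

definition forced :: "bool \<Rightarrow> bool \<Rightarrow> gvert \<Rightarrow> gvert \<Rightarrow> bool" where
  "forced su sv p q = (case p of
      Term s \<Rightarrow> (case q of Term t \<Rightarrow> s = t | Node _ v _ \<Rightarrow> s \<in> A \<and> v = ter s)
    | Node s v z \<Rightarrow> (case q of Term t \<Rightarrow> t \<notin> A \<and> v = ter t | Node _ _ _ \<Rightarrow> p = q \<and> (if s then su else sv)))"

lemma gwt_Term [simp]: "gwt R \<pi> (Term s) q = 0" "gwt R \<pi> p (Term s) = 0"
  by (auto simp: gwt_def arc_sum_def intro!: sum.neutral)

lemma gcost_mono:
  assumes "\<And>p q. p \<in> gverts R \<Longrightarrow> q \<in> gverts R \<Longrightarrow> viol p q \<Longrightarrow> gwt R \<pi> p q \<noteq> 0 \<Longrightarrow> viol' p q"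
  shows "gcost R \<pi> viol \<le> gcost R \<pi> viol'"
  unfolding gcost_def
proof (intro sum_mono)
  fix p q assume "p \<in> gverts R" "q \<in> gverts R"
  then show "(if viol p q then gwt R \<pi> p q else 0) \<le> (if viol' p q then gwt R \<pi> p q else 0)"
    using assms[of p q] by (cases "gwt R \<pi> p q = 0") auto
qed

section \<open>Cuts of the whole instance\<close>

definition positions :: "nat \<Rightarrow> nat \<Rightarrow> (nat \<times> gvert) set" where
  "positions m R = {..<m} \<times> gverts R"

lemma finite_positions: "finite (positions m R)"
  by (simp add: positions_def finite_gverts)

definition awt :: "nat \<Rightarrow> (nat \<Rightarrow> nat) \<Rightarrow> (nat \<Rightarrow> nat) \<Rightarrow> (nat \<Rightarrow> nat \<Rightarrow> nat) \<Rightarrow> nat \<Rightarrow> nat \<times> gvert \<Rightarrow> nat \<times> gvert \<Rightarrow> nat" where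
  "awt R us vs ps big x y = (if forced (us (fst x) = us (fst y)) (vs (fst x) = vs (fst y)) (snd x) (snd y) then big
     else if fst x = fst y then gwt R (ps (fst x)) (snd x) (snd y) else 0)"

definition unforced :: "(nat \<Rightarrow> nat) \<Rightarrow> (nat \<Rightarrow> nat) \<Rightarrow> ((nat \<times> gvert) \<times> (nat \<times> gvert)) set \<Rightarrow> bool" where
  "unforced us vs C \<longleftrightarrow> (\<forall>(x, y)\<in>C. \<not> forced (us (fst x) = us (fst y)) (vs (fst x) = vs (fst y)) (snd x) (snd y))"

text \<open>Forced arcs tie the copies of a terminal in all constraints together, so those of
  constraint 0 can represent them. The demands are all those of \<open>H\<close>, not only the
  bipartite piece.\<close>

definition separating :: "nat \<Rightarrow> nat \<Rightarrow> ((nat \<times> gvert) \<times> (nat \<times> gvert)) set \<Rightarrow> bool" where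
  "separating m R C \<longleftrightarrow> C \<subseteq> positions m R \<times> positions m R \<and>
     (\<forall>(s, t)\<in>F. ((0, Term s), (0, Term t)) \<notin> (positions m R \<times> positions m R - C)\<^sup>*)"

lemma sum_awt:
  assumes C: "C \<subseteq> positions m R \<times> positions m R" and u: "unforced us vs C"
  shows "(\<Sum>(x, y)\<in>C. awt R us vs ps big x y) = (\<Sum>j<m. gcost R (ps j) (\<lambda>p q. ((j, p), (j, q)) \<in> C))"
proof -
  have fin: "finite (positions m R \<times> positions m R)" using finite_positions by simp
  have "(\<Sum>(x, y)\<in>C. awt R us vs ps big x y) =
      (\<Sum>(x, y)\<in>C. if fst x = fst y then gwt R (ps (fst x)) (snd x) (snd y) else 0)"
    using u by (intro sum.cong) (auto simp: awt_def unforced_def)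
  also have "\<dots> = (\<Sum>(x, y)\<in>positions m R \<times> positions m R. if (x, y) \<in> C \<and> fst x = fst y then gwt R (ps (fst x)) (snd x) (snd y) else 0)"
    using C fin by (intro sum.mono_neutral_cong_left) (auto split: if_splits)
  also have "\<dots> = (\<Sum>j<m. \<Sum>p\<in>gverts R. \<Sum>j'<m. \<Sum>q\<in>gverts R. if ((j, p), (j', q)) \<in> C \<and> j = j' then gwt R (ps j) p q else 0)"
    unfolding positions_def by (simp add: sum.cartesian_product' cong: if_cong)
  also have "\<dots> = (\<Sum>j<m. \<Sum>p\<in>gverts R. \<Sum>q\<in>gverts R. if ((j, p), (j, q)) \<in> C then gwt R (ps j) p q else 0)"
  proof (intro sum.cong refl)
    fix j p assume j: "j \<in> {..<m}"
    have "(\<Sum>j'<m. \<Sum>q\<in>gverts R. if ((j, p), (j', q)) \<in> C \<and> j = j' then gwt R (ps j) p q else 0) =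
       (\<Sum>j'<m. if j' = j then (\<Sum>q\<in>gverts R. if ((j, p), (j, q)) \<in> C then gwt R (ps j) p q else 0) else 0)"
      by (intro sum.cong) (auto intro!: sum.cong)
    also have "\<dots> = (\<Sum>q\<in>gverts R. if ((j, p), (j, q)) \<in> C then gwt R (ps j) p q else 0)" using j by simp
    finally show "(\<Sum>j'<m. \<Sum>q\<in>gverts R. if ((j, p), (j', q)) \<in> C \<and> j = j' then gwt R (ps j) p q else 0) =
       (\<Sum>q\<in>gverts R. if ((j, p), (j, q)) \<in> C then gwt R (ps j) p q else 0)" .
  qed
  finally show ?thesis by (simp add: gcost_def)
qed

lemma completeness:
  assumes m: "0 < m" and ps: "\<And>j. j < m \<Longrightarrow> ps j permutes {..<R}"
    and f: "\<And>j. j < m \<Longrightarrow> f (us j) < R" and g: "\<And>j. j < m \<Longrightarrow> g (vs j) < R"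
    and unsat: "card {j. j < m \<and> g (vs j) \<noteq> ps j (f (us j))} \<le> N"
  obtains C where "separating m R C" "unforced us vs C"
    "2 ^ n * (\<Sum>(x, y)\<in>C. awt R us vs ps big x y) \<le>
       cube_size R n * (m * (P * (\<Sum>e\<in>E. w e * l e) + 2 ^ n * (2 * card V * n)) + N * (2 ^ n * (2 * Q * card V)))"
proof -
  define S where "S x = dictator (f (us (fst x))) (g (vs (fst x))) (snd x)" for x :: "nat \<times> gvert"
  define frc where "frc x y = forced (us (fst x) = us (fst y)) (vs (fst x) = vs (fst y)) (snd x) (snd y)" for x y :: "nat \<times> gvert"
  \<comment> \<open>Arcs of weight 0 and all unforced arcs between different constraints are cut as
    well; the weight comes only from arcs inside a constraint along which the dictator labels
    shrink.\<close>
  define C where "C = {(x, y). x \<in> positions m R \<and> y \<in> positions m R \<and> \<not> frc x y \<and>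
      (fst x \<noteq> fst y \<or> gwt R (ps (fst x)) (snd x) (snd y) = 0 \<or> \<not> S x \<subseteq> S y)}"
  define U where "U = positions m R \<times> positions m R - C"
  have C_sub: "C \<subseteq> positions m R \<times> positions m R" by (auto simp: C_def)
  have unf: "unforced us vs C" by (auto simp: unforced_def C_def frc_def)
  have frcS: "S x \<subseteq> S y" if "frc x y" "x \<in> positions m R" "y \<in> positions m R" for x y
  proof (cases "snd x")
    case (Term s)
    show ?thesis
    proof (cases "snd y")
      case (Term t)
      then show ?thesis using that(1) \<open>snd x = Term s\<close> by (simp add: frc_def forced_def S_def dictator_def)
    next
      case (Node s' v z)
      then have "s \<in> A" "v = ter s" using that(1) Term by (auto simp: frc_def forced_def)
      then show ?thesis using Node Term D_source[of s] A_sub by (auto simp: S_def dictator_def)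
    qed
  next
    case (Node s v z)
    show ?thesis
    proof (cases "snd y")
      case (Term t)
      then have t: "t \<notin> A" "v = ter t" using that(1) Node by (auto simp: frc_def forced_def)
      have "(a, t) \<notin> F" if "a \<in> A" "D a (ter t) \<le> block n i z" for a i
        using D_sink[of a t] that t block_less[of n i z] by auto
      then show ?thesis using Node Term t by (auto simp: S_def dictator_def)
    next
      case Node': (Node s' v' z')
      then have y: "snd y = Node s v z" "if s then us (fst x) = us (fst y) else vs (fst x) = vs (fst y)"
        using that(1) Node by (auto simp: frc_def forced_def)
      show ?thesis using Node y by (auto simp: S_def dictator_def split: if_splits)
    qed
  qed
  have US: "S x \<subseteq> S y" if "(x, y) \<in> U" for x y
    using that frcS[of x y] by (auto simp: U_def C_def)
  \<comment> \<open>No arc of finite positive weight touches a terminal, so a terminal outside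
    \<open>A\<close> keeps only the arcs to its own copies. Demands that start there are separated
    at no cost.\<close>
  have UT: "snd y = Term s" if "(x, y) \<in> U" "snd x = Term s" "s \<notin> A" for x y s
  proof -
    have "frc x y" using that by (auto simp: U_def C_def)
    then show ?thesis using that by (cases "snd y") (auto simp: frc_def forced_def)
  qed
  have "separating m R C"
    unfolding separating_def U_def[symmetric]
  proof (intro conjI C_sub ballI, clarify)
    fix s t assume st: "(s, t) \<in> F" and r: "((0, Term s), (0, Term t)) \<in> U\<^sup>*"
    have "s \<noteq> t" using st F_loopfree by auto
    show False
    proof (cases "s \<in> A")
      case True
      have "S x \<subseteq> S y" if "(x, y) \<in> U\<^sup>*" for x y using that by (induction rule: rtrancl_induct) (use US in blast)+
      from this[OF r] show False using True \<open>s \<noteq> t\<close> st by (auto simp: S_def dictator_def split: if_splits)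
    next
      case False
      have "snd y = Term s" if "(x, y) \<in> U\<^sup>*" "snd x = Term s" for x y
        using that by (induction rule: rtrancl_induct) (use UT False in blast)+
      from this[OF r] show False using \<open>s \<noteq> t\<close> by simp
    qed
  qed
  moreover have "2 ^ n * (\<Sum>(x, y)\<in>C. awt R us vs ps big x y) \<le>
       cube_size R n * (m * (P * (\<Sum>e\<in>E. w e * l e) + 2 ^ n * (2 * card V * n)) + N * (2 ^ n * (2 * Q * card V)))"
  proof -
    define X where "X = P * (\<Sum>e\<in>E. w e * l e) + 2 ^ n * (2 * card V * n)"
    define Y where "Y = 2 ^ n * (2 * Q * card V)"
    have Y_if: "2 ^ n * (if c then 0 else 2 * Q * card V) = (if c then 0 else Y)" for c by (simp add: Y_def)
    have le: "2 ^ n * gcost R (ps j) (\<lambda>p q. ((j, p), (j, q)) \<in> C) \<le> cube_size R n * (X + (if g (vs j) = ps j (f (us j)) then 0 else Y))"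
      if j: "j < m" for j
    proof -
      have "gcost R (ps j) (\<lambda>p q. ((j, p), (j, q)) \<in> C) \<le>
          gcost R (ps j) (\<lambda>p q. \<not> dictator (f (us j)) (g (vs j)) p \<subseteq> dictator (f (us j)) (g (vs j)) q)"
        by (rule gcost_mono) (auto simp: C_def S_def)
      then have "2 ^ n * gcost R (ps j) (\<lambda>p q. ((j, p), (j, q)) \<in> C) \<le>
          2 ^ n * gcost R (ps j) (\<lambda>p q. \<not> dictator (f (us j)) (g (vs j)) p \<subseteq> dictator (f (us j)) (g (vs j)) q)" by (rule mult_le_mono2)
      also have "\<dots> \<le> cube_size R n * (X + (if g (vs j) = ps j (f (us j)) then 0 else Y))"
        by (rule gcost_dictator[OF ps[OF j] f[OF j] g[OF j], folded X_def, unfolded Y_if])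
      finally show ?thesis .
    qed
    have "2 ^ n * (\<Sum>(x, y)\<in>C. awt R us vs ps big x y) = (\<Sum>j<m. 2 ^ n * gcost R (ps j) (\<lambda>p q. ((j, p), (j, q)) \<in> C))"
      unfolding sum_awt[OF C_sub unf] sum_distrib_left ..
    also have "\<dots> \<le> (\<Sum>j<m. cube_size R n * (X + (if g (vs j) = ps j (f (us j)) then 0 else Y)))"
      using le by (intro sum_mono) auto
    also have "\<dots> = cube_size R n * (m * X + (\<Sum>j<m. if g (vs j) \<noteq> ps j (f (us j)) then Y else 0))"
    proof -
      have "(\<Sum>j<m. if g (vs j) = ps j (f (us j)) then 0 else Y) = (\<Sum>j<m. if g (vs j) \<noteq> ps j (f (us j)) then Y else 0)"
        by (intro sum.cong) auto
      then show ?thesis unfolding sum_distrib_left[symmetric] sum.distrib by (simp only: sum_constant card_lessThan of_nat_id)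
    qed
    also have "(\<Sum>j<m. if g (vs j) \<noteq> ps j (f (us j)) then Y else 0) = card {j. j < m \<and> g (vs j) \<noteq> ps j (f (us j))} * Y"
    proof -
      have "(\<Sum>j<m. if g (vs j) \<noteq> ps j (f (us j)) then Y else 0) = (\<Sum>j\<in>{j \<in> {..<m}. g (vs j) \<noteq> ps j (f (us j))}. Y)"
        by (rule sum.inter_filter[symmetric]) simp
      also have "{j \<in> {..<m}. g (vs j) \<noteq> ps j (f (us j))} = {j. j < m \<and> g (vs j) \<noteq> ps j (f (us j))}" by auto
      finally show ?thesis by simp
    qed
    also have "cube_size R n * (m * X + card {j. j < m \<and> g (vs j) \<noteq> ps j (f (us j))} * Y) \<le> cube_size R n * (m * X + N * Y)"
      using unsat by (intro mult_le_mono2 add_left_mono mult_le_mono1)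
    finally show ?thesis by (simp add: X_def Y_def)
  qed
  ultimately show ?thesis using that unf by blast
qed

text \<open>The label of a point is the set of sources in \<open>A\<close> that still reach it.
  Forced arcs make these sets, and hence the influential coordinates, depend on the endpoint in the
  unique game and not on the constraint. By averaging, more than a fraction \<open>\<delta>\<close>
  of the constraints are cheap, and \<open>local_soundness\<close> gives each of them a matching
  pair of influential coordinates.\<close>

lemma soundness:
  fixes \<delta> \<tau> :: real
  assumes m: "0 < m" and R: "0 < R" and ps: "\<And>j. j < m \<Longrightarrow> ps j permutes {..<R}"
    and \<delta>: "0 < \<delta>" "\<delta> < 1 / 2" and \<tau>: "0 < \<tau>" "4 * P * K \<le> \<tau> * Q"
    and kkl: "\<And>f. (\<And>x. x \<in> coords R n \<Longrightarrow> influence (coords R n) f x \<le> \<tau>) \<Longrightarrow>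
       (\<Sum>x\<in>coords R n. influence (coords R n) f x) \<le> 2 * P * K \<Longrightarrow>
       mean (coords R n) (\<lambda>z. of_bool (f z)) \<le> \<delta> \<or> 1 - \<delta> \<le> mean (coords R n) (\<lambda>z. of_bool (f z))"
    and \<Lambda>: "real (card V * card A) * (4 * P * K / \<tau>) \<le> \<Lambda>"
    and sep: "separating m R C" and unf: "unforced us vs C"
    and cost: "real (\<Sum>(x, y)\<in>C. awt R us vs ps big x y) < P * K * (1 - 3 * \<delta>) * cube_size R n * m"
  obtains f g where "\<And>u. f u < R" "\<And>v. g v < R"
    "\<delta> * m \<le> real \<Lambda> * real \<Lambda> * real (card {j. j < m \<and> g (vs j) = ps j (f (us j))})"
proof -
  define Z where "Z = cube_size R n"
  have Z: "0 < real Z" by (simp add: Z_def cube_size_def)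
  define U where "U = positions m R \<times> positions m R - C"
  define frc where "frc x y = forced (us (fst x) = us (fst y)) (vs (fst x) = vs (fst y)) (snd x) (snd y)" for x y :: "nat \<times> gvert"
  have C_sub: "C \<subseteq> positions m R \<times> positions m R" using sep by (simp add: separating_def)
  have frcU: "(x, y) \<in> U" if "frc x y" "x \<in> positions m R" "y \<in> positions m R" for x y
    using that unf by (auto simp: U_def unforced_def frc_def)
  define S where "S j p = {a \<in> A. ((0, Term a), (j, p)) \<in> U\<^sup>*}" for j p
  have Ustep: "S j p \<subseteq> S j' q" if "((j, p), (j', q)) \<in> U" for j p j' q
    using that by (auto simp: S_def intro: rtrancl_into_rtrancl)
  have S_empty: "S j (Node s v z) = {}" if "Node s v z \<notin> gverts R" for j s v z
  proof -
    have "y = (0, Term a) \<or> y \<in> positions m R" if "((0, Term a), y) \<in> U\<^sup>*" for y a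
      using that by (cases rule: rtrancl.cases) (auto simp: U_def)
    then show ?thesis using that by (fastforce simp: S_def positions_def)
  qed
  have HVpos: "(j, Term a) \<in> positions m R" if "a \<in> HV" "j < m" for a j
    using that by (auto simp: positions_def gverts_def)
  have NodePos: "(j, Node s (ter a) z) \<in> positions m R" if "a \<in> HV" "j < m" "z \<subseteq> coords R n" for a j s z
    using that ter_V by (auto simp: positions_def intro!: Node_in_gverts)
  have S_source: "a \<in> S j (Node s (ter a) z)" if "a \<in> A" "z \<subseteq> coords R n" "j < m" for a j s z
  proof -
    have "((0, Term a), (j, Node s (ter a) z)) \<in> U"
      using that m A_sub by (intro frcU HVpos NodePos) (auto simp: frc_def forced_def)
    then show ?thesis using that by (auto simp: S_def)
  qed
  have S_sink: "a \<notin> S j (Node s (ter b) z)" if ab: "(a, b) \<in> F" "a \<in> A" "b \<notin> A" "z \<subseteq> coords R n" "j < m" for a b j s z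
  proof
    assume "a \<in> S j (Node s (ter b) z)"
    then have "((0, Term a), (j, Node s (ter b) z)) \<in> U\<^sup>*" by (simp add: S_def)
    moreover have "((j, Node s (ter b) z), (0, Term b)) \<in> U"
      using ab m F_sub by (intro frcU HVpos NodePos) (auto simp: frc_def forced_def)
    ultimately have "((0, Term a), (0, Term b)) \<in> U\<^sup>*" by (rule rtrancl_into_rtrancl)
    then show False using sep ab by (auto simp: separating_def U_def)
  qed
  have S_eq: "S j (Node s v z) = S j' (Node s v z)" if "j < m" "j' < m" "if s then us j = us j' else vs j = vs j'" for j j' s v z
  proof (cases "Node s v z \<in> gverts R")
    case True
    then have "((j, Node s v z), (j', Node s v z)) \<in> U" "((j', Node s v z), (j, Node s v z)) \<in> U"
      using that by (auto intro!: frcU simp: positions_def frc_def forced_def split: if_splits)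
    then show ?thesis using Ustep by (meson subset_antisym)
  qed (simp add: S_empty)
  define L where "L j s = labels \<tau> R (S j) s" for j s
  have L_eq: "L j s = L j' s" if "j < m" "j' < m" "if s then us j = us j' else vs j = vs j'" for j j' s
    unfolding L_def labels_def S_eq[OF that] ..
  have finL: "finite (L j s)" for j s by (rule finite_subset[of _ "{..<R}"]) (auto simp: L_def labels_def)
  have L_R: "i < R" if "i \<in> L j s" for i j s using that by (simp add: L_def labels_def)
  define c where "c j = real (gcost R (ps j) (\<lambda>p q. ((j, p), (j, q)) \<in> C))" for j
  define B where "B = P * K * (1 - 2 * \<delta>) * Z"
  have "0 < B" unfolding B_def using K_pos P_pos \<delta> Z by simp
  \<comment> \<open>If there were few of these, the remaining constraints alone would use up the
    budget: a loss of \<open>3 * \<delta>\<close> in total against \<open>2 * \<delta>\<close> per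
    constraint leaves a fraction \<open>\<delta>\<close>.\<close>
  define Gd where "Gd = {j. j < m \<and> c j < B}"
  have "B * (m - card Gd) \<le> (\<Sum>j<m. c j)"
  proof -
    have "card ({..<m} - Gd) = m - card Gd" by (subst card_Diff_subset) (auto simp: Gd_def)
    then have "B * (m - card Gd) = (\<Sum>j\<in>{..<m} - Gd. B)" by simp
    also have "\<dots> \<le> (\<Sum>j\<in>{..<m} - Gd. c j)" by (intro sum_mono) (auto simp: Gd_def)
    also have "\<dots> \<le> (\<Sum>j<m. c j)" by (intro sum_mono2) (auto simp: c_def)
    finally show ?thesis .
  qed
  also have "\<dots> = real (\<Sum>(x, y)\<in>C. awt R us vs ps big x y)" unfolding sum_awt[OF C_sub unf] c_def by simp
  also have "\<dots> < P * K * (1 - 3 * \<delta>) * Z * m" using cost by (simp add: Z_def)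
  finally have lt: "B * (m - card Gd) < P * K * (1 - 3 * \<delta>) * Z * m" .
  have "card Gd \<le> card {..<m}" by (rule card_mono) (auto simp: Gd_def)
  then have cG: "real (m - card Gd) = real m - real (card Gd)" by (simp add: of_nat_diff)
  have "P * K * Z * ((1 - 2 * \<delta>) * (real m - card Gd)) < P * K * Z * ((1 - 3 * \<delta>) * m)"
    using lt unfolding B_def cG by (simp add: mult_ac)
  moreover have "0 < P * K * Z" using K_pos P_pos Z by simp
  ultimately have "(1 - 2 * \<delta>) * (real m - card Gd) < (1 - 3 * \<delta>) * m" using mult_less_cancel_left_pos by blast
  then have "\<delta> * m < (1 - 2 * \<delta>) * card Gd" by (simp add: algebra_simps)
  also have "\<dots> \<le> 1 * real (card Gd)" using \<delta> by (intro mult_right_mono) auto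
  finally have Gd_big: "\<delta> * m < card Gd" by simp
  have good: "\<exists>i\<in>L j True. ps j i \<in> L j False" "card (L j s) \<le> \<Lambda>" if "j \<in> Gd" for j s
  proof -
    have j: "j < m" "c j < B" using that by (auto simp: Gd_def)
    have "gcost R (ps j) (\<lambda>p q. \<not> S j p \<subseteq> S j q) \<le> gcost R (ps j) (\<lambda>p q. ((j, p), (j, q)) \<in> C)"
    proof (rule gcost_mono)
      fix p q assume "p \<in> gverts R" "q \<in> gverts R" "\<not> S j p \<subseteq> S j q"
      then show "((j, p), (j, q)) \<in> C" using Ustep[of j p j q] j(1) by (auto simp: U_def positions_def)
    qed
    then have cost': "real (gcost R (ps j) (\<lambda>p q. \<not> S j p \<subseteq> S j q)) < P * K * (1 - 2 * \<delta>) * cube_size R n"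
      using j(2) by (simp add: c_def B_def Z_def)
    have sub: "S j p \<subseteq> A" for p by (auto simp: S_def)
    note ls = local_soundness[OF \<delta> \<tau> kkl ps[OF j(1)], of "S j", OF _ _ S_source S_sink sub cost']
    show "\<exists>i\<in>L j True. ps j i \<in> L j False" unfolding L_def by (rule ls(1)) (use j in auto)
    have "real (card (L j s)) \<le> real (card V * card A) * (4 * P * K / \<tau>)" unfolding L_def by (rule ls(2)) (use j in auto)
    then show "card (L j s) \<le> \<Lambda>" using \<Lambda> by linarith
  qed
  \<comment> \<open>The usual random choice from a label list is replaced by a position in it: every
    cheap constraint is satisfied for some pair of positions below \<open>\<Lambda>\<close>, so one
    of the \<open>\<Lambda> * \<Lambda>\<close> labellings gets its share. The default 0 is a valid
    label because \<open>R\<close> is positive.\<close>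
  define pick where "pick J r s = (let xs = sorted_list_of_set (L J s) in if r < length xs then xs ! r else 0)" for J r s
  have pick_R: "pick J r s < R" for J r s
    using L_R[of "sorted_list_of_set (L J s) ! r" J s] R finL
    by (auto simp: pick_def Let_def) (metis finL nth_mem set_sorted_list_of_set sorted_list_of_set.length_sorted_key_list_of_set)
  have pick_ex: "\<exists>r<\<Lambda>. pick j r s = i" if "j \<in> Gd" "i \<in> L j s" for j s i
  proof -
    have "i \<in> set (sorted_list_of_set (L j s))" using that finL by simp
    then obtain r where r: "r < length (sorted_list_of_set (L j s))" "sorted_list_of_set (L j s) ! r = i" by (metis in_set_conv_nth)
    moreover have "length (sorted_list_of_set (L j s)) \<le> \<Lambda>" using good(2)[OF that(1)] by simp
    ultimately show ?thesis by (intro exI[of _ r]) (auto simp: pick_def Let_def)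
  qed
  define f where "f r u = pick (SOME j. j < m \<and> us j = u) r True" for r u
  define g where "g r v = pick (SOME j. j < m \<and> vs j = v) r False" for r v
  have fj: "f r (us j) = pick j r True" "g r (vs j) = pick j r False" if "j < m" for r j
  proof -
    have "(SOME j'. j' < m \<and> us j' = us j) < m \<and> us (SOME j'. j' < m \<and> us j' = us j) = us j"
      by (rule someI[of "\<lambda>j'. j' < m \<and> us j' = us j" j]) (use that in simp)
    then show "f r (us j) = pick j r True" unfolding f_def pick_def using L_eq[OF _ that, of _ True] by simp
    have "(SOME j'. j' < m \<and> vs j' = vs j) < m \<and> vs (SOME j'. j' < m \<and> vs j' = vs j) = vs j"
      by (rule someI[of "\<lambda>j'. j' < m \<and> vs j' = vs j" j]) (use that in simp)
    then show "g r (vs j) = pick j r False" unfolding g_def pick_def using L_eq[OF _ that, of _ False] by simp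
  qed
  define sat where "sat r r' = {j. j < m \<and> g r' (vs j) = ps j (f r (us j))}" for r r'
  have fin_sat: "finite (sat r r')" for r r' by (simp add: sat_def)
  have "Gd \<subseteq> (\<Union>r<\<Lambda>. \<Union>r'<\<Lambda>. sat r r')"
  proof
    fix j assume j: "j \<in> Gd"
    then have jm: "j < m" by (simp add: Gd_def)
    obtain i where i: "i \<in> L j True" "ps j i \<in> L j False" using good(1)[OF j] by blast
    obtain r r' where "r < \<Lambda>" "pick j r True = i" "r' < \<Lambda>" "pick j r' False = ps j i"
      using pick_ex[OF j i(1)] pick_ex[OF j i(2)] by blast
    then show "j \<in> (\<Union>r<\<Lambda>. \<Union>r'<\<Lambda>. sat r r')" using jm by (auto simp: sat_def fj[OF jm])
  qed
  then have "card Gd \<le> card (\<Union>r<\<Lambda>. \<Union>r'<\<Lambda>. sat r r')" using fin_sat by (intro card_mono) auto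
  also have "\<dots> \<le> (\<Sum>r<\<Lambda>. card (\<Union>r'<\<Lambda>. sat r r'))" by (rule card_UN_le) simp
  also have "\<dots> \<le> (\<Sum>r<\<Lambda>. \<Sum>r'<\<Lambda>. card (sat r r'))" by (intro sum_mono card_UN_le) simp
  finally have tot: "card Gd \<le> (\<Sum>r<\<Lambda>. \<Sum>r'<\<Lambda>. card (sat r r'))" .
  have "\<exists>r r'. \<delta> * m \<le> real \<Lambda> * real \<Lambda> * real (card (sat r r'))"
  proof (rule ccontr)
    assume neg: "\<not> ?thesis"
    have "0 < \<delta> * m" using \<delta> m by simp
    then have "0 < card Gd" using Gd_big by linarith
    then have "0 < \<Lambda>" using tot by (cases \<Lambda>) auto
    have "real (card Gd) \<le> (\<Sum>r<\<Lambda>. \<Sum>r'<\<Lambda>. real (card (sat r r')))"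
      using tot by (metis (mono_tags, lifting) of_nat_le_iff of_nat_sum sum.cong)
    also have "\<dots> \<le> (\<Sum>r<\<Lambda>. \<Sum>r'<\<Lambda>. \<delta> * m / (real \<Lambda> * real \<Lambda>))"
    proof (intro sum_mono)
      fix r r'
      have "real \<Lambda> * real \<Lambda> * real (card (sat r r')) < \<delta> * m" using neg by (meson not_le)
      then show "real (card (sat r r')) \<le> \<delta> * m / (real \<Lambda> * real \<Lambda>)"
        using \<open>0 < \<Lambda>\<close> by (simp add: field_simps)
    qed
    also have "\<dots> = \<delta> * m" using \<open>0 < \<Lambda>\<close> by simp
    finally show False using Gd_big by linarith
  qed
  then obtain r r' where "\<delta> * m \<le> real \<Lambda> * real \<Lambda> * real (card (sat r r'))" by blast
  then show ?thesis using that[of "f r" "g r'"] pick_R unfolding sat_def f_def g_def by blast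
qed

end

section \<open>Gap instances\<close>

lemma ex_apath_iff_rtrancl:
  assumes "pair_wf_digraph G" "u \<in> pverts G"
  shows "(\<exists>p. pre_digraph.apath (with_proj G) u p v) \<longleftrightarrow> (u, v) \<in> (parcs G)\<^sup>*"
proof -
  interpret pair_wf_digraph G by fact
  have "(u, v) \<in> rtrancl_on (pverts G) (parcs G) \<longleftrightarrow> (u, v) \<in> (parcs G)\<^sup>*"
  proof
    assume uv: "(u, v) \<in> (parcs G)\<^sup>*"
    then have "v \<in> pverts G" using assms(2) by (induction) (auto dest: in_arcsD2)
    with uv show "(u, v) \<in> rtrancl_on (pverts G) (parcs G)"
      using assms(2)
      by (intro rtrancl_consistent_rtrancl_on) (auto dest: in_arcsD1 in_arcsD2)
  qed (rule rtrancl_on_rtranclI)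
  then show ?thesis using reachable_apath[of u v] unfolding reachable_def by simp
qed

section \<open>Multicuts as separating sets of arcs\<close>

definition separates :: "dmc \<Rightarrow> (nat \<times> nat) set \<Rightarrow> (nat \<times> nat) set \<Rightarrow> bool" where
  "separates I F C \<longleftrightarrow> C \<subseteq> parcs (supply_graph I) \<and>
     (\<forall>(s, t) \<in> F. (terminal I s, terminal I t) \<notin> (parcs (supply_graph I) - C)\<^sup>*)"

lemma multicut_iff_separates:
  assumes "pair_digraph H" "dmc_instance H I"
  shows "multicut H I C \<longleftrightarrow> separates I (parcs H) C"
proof -
  interpret H: pair_digraph H by fact
  interpret G: pair_fin_digraph "supply_graph I" using assms(2) by (simp add: dmc_instance_def)
  have "(\<exists>p. pre_digraph.apath (with_proj ((supply_graph I)\<lparr>parcs := parcs (supply_graph I) - C\<rparr>)) (terminal I s) p (terminal I t))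
      \<longleftrightarrow> (terminal I s, terminal I t) \<in> (parcs (supply_graph I) - C)\<^sup>*" if "(s, t) \<in> parcs H" for s t
  proof -
    have "terminal I s \<in> pverts (supply_graph I)"
      using H.in_arcsD1[OF that] assms(2) by (auto simp: dmc_instance_def)
    moreover have "pair_wf_digraph ((supply_graph I)\<lparr>parcs := parcs (supply_graph I) - C\<rparr>)"
      by unfold_locales (auto dest: G.in_arcsD1 G.in_arcsD2)
    ultimately show ?thesis
      using ex_apath_iff_rtrancl[of "(supply_graph I)\<lparr>parcs := parcs (supply_graph I) - C\<rparr>" "terminal I s" "terminal I t"]
      by simp
  qed
  then show ?thesis unfolding multicut_def separates_def by blast
qed

lemma separates_all:
  assumes "pair_digraph H" "dmc_instance H I" "F \<subseteq> parcs H"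
  shows "separates I F (parcs (supply_graph I))"
proof -
  interpret H: pair_digraph H by fact
  have "terminal I s \<noteq> terminal I t" if "(s, t) \<in> F" for s t
  proof
    assume "terminal I s = terminal I t"
    moreover have st: "(s, t) \<in> parcs H" using that assms(3) by auto
    ultimately have "s = t"
      using H.in_arcsD1[OF st] H.in_arcsD2[OF st] assms(2) by (auto simp: dmc_instance_def dest: inj_onD)
    then show False using H.pair_no_loops[OF st] by simp
  qed
  then show ?thesis by (auto simp: separates_def)
qed

lemma multicut_opt_le:
  assumes "dmc_instance H I" "multicut H I C"
  shows "multicut_opt H I \<le> (\<Sum>e\<in>C. weight I e)"
proof -
  have "bdd_below ((\<lambda>C. \<Sum>e\<in>C. weight I e) ` {C. multicut H I C})"
    using assms(1) by (intro bdd_belowI[of _ 0]) (force simp: multicut_def dmc_instance_def intro!: sum_nonneg)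
  then show ?thesis unfolding multicut_opt_def using assms(2) by (intro cINF_lower) auto
qed

lemma le_multicut_opt:
  assumes "pair_digraph H" "dmc_instance H I" "\<And>C. multicut H I C \<Longrightarrow> b \<le> (\<Sum>e\<in>C. weight I e)"
  shows "b \<le> multicut_opt H I"
proof -
  have "multicut H I (parcs (supply_graph I))"
    using multicut_iff_separates[OF assms(1,2)] separates_all[OF assms(1,2)] by blast
  then show ?thesis unfolding multicut_opt_def using assms(3) by (intro cINF_greatest) auto
qed

text \<open>If every piece had a cut of weight at most \<open>\<rho>\<close> times the LP value, the
  union of these cuts would be a multicut for \<open>H\<close> of weight at most
  \<open>card J * \<rho>\<close> times that value.\<close>

lemma gap_instance_of_piece:
  fixes \<rho> :: real and F :: "'j \<Rightarrow> (nat \<times> nat) set"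
  assumes H: "pair_digraph H" and J: "finite J" "J \<noteq> {}" and F: "(\<Union>j\<in>J. F j) = parcs H"
    and \<rho>: "0 < \<rho>" "ereal (real (card J) * \<rho>) < flow_cut_gap H"
  obtains I x j where "dmc_instance H I" "distance_lp_feasible H I x" "j \<in> J"
    "\<forall>C. separates I (F j) C \<longrightarrow> \<rho> * (\<Sum>e\<in>parcs (supply_graph I). weight I e * x e) < (\<Sum>e\<in>C. weight I e)"
proof -
  obtain I where I: "dmc_instance H I" "distance_lp_opt H I > 0"
      "real (card J) * \<rho> < multicut_opt H I / distance_lp_opt H I"
    using \<rho>(2) unfolding flow_cut_gap_def less_SUP_iff by auto
  interpret G: pair_fin_digraph "supply_graph I" using I(1) by (simp add: dmc_instance_def)
  define lp where "lp x = (\<Sum>e\<in>parcs (supply_graph I). weight I e * x e)" for x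
  have r: "0 < real (card J) * \<rho>" using J \<rho>(1) by (simp add: card_gt_0_iff)
  have "distance_lp_opt H I < multicut_opt H I / (real (card J) * \<rho>)"
    using I(2,3) r by (simp add: field_simps)
  moreover have "distance_lp_feasible H I (\<lambda>_. 1)"
    unfolding distance_lp_feasible_def
  proof (intro conjI ballI, clarsimp, clarify)
    fix s t p assume st: "(s, t) \<in> parcs H" and p: "G.apath (terminal I s) p (terminal I t)"
    have "separates I (parcs H) (parcs (supply_graph I))" using separates_all[OF H I(1)] by blast
    then have "terminal I s \<noteq> terminal I t" using st by (auto simp: separates_def)
    then have "p \<noteq> []" using p by (auto simp: G.apath_Nil_iff)
    then show "1 \<le> (\<Sum>e\<leftarrow>p. 1 :: real)" by (cases p) (auto simp: sum_list_triv)
  qed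
  \<comment> \<open>The LP optimum is defined as an infimum; the strict gap leaves room for a
    feasible solution that need not attain it.\<close>
  ultimately obtain x where x: "distance_lp_feasible H I x" "lp x < multicut_opt H I / (real (card J) * \<rho>)"
    unfolding distance_lp_opt_def lp_def using cInf_lessD by (metis (no_types, lifting) empty_iff imageE image_eqI mem_Collect_eq)
  have "\<exists>j\<in>J. \<forall>C. separates I (F j) C \<longrightarrow> \<rho> * lp x < (\<Sum>e\<in>C. weight I e)"
  proof (rule ccontr)
    assume "\<not> ?thesis"
    then obtain C where C: "\<And>j. j \<in> J \<Longrightarrow> separates I (F j) (C j)" "\<And>j. j \<in> J \<Longrightarrow> (\<Sum>e\<in>C j. weight I e) \<le> \<rho> * lp x"
      by (metis not_le)
    define U where "U = (\<Union>j\<in>J. C j)"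
    have "separates I (parcs H) U"
      unfolding separates_def
    proof (intro conjI ballI, clarsimp simp: U_def)
      fix a b j assume "(a, b) \<in> C j" "j \<in> J"
      then show "(a, b) \<in> parcs (supply_graph I)" using C(1)[of j] by (auto simp: separates_def)
    next
      fix st assume "st \<in> parcs H"
      then obtain s t j where st: "st = (s, t)" "j \<in> J" "(s, t) \<in> F j" using F by (cases st) blast
      have "(parcs (supply_graph I) - U)\<^sup>* \<subseteq> (parcs (supply_graph I) - C j)\<^sup>*"
        using st(2) by (intro rtrancl_mono) (auto simp: U_def)
      then show "case st of (s, t) \<Rightarrow> (terminal I s, terminal I t) \<notin> (parcs (supply_graph I) - U)\<^sup>*"
        using C(1)[OF st(2)] st by (auto simp: separates_def)
    qed
    then have "multicut H I U" using multicut_iff_separates[OF H I(1)] by blast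
    then have "multicut_opt H I \<le> (\<Sum>e\<in>U. weight I e)" by (rule multicut_opt_le[OF I(1)])
    also have "\<dots> \<le> (\<Sum>j\<in>J. \<Sum>e\<in>C j. weight I e)"
    proof -
      have sub: "C j \<subseteq> parcs (supply_graph I)" if "j \<in> J" for j using C(1)[OF that] by (simp add: separates_def)
      have fin: "finite (C j)" if "j \<in> J" for j using sub[OF that] G.pair_finite_arcs by (rule finite_subset)
      have "sum (weight I) (\<Union>j\<in>J'. C j) \<le> (\<Sum>j\<in>J'. sum (weight I) (C j))" if "J' \<subseteq> J" for J'
        using finite_subset[OF that J(1)] that
      proof (induction J' rule: finite_induct)
        case (insert j J')
        have f: "finite (C j)" "finite (\<Union>j\<in>J'. C j)" using insert fin by auto
        have "0 \<le> sum (weight I) (C j \<inter> (\<Union>j\<in>J'. C j))"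
          using sub[of j] insert(4) I(1) by (intro sum_nonneg) (auto simp: dmc_instance_def)
        then have "sum (weight I) (C j \<union> (\<Union>j\<in>J'. C j)) \<le> sum (weight I) (C j) + sum (weight I) (\<Union>j\<in>J'. C j)"
          using sum.union_inter[OF f, of "weight I"] by simp
        then show ?case using insert by simp
      qed simp
      from this[of J] show ?thesis by (simp add: U_def)
    qed
    also have "\<dots> \<le> (\<Sum>j\<in>J. \<rho> * lp x)" using C(2) by (rule sum_mono)
    also have "\<dots> = real (card J) * \<rho> * lp x" by simp
    also have "\<dots> < multicut_opt H I" using x(2) r by (simp add: field_simps)
    finally show False by simp
  qed
  then show ?thesis using that I(1) x(1) unfolding lp_def by blast
qed

text \<open>
  Data extracted from an instance with a large gap: weights and lengths are scaled to integers,
  \<open>D a\<close> is the distance from terminal \<open>a\<close>, and multicuts become labellings of the vertices by sets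
  of sources.
\<close>

lemma gap_data:
  fixes \<rho> :: real
  assumes H: "pair_digraph H" and I: "dmc_instance H I" and x: "distance_lp_feasible H I x" and F: "F \<subseteq> parcs H"
    and \<rho>: "0 < \<rho>"
    and cut: "\<forall>C. separates I F C \<longrightarrow> \<rho> * (\<Sum>e\<in>parcs (supply_graph I). weight I e * x e) < (\<Sum>e\<in>C. weight I e)"
  obtains n :: nat and w l :: "nat \<times> nat \<Rightarrow> nat" and D :: "nat \<Rightarrow> nat \<Rightarrow> nat" and K :: real where
    "\<forall>a\<in>pverts H. D a (terminal I a) = 0"
    "\<forall>a. \<forall>(u, v)\<in>parcs (supply_graph I). D a v \<le> D a u + l (u, v)"
    "\<forall>(a, b)\<in>F. 2 ^ n \<le> D a (terminal I b)"
    "\<forall>S. (\<forall>(a, b)\<in>F. a \<in> S (terminal I a) \<and> a \<notin> S (terminal I b)) \<longrightarrow>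
       K \<le> (\<Sum>(u, v) | (u, v) \<in> parcs (supply_graph I) \<and> \<not> S u \<subseteq> S v. real (w (u, v)))"
    "\<rho> * (\<Sum>e\<in>parcs (supply_graph I). real (w e * l e)) < 2 ^ n * K"
proof -
  interpret H: pair_digraph H by fact
  interpret G: pair_fin_digraph "supply_graph I" using I by (simp add: dmc_instance_def)
  define E where "E = parcs (supply_graph I)"
  have finE: "finite E" using G.pair_finite_arcs by (simp add: E_def)
  have w0: "0 \<le> weight I e" if "e \<in> E" for e using I that by (simp add: dmc_instance_def E_def)
  have x0: "0 \<le> x e" if "e \<in> E" for e using x that by (simp add: distance_lp_feasible_def E_def)
  define lp where "lp = (\<Sum>e\<in>E. weight I e * x e)"
  define cuts where "cuts = {C. separates I F C}"
  have fin: "finite cuts" using finE by (auto simp: cuts_def separates_def E_def intro: finite_subset[of _ "Pow E"])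
  have ne: "cuts \<noteq> {}" using separates_all[OF H I F] by (auto simp: cuts_def)
  define c0 where "c0 = Min ((\<lambda>C. \<Sum>e\<in>C. weight I e) ` cuts)"
  have "c0 \<in> (\<lambda>C. \<Sum>e\<in>C. weight I e) ` cuts" unfolding c0_def using fin ne by (intro Min_in) auto
  then have gap: "\<rho> * lp < c0" using cut by (auto simp: cuts_def lp_def E_def)
  have c0: "c0 \<le> (\<Sum>e\<in>C. weight I e)" if "separates I F C" for C
    unfolding c0_def using that fin by (intro Min_le) (auto simp: cuts_def)
  define R where "R = (\<Sum>e\<in>E. weight I e) + (\<Sum>e\<in>E. x e) + card E"
  \<comment> \<open>Scaling weights and lengths by \<open>N = 2 ^ n\<close> and rounding up adds at
    most \<open>N * R\<close> to the LP value, while the slack in the gap becomes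
    \<open>N * N * (c0 - \<rho> * lp)\<close>; a large \<open>n\<close> lets the slack win.\<close>
  obtain n :: nat where n: "\<rho> * R / (c0 - \<rho> * lp) < 2 ^ n" using real_arch_pow[of 2] by auto
  define N :: nat where "N = 2 ^ n"
  have N1: "1 \<le> real N" by (simp add: N_def)
  define w where "w e = nat \<lceil>N * weight I e\<rceil>" for e
  define l where "l e = nat \<lceil>N * x e\<rceil>" for e
  have wl: "N * weight I e \<le> w e" "w e \<le> N * weight I e + 1" "N * x e \<le> l e" "l e \<le> N * x e + 1" if "e \<in> E" for e
    using w0[OF that] x0[OF that] by (simp_all add: w_def l_def le_of_int_ceiling of_int_ceiling_le_add_one)
  define K where "K = N * c0"
  have "(\<Sum>e\<in>E. real (w e * l e)) \<le> (\<Sum>e\<in>E. (N * weight I e + 1) * (N * x e + 1))"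
  proof (rule sum_mono)
    fix e assume e: "e \<in> E"
    show "real (w e * l e) \<le> (N * weight I e + 1) * (N * x e + 1)"
      unfolding of_nat_mult using wl[OF e] w0[OF e] by (intro mult_mono) auto
  qed
  also have "\<dots> = N * N * lp + N * (\<Sum>e\<in>E. weight I e) + N * (\<Sum>e\<in>E. x e) + card E"
    by (simp add: lp_def sum_distrib_left algebra_simps sum.distrib)
  also have "\<dots> \<le> N * N * lp + N * R"
    using N1 mult_right_mono[OF N1, of "real (card E)"] by (simp add: R_def algebra_simps)
  finally have "\<rho> * (\<Sum>e\<in>E. real (w e * l e)) \<le> \<rho> * (N * N * lp + N * R)" using \<rho> by (intro mult_left_mono) auto
  also have "\<dots> = N * (N * (\<rho> * lp) + \<rho> * R)" by (simp add: algebra_simps)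
  also have "\<dots> < N * (N * c0)"
  proof -
    have "\<rho> * R < N * (c0 - \<rho> * lp)" using n gap by (simp add: N_def field_simps)
    then have "N * (\<rho> * lp) + \<rho> * R < N * c0" by (simp add: algebra_simps)
    then show ?thesis using N1 by (intro mult_strict_left_mono) auto
  qed
  finally have P5: "\<rho> * (\<Sum>e\<in>E. real (w e * l e)) < 2 ^ n * K" by (simp add: K_def N_def)
  \<comment> \<open>Inserting \<open>N\<close> truncates the distances, so that the minimum exists
    also for vertices that cannot be reached.\<close>
  define lens where "lens a v = insert N {\<Sum>e\<leftarrow>p. l e | p. G.awalk (terminal I a) p v}" for a v
  define D where "D a v = (LEAST m. m \<in> lens a v)" for a v
  have Din: "D a v \<in> lens a v" for a v unfolding D_def by (rule LeastI[of _ N]) (simp add: lens_def)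
  have Dle: "D a v \<le> m" if "m \<in> lens a v" for a v m unfolding D_def by (rule Least_le) (rule that)
  have P1: "D a (terminal I a) = 0" if "a \<in> pverts H" for a
  proof -
    have "terminal I a \<in> pverts (supply_graph I)" using that I by (auto simp: dmc_instance_def)
    then have "0 \<in> lens a (terminal I a)"
      unfolding lens_def by (intro insertI2) (auto intro!: exI[of _ "[]"] simp: G.awalk_Nil_iff)
    then show ?thesis using Dle by fastforce
  qed
  have P2: "D a v \<le> D a u + l (u, v)" if "(u, v) \<in> E" for a u v
  proof (cases "D a u = N")
    case True
    then show ?thesis using Dle[of N a v] by (simp add: lens_def)
  next
    case False
    then obtain p where p: "D a u = (\<Sum>e\<leftarrow>p. l e)" "G.awalk (terminal I a) p u"
      using Din[of a u] by (auto simp: lens_def)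
    have "G.awalk u [(u, v)] v" using that G.in_arcsD1 G.in_arcsD2 by (auto simp: E_def G.awalk_def)
    then have "G.awalk (terminal I a) (p @ [(u, v)]) v" using p(2) by (auto simp: G.awalk_append_iff G.awlast_if_cas G.awalk_def)
    then have "(\<Sum>e\<leftarrow>p @ [(u, v)]. l e) \<in> lens a v" unfolding lens_def by blast
    from Dle[OF this] show ?thesis using p(1) by simp
  qed
  have P3: "N \<le> D a (terminal I b)" if "(a, b) \<in> F" for a b
  proof (cases "D a (terminal I b) = N")
    case False
    then obtain p where p: "D a (terminal I b) = (\<Sum>e\<leftarrow>p. l e)" "G.awalk (terminal I a) p (terminal I b)"
      using Din[of a "terminal I b"] by (auto simp: lens_def)
    \<comment> \<open>The LP constrains simple paths only. A walk is at least as long as a path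
      whose arcs it contains, and rounding up the scaled lengths keeps that path at length
      \<open>N\<close> or more.\<close>
    define p' where "p' = G.awalk_to_apath p"
    have p': "G.apath (terminal I a) p' (terminal I b)" "set p' \<subseteq> set p"
      unfolding p'_def using p(2) by (auto intro: G.apath_awalk_to_apath dest: G.awalk_to_apath_subset)
    have "distinct p'" using p'(1) G.distinct_verts_imp_distinct by (auto simp: G.apath_def)
    have pE: "set p \<subseteq> E" using p(2) by (auto simp: G.awalk_def E_def)
    have "1 \<le> (\<Sum>e\<leftarrow>p'. x e)" using x that F p'(1) unfolding distance_lp_feasible_def by blast
    then have "real N \<le> N * (\<Sum>e\<in>set p'. x e)" using N1 \<open>distinct p'\<close> by (simp add: sum_list_distinct_conv_sum_set)
    also have "\<dots> \<le> (\<Sum>e\<in>set p'. real (l e))"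
      unfolding sum_distrib_left using wl p'(2) pE by (intro sum_mono) auto
    also have "\<dots> = real (\<Sum>e\<in>set p'. l e)" by simp
    also have "(\<Sum>e\<in>set p'. l e) \<le> (\<Sum>e\<in>set p. l e)" using p'(2) by (intro sum_mono2) auto
    also have "\<dots> \<le> (\<Sum>e\<leftarrow>p. l e)"
    proof (induction p)
      case (Cons e p)
      then show ?case by (cases "e \<in> set p") (auto simp: insert_absorb)
    qed simp
    finally show ?thesis using p(1) by simp
  qed simp
  have P4: "K \<le> (\<Sum>(u, v) | (u, v) \<in> E \<and> \<not> S u \<subseteq> S v. real (w (u, v)))"
    if S: "\<And>a b. (a, b) \<in> F \<Longrightarrow> a \<in> S (terminal I a) \<and> a \<notin> S (terminal I b)" for S :: "nat \<Rightarrow> nat set"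
  proof -
    \<comment> \<open>Outside this set labels only grow along arcs, so a source that is present at
      its own terminal and absent at the sink cannot reach it.\<close>
    define C where "C = {(u, v). (u, v) \<in> E \<and> \<not> S u \<subseteq> S v}"
    have "separates I F C"
      unfolding separates_def
    proof (intro conjI ballI, force simp: C_def E_def)
      fix st assume "st \<in> F"
      then obtain a b where st: "st = (a, b)" "(a, b) \<in> F" by (cases st) auto
      have "S u \<subseteq> S v" if "(u, v) \<in> (E - C)\<^sup>*" for u v
        using that by (induction rule: rtrancl_induct) (auto simp: C_def)
      then show "case st of (s, t) \<Rightarrow> (terminal I s, terminal I t) \<notin> (parcs (supply_graph I) - C)\<^sup>*"
        using S[OF st(2)] st by (auto simp: E_def)
    qed
    then have "K \<le> N * (\<Sum>e\<in>C. weight I e)" using c0[of C] by (simp add: K_def mult_left_mono)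
    also have "\<dots> \<le> (\<Sum>e\<in>C. real (w e))"
      unfolding sum_distrib_left using wl by (intro sum_mono) (auto simp: C_def)
    also have "\<dots> = (\<Sum>(u, v) | (u, v) \<in> E \<and> \<not> S u \<subseteq> S v. real (w (u, v)))"
      unfolding C_def by (intro sum.cong) auto
    finally show ?thesis .
  qed
  show ?thesis
  proof (rule that[of D l n K w])
    show "\<forall>S. (\<forall>(a, b)\<in>F. a \<in> S (terminal I a) \<and> a \<notin> S (terminal I b)) \<longrightarrow>
       K \<le> (\<Sum>(u, v) | (u, v) \<in> parcs (supply_graph I) \<and> \<not> S u \<subseteq> S v. real (w (u, v)))"
      using P4 unfolding E_def by blast
  qed (use P1 P2 P3 P5 in \<open>auto simp: E_def N_def\<close>)
qed

text \<open>\<open>H\<close> serves as its own supply graph with unit weights: every demand is an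
  arc, which has to be cut and to which the LP gives length at least 1. Positivity of the gap allows
  a positive ratio \<open>\<rho>\<close> below it.\<close>

lemma flow_cut_gap_pos:
  assumes H: "pair_digraph H" and ne: "parcs H \<noteq> {}"
  shows "0 < flow_cut_gap H"
proof -
  interpret pair_digraph H by fact
  define I where "I = \<lparr>supply_graph = H, weight = \<lambda>_. 1, terminal = id\<rparr>"
  have I: "dmc_instance H I"
    unfolding dmc_instance_def I_def using pair_fin_digraph_axioms by simp
  have card: "0 < card (parcs H)" using ne pair_finite_arcs by (simp add: card_gt_0_iff)
  have "real (card (parcs H)) \<le> multicut_opt H I"
  proof (rule le_multicut_opt[OF H I])
    fix C assume "multicut H I C"
    then have "separates I (parcs H) C" using multicut_iff_separates[OF H I] by simp
    then have "C = parcs H" by (fastforce simp: separates_def I_def)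
    then show "real (card (parcs H)) \<le> (\<Sum>e\<in>C. weight I e)" by (simp add: I_def)
  qed
  moreover have "real (card (parcs H)) \<le> distance_lp_opt H I"
    unfolding distance_lp_opt_def
  proof (rule cINF_greatest)
    have "distance_lp_feasible H I (\<lambda>_. 1)"
      unfolding distance_lp_feasible_def
    proof (intro conjI ballI, simp, clarify)
      fix s t p assume st: "(s, t) \<in> parcs H" and p: "pre_digraph.apath (with_proj (supply_graph I)) (terminal I s) p (terminal I t)"
      have "s \<noteq> t" using pair_no_loops[OF st] by simp
      then have "p \<noteq> []" using p by (auto simp: I_def apath_Nil_iff)
      then show "1 \<le> (\<Sum>e\<leftarrow>p. 1 :: real)" by (cases p) (auto simp: sum_list_triv)
    qed
    then show "{x. distance_lp_feasible H I x} \<noteq> {}" by blast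
    fix x assume "x \<in> {x. distance_lp_feasible H I x}"
    then have x: "distance_lp_feasible H I x" by simp
    have "1 \<le> x (s, t)" if st: "(s, t) \<in> parcs H" for s t
    proof -
      have "s \<noteq> t" using pair_no_loops[OF st] by simp
      then have "apath s [(s, t)] t" using st in_arcsD1[OF st] in_arcsD2[OF st] by (auto simp: apath_def awalk_def)
      moreover have "\<forall>p. pre_digraph.apath (with_proj (supply_graph I)) (terminal I s) p (terminal I t) \<longrightarrow> (\<Sum>e\<leftarrow>p. x e) \<ge> 1"
        using x st unfolding distance_lp_feasible_def by blast
      ultimately have "1 \<le> (\<Sum>e\<leftarrow>[(s, t)]. x e)" by (auto simp: I_def)
      then show ?thesis by simp
    qed
    then have "(\<Sum>e\<in>parcs H. 1) \<le> (\<Sum>e\<in>parcs H. x e)" by (intro sum_mono) auto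
    then show "real (card (parcs H)) \<le> (\<Sum>e\<in>parcs (supply_graph I). weight I e * x e)" by (simp add: I_def)
  qed
  ultimately have pos: "0 < distance_lp_opt H I" "0 < multicut_opt H I" using card by linarith+
  then have "ereal (multicut_opt H I / distance_lp_opt H I) \<le> flow_cut_gap H"
    unfolding flow_cut_gap_def using I by (intro SUP_upper) auto
  moreover have "0 < ereal (multicut_opt H I / distance_lp_opt H I)" using pos by simp
  ultimately show ?thesis by (rule less_le_trans[rotated])
qed

text \<open>Excludes an infinite gap. With single demands as pieces, a larger gap would yield an
  instance with one source and one sink and a gap above 1, against the duality of flows and cuts:
  averaged over the thresholds \<open>\<theta>\<close> below \<open>2 ^ n\<close>, the cut at
  distance \<open>\<theta>\<close> costs at most the LP value.\<close>

lemma flow_cut_gap_le: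
  assumes H: "pair_digraph H" and ne: "parcs H \<noteq> {}"
  shows "flow_cut_gap H \<le> ereal (real (card (parcs H)))"
proof (rule ccontr)
  assume "\<not> ?thesis"
  then have gap: "ereal (real (card (parcs H)) * 1) < flow_cut_gap H" by simp
  interpret pair_digraph H by fact
  have cov: "(\<Union>e\<in>parcs H. {e}) = parcs H" by simp
  obtain I x e where I: "dmc_instance H I" "distance_lp_feasible H I x" "e \<in> parcs H"
    "\<forall>C. separates I {e} C \<longrightarrow> 1 * (\<Sum>e\<in>parcs (supply_graph I). weight I e * x e) < (\<Sum>e\<in>C. weight I e)"
    using gap_instance_of_piece[OF H pair_finite_arcs ne cov zero_less_one gap] by metis
  obtain a b where e: "e = (a, b)" by fastforce
  have sub: "{(a, b)} \<subseteq> parcs H" using I(3) e by simp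
  obtain n :: nat and w l :: "nat \<times> nat \<Rightarrow> nat" and D :: "nat \<Rightarrow> nat \<Rightarrow> nat" and K :: real where
    D: "\<forall>a\<in>pverts H. D a (terminal I a) = 0"
    "\<forall>a. \<forall>(u, v)\<in>parcs (supply_graph I). D a v \<le> D a u + l (u, v)"
    "\<forall>(a, b)\<in>{(a, b)}. 2 ^ n \<le> D a (terminal I b)"
    and K: "\<forall>S. (\<forall>(a, b)\<in>{(a, b)}. a \<in> S (terminal I a) \<and> a \<notin> S (terminal I b)) \<longrightarrow>
       K \<le> (\<Sum>(u, v) | (u, v) \<in> parcs (supply_graph I) \<and> \<not> S u \<subseteq> S v. real (w (u, v)))"
    "1 * (\<Sum>e\<in>parcs (supply_graph I). real (w e * l e)) < 2 ^ n * K"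
    by (rule gap_data[OF H I(1,2) sub zero_less_one I(4)[unfolded e]]) (rule that, assumption+)
  define G where "G = parcs (supply_graph I)"
  have finG: "finite G" using I(1) by (auto simp: G_def dmc_instance_def pair_fin_digraph_def pair_fin_digraph_axioms_def)
  define viol where "viol \<theta> uv \<longleftrightarrow> D a (fst uv) \<le> \<theta> \<and> \<theta> < D a (snd uv)" for \<theta> and uv :: "nat \<times> nat"
  have K\<theta>: "K \<le> (\<Sum>uv\<in>G. of_bool (viol \<theta> uv) * real (w uv))" if "\<theta> < 2 ^ n" for \<theta>
  proof -
    define S where "S v = {c. c = a \<and> D a v \<le> \<theta>}" for v
    have "a \<in> S (terminal I a)" "a \<notin> S (terminal I b)"
      using D(1) D(3) in_arcsD1[of a b] I(3) e that by (auto simp: S_def)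
    then have "K \<le> (\<Sum>(u, v) | (u, v) \<in> G \<and> \<not> S u \<subseteq> S v. real (w (u, v)))"
      unfolding G_def using K(1)[rule_format, of S] by auto
    also have "\<dots> = (\<Sum>uv\<in>G. of_bool (viol \<theta> uv) * real (w uv))"
      using finG by (intro sum.mono_neutral_cong_left) (auto simp: S_def viol_def)
    finally show ?thesis .
  qed
  have "2 ^ n * K = (\<Sum>\<theta><(2 ^ n :: nat). K)" by simp
  also have "\<dots> \<le> (\<Sum>\<theta><(2 ^ n :: nat). \<Sum>uv\<in>G. of_bool (viol \<theta> uv) * real (w uv))" by (intro sum_mono K\<theta>) auto
  also have "\<dots> = (\<Sum>uv\<in>G. \<Sum>\<theta><(2 ^ n :: nat). of_bool (viol \<theta> uv) * real (w uv))" by (rule sum.swap)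
  also have "\<dots> \<le> (\<Sum>uv\<in>G. real (w uv * l uv))"
  proof (rule sum_mono)
    fix uv assume uv: "uv \<in> G"
    have "(\<Sum>\<theta><(2 ^ n :: nat). of_bool (viol \<theta> uv)) = real (card ({..<2 ^ n :: nat} \<inter> {\<theta>. viol \<theta> uv}))" by simp
    also have "card ({..<2 ^ n} \<inter> {\<theta>. viol \<theta> uv}) \<le> card {D a (fst uv)..<D a (snd uv)}"
      by (rule card_mono) (auto simp: viol_def)
    also have "\<dots> \<le> l uv" using D(2)[rule_format, of uv a] uv by (cases uv) (simp add: G_def)
    finally have "(\<Sum>\<theta><(2 ^ n :: nat). of_bool (viol \<theta> uv)) \<le> real (l uv)" by simp
    from mult_right_mono[OF this, of "real (w uv)"]
    show "(\<Sum>\<theta><(2 ^ n :: nat). of_bool (viol \<theta> uv) * real (w uv)) \<le> real (w uv * l uv)"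
      unfolding sum_distrib_right by (simp add: mult.commute)
  qed
  finally show False using K(2) by (simp add: G_def)
qed

text \<open>The multiplicity \<open>P\<close> stays free because it is chosen when \<open>K\<close>
  and the LP value are known. A demand joins two different vertices, whose numbers differ in some
  bit; this also makes the number of bits positive.\<close>

lemma obtain_gap_gadget:
  fixes \<rho> :: real
  assumes H: "pair_digraph H" and ne: "parcs H \<noteq> {}" and \<rho>: "0 < \<rho>"
    and gap: "ereal (2 * real_of_int \<lceil>log 2 (card (pverts H))\<rceil> * \<rho>) < flow_cut_gap H"
  obtains A V E w l ter D K n where
    "\<And>P. 0 < P \<Longrightarrow> gap_gadget (pverts H) (parcs H) A V E w l ter D K n P"
    "\<rho> * (\<Sum>e\<in>E. real (w e * l e)) < 2 ^ n * K"
proof -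
  interpret pair_digraph H by fact
  define k where "k = card (pverts H)"
  define L where "L = nat \<lceil>log 2 k\<rceil>"
  obtain s0 t0 where st0: "(s0, t0) \<in> parcs H" using ne by auto
  then have "s0 \<noteq> t0" "s0 \<in> pverts H" "t0 \<in> pverts H" using pair_no_loops[OF st0] in_arcsD1[OF st0] in_arcsD2[OF st0] by auto
  then have k2: "2 \<le> k"
    using card_mono[OF pair_finite_verts, of "{s0, t0}"] by (simp add: k_def)
  then have "1 \<le> log 2 k" by (simp add: one_le_log_cancel_iff)
  then have L1: "1 \<le> \<lceil>log 2 k\<rceil>" by linarith
  then have Lr: "real L = real_of_int \<lceil>log 2 k\<rceil>" and Lpos: "0 < L" by (auto simp: L_def)
  have "log 2 k \<le> L" using Lr by (simp add: le_of_int_ceiling)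
  then have "real k \<le> 2 powr L" using k2 by (simp add: log_le_iff)
  then have kL: "k \<le> 2 ^ L" by (simp add: powr_realpow flip: of_nat_le_iff)
  obtain num where num: "bij_betw num (pverts H) {0..<k}"
    using ex_bij_betw_finite_nat[OF pair_finite_verts] by (auto simp: k_def)
  define A where "A jb = {s \<in> pverts H. bit (num s) (fst jb) = snd jb}" for jb :: "nat \<times> bool"
  define F where "F jb = {(s, t) \<in> parcs H. s \<in> A jb \<and> t \<notin> A jb}" for jb
  define J where "J = {..<L} \<times> (UNIV :: bool set)"
  have cover: "(\<Union>jb\<in>J. F jb) = parcs H"
  proof (intro equalityI subsetI)
    fix st assume "st \<in> parcs H"
    then obtain s t where st: "st = (s, t)" "(s, t) \<in> parcs H" by (cases st) auto
    then have V: "s \<in> pverts H" "t \<in> pverts H" "s \<noteq> t" using pair_no_loops[OF st(2)] in_arcsD1[OF st(2)] in_arcsD2[OF st(2)] by auto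
    then have "num s \<noteq> num t" using num by (auto simp: bij_betw_def dest: inj_onD)
    moreover have lt: "num s < 2 ^ L" "num t < 2 ^ L" using bij_betw_apply[OF num V(1)] bij_betw_apply[OF num V(2)] kL by auto
    ultimately obtain j where j: "j < L" "bit (num s) j \<noteq> bit (num t) j"
      by (metis bit_eqI bit_take_bit_iff take_bit_nat_eq_self)
    then have "st \<in> F (j, bit (num s) j)" using st V by (auto simp: F_def A_def)
    then show "st \<in> (\<Union>jb\<in>J. F jb)" using j by (auto simp: J_def)
  qed (auto simp: F_def)
  have J: "finite J" "J \<noteq> {}" "card J = 2 * L" using Lpos by (auto simp: J_def card_cartesian_product)
  have "ereal (real (card J) * \<rho>) < flow_cut_gap H" using gap J(3) by (simp add: Lr k_def)
  then obtain I x jb where I: "dmc_instance H I" "distance_lp_feasible H I x" "jb \<in> J"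
    "\<forall>C. separates I (F jb) C \<longrightarrow> \<rho> * (\<Sum>e\<in>parcs (supply_graph I). weight I e * x e) < (\<Sum>e\<in>C. weight I e)"
    using gap_instance_of_piece[OF H J(1,2) cover \<rho>] by metis
  have sub: "F jb \<subseteq> parcs H" by (auto simp: F_def)
  obtain n :: nat and w l :: "nat \<times> nat \<Rightarrow> nat" and D :: "nat \<Rightarrow> nat \<Rightarrow> nat" and K :: real where
    D: "\<forall>a\<in>pverts H. D a (terminal I a) = 0"
    "\<forall>a. \<forall>(u, v)\<in>parcs (supply_graph I). D a v \<le> D a u + l (u, v)"
    "\<forall>(a, b)\<in>F jb. 2 ^ n \<le> D a (terminal I b)"
    and K: "\<forall>S. (\<forall>(a, b)\<in>F jb. a \<in> S (terminal I a) \<and> a \<notin> S (terminal I b)) \<longrightarrow>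
       K \<le> (\<Sum>(u, v) | (u, v) \<in> parcs (supply_graph I) \<and> \<not> S u \<subseteq> S v. real (w (u, v)))"
    "\<rho> * (\<Sum>e\<in>parcs (supply_graph I). real (w e * l e)) < 2 ^ n * K"
    by (rule gap_data[OF H I(1,2) sub \<rho> I(4)]) (rule that, assumption+)
  interpret G: pair_fin_digraph "supply_graph I" using I(1) by (simp add: dmc_instance_def)
  have "0 \<le> \<rho> * (\<Sum>e\<in>parcs (supply_graph I). real (w e * l e))" using \<rho> by (intro mult_nonneg_nonneg sum_nonneg) auto
  then have "0 < 2 ^ n * K" using K(2) by linarith
  then have "0 < K" by (simp add: zero_less_mult_iff)
  have gg: "gap_gadget (pverts H) (parcs H) (A jb) (pverts (supply_graph I)) (parcs (supply_graph I)) w l (terminal I) D K n P"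
    if "0 < P" for P
  proof
    show "finite (pverts H)" by (rule pair_finite_verts)
    show "finite (pverts (supply_graph I))" by (rule G.pair_finite_verts)
    show "parcs (supply_graph I) \<subseteq> pverts (supply_graph I) \<times> pverts (supply_graph I)" using G.in_arcsD1 G.in_arcsD2 by auto
    show "A jb \<subseteq> pverts H" by (auto simp: A_def)
    show "parcs H \<subseteq> pverts H \<times> pverts H" using in_arcsD1 in_arcsD2 by auto
    show "(s, s) \<notin> parcs H" for s using pair_no_loops[of "(s, s)"] by auto
    show "terminal I ` pverts H \<subseteq> pverts (supply_graph I)" using I(1) by (simp add: dmc_instance_def)
    show "K \<le> (\<Sum>(u, v) | (u, v) \<in> parcs (supply_graph I) \<and> \<not> S u \<subseteq> S v. real (w (u, v)))"
      if "\<And>a b. (a, b) \<in> parcs H \<Longrightarrow> a \<in> A jb \<Longrightarrow> b \<notin> A jb \<Longrightarrow> a \<in> S (terminal I a) \<and> a \<notin> S (terminal I b)" for S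
      using that by (intro K(1)[rule_format]) (auto simp: F_def)
  qed (use D \<open>0 < K\<close> that in \<open>auto simp: F_def\<close>)
  show ?thesis by (rule that[OF gg K(2)])
qed

section \<open>Hardness of approximation\<close>

lemma class_P_subset_NP: "class_P \<subseteq> class_NP"
proof
  fix L assume "L \<in> class_P"
  then have L: "poly_time_on UNIV (\<lambda>x. [x \<in> L])" by (simp add: class_P_def)
  \<comment> \<open>Recovers the instance from an input of the verifier; state 2 absorbs whatever
    follows. With length bound 0 the empty word is the only witness.\<close>
  define unquote where "unquote = transduce (automaton [1, 0, 2] [2, 0, 2] (em_range 1 1)) 0"
  have unquote: "unquote (enc_bits x) = x" for x
    unfolding unquote_def by (induction x) (auto simp: enc_bits_def automaton_def em_range_def)
  have "computable 1 (\<lambda>s. s 0 \<in> UNIV) (\<lambda>s. unquote (s 0))"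
    unfolding unquote_def by (rule computable_automaton[where n = 3]) (auto intro!: computable_var)
  then have "computable 1 (\<lambda>s. s 0 \<in> UNIV) (\<lambda>s. [unquote (s 0) \<in> L])"
    by (rule computable_call[OF L]) simp
  then have "poly_time_on UNIV (\<lambda>y. [y \<in> {y. unquote y \<in> L}])"
    using poly_time_on_computable[of UNIV "\<lambda>y. [unquote y \<in> L]"] by simp
  then have "{y. unquote y \<in> L} \<in> class_P" by (simp add: class_P_def)
  then show "L \<in> class_NP"
    unfolding class_NP_def using unquote
    by (intro CollectI bexI[of _ "{y. unquote y \<in> L}"] exI[of _ 0]) auto
qed

lemma rtrancl_image_iff:
  assumes inj: "inj_on f A" and r: "r \<subseteq> A \<times> A" and xy: "x \<in> A" "y \<in> A"
  shows "(f x, f y) \<in> (map_prod f f ` r)\<^sup>* \<longleftrightarrow> (x, y) \<in> r\<^sup>*"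
proof
  assume "(f x, f y) \<in> (map_prod f f ` r)\<^sup>*"
  then have "\<exists>z\<in>A. f y = f z \<and> (x, z) \<in> r\<^sup>*"
  proof (induction "f y" arbitrary: y rule: rtrancl_induct)
    case base
    then show ?case using xy by (intro bexI[of _ x]) auto
  next
    case (step b)
    then obtain a c where ac: "(a, c) \<in> r" "b = f a" "f y = f c" by auto
    then obtain z where "z \<in> A" "b = f z" "(x, z) \<in> r\<^sup>*" using step(3)[of a] by auto
    moreover have "a \<in> A" "c \<in> A" using ac r by auto
    ultimately show ?case using ac inj by (metis inj_onD rtrancl.rtrancl_into_rtrancl)
  qed
  then show "(x, y) \<in> r\<^sup>*" using inj xy by (metis inj_onD)
next
  assume "(x, y) \<in> r\<^sup>*"
  then show "(f x, f y) \<in> (map_prod f f ` r)\<^sup>*"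
    by induction (auto intro: rtrancl_into_rtrancl)
qed

section \<open>Values of unique games\<close>

lemma ug_satisfied_eq:
  "ug_satisfied U f g = real (card {j. j < length (ug_constraints U) \<and>
      g (fst (snd (ug_constraints U ! j))) = snd (snd (ug_constraints U ! j)) (f (fst (ug_constraints U ! j)))})
    / real (length (ug_constraints U))"
  unfolding ug_satisfied_def length_filter_conv_card by (simp add: case_prod_unfold)

lemma finite_ug_values:
  "finite {ug_satisfied U f g | f g. f \<in> {..<ug_left U} \<rightarrow>\<^sub>E {..<R} \<and> g \<in> {..<ug_right U} \<rightarrow>\<^sub>E {..<R}}"
proof -
  have "{ug_satisfied U f g | f g. f \<in> {..<ug_left U} \<rightarrow>\<^sub>E {..<R} \<and> g \<in> {..<ug_right U} \<rightarrow>\<^sub>E {..<R}} =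
     (\<lambda>(f, g). ug_satisfied U f g) ` (({..<ug_left U} \<rightarrow>\<^sub>E {..<R}) \<times> ({..<ug_right U} \<rightarrow>\<^sub>E {..<R}))" by auto
  then show ?thesis by (simp add: finite_PiE)
qed

lemma ug_value_attained:
  assumes "1 \<le> R"
  obtains f g where "f \<in> {..<ug_left U} \<rightarrow>\<^sub>E {..<R}" "g \<in> {..<ug_right U} \<rightarrow>\<^sub>E {..<R}" "ug_value R U = ug_satisfied U f g"
proof -
  let ?S = "{ug_satisfied U f g | f g. f \<in> {..<ug_left U} \<rightarrow>\<^sub>E {..<R} \<and> g \<in> {..<ug_right U} \<rightarrow>\<^sub>E {..<R}}"
  have "restrict (\<lambda>_. 0) {..<ug_left U} \<in> {..<ug_left U} \<rightarrow>\<^sub>E {..<R}" "restrict (\<lambda>_. 0) {..<ug_right U} \<in> {..<ug_right U} \<rightarrow>\<^sub>E {..<R}"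
    using assms by (auto simp: PiE_def)
  then have "?S \<noteq> {}" by blast
  then have "Max ?S \<in> ?S" by (rule Max_in[OF finite_ug_values])
  then show ?thesis using that unfolding ug_value_def by blast
qed

lemma ug_satisfied_le_value:
  assumes U: "ug_instance R U" and f: "\<And>u. f u < R" and g: "\<And>v. g v < R"
  shows "ug_satisfied U f g \<le> ug_value R U"
proof -
  let ?f = "restrict f {..<ug_left U}" and ?g = "restrict g {..<ug_right U}"
  have "ug_satisfied U f g = ug_satisfied U ?f ?g"
    unfolding ug_satisfied_def using U
    by (intro arg_cong2[of _ _ _ _ "(/)"] arg_cong[of _ _ real] arg_cong[of _ _ length] filter_cong) (auto simp: ug_instance_def)
  also have "\<dots> \<le> ug_value R U"
    unfolding ug_value_def by (rule Max_ge[OF finite_ug_values], rule CollectI, rule exI[of _ ?f], rule exI[of _ ?g]) (use f g in auto)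
  finally show ?thesis .
qed

locale gadget_reduction = gap_gadget "pverts H" "parcs H" A V E w l ter D K n P Q
  for H :: "nat pair_pre_digraph" and A V E w l ter D K n P Q +
  fixes R M q B Thr :: nat and num :: "gvert \<Rightarrow> nat"
  assumes H: "pair_digraph H" and num: "bij_betw num (gverts R) {..<M}" and size_le: "M \<le> 2 ^ q" and Thr_bound: "Thr \<le> 2 ^ B"
begin

section \<open>The reduction for a gap gadget\<close>

definition vtx :: "nat \<Rightarrow> gvert" where
  "vtx = inv_into (gverts R) num"

text \<open>The first three bits of a key say whether the constraints, their left and their right
  endpoints agree; the rest is the code of the permutation. It determines the permutation, because a
  permutation of \<open>{..<R}\<close> fixes all other numbers. Finite weights are nonzero only
  inside a constraint.\<close>

definition table :: "bool list \<Rightarrow> nat \<Rightarrow> nat \<Rightarrow> nat option" where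
  "table k c c' = (if forced (k ! 1) (k ! 2) (vtx c) (vtx c') then None
     else Some (if k ! 0 then gwt R (THE \<pi>. \<pi> permutes {..<R} \<and> enc_list enc_nat (map \<pi> [0..<R]) = drop 3 k) (vtx c) (vtx c') else 0))"

lemma Term_gverts: "s \<in> pverts H \<Longrightarrow> Term s \<in> gverts R"
  by (simp add: gverts_def)

sublocale reduction_table R M q B Thr table "\<lambda>s. num (Term s)" H
proof
  show "num (Term s) < M" if "s \<in> pverts H" for s
    using bij_betw_apply[OF num Term_gverts[OF that]] by simp
  show "inj_on (\<lambda>s. num (Term s)) (pverts H)"
    using num Term_gverts by (auto simp: inj_on_def bij_betw_def)
qed (auto simp: size_le Thr_bound finite_HV)

abbreviation "us U j \<equiv> fst (ug_constraints U ! j)"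
abbreviation "vs U j \<equiv> fst (snd (ug_constraints U ! j))"
abbreviation "ps U j \<equiv> snd (snd (ug_constraints U ! j))"

lemma permutes_constraint: "ug_instance R U \<Longrightarrow> j < length (ug_constraints U) \<Longrightarrow> ps U j permutes {..<R}"
  using nth_mem[of j "ug_constraints U"] unfolding ug_instance_def by fastforce

lemma num_inverse: "p \<in> gverts R \<Longrightarrow> num p < M" "p \<in> gverts R \<Longrightarrow> vtx (num p) = p"
  using num by (auto simp: bij_betw_def vtx_def)

lemma arc_weight_eq:
  assumes U: "ug_instance R U" and j: "j < length (ug_constraints U)" and p: "p \<in> gverts R" "p' \<in> gverts R"
  shows "arc_weight U j (num p) j' (num p') = awt R (us U) (vs U) (ps U) (2 ^ (length (ug_constraints U) + B)) (j, p) (j', p')"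
proof -
  obtain u v \<pi> where c: "ug_constraints U ! j = (u, v, \<pi>)" by (cases "ug_constraints U ! j") auto
  obtain u' v' \<pi>' where c': "ug_constraints U ! j' = (u', v', \<pi>')" by (cases "ug_constraints U ! j'") auto
  have k: "key U j j' = [j = j', u = u', v = v'] @ enc_list enc_nat (map \<pi> [0..<R])" by (simp add: key_def c c')
  have \<pi>: "\<pi> permutes {..<R}" using permutes_constraint[OF U j] by (simp add: c)
  have "(THE \<sigma>. \<sigma> permutes {..<R} \<and> enc_list enc_nat (map \<sigma> [0..<R]) = enc_list enc_nat (map \<pi> [0..<R])) = \<pi>"
  proof (rule the_equality)
    fix \<sigma> assume \<sigma>: "\<sigma> permutes {..<R} \<and> enc_list enc_nat (map \<sigma> [0..<R]) = enc_list enc_nat (map \<pi> [0..<R])"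
    then have "map \<sigma> [0..<R] = map \<pi> [0..<R]" using enc_nat_list_inj by blast
    then have "\<sigma> i = \<pi> i" if "i < R" for i using that by simp
    moreover have "\<sigma> i = i \<and> \<pi> i = i" if "\<not> i < R" for i using \<sigma> \<pi> that by (simp add: permutes_def)
    ultimately show "\<sigma> = \<pi>" by (metis ext)
  qed (use \<pi> in simp)
  moreover have "\<pi>' = \<pi>" if "j = j'" using that c c' by simp
  ultimately show ?thesis
    unfolding arc_weight_def table_def k by (simp add: num_inverse p awt_def c c')
qed

definition place :: "nat \<times> gvert \<Rightarrow> nat" where
  "place x = vid q (fst x) (num (snd x))"

lemma bij_place: "bij_betw place (positions (length (ug_constraints U)) R) (verts_of U)"
proof -
  have "inj_on num (gverts R)" "num ` gverts R = {..<M}" using num by (auto simp: bij_betw_def)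
  then have "bij_betw (map_prod id num) (positions (length (ug_constraints U)) R) ({..<length (ug_constraints U)} \<times> {..<M})"
    unfolding positions_def bij_betw_def by (auto intro!: map_prod_inj_on map_prod_surj_on)
  moreover have "bij_betw (\<lambda>(j, c). vid q j c) ({..<length (ug_constraints U)} \<times> {..<M}) (verts_of U)"
    unfolding bij_betw_def verts_of_def by (auto simp: inj_on_def vid_inj less_M)
  ultimately have "bij_betw ((\<lambda>(j, c). vid q j c) \<circ> map_prod id num) (positions (length (ug_constraints U)) R) (verts_of U)"
    by (rule bij_betw_trans)
  moreover have "(\<lambda>(j, c). vid q j c) \<circ> map_prod id num = place" by (auto simp: place_def)
  ultimately show ?thesis by simp
qed

lemma multicut_place_iff:
  assumes U: "ug_instance R U" and C: "C \<subseteq> positions m R \<times> positions m R" and m: "m = length (ug_constraints U)"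
  shows "multicut H (inst U) (map_prod place place ` C) \<longleftrightarrow> separating m R C"
proof -
  let ?X = "positions m R" and ?f = "map_prod place place"
  interpret H: pair_digraph H by (rule H)
  have inj: "inj_on place ?X" and im: "place ` ?X = verts_of U" using bij_place[of U] m by (auto simp: bij_betw_def)
  have inj2: "inj_on ?f (?X \<times> ?X)" using inj by (rule map_prod_inj_on) (rule inj)
  have arcs: "parcs (supply_graph (inst U)) = ?f ` (?X \<times> ?X)" using map_prod_surj_on[OF im im] by (simp add: inst_def)
  have diff: "?f ` (?X \<times> ?X) - ?f ` C = ?f ` (?X \<times> ?X - C)"
    using inj_on_image_set_diff[OF inj2, of "?X \<times> ?X" C] C by auto
  have m0: "0 < m" using U m by (simp add: ug_instance_def)
  have "(terminal (inst U) s, terminal (inst U) t) \<in> (?f ` (?X \<times> ?X - C))\<^sup>* \<longleftrightarrow> ((0, Term s), (0, Term t)) \<in> (?X \<times> ?X - C)\<^sup>*"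
    if "(s, t) \<in> parcs H" for s t
  proof -
    have "(0, Term s) \<in> ?X" "(0, Term t) \<in> ?X"
      using H.in_arcsD1[OF that] H.in_arcsD2[OF that] Term_gverts m0 by (auto simp: positions_def)
    from rtrancl_image_iff[OF inj _ this, of "?X \<times> ?X - C"]
    show ?thesis by (simp add: inst_def place_def)
  qed
  moreover have "?f ` C \<subseteq> ?f ` (?X \<times> ?X)" using C by auto
  moreover have "dmc_instance H (inst U)" using inst_input[OF U] by (simp add: dmc_inputs_def)
  ultimately show ?thesis
    unfolding multicut_iff_separates[OF H \<open>dmc_instance H (inst U)\<close>] separates_def separating_def arcs diff using C by auto
qed

lemma weight_place:
  assumes U: "ug_instance R U" and C: "C \<subseteq> positions m R \<times> positions m R" and m: "m = length (ug_constraints U)"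
  shows "(\<Sum>e\<in>map_prod place place ` C. weight (inst U) e) = real (\<Sum>(x, y)\<in>C. awt R (us U) (vs U) (ps U) (2 ^ (m + B)) x y)"
proof -
  have inj: "inj_on place (positions m R)" using bij_place[of U] m by (auto simp: bij_betw_def)
  have "inj_on (map_prod place place) C"
    by (rule inj_on_subset[OF map_prod_inj_on[OF inj inj] C])
  moreover have "weight (inst U) (map_prod place place xy) = real (case xy of (x, y) \<Rightarrow> awt R (us U) (vs U) (ps U) (2 ^ (m + B)) x y)"
    if "xy \<in> C" for xy
  proof -
    obtain j p j' p' where xy: "xy = ((j, p), (j', p'))" by (metis surj_pair)
    have "j < m" "p \<in> gverts R" "p' \<in> gverts R" using that C xy by (auto simp: positions_def)
    then show ?thesis using arc_weight_eq[OF U, of j p p' j'] m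
      by (simp add: xy inst_def place_def num_inverse)
  qed
  ultimately show ?thesis by (simp add: sum.reindex)
qed

text \<open>An optimal labelling of the unique game becomes a family of dictator cuts; at most
  \<open>\<epsilon> * m\<close> constraints are unsatisfied and pay for their heavy links.\<close>

lemma multicut_opt_le_of_value:
  assumes U: "ug_instance R U" and val: "1 - \<epsilon> \<le> ug_value R U" and m: "m = length (ug_constraints U)"
  shows "2 ^ n * multicut_opt H (inst U) \<le>
    real (cube_size R n) * (real m * (real P * (\<Sum>e\<in>E. real (w e * l e)) + 2 ^ n * (2 * real (card V) * real n)) + \<epsilon> * m * (2 ^ n * (2 * real Q * real (card V))))"
proof -
  have R: "1 \<le> R" and m0: "0 < m" using U m by (auto simp: ug_instance_def)
  obtain f g where fg: "f \<in> {..<ug_left U} \<rightarrow>\<^sub>E {..<R}" "g \<in> {..<ug_right U} \<rightarrow>\<^sub>E {..<R}" "ug_value R U = ug_satisfied U f g"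
    by (rule ug_value_attained[OF R])
  define N where "N = card {j. j < m \<and> g (vs U j) \<noteq> ps U j (f (us U j))}"
  define N' where "N' = card {j. j < m \<and> g (vs U j) = ps U j (f (us U j))}"
  have "N + N' = card ({j. j < m \<and> g (vs U j) \<noteq> ps U j (f (us U j))} \<union> {j. j < m \<and> g (vs U j) = ps U j (f (us U j))})"
    unfolding N_def N'_def by (rule card_Un_disjoint[symmetric]) auto
  also have "\<dots> = card {..<m}" by (rule arg_cong[of _ _ card]) auto
  finally have "real N + real N' = m" by (metis card_lessThan of_nat_add)
  moreover have "(1 - \<epsilon>) * m \<le> N'"
    using val m0 unfolding fg(3) ug_satisfied_eq N'_def m by (simp add: field_simps)
  ultimately have N: "real N \<le> \<epsilon> * m" by (simp add: algebra_simps)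
  have con: "us U j < ug_left U \<and> vs U j < ug_right U" if "j < m" for j
    using nth_mem[of j "ug_constraints U"] U that m unfolding ug_instance_def by fastforce
  obtain C where C: "separating m R C" "unforced (us U) (vs U) C"
    "2 ^ n * (\<Sum>(x, y)\<in>C. awt R (us U) (vs U) (ps U) (2 ^ (m + B)) x y) \<le>
       cube_size R n * (m * (P * (\<Sum>e\<in>E. w e * l e) + 2 ^ n * (2 * card V * n)) + N * (2 ^ n * (2 * Q * card V)))"
  proof (rule completeness[of m "ps U" R f "us U" g "vs U" N "2 ^ (m + B)"])
    show "f (us U j) < R" "g (vs U j) < R" if "j < m" for j using con[OF that] fg(1,2) by auto
    show "ps U j permutes {..<R}" if "j < m" for j using permutes_constraint[OF U] that m by simp
  qed (auto simp: m0 N_def intro: that)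
  have sub: "C \<subseteq> positions m R \<times> positions m R" using C(1) by (simp add: separating_def)
  have "dmc_instance H (inst U)" using inst_input[OF U] by (simp add: dmc_inputs_def)
  then have "multicut_opt H (inst U) \<le> (\<Sum>e\<in>map_prod place place ` C. weight (inst U) e)"
    using multicut_place_iff[OF U sub m] C(1) by (intro multicut_opt_le) auto
  also have "\<dots> = real (\<Sum>(x, y)\<in>C. awt R (us U) (vs U) (ps U) (2 ^ (m + B)) x y)" by (rule weight_place[OF U sub m])
  finally have "2 ^ n * multicut_opt H (inst U) \<le> real (2 ^ n * (\<Sum>(x, y)\<in>C. awt R (us U) (vs U) (ps U) (2 ^ (m + B)) x y))" by simp
  also have "\<dots> \<le> real (cube_size R n * (m * (P * (\<Sum>e\<in>E. w e * l e) + 2 ^ n * (2 * card V * n)) + N * (2 ^ n * (2 * Q * card V))))"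
    using C(3) of_nat_le_iff by blast
  also have "\<dots> = real (cube_size R n) * (real m * (real P * (\<Sum>e\<in>E. real (w e * l e)) + 2 ^ n * (2 * real (card V) * real n)) + real N * (2 ^ n * (2 * real Q * real (card V))))"
    by simp
  also have "\<dots> \<le> real (cube_size R n) * (real m * (real P * (\<Sum>e\<in>E. real (w e * l e)) + 2 ^ n * (2 * real (card V) * real n)) + \<epsilon> * m * (2 ^ n * (2 * real Q * real (card V))))"
    using N by (intro mult_left_mono add_left_mono mult_right_mono) auto
  finally show ?thesis .
qed

lemma light_multicut_imp_value:
  fixes \<delta> \<tau> :: real
  assumes U: "ug_instance R U" and m: "m = length (ug_constraints U)"
    and \<delta>: "0 < \<delta>" "\<delta> < 1 / 2" and \<tau>: "0 < \<tau>" "4 * P * K \<le> \<tau> * Q"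
    and kkl: "\<And>f. (\<And>x. x \<in> coords R n \<Longrightarrow> influence (coords R n) f x \<le> \<tau>) \<Longrightarrow>
       (\<Sum>x\<in>coords R n. influence (coords R n) f x) \<le> 2 * P * K \<Longrightarrow>
       mean (coords R n) (\<lambda>z. of_bool (f z)) \<le> \<delta> \<or> 1 - \<delta> \<le> mean (coords R n) (\<lambda>z. of_bool (f z))"
    and \<Lambda>: "real (card V * card A) * (4 * P * K / \<tau>) \<le> \<Lambda>"
    and Thr: "real Thr \<le> P * K * (1 - 3 * \<delta>) * cube_size R n"
    and X: "multicut H (inst U) X" "(\<Sum>e\<in>X. weight (inst U) e) < real (Thr * m)"
  shows "\<delta> \<le> real \<Lambda> * real \<Lambda> * ug_value R U"
proof -
  have R: "0 < R" and m0: "0 < m" using U m by (auto simp: ug_instance_def)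
  define C where "C = {(x, y). x \<in> positions m R \<and> y \<in> positions m R \<and> (place x, place y) \<in> X}"
  have sub: "C \<subseteq> positions m R \<times> positions m R" by (auto simp: C_def)
  have im: "place ` positions m R = verts_of U" using bij_place[of U] m by (auto simp: bij_betw_def)
  have "X \<subseteq> verts_of U \<times> verts_of U" using X(1) by (auto simp: multicut_def inst_def)
  then have XC: "X = map_prod place place ` C"
    unfolding im[symmetric] by (force simp: C_def image_iff)
  have sep: "separating m R C" using X(1) multicut_place_iff[OF U sub m] XC by simp
  let ?a = "\<lambda>(x, y). awt R (us U) (vs U) (ps U) (2 ^ (m + B)) x y"
  have "real (sum ?a C) < real (Thr * m)"
    using X(2) weight_place[OF U sub m] unfolding XC by simp
  then have lt: "sum ?a C < Thr * m" by (simp only: of_nat_less_iff)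
  have "finite C" using sub finite_positions by (metis finite_SigmaI finite_subset)
  \<comment> \<open>A cut lighter than \<open>Thr * m\<close> contains no arc of infinite weight,
    because \<open>Thr * m\<close> is at most \<open>2 ^ B * 2 ^ m\<close>.\<close>
  have "?a xy < 2 ^ (m + B)" if "xy \<in> C" for xy
  proof -
    have "?a xy \<le> sum ?a C" by (rule member_le_sum[OF that _ \<open>finite C\<close>]) simp
    also have "\<dots> < Thr * m" by (rule lt)
    also have "\<dots> \<le> 2 ^ B * 2 ^ m" using Thr_bound less_exp[of m] by (intro mult_le_mono) auto
    finally show ?thesis by (simp add: power_add mult.commute)
  qed
  then have unf: "unforced (us U) (vs U) C" unfolding unforced_def awt_def by fastforce
  have cost: "real (sum ?a C) < P * K * (1 - 3 * \<delta>) * cube_size R n * m"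
    using \<open>real (sum ?a C) < real (Thr * m)\<close> mult_right_mono[OF Thr, of "real m"] by simp
  obtain f g where fg: "\<And>u. f u < R" "\<And>v. g v < R"
    "\<delta> * m \<le> real \<Lambda> * real \<Lambda> * real (card {j. j < m \<and> g (vs U j) = ps U j (f (us U j))})"
    by (rule soundness[where us = "us U" and vs = "vs U" and ps = "ps U" and big = "2 ^ (m + B)", OF m0 R _ \<delta> \<tau> kkl \<Lambda> sep unf cost])
      (auto intro: permutes_constraint[OF U] that simp: m)
  have "\<delta> \<le> real \<Lambda> * real \<Lambda> * ug_satisfied U f g"
    using fg(3) m0 unfolding ug_satisfied_eq m by (simp add: field_simps)
  also have "\<dots> \<le> real \<Lambda> * real \<Lambda> * ug_value R U"
    by (rule mult_left_mono[OF ug_satisfied_le_value[OF U fg(1,2)]]) simp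
  finally show ?thesis .
qed

text \<open>The algorithm may misbehave on words that encode no instance. This does no harm: the
  reduction \<open>f\<close> from \<open>L\<close> maps every word to the code of a unique game, so
  the decision procedure only ever runs on \<open>ugs\<close>.\<close>

lemma class_NP_subset_P_of_approximation:
  assumes poly: "poly_time_on (enc_dmc H ` dmc_inputs H) Alg" and approx: "dmc_approximation H (ereal \<alpha>) Alg"
    and hard: "NP_hard_promise {enc_ug R U | U. ug_instance R U \<and> ug_value R U \<ge> 1 - \<epsilon>}
       {enc_ug R U | U. ug_instance R U \<and> ug_value R U \<le> \<delta>}"
    and yes: "\<And>U. ug_instance R U \<Longrightarrow> 1 - \<epsilon> \<le> ug_value R U \<Longrightarrow>
       \<alpha> * multicut_opt H (inst U) < real (Thr * length (ug_constraints U))"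
    and no: "\<And>U X. ug_instance R U \<Longrightarrow> ug_value R U \<le> \<delta> \<Longrightarrow> multicut H (inst U) X \<Longrightarrow>
       real (Thr * length (ug_constraints U)) \<le> (\<Sum>e\<in>X. weight (inst U) e)"
  shows "class_NP \<subseteq> class_P"
proof
  fix L assume "L \<in> class_NP"
  then obtain f where f: "poly_time_on UNIV f"
    and f_yes: "\<And>x. x \<in> L \<Longrightarrow> \<exists>U. f x = enc_ug R U \<and> ug_instance R U \<and> 1 - \<epsilon> \<le> ug_value R U"
    and f_no: "\<And>x. x \<notin> L \<Longrightarrow> \<exists>U. f x = enc_ug R U \<and> ug_instance R U \<and> ug_value R U \<le> \<delta>"
    using hard unfolding NP_hard_promise_def by fastforce
  define Y where "Y X = Alg (reduce X)" for X
  have sol: "\<exists>es. Y (enc_ug R U) = enc_list enc_arc es \<and> multicut H (inst U) (set es) \<and>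
      (\<Sum>e\<in>set es. weight (inst U) e) \<le> \<alpha> * multicut_opt H (inst U)" if "ug_instance R U" for U
    using approx inst_input[OF that] reduce_eq[OF that] unfolding dmc_approximation_def Y_def by auto
  have red: "reduce X \<in> enc_dmc H ` dmc_inputs H" if "X \<in> ugs" for X
    using that inst_input reduce_eq by (auto simp: ugs_def)
  have "computable 1 valid_input (\<lambda>s. Y (s 0))"
    unfolding Y_def by (rule computable_call[OF poly computable_reduce]) (auto simp: valid_input_def red)
  moreover have "\<exists>es. Y X = enc_list enc_arc es" if "X \<in> ugs" for X using that sol by (auto simp: ugs_def)
  ultimately have "computable 1 valid_input (\<lambda>s. decide Y (s 0))" by (rule computable_decide)
  then have dec: "poly_time_on ugs (decide Y)" unfolding valid_input_def by (rule poly_time_on_computable)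
  have "f x \<in> ugs" for x using f_yes[of x] f_no[of x] by (cases "x \<in> L") (auto simp: ugs_def)
  then have "poly_time_on UNIV (\<lambda>x. decide Y (f x))" by (intro poly_time_on_comp[OF f dec]) auto
  moreover have "decide Y (f x) = [x \<in> L]" for x
  proof -
    have *: "\<exists>es. decide Y (enc_ug R U) = [(\<Sum>e\<in>set es. weight (inst U) e) < real (Thr * length (ug_constraints U))] \<and>
        multicut H (inst U) (set es) \<and> (\<Sum>e\<in>set es. weight (inst U) e) \<le> \<alpha> * multicut_opt H (inst U)" if U: "ug_instance R U" for U
    proof -
      obtain es where es: "Y (enc_ug R U) = enc_list enc_arc es" "multicut H (inst U) (set es)"
        "(\<Sum>e\<in>set es. weight (inst U) e) \<le> \<alpha> * multicut_opt H (inst U)" using sol[OF U] by blast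
      have "set es \<subseteq> verts_of U \<times> verts_of U" using es(2) by (auto simp: multicut_def inst_def)
      from decide_eq[of U Y es, OF U es(1) this] es(2,3) show ?thesis by blast
    qed
    show ?thesis
    proof (cases "x \<in> L")
      case True
      then obtain U where U: "f x = enc_ug R U" "ug_instance R U" "1 - \<epsilon> \<le> ug_value R U" using f_yes by blast
      then show ?thesis using *[OF U(2)] yes[OF U(2,3)] True by fastforce
    next
      case False
      then obtain U where U: "f x = enc_ug R U" "ug_instance R U" "ug_value R U \<le> \<delta>" using f_no by blast
      obtain es where es: "decide Y (enc_ug R U) = [(\<Sum>e\<in>set es. weight (inst U) e) < real (Thr * length (ug_constraints U))]"
        "multicut H (inst U) (set es)" using *[OF U(2)] by blast
      then show ?thesis using no[OF U(2,3) es(2)] False U(1) by simp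
    qed
  qed
  ultimately show "L \<in> class_P" by (simp add: class_P_def)
qed

end

theorem theorem3:
  fixes H :: "nat pair_pre_digraph" and k :: nat and \<epsilon> :: real
  assumes ugc: "unique_games_conjecture"
    and P_NP: "class_P \<noteq> class_NP"
    and H: "pair_digraph H" "card (pverts H) = k"
    and demand: "parcs H \<noteq> {}"
    and eps: "\<epsilon> > 0"
  shows "\<not> poly_time_dmc_approximable H
            (flow_cut_gap H / ereal (2 * real_of_int \<lceil>log 2 (real k)\<rceil>) - ereal \<epsilon>)"
proof
  assume "poly_time_dmc_approximable H (flow_cut_gap H / ereal (2 * real_of_int \<lceil>log 2 (real k)\<rceil>) - ereal \<epsilon>)"
  then obtain Alg where poly: "poly_time_on (enc_dmc H ` dmc_inputs H) Alg"
    and approx: "dmc_approximation H (flow_cut_gap H / ereal (2 * real_of_int \<lceil>log 2 (real k)\<rceil>) - ereal \<epsilon>) Alg"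
    by (auto simp: poly_time_dmc_approximable_def)
  interpret H: pair_digraph H by fact
  define L where "L = real_of_int \<lceil>log 2 (real k)\<rceil>"
  obtain s0 t0 where st0: "(s0, t0) \<in> parcs H" using demand by auto
  then have "card {s0, t0} \<le> k"
    unfolding H(2)[symmetric] using H.in_arcsD1[OF st0] H.in_arcsD2[OF st0] by (intro card_mono) auto
  moreover have "s0 \<noteq> t0" using H.pair_no_loops[OF st0] by simp
  ultimately have "1 \<le> log 2 (real k)" by (simp add: one_le_log_cancel_iff)
  then have "1 \<le> \<lceil>log 2 (real k)\<rceil>" by linarith
  then have L1: "1 \<le> L" by (simp add: L_def)
  obtain \<gamma> where \<gamma>: "flow_cut_gap H = ereal \<gamma>" "0 < \<gamma>"
    using flow_cut_gap_pos[OF H(1) demand] flow_cut_gap_le[OF H(1) demand] by (cases "flow_cut_gap H") auto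
  define \<alpha> where "\<alpha> = \<gamma> / (2 * L) - \<epsilon>"
  have approx: "dmc_approximation H (ereal \<alpha>) Alg" using approx L1 by (simp add: \<gamma> \<alpha>_def L_def[symmetric])
  \<comment> \<open>The assumed ratio is zero or negative if \<open>\<epsilon>\<close> is large. The
    maximum with a positive number below \<open>\<gamma> / (2 * L)\<close> is a ratio that is no
    smaller and to which the gap instance applies.\<close>
  define \<rho> where "\<rho> = max \<alpha> (\<gamma> / (4 * L))"
  have \<rho>: "0 < \<rho>" "\<alpha> \<le> \<rho>" using L1 \<gamma>(2) by (auto simp: \<rho>_def less_max_iff_disj)
  have "\<rho> < \<gamma> / (2 * L)" using L1 \<gamma>(2) eps by (auto simp: \<rho>_def \<alpha>_def field_simps)
  then have "ereal (2 * real_of_int \<lceil>log 2 (card (pverts H))\<rceil> * \<rho>) < flow_cut_gap H"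
    unfolding H(2) \<gamma>(1) L_def[symmetric] using L1 by (simp add: field_simps)
  then obtain A V E w l ter D K n where gg: "\<And>P. 0 < P \<Longrightarrow> gap_gadget (pverts H) (parcs H) A V E w l ter D K n P"
    and gap: "\<rho> * (\<Sum>e\<in>E. real (w e * l e)) < 2 ^ n * K"
    by (rule obtain_gap_gadget[OF H(1) demand \<rho>(1)]) (rule that, assumption+)
  define S where "S = (\<Sum>e\<in>E. real (w e * l e))"
  have K: "0 < K" using gg[of 1] by (simp add: gap_gadget_def)
  \<comment> \<open>The slack of the gap instance. One half of it pays for the loss
    \<open>3 * \<delta>\<close> in the soundness; the other half, multiplied by \<open>P\<close>,
    pays for the overhead \<open>c\<close> of the dictator cuts.\<close>
  define G where "G = K - \<rho> * S / 2 ^ n"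
  have G: "0 < G" using gap by (simp add: G_def S_def field_simps)
  define \<delta> where "\<delta> = min (1 / 4) (G / (6 * K))"
  have \<delta>: "0 < \<delta>" "\<delta> < 1 / 2" "\<delta> \<le> 1 / 2" using G K by (auto simp: \<delta>_def)
  have "6 * K * \<delta> \<le> G" using K mult_left_mono[of \<delta> "G / (6 * K)" "6 * K"] by (simp add: \<delta>_def)
  moreover have "\<rho> * S / 2 ^ n = K - G" "K * (1 - 3 * \<delta>) = K - 6 * K * \<delta> / 2" by (auto simp: G_def algebra_simps)
  ultimately have KG: "\<rho> * S / 2 ^ n + G / 2 \<le> K * (1 - 3 * \<delta>)" by linarith
  \<comment> \<open>Per constraint and in units of the cube size: \<open>2 * card V * n\<close> for
    the unit arcs cut by a dictator and 1 for the unsatisfied constraints, times the ratio.\<close>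
  define c where "c = \<rho> * (2 * real (card V) * real n + 1)"
  obtain P :: nat where P: "(c + 2) / (G / 2) < real P" using reals_Archimedean2 by blast
  have "0 < c" using \<rho>(1) by (simp add: c_def add_nonneg_pos)
  then have "0 < (c + 2) / (G / 2)" using G by simp
  then have P0: "0 < P" using P by (cases P) auto
  have PG: "c + 2 \<le> real P * (G / 2)" using P G by (simp add: field_simps)
  \<comment> \<open>The threshold per constraint, in units of the cube size. The summand 2 in the
    choice of \<open>P\<close> leaves room for rounding down and for a strict inequality.\<close>
  define t where "t = nat \<lfloor>real P * K * (1 - 3 * \<delta>)\<rfloor>"
  have PK: "real P * (\<rho> * S / 2 ^ n) + c + 2 \<le> real P * K * (1 - 3 * \<delta>)"
    using mult_left_mono[OF KG, of "real P"] PG by (simp add: algebra_simps)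
  have S0: "0 \<le> S" unfolding S_def by (rule sum_nonneg) simp
  then have PS: "0 \<le> real P * (\<rho> * S / 2 ^ n)" using \<rho>(1) by simp
  have t: "real P * (\<rho> * S / 2 ^ n) + c < t" "real t \<le> real P * K * (1 - 3 * \<delta>)"
    using PK PS \<open>0 < c\<close> by (auto simp: t_def) linarith+
  have C0: "0 \<le> 2 * P * K" using K by simp
  obtain \<tau> where \<tau>: "0 < \<tau>" and kkl: "\<And>(X :: (nat \<times> nat) set) f. finite X \<Longrightarrow> (\<And>x. x \<in> X \<Longrightarrow> influence X f x \<le> \<tau>) \<Longrightarrow>
      (\<Sum>x\<in>X. influence X f x) \<le> 2 * P * K \<Longrightarrow>
      mean X (\<lambda>z. of_bool (f z)) \<le> \<delta> \<or> 1 - \<delta> \<le> mean X (\<lambda>z. of_bool (f z))"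
  proof (rule low_influences_imp_almost_constant[OF C0 \<delta>(1,3)])
    fix \<tau> :: real assume \<tau>: "0 < \<tau>" and kkl: "\<And>(X :: (nat \<times> nat) set) f. finite X \<Longrightarrow> (\<And>x. x \<in> X \<Longrightarrow> influence X f x \<le> \<tau>) \<Longrightarrow>
      (\<Sum>x\<in>X. influence X f x) \<le> 2 * P * K \<Longrightarrow>
      mean X (\<lambda>z. of_bool (f z)) \<le> \<delta> \<or> 1 - \<delta> \<le> mean X (\<lambda>z. of_bool (f z))"
    show thesis by (rule that[OF \<tau> kkl]; blast)
  qed
  \<comment> \<open>With links this heavy, the two sides of a cheap constraint disagree at less than
    a fraction \<open>\<tau> / 4\<close> of the points of any one cube.\<close>
  obtain Q :: nat where "4 * P * K / \<tau> < Q" using reals_Archimedean2 by blast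
  then have Q: "4 * P * K \<le> \<tau> * Q" using \<tau> by (simp add: field_simps)
  obtain \<Lambda> :: nat where \<Lambda>: "real (card V * card A) * (4 * P * K / \<tau>) \<le> \<Lambda>" using real_arch_simple by blast
  \<comment> \<open>Spread over all constraints, the links at the unsatisfied ones cost at most one
    cube size each; \<open>\<delta>'\<close> lies below the value that \<open>soundness\<close>
    extracts from a light cut.\<close>
  define \<epsilon>' where "\<epsilon>' = 1 / (2 * real Q * real (card V) + 1)"
  define \<delta>' where "\<delta>' = \<delta> / (real \<Lambda> * real \<Lambda> + 1)"
  have aux: "0 < y / (a + 1)" "y / (a + 1) * a < y" if "0 \<le> a" "0 < y" for a y :: real
    using that by (auto simp: field_simps pos_divide_less_eq)
  have \<epsilon>': "0 < \<epsilon>'" "\<epsilon>' * (2 * real Q * real (card V)) \<le> 1"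
    unfolding \<epsilon>'_def using aux[of "2 * real Q * real (card V)" 1] by simp_all
  have \<delta>': "0 < \<delta>'" "real \<Lambda> * real \<Lambda> * \<delta>' < \<delta>"
    unfolding \<delta>'_def using aux[of "real \<Lambda> * real \<Lambda>" \<delta>] \<delta>(1) by (simp_all add: mult.commute)
  obtain R where hard: "NP_hard_promise {enc_ug R U | U. ug_instance R U \<and> ug_value R U \<ge> 1 - \<epsilon>'}
      {enc_ug R U | U. ug_instance R U \<and> ug_value R U \<le> \<delta>'}"
    using ugc \<epsilon>'(1) \<delta>'(1) unfolding unique_games_conjecture_def by blast
  interpret gg: gap_gadget "pverts H" "parcs H" A V E w l ter D K n P Q by (rule gg[OF P0])
  define M where "M = card (gg.gverts R)"
  obtain num where num: "bij_betw num (gg.gverts R) {..<M}"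
    using ex_bij_betw_finite_nat[OF gg.finite_gverts] by (auto simp: M_def atLeast0LessThan)
  define Thr where "Thr = cube_size R n * t"
  \<comment> \<open>The exponents \<open>M\<close> and \<open>Thr\<close> are crude but sufficient,
    since every number is below the power of two with that exponent.\<close>
  interpret gr: gadget_reduction H A V E w l ter D K n P Q R M M Thr Thr num
    by unfold_locales (auto simp: H(1) num less_imp_le[OF less_exp])
  have Z: "0 < cube_size R n" by (simp add: cube_size_def)
  have "class_NP \<subseteq> class_P"
  proof (rule gr.class_NP_subset_P_of_approximation[OF poly approx hard])
    fix U assume U: "ug_instance R U" "1 - \<epsilon>' \<le> ug_value R U"
    define m where "m = length (ug_constraints U)"
    have m0: "0 < m" using U(1) by (simp add: m_def ug_instance_def)
    have I: "dmc_instance H (gr.inst U)" using gr.inst_input[OF U(1)] by (simp add: dmc_inputs_def)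
    have "0 \<le> multicut_opt H (gr.inst U)"
      by (rule le_multicut_opt[OF H(1) I]) (use I in \<open>force simp: multicut_def dmc_instance_def intro!: sum_nonneg\<close>)
    then have "\<alpha> * multicut_opt H (gr.inst U) \<le> \<rho> * multicut_opt H (gr.inst U)"
      using \<rho>(2) by (rule mult_right_mono[rotated])
    also have "\<dots> = \<rho> / 2 ^ n * (2 ^ n * multicut_opt H (gr.inst U))" by simp
    also have "\<dots> \<le> \<rho> / 2 ^ n * (real (cube_size R n) * (real m * (real P * S + 2 ^ n * (2 * real (card V) * real n)) + \<epsilon>' * m * (2 ^ n * (2 * real Q * real (card V)))))"
      using gr.multicut_opt_le_of_value[OF U m_def] \<rho>(1) unfolding S_def by (intro mult_left_mono) auto
    also have "\<dots> = real (cube_size R n) * m * (real P * (\<rho> * S / 2 ^ n) + \<rho> * (2 * real (card V) * real n + \<epsilon>' * (2 * real Q * real (card V))))"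
      by (simp add: field_simps)
    also have "\<dots> \<le> real (cube_size R n) * m * (real P * (\<rho> * S / 2 ^ n) + c)"
      unfolding c_def using \<epsilon>'(2) \<rho>(1) by (intro mult_left_mono add_left_mono) auto
    also have "\<dots> < real (cube_size R n) * m * t" using t(1) m0 Z by (intro mult_strict_left_mono) auto
    finally show "\<alpha> * multicut_opt H (gr.inst U) < real (Thr * length (ug_constraints U))"
      by (simp add: Thr_def m_def mult_ac)
  next
    fix U X assume U: "ug_instance R U" "ug_value R U \<le> \<delta>'" and X: "multicut H (gr.inst U) X"
    have "real Thr \<le> P * K * (1 - 3 * \<delta>) * cube_size R n"
      using mult_left_mono[OF t(2), of "real (cube_size R n)"] by (simp add: Thr_def mult_ac)
    note light = gr.light_multicut_imp_value[OF U(1) refl \<delta>(1,2) \<tau> Q kkl[OF finite_coords] \<Lambda> this X]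
    show "real (Thr * length (ug_constraints U)) \<le> (\<Sum>e\<in>X. weight (gr.inst U) e)"
    proof (rule ccontr)
      assume "\<not> ?thesis"
      then have "\<delta> \<le> real \<Lambda> * real \<Lambda> * ug_value R U" by (intro light) auto
      also have "\<dots> \<le> real \<Lambda> * real \<Lambda> * \<delta>'" using U(2) by (intro mult_left_mono) auto
      finally show False using \<delta>'(2) by simp
    qed
  qed
  then show False using P_NP class_P_subset_NP by blast
qed

end
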